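(* Let $\lambda=(\lambda_1,\ldots,\lambda_p)$ be a partition of the integer $n$ with $p$ parts. Then $$\varphi_p(b^{\lambda_1},\ldots,b^{\lambda_p})=\sum_{k=1}^p\ \sum_{\substack{\tilde\pi\in\mathcal P(n),\ \tilde\pi\ge\Pi(\gamma_\lambda)\\ \#(\tilde\pi)=k}}\ \sum_{T\in\mathcal G_k}\ \sum_{(j,\,k)}\Biggl(\prod_{I\in\mathcal I(T)}\kappa_{\{j_i^I\}_{i\in I}}[b]\Biggr)\Biggl(\prod_{i=1}^k\mathcal M\bigl(\lambda_{|i};\Lambda_{\{k_a^{(i)}+q_a^{(i)}\}_a}\bigr)\prod_{a=1}^{|G_i|}\frac{(k_a^{(i)}+q_a^{(i)})!}{k_a^{(i)}!}\,\kappa_a[b]^{k_a^{(i)}}\Biggr),$$ where, for each $\tilde\pi$, its blocks are labeled $G_1,\dots,G_k$ (in increasing order of their minimal elements); the innermost sum $\sum_{(j,k)}$ is over all families of integers, for each $i\in\{1,\dots,k\}$, $\{j_i^I\ge1\}_{I\in\mathcal I_i(T)}$ and $k_1^{(i)},\dots,k_{|G_i|}^{(i)}\ge0$, such that $$\sum_{I\in\mathcal I_i(T)}j_i^I+\sum_{a=1}^{|G_i|}a\,k_a^{(i)}=|G_i|\qquad(1\le i\le k);$$ $\lambda_{|i}$ is the integer partition of $|G_i|$ given by the cycle lengths of $(\gamma_\lambda)_{|G_i}$; and $q_a^{(i)}$ is the number of $I\in\mathcal I_i(T)$ such that $j_i^I=a$.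
   Context: **Permutations and partitions.** $\mathcal P(n)$ is the set of partitions of $\{1,\dots,n\}$, ordered by refinement $\le$, with join $\vee$; $\#(\pi)$ is the number of blocks, $1_n$ the one-block partition. For $\sigma\in S_n$, $\#(\sigma)$ is its number of cycles, $\Pi(\sigma)$ the partition into cycles, $\Lambda(\sigma)$ the integer partition of $n$ given by its cycle lengths, and $\sigma_{|G}$ its restriction to a union $G$ of cycles. $\gamma_\lambda=(1\cdots\lambda_1)(\lambda_1+1\cdots\lambda_1+\lambda_2)\cdots\in S_n$. The genus $g(\sigma_1,\sigma_2)$ is defined by $\#(\sigma_1)+\#(\sigma_2)+\#(\sigma_1\sigma_2)-n=2\#(\Pi(\sigma_1)\vee\Pi(\sigma_2))-2g(\sigma_1,\sigma_2)$. $\Lambda_{\{d_a\}_a}$ is the integer partition of $\sum_a a\,d_a$ having $d_a$ parts equal to $a$. For integer partitions $\lambda,\lambda'$ of $n$, $$\mathcal M(\lambda;\lambda')=\mathrm{Card}\{\tau\in S_n\mid g(\gamma_\lambda,\tau)=0,\ \Pi(\gamma_\lambda)\vee\Pi(\tau)=1_n,\ \Lambda(\tau)=\lambda'\}.$$ **Trees.** $\mathcal G_k$ is the set of bipartite trees with white vertices labeled $1,\dots,k$ and all black vertices of valency at least 2. Such a tree $T$ is encoded by the set $\mathcal I(T)$ of subsets $I\subset\{1,\dots,k\}$, $|I|\ge2$, one per black vertex, $I$ being the set of its white neighbours; these are exactly the sets of subsets whose associated bipartite graph is connected and with $\sum_I(|I|-1)=k-1$. $\mathcal I_i(T)=\{I\in\mathcal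 I(T):i\in I\}$. $\mathcal G_1$ has a single element, with $\mathcal I(T)=\emptyset$. **Moments and free cumulants.** $B$ is an $N\times N$ random matrix for each $N$, $\mathrm{Tr}$ the unnormalized trace, $k_m$ the $m$-th classical joint cumulant. For $\pi\ge\Pi(\tau)$, $\varphi(\pi,\tau)[B]=\prod_{G\in\pi}k_{\#(\tau_{|G})}(\{\mathrm{Tr}(B^{|V|})\}_{V\in\Pi(\tau_{|G})})$ and for $\pi\ge\Pi(\sigma)$ $$\kappa(\pi,\sigma)[B]=\sum_{\tau\in S_n}\ \sum_{\pi\ge\pi'\ge\Pi(\tau)}\varphi(\pi',\tau)[B]\sum_{\pi\ge\pi''\ge\Pi(\sigma)\vee\pi'}\lambda_{\pi'',\pi}\prod_{G\in\pi''}W^{(N)}\bigl((\sigma\tau^{-1})_{|G}\bigr),$$ where $\lambda_{\pi'',\pi}$ is the Möbius function of the lattice of partitions and $W^{(N)}$ the unitary Weingarten function (for $N\ge n$, the convolution inverse on $S_n$ of $\nu\mapsto N^{\#(\nu)}$). The limits $\varphi(\pi,\sigma)[b]=\lim_N N^{\#(\sigma)-2\#(\pi)}\varphi(\pi,\sigma)[B]$ are assumed to exist, and $\kappa(\pi,\sigma)[b]=\lim_N N^{\#(\sigma)+n-2\#(\pi)}\kappa(\pi,\sigma)[B]$. Then $\varphi_p(b^{\lambda_1},\dots,b^{\lambda_p})=\varphi(1_n,\gamma_\lambda)[b]$ and $\kappa_{\lambda_1,\dots,\lambda_p}[b]=\kappa(1_n,\gamma_\lambda)[b]$ (symmetric in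 the indices); in particular $\kappa_a[b]$ is the first order free cumulant. *)

theory Defs
  imports
    "Jordan_Normal_Form.Matrix"
    "HOL-Probability.Probability"
    "HOL-Combinatorics.Combinatorics"
    "HOL-Combinatorics.Orbits"
begin

section \<open>Set partitions\<close>

text \<open>Partitions of \<open>A\<close> are the \<open>\<pi>\<close> with \<^term>\<open>partition_on A \<pi>\<close>; the order \<open>\<pi> \<le> \<rho>\<close> is
  \<^term>\<open>refines A \<pi> \<rho>\<close> (which includes that both are partitions of \<open>A\<close>).\<close>

definition one_part :: "nat \<Rightarrow> nat set set" where
  "one_part n = {{1..n}}"

definition same_block :: "'a set set \<Rightarrow> ('a \<times> 'a) set" where
  "same_block \<pi> = {(x, y). \<exists>X\<in>\<pi>. x \<in> X \<and> y \<in> X}"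

definition join_part :: "'a set \<Rightarrow> 'a set set \<Rightarrow> 'a set set \<Rightarrow> 'a set set" where
  "join_part A \<pi> \<rho> = A // (same_block \<pi> \<union> same_block \<rho>)\<^sup>+"

lemma equiv_join_part:
  assumes "partition_on A \<pi>" "partition_on A \<rho>"
  shows "equiv A ((same_block \<pi> \<union> same_block \<rho>)\<^sup>+)"
proof (rule equivI)
  have 1: "same_block \<pi> \<union> same_block \<rho> \<subseteq> A \<times> A"
    using assms unfolding same_block_def partition_on_def by blast
  then show "(same_block \<pi> \<union> same_block \<rho>)\<^sup>+ \<subseteq> A \<times> A"
    by (rule trancl_subset_Sigma)
  have "(x, x) \<in> same_block \<pi>" if "x \<in> A" for x
    using that assms(1) unfolding same_block_def partition_on_def by blast
  then show "refl_on A ((same_block \<pi> \<union> same_block \<rho>)\<^sup>+)"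
    using 1 by (auto simp: refl_on_def)
  have "sym (same_block \<pi> \<union> same_block \<rho>)"
    by (auto simp: sym_def same_block_def)
  then show "sym ((same_block \<pi> \<union> same_block \<rho>)\<^sup>+)"
    by (rule sym_trancl)
qed (rule trans_trancl)

text \<open>\<^const>\<open>join_part\<close> is the least upper bound for refinement.\<close>

lemma refines_join_part:
  assumes "partition_on A \<pi>" "partition_on A \<rho>"
  shows "refines A \<pi> (join_part A \<pi> \<rho>)" "refines A \<rho> (join_part A \<pi> \<rho>)"
proof -
  let ?R = "(same_block \<pi> \<union> same_block \<rho>)\<^sup>+"
  have part: "partition_on A (join_part A \<pi> \<rho>)"
    unfolding join_part_def by (rule partition_on_quotient[OF equiv_join_part[OF assms]])
  have "\<exists>Y\<in>A // ?R. X \<subseteq> Y" if "X \<in> \<pi> \<union> \<rho>" for X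
  proof -
    have "X \<noteq> {}" "X \<subseteq> A"
      using that assms unfolding partition_on_def by auto
    then obtain x where x: "x \<in> X" "x \<in> A" by auto
    have "X \<subseteq> ?R `` {x}"
      using that x unfolding same_block_def by blast
    with x show ?thesis by (blast intro: quotientI)
  qed
  then show "refines A \<pi> (join_part A \<pi> \<rho>)" "refines A \<rho> (join_part A \<pi> \<rho>)"
    using assms part unfolding refines_def join_part_def by blast+
qed

lemma join_part_least:
  assumes "refines A \<pi> \<sigma>" "refines A \<rho> \<sigma>"
  shows "refines A (join_part A \<pi> \<rho>) \<sigma>"
proof -
  let ?R = "(same_block \<pi> \<union> same_block \<rho>)\<^sup>+"
  have p: "partition_on A \<pi>" "partition_on A \<rho>" "partition_on A \<sigma>"
    using assms by (simp_all add: refines_def)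
  have "same_block \<tau> \<subseteq> same_block \<sigma>" if "refines A \<tau> \<sigma>" for \<tau>
  proof (rule subrelI)
    fix x y assume "(x, y) \<in> same_block \<tau>"
    then obtain X where X: "X \<in> \<tau>" "x \<in> X" "y \<in> X"
      unfolding same_block_def by blast
    with that obtain Y where "Y \<in> \<sigma>" "X \<subseteq> Y"
      unfolding refines_def by blast
    with X show "(x, y) \<in> same_block \<sigma>"
      unfolding same_block_def by blast
  qed
  with assms have sub: "same_block \<pi> \<union> same_block \<rho> \<subseteq> same_block \<sigma>"
    by simp
  have tr: "trans (same_block \<sigma>)"
  proof (rule transI)
    fix x y z assume "(x, y) \<in> same_block \<sigma>" "(y, z) \<in> same_block \<sigma>"
    then obtain X Y where XY: "X \<in> \<sigma>" "Y \<in> \<sigma>" "x \<in> X" "y \<in> X" "y \<in> Y" "z \<in> Y"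
      unfolding same_block_def by blast
    then have "X = Y"
      using p(3) unfolding partition_on_def disjoint_def by blast
    with XY show "(x, z) \<in> same_block \<sigma>" unfolding same_block_def by blast
  qed
  have R: "?R \<subseteq> same_block \<sigma>"
    using trancl_mono_subset[OF sub] trancl_id[OF tr] by simp
  have "\<exists>Y\<in>\<sigma>. X \<subseteq> Y" if "X \<in> A // ?R" for X
  proof -
    from that obtain x where x: "x \<in> A" "X = ?R `` {x}" by (rule quotientE)
    obtain Y where Y: "Y \<in> \<sigma>" "x \<in> Y"
      using x(1) p(3) unfolding partition_on_def by blast
    have "X \<subseteq> Y"
    proof
      fix y assume "y \<in> X"
      then obtain Z where "Z \<in> \<sigma>" "x \<in> Z" "y \<in> Z"
        using x R unfolding same_block_def by blast
      moreover from this have "Z = Y"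
        using Y p(3) unfolding partition_on_def disjoint_def by blast
      ultimately show "y \<in> Y" by simp
    qed
    with Y show ?thesis by blast
  qed
  then show ?thesis
    using p(3) partition_on_quotient[OF equiv_join_part[OF p(1,2)]]
    unfolding refines_def join_part_def by blast
qed

text \<open>The Moebius function of the lattice of partitions of a finite set.\<close>

function moebius :: "'a set \<Rightarrow> 'a set set \<Rightarrow> 'a set set \<Rightarrow> int" where
  "moebius A \<pi> \<rho> =
    (if \<pi> = \<rho> then 1
     else if finite A \<and> refines A \<pi> \<rho>
       then - (\<Sum>\<tau> | refines A \<pi> \<tau> \<and> refines A \<tau> \<rho> \<and> \<tau> \<noteq> \<rho>. moebius A \<pi> \<tau>)
     else 0)"
  by pat_completeness auto
termination
proof (relation "Wellfounded.measure (\<lambda>(A, \<pi>, \<rho>). card {\<tau>. refines A \<pi> \<tau> \<and> refines A \<tau> \<rho>})")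
  fix A :: "'a set" and \<pi> \<rho> \<tau>
  assume fin: "finite A \<and> refines A \<pi> \<rho>"
    and t: "\<tau> \<in> {\<tau>. refines A \<pi> \<tau> \<and> refines A \<tau> \<rho> \<and> \<tau> \<noteq> \<rho>}"
  have "{\<tau>. refines A \<pi> \<tau> \<and> refines A \<tau> \<rho>} \<subseteq> Pow (Pow A)"
    unfolding refines_def partition_on_def by auto
  then have "finite {\<tau>. refines A \<pi> \<tau> \<and> refines A \<tau> \<rho>}"
    using fin by (meson finite_Pow_iff finite_subset)
  moreover have "{\<tau>'. refines A \<pi> \<tau>' \<and> refines A \<tau>' \<tau>} \<subset> {\<tau>'. refines A \<pi> \<tau>' \<and> refines A \<tau>' \<rho>}"
  proof
    show "{\<tau>'. refines A \<pi> \<tau>' \<and> refines A \<tau>' \<tau>} \<subseteq> {\<tau>'. refines A \<pi> \<tau>' \<and> refines A \<tau>' \<rho>}"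
      using t refines_trans by blast
    have "refines A \<rho> \<rho>"
      using fin unfolding refines_def by blast
    moreover have "\<not> refines A \<rho> \<tau>"
      using t refines_asym by blast
    ultimately show "{\<tau>'. refines A \<pi> \<tau>' \<and> refines A \<tau>' \<tau>} \<noteq> {\<tau>'. refines A \<pi> \<tau>' \<and> refines A \<tau>' \<rho>}"
      using fin by blast
  qed
  ultimately show "((A, \<pi>, \<tau>), (A, \<pi>, \<rho>))
      \<in> Wellfounded.measure (\<lambda>(A, \<pi>, \<rho>). card {\<tau>. refines A \<pi> \<tau> \<and> refines A \<tau> \<rho>})"
    by (simp add: psubset_card_mono)
qed simp

declare moebius.simps [simp del]

section \<open>Permutations\<close>

text \<open>For a permutation \<open>\<sigma>\<close> and a union \<open>A\<close> of cycles of \<open>\<sigma>\<close>, \<open>cycles_on A \<sigma>\<close> is the partition of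
  \<open>A\<close> into cycles of \<open>\<sigma>\<close>, i.e. the partition attached to the restriction of \<open>\<sigma>\<close> to \<open>A\<close>. Fixed points
  count as cycles.\<close>

definition cycles_on :: "'a set \<Rightarrow> ('a \<Rightarrow> 'a) \<Rightarrow> 'a set set" where
  "cycles_on A \<sigma> = orbit \<sigma> ` A"

definition cycle_type :: "'a set \<Rightarrow> ('a \<Rightarrow> 'a) \<Rightarrow> nat multiset" where
  "cycle_type A \<sigma> = image_mset card (mset_set (cycles_on A \<sigma>))"

fun gamma_from :: "nat \<Rightarrow> nat list \<Rightarrow> nat \<Rightarrow> nat" where
  "gamma_from s [] = id"
| "gamma_from s (l # ls) = cycle_of_list [Suc s..<Suc (s + l)] \<circ> gamma_from (s + l) ls"

definition gamma :: "nat list \<Rightarrow> nat \<Rightarrow> nat" where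
  "gamma ls = gamma_from 0 ls"

definition genus :: "'a set \<Rightarrow> ('a \<Rightarrow> 'a) \<Rightarrow> ('a \<Rightarrow> 'a) \<Rightarrow> rat" where
  "genus A \<sigma>\<^sub>1 \<sigma>\<^sub>2 =
    (2 * of_nat (card (join_part A (cycles_on A \<sigma>\<^sub>1) (cycles_on A \<sigma>\<^sub>2))) + of_nat (card A)
      - of_nat (card (cycles_on A \<sigma>\<^sub>1)) - of_nat (card (cycles_on A \<sigma>\<^sub>2))
      - of_nat (card (cycles_on A (\<sigma>\<^sub>1 \<circ> \<sigma>\<^sub>2)))) / 2"

text \<open>Integer partitions as multisets of parts; \<open>parts_list\<close> lists the parts in decreasing order.\<close>

definition parts_list :: "nat multiset \<Rightarrow> nat list" where
  "parts_list \<mu> = rev (sorted_list_of_multiset \<mu>)"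

definition mcount :: "nat multiset \<Rightarrow> nat multiset \<Rightarrow> nat" where
  "mcount \<mu> \<mu>' =
    (let A = {1..sum_mset \<mu>}; \<gamma> = gamma (parts_list \<mu>) in
      card {\<tau>. \<tau> permutes A \<and> genus A \<gamma> \<tau> = 0 \<and>
        join_part A (cycles_on A \<gamma>) (cycles_on A \<tau>) = one_part (sum_mset \<mu>) \<and>
        cycle_type A \<tau> = \<mu>'})"

text \<open>The integer partition with \<open>d a\<close> parts equal to \<open>a\<close>, for \<open>1 \<le> a \<le> m\<close>.\<close>

definition mult_partition :: "nat \<Rightarrow> (nat \<Rightarrow> nat) \<Rightarrow> nat multiset" where
  "mult_partition m d = (\<Sum>a\<in>{1..m}. replicate_mset (d a) a)"

section \<open>Labeled bipartite trees\<close>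

definition incidence_edges :: "'a set set \<Rightarrow> (('a + 'a set) \<times> ('a + 'a set)) set" where
  "incidence_edges \<I> =
    (\<Union>I\<in>\<I>. \<Union>i\<in>I. {(Inl i, Inr I), (Inr I, Inl i)})"

definition incidence_connected :: "'a set \<Rightarrow> 'a set set \<Rightarrow> bool" where
  "incidence_connected V \<I> \<longleftrightarrow>
    (\<forall>u\<in>Inl ` V \<union> Inr ` \<I>. \<forall>v\<in>Inl ` V \<union> Inr ` \<I>. (u, v) \<in> (incidence_edges \<I>)\<^sup>*)"

text \<open>A bipartite tree with white vertices \<open>1, \<dots>, k\<close> and black vertices of valency at least 2 is
  encoded by the set of neighbourhoods of its black vertices. The bipartite graph has
  \<open>k + card \<I>\<close> vertices and \<open>\<Sum>I\<in>\<I>. card I\<close> edges, so that, being connected, it is a tree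
  iff \<open>(\<Sum>I\<in>\<I>. card I - 1) = k - 1\<close>.\<close>

definition bip_trees :: "nat \<Rightarrow> nat set set set" where
  "bip_trees k =
    {\<I>. (\<forall>I\<in>\<I>. I \<subseteq> {1..k} \<and> 2 \<le> card I) \<and> incidence_connected {1..k} \<I> \<and>
        (\<Sum>I\<in>\<I>. card I - 1) = k - 1}"

section \<open>Random matrices, moments and free cumulants\<close>

definition tr :: "complex mat \<Rightarrow> complex" where
  "tr A = (\<Sum>i<dim_row A. A $$ (i, i))"

text \<open>A sequence of \<open>N \<times> N\<close> random matrices for which all joint moments, hence all joint classical
  cumulants, of traces of powers are defined.\<close>

definition random_matrices :: "(nat \<Rightarrow> 'w measure) \<Rightarrow> (nat \<Rightarrow> 'w \<Rightarrow> complex mat) \<Rightarrow> bool" where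
  "random_matrices P B \<longleftrightarrow>
    (\<forall>N. prob_space (P N) \<and>
      (\<forall>\<omega>\<in>space (P N). B N \<omega> \<in> carrier_mat N N) \<and>
      (\<forall>i<N. \<forall>j<N. (\<lambda>\<omega>. B N \<omega> $$ (i, j)) \<in> borel_measurable (P N)) \<and>
      (\<forall>ms :: nat list. integrable (P N) (\<lambda>\<omega>. \<Prod>m\<leftarrow>ms. tr (B N \<omega> ^\<^sub>m m))))"

text \<open>The joint cumulant of a family \<open>(X i)\<close> indexed by a finite nonempty set \<open>S\<close>.\<close>

definition joint_cumulant :: "'w measure \<Rightarrow> 'i set \<Rightarrow> ('i \<Rightarrow> 'w \<Rightarrow> complex) \<Rightarrow> complex" where
  "joint_cumulant M S X =
    (\<Sum>\<rho> | partition_on S \<rho>. (-1) ^ (card \<rho> - 1) * fact (card \<rho> - 1) *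
      (\<Prod>V\<in>\<rho>. LINT \<omega>|M. (\<Prod>i\<in>V. X i \<omega>)))"

text \<open>\<open>weingarten N G\<close> is the inverse, in the group algebra of the permutations of \<open>G\<close>, of
  \<open>\<nu> \<mapsto> N ^ #\<nu>\<close>. It is well defined for \<open>N \<ge> card G\<close> and unspecified otherwise; it only enters
  through limits \<open>N \<rightarrow> \<infinity>\<close> with \<open>G\<close> fixed.\<close>

definition weingarten :: "nat \<Rightarrow> 'a set \<Rightarrow> ('a \<Rightarrow> 'a) \<Rightarrow> complex" where
  "weingarten N G = (THE w.
    (\<forall>\<nu>. \<not> \<nu> permutes G \<longrightarrow> w \<nu> = 0) \<and>
    (\<forall>\<nu>. \<nu> permutes G \<longrightarrow>
      (\<Sum>\<mu> | \<mu> permutes G. w (\<nu> \<circ> inv_into UNIV \<mu>) * of_nat N ^ card (cycles_on G \<mu>))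
        = (if \<nu> = id then 1 else 0)))"

text \<open>In the following definitions \<open>X\<close> is a random matrix on the probability space \<open>M\<close>, and
  \<open>\<pi>\<close> is coarser than the cycle partition of the permutation.\<close>

definition phi :: "'w measure \<Rightarrow> ('w \<Rightarrow> complex mat) \<Rightarrow> nat set set \<Rightarrow> (nat \<Rightarrow> nat) \<Rightarrow> complex" where
  "phi M X \<pi> \<tau> =
    (\<Prod>G\<in>\<pi>. joint_cumulant M (cycles_on G \<tau>) (\<lambda>V \<omega>. tr (X \<omega> ^\<^sub>m card V)))"

definition kappa ::
  "'w measure \<Rightarrow> ('w \<Rightarrow> complex mat) \<Rightarrow> nat \<Rightarrow> nat \<Rightarrow> nat set set \<Rightarrow> (nat \<Rightarrow> nat) \<Rightarrow> complex" where
  "kappa M X N n \<pi> \<sigma> =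
    (\<Sum>\<tau> | \<tau> permutes {1..n}.
      \<Sum>\<pi>' | refines {1..n} (cycles_on {1..n} \<tau>) \<pi>' \<and> refines {1..n} \<pi>' \<pi>.
        phi M X \<pi>' \<tau> *
        (\<Sum>\<pi>'' | refines {1..n} (join_part {1..n} (cycles_on {1..n} \<sigma>) \<pi>') \<pi>'' \<and>
                 refines {1..n} \<pi>'' \<pi>.
          of_int (moebius {1..n} \<pi>'' \<pi>) *
          (\<Prod>G\<in>\<pi>''. weingarten N G (perm_restrict (\<sigma> \<circ> inv_into UNIV \<tau>) G))))"

definition phi_scaled ::
  "(nat \<Rightarrow> 'w measure) \<Rightarrow> (nat \<Rightarrow> 'w \<Rightarrow> complex mat) \<Rightarrow> nat \<Rightarrow> nat set set \<Rightarrow> (nat \<Rightarrow> nat) \<Rightarrow> nat \<Rightarrow> complex"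
  where
  "phi_scaled P B n \<pi> \<sigma> N =
    of_nat N powi (int (card (cycles_on {1..n} \<sigma>)) - 2 * int (card \<pi>)) * phi (P N) (B N) \<pi> \<sigma>"

definition kappa_scaled ::
  "(nat \<Rightarrow> 'w measure) \<Rightarrow> (nat \<Rightarrow> 'w \<Rightarrow> complex mat) \<Rightarrow> nat \<Rightarrow> nat set set \<Rightarrow> (nat \<Rightarrow> nat) \<Rightarrow> nat \<Rightarrow> complex"
  where
  "kappa_scaled P B n \<pi> \<sigma> N =
    of_nat N powi (int (card (cycles_on {1..n} \<sigma>)) + int n - 2 * int (card \<pi>)) *
    kappa (P N) (B N) N n \<pi> \<sigma>"

definition phi_limits_exist ::
  "(nat \<Rightarrow> 'w measure) \<Rightarrow> (nat \<Rightarrow> 'w \<Rightarrow> complex mat) \<Rightarrow> bool" where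
  "phi_limits_exist P B \<longleftrightarrow>
    (\<forall>n \<pi> \<sigma>. \<sigma> permutes {1..n} \<and> refines {1..n} (cycles_on {1..n} \<sigma>) \<pi> \<longrightarrow>
      convergent (phi_scaled P B n \<pi> \<sigma>))"

definition phi_lim ::
  "(nat \<Rightarrow> 'w measure) \<Rightarrow> (nat \<Rightarrow> 'w \<Rightarrow> complex mat) \<Rightarrow> nat \<Rightarrow> nat set set \<Rightarrow> (nat \<Rightarrow> nat) \<Rightarrow> complex"
  where
  "phi_lim P B n \<pi> \<sigma> = lim (phi_scaled P B n \<pi> \<sigma>)"

definition kappa_lim ::
  "(nat \<Rightarrow> 'w measure) \<Rightarrow> (nat \<Rightarrow> 'w \<Rightarrow> complex mat) \<Rightarrow> nat \<Rightarrow> nat set set \<Rightarrow> (nat \<Rightarrow> nat) \<Rightarrow> complex"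
  where
  "kappa_lim P B n \<pi> \<sigma> = lim (kappa_scaled P B n \<pi> \<sigma>)"

text \<open>\<open>moment P B [l\<^sub>1, \<dots>, l\<^sub>p]\<close> is the limiting moment of \<open>b ^ l\<^sub>1, \<dots>, b ^ l\<^sub>p\<close> and
  \<open>free_cumulant P B [l\<^sub>1, \<dots>, l\<^sub>p]\<close> the free cumulant of \<open>b\<close> with indices \<open>l\<^sub>1, \<dots>, l\<^sub>p\<close>.\<close>

definition moment ::
  "(nat \<Rightarrow> 'w measure) \<Rightarrow> (nat \<Rightarrow> 'w \<Rightarrow> complex mat) \<Rightarrow> nat list \<Rightarrow> complex" where
  "moment P B ls = phi_lim P B (sum_list ls) (one_part (sum_list ls)) (gamma ls)"

definition free_cumulant ::
  "(nat \<Rightarrow> 'w measure) \<Rightarrow> (nat \<Rightarrow> 'w \<Rightarrow> complex mat) \<Rightarrow> nat list \<Rightarrow> complex" where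
  "free_cumulant P B ls = kappa_lim P B (sum_list ls) (one_part (sum_list ls)) (gamma ls)"

section \<open>Index families\<close>

text \<open>The \<open>i\<close>-th block (\<open>i \<ge> 1\<close>) in increasing order of the minimal elements.\<close>

definition nth_block :: "nat set set \<Rightarrow> nat \<Rightarrow> nat set" where
  "nth_block \<pi> i = (THE G. G \<in> \<pi> \<and> card {H \<in> \<pi>. Min H \<le> Min G} = i)"

text \<open>Families \<open>(j, c)\<close> where \<open>j I i\<close> is defined for \<open>i \<in> I \<in> \<I>\<close> and \<open>c i a\<close> for
  \<open>1 \<le> a \<le> card (G i)\<close>; both are set to \<^const>\<open>undefined\<close> elsewhere, so that each family
  is represented by exactly one pair of functions.\<close>

definition index_families ::
  "nat \<Rightarrow> (nat \<Rightarrow> nat set) \<Rightarrow> nat set set \<Rightarrow> ((nat set \<Rightarrow> nat \<Rightarrow> nat) \<times> (nat \<Rightarrow> nat \<Rightarrow> nat)) set"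
  where
  "index_families k G \<I> =
    {(j, c). j \<in> (\<Pi>\<^sub>E I\<in>\<I>. \<Pi>\<^sub>E i\<in>I. {1..}) \<and>
             c \<in> (\<Pi>\<^sub>E i\<in>{1..k}. \<Pi>\<^sub>E a\<in>{1..card (G i)}. UNIV) \<and>
             (\<forall>i\<in>{1..k}. (\<Sum>I | I \<in> \<I> \<and> i \<in> I. j I i) + (\<Sum>a = 1..card (G i). a * c i a)
                = card (G i))}"

definition q_mult :: "nat set set \<Rightarrow> (nat set \<Rightarrow> nat \<Rightarrow> nat) \<Rightarrow> nat \<Rightarrow> nat \<Rightarrow> nat" where
  "q_mult \<I> j i a = card {I \<in> \<I>. i \<in> I \<and> j I i = a}"

end

theory Submission
  imports Defs "Jordan_Normal_Form.Determinant"
begin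

text \<open>Inverting the Weingarten convolution gives, for each \<open>N\<close>, an exact formula for the cumulants of
  traces: a sum over permutations \<open>\<sigma>\<close> and partitions \<open>\<rho> \<ge> \<Pi>(\<sigma>)\<close> with \<open>\<rho> \<or> \<Pi>(\<tau>) = 1\<close> of a power of \<open>N\<close> times the
  product over \<open>V \<in> \<rho>\<close> of the finite-\<open>N\<close> free cumulants with indices the cycle lengths of \<open>\<sigma>\<close> in \<open>V\<close>. The
  exponent of \<open>N\<close> is never positive, which lets the free cumulants converge (by induction on the size,
  through a linear system whose limit is triangular) and leaves in the limit the pairs
  \<open>(\<sigma>, \<rho>)\<close> of exponent zero. With \<open>\<pi> = \<Pi>(\<sigma>) \<or> \<Pi>(\<tau>)\<close>, exponent zero means that \<open>\<sigma>\<close> is planar and connected with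
  \<open>\<tau>\<close> inside each block of \<open>\<pi>\<close>, and that the blocks of \<open>\<rho>\<close>, seen as hyperedges between the blocks
  of \<open>\<pi>\<close>, form a tree. The singletons of this tree are the factors \<open>\<kappa>\<^sub>a\<close>, the larger hyperedges the factors
  indexed by \<open>\<I>(T)\<close>, and the ratio of factorials counts the choices of the cycles attached to the
  tree.\<close>

section \<open>Sums over partitions\<close>

text \<open>All finite-N quantities depend on a permutation only through its cycle type, and are
  therefore carried as functions of multisets. This lets blocks that live on different subsets be
  compared, and it rests on the uniqueness of the Weingarten inverse, hence on N >= n!. Between the
  two kinds of cumulants stands \<open>dual_moment\<close>, the convolution of trace moments with
  the Weingarten function: \<open>kappa\<close> at the one-block partition is the classical cumulant
  of dual moments, as \<open>phi\<close> is that of trace moments. So the exact formula is an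
  inversion in each block combined with the moment-cumulant relation, and the condition on the join
  is what the Moebius coefficients leave. Sets that are not invariant are given the value zero, so
  that sums over permutations and sums over partitions can be exchanged freely. The exponent is a
  genus defect plus twice a hypergraph defect, each nonpositive by itself. Convergence of the
  cumulants is a true obligation, since \<open>kappa_lim\<close> is a bare \<open>lim\<close> and
  the assumed limits are those of \<open>phi\<close>.\<close>

lemma partition_on_subset: "partition_on A P \<Longrightarrow> X \<in> P \<Longrightarrow> X \<subseteq> A"
  by (auto simp: partition_on_def)

lemma partition_on_nonempty: "partition_on A P \<Longrightarrow> X \<in> P \<Longrightarrow> X \<noteq> {}"
  by (auto simp: partition_on_def)

lemma partition_on_same_block:
  "partition_on A P \<Longrightarrow> X \<in> P \<Longrightarrow> Y \<in> P \<Longrightarrow> x \<in> X \<Longrightarrow> x \<in> Y \<Longrightarrow> X = Y"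
  by (auto simp: partition_on_def disjoint_def)

lemma partition_on_ex: "partition_on A P \<Longrightarrow> x \<in> A \<Longrightarrow> \<exists>X\<in>P. x \<in> X"
  by (auto simp: partition_on_def)

lemma partition_on_split:
  assumes p: "partition_on (G \<union> H) \<rho>" and GH: "G \<inter> H = {}" and b: "\<forall>K\<in>\<rho>. K \<subseteq> G \<or> K \<subseteq> H"
  shows "partition_on G {K\<in>\<rho>. K \<subseteq> G}"
proof (rule partition_onI)
  show "\<Union> {K\<in>\<rho>. K \<subseteq> G} = G"
  proof (intro equalityI subsetI)
    fix x assume x: "x \<in> G"
    then have "x \<in> G \<union> H" by simp
    then obtain X where X: "X \<in> \<rho>" "x \<in> X" using partition_on_ex[OF p, of x] by blast
    moreover have "X \<subseteq> G \<or> X \<subseteq> H" using b X by blast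
    moreover have "x \<notin> H" using x GH by blast
    ultimately have "X \<subseteq> G" by blast
    then show "x \<in> \<Union> {K\<in>\<rho>. K \<subseteq> G}" using X by blast
  qed auto
  show "{} \<notin> {K\<in>\<rho>. K \<subseteq> G}" using partition_on_nonempty[OF p] by auto
  fix K L assume "K \<in> {K\<in>\<rho>. K \<subseteq> G}" "L \<in> {K\<in>\<rho>. K \<subseteq> G}" "K \<noteq> L"
  then show "disjnt K L" using partition_on_same_block[OF p, of K L] by (auto simp: disjnt_iff)
qed

text \<open>A partition of \<open>insert x S\<close> comes from exactly one partition of
  \<open>S\<close>: either \<open>x\<close> is a block by itself, or it has been added to one block
  \<open>V\<close>. Alternating sums can thus be treated one point at a time.\<close>

lemma sum_partition_on_insert:
  fixes f :: "'a set set \<Rightarrow> 'b::comm_monoid_add"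
  assumes fin: "finite S" and x: "x \<notin> S"
  shows "(\<Sum>\<rho> | partition_on (insert x S) \<rho>. f \<rho>) =
    (\<Sum>\<rho> | partition_on S \<rho>. f (insert {x} \<rho>) + (\<Sum>V\<in>\<rho>. f (insert (insert x V) (\<rho> - {V}))))"
proof -
  let ?P = "{\<rho>. partition_on S \<rho>}"
  let ?h = "\<lambda>(\<rho>, V). insert (insert x V) (\<rho> - {V})"
  let ?D = "SIGMA \<rho>:?P. \<rho>"
  have finP: "finite ?P" using finitely_many_partition_on[OF fin] .
  have finb: "finite \<rho>" if "partition_on S \<rho>" for \<rho> using finite_elements[OF fin that] .
  have sub: "V \<subseteq> S" if "partition_on S \<rho>" "V \<in> \<rho>" for \<rho> V
    using that by (auto simp: partition_on_def)
  have 1: "insert {x} \<rho> \<in> {\<rho>. partition_on (insert x S) \<rho>}" if "partition_on S \<rho>" for \<rho>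
    using that x by (auto simp: partition_on_def disjoint_def)
  have 2: "?h (\<rho>, V) \<in> {\<rho>. partition_on (insert x S) \<rho>}" if "partition_on S \<rho>" "V \<in> \<rho>" for \<rho> V
  proof -
    have "\<Union> (insert (insert x V) (\<rho> - {V})) = insert x S"
      using that by (auto simp: partition_on_def)
    moreover have "disjnt p q" if pq: "p \<in> insert (insert x V) (\<rho> - {V})" "q \<in> insert (insert x V) (\<rho> - {V})" "p \<noteq> q" for p q
    proof -
      have dd: "A \<inter> B = {}" if "A \<in> \<rho>" "B \<in> \<rho>" "A \<noteq> B" for A B
        using \<open>partition_on S \<rho>\<close> that by (auto simp: partition_on_def disjoint_def)
      have nx: "x \<notin> A" if "A \<in> \<rho>" for A using sub[OF \<open>partition_on S \<rho>\<close> that] x by blast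
      consider "p = insert x V" "q \<in> \<rho>" "q \<noteq> V" | "q = insert x V" "p \<in> \<rho>" "p \<noteq> V" | "p \<in> \<rho>" "q \<in> \<rho>"
        using pq by blast
      then show ?thesis
      proof cases
        case 1 then show ?thesis using dd[of V q] nx[of q] \<open>V \<in> \<rho>\<close> by (auto simp: disjnt_def)
      next
        case 2 then show ?thesis using dd[of V p] nx[of p] \<open>V \<in> \<rho>\<close> by (auto simp: disjnt_def)
      next
        case 3 then show ?thesis using dd[of p q] \<open>p \<noteq> q\<close> by (auto simp: disjnt_def)
      qed
    qed
    moreover have "{} \<notin> insert (insert x V) (\<rho> - {V})" using that by (auto simp: partition_on_def)
    ultimately have "partition_on (insert x S) (insert (insert x V) (\<rho> - {V}))"
      by (rule partition_onI)
    then show ?thesis by simp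
  qed
  have eq: "{\<rho>. partition_on (insert x S) \<rho>} = insert {x} ` ?P \<union> ?h ` ?D" (is "?L = ?R")
  proof
    show "?R \<subseteq> ?L" using 1 2 by auto
    show "?L \<subseteq> ?R"
    proof
      fix \<rho> assume "\<rho> \<in> ?L"
      then have \<rho>: "partition_on (insert x S) \<rho>" by simp
      then obtain W where W: "W \<in> \<rho>" "x \<in> W" by (auto simp: partition_on_def)
      have oth: "x \<notin> V" if "V \<in> \<rho>" "V \<noteq> W" for V
        using \<rho> W that by (auto simp: partition_on_def disjoint_def)
      show "\<rho> \<in> ?R"
      proof (cases "W = {x}")
        case True
        have r: "\<rho> = insert {x} (\<rho> - {{x}})" using W True by auto
        have "disjnt {x} (\<Union>(\<rho> - {{x}}))" using oth True by (auto simp: disjnt_def)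
        then have "partition_on (insert x S - {x}) (\<rho> - {{x}})"
          using partition_on_insert[of "{x}" "\<rho> - {{x}}" "insert x S"] \<rho> r by simp
        then have "partition_on S (\<rho> - {{x}})" using x by simp
        moreover note r
        ultimately show ?thesis by blast
      next
        case False
        let ?r = "insert (W - {x}) (\<rho> - {W})"
        \<comment> \<open>If \<open>W - {x}\<close> were already a block, deleting it from
          \<open>?r\<close> would not give back the other blocks; disjointness rules this
          out.\<close>
        have nin: "W - {x} \<notin> \<rho> - {W}"
        proof
          assume "W - {x} \<in> \<rho> - {W}"
          moreover obtain y where "y \<in> W - {x}" using W False by blast
          ultimately have "W - {x} = W" using W partition_on_same_block[OF \<rho>, of "W - {x}" W y] by blast
          then show False using W by auto
        qed
        have "partition_on S ?r"
        proof (rule partition_onI)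
          have "\<Union> ?r = \<Union> \<rho> - {x}" using W oth by auto
          then show "\<Union> ?r = S" using \<rho> x by (auto simp: partition_on_def)
          show "{} \<notin> ?r" using \<rho> W False by (auto simp: partition_on_def)
          fix p q assume "p \<in> ?r" "q \<in> ?r" "p \<noteq> q"
          have dd: "A \<inter> B = {}" if "A \<in> \<rho>" "B \<in> \<rho>" "A \<noteq> B" for A B
            using \<rho> that by (auto simp: partition_on_def disjoint_def)
          consider "p = W - {x}" "q \<in> \<rho>" "q \<noteq> W" | "q = W - {x}" "p \<in> \<rho>" "p \<noteq> W" | "p \<in> \<rho>" "q \<in> \<rho>"
            using \<open>p \<in> ?r\<close> \<open>q \<in> ?r\<close> \<open>p \<noteq> q\<close> by blast
          then show "disjnt p q"
          proof cases
            case 1 then show ?thesis using dd[of W q] W by (auto simp: disjnt_def)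
          next
            case 2 then show ?thesis using dd[of W p] W by (auto simp: disjnt_def)
          next
            case 3 then show ?thesis using dd[of p q] \<open>p \<noteq> q\<close> by (auto simp: disjnt_def)
          qed
        qed
        moreover have "?h (?r, W - {x}) = \<rho>" using W nin by (auto simp: insert_absorb)
        ultimately have "\<rho> \<in> ?h ` ?D" by (intro image_eqI[of _ _ "(?r, W - {x})"]) auto
        then show ?thesis by blast
      qed
    qed
  qed
  have "inj_on ?h ?D"
  proof (rule inj_onI, clarify)
    fix \<rho> V \<rho>' V'
    assume a: "partition_on S \<rho>" "V \<in> \<rho>" "partition_on S \<rho>'" "V' \<in> \<rho>'"
      and e: "insert (insert x V) (\<rho> - {V}) = insert (insert x V') (\<rho>' - {V'})"
    have n: "x \<notin> W" if "W \<in> \<rho> \<or> W \<in> \<rho>'" for W using that a x sub by blast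
    have "insert x V = insert x V'" using e n by (metis DiffD1 insertE insertI1)
    then have V: "V = V'" using n a by (metis insert_ident)
    have "\<rho> - {V} = \<rho>' - {V'}"
      using e V n by (metis DiffD1 insertI1 insert_ident)
    then show "\<rho> = \<rho>' \<and> V = V'" using V a by blast
  qed
  moreover have "inj_on (insert {x}) ?P"
  proof (rule inj_onI, clarify)
    fix \<rho> \<rho>' assume a: "partition_on S \<rho>" "partition_on S \<rho>'" "insert {x} \<rho> = insert {x} \<rho>'"
    then have "{x} \<notin> \<rho>" "{x} \<notin> \<rho>'" using x sub by blast+
    then show "\<rho> = \<rho>'" using a(3) by (metis insert_ident)
  qed
  moreover have "insert {x} ` ?P \<inter> ?h ` ?D = {}"
  proof -
    have False if a: "partition_on S \<rho>" "partition_on S \<rho>'" "V \<in> \<rho>'"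
        "insert {x} \<rho> = insert (insert x V) (\<rho>' - {V})" for \<rho> \<rho>' V
    proof -
      have "insert x V \<in> insert {x} \<rho>" using a(4) by simp
      moreover have "V \<noteq> {}" "x \<notin> V" using partition_on_nonempty[OF a(2,3)] sub[OF a(2,3)] x by auto
      moreover have "insert x V \<notin> \<rho>" using sub[OF a(1), of "insert x V"] x by auto
      ultimately show False by auto
    qed
    then show ?thesis by (intro equals0I) (elim IntE imageE, clarsimp, metis)
  qed
  ultimately have "(\<Sum>\<rho> | partition_on (insert x S) \<rho>. f \<rho>) =
      (\<Sum>\<rho>\<in>?P. f (insert {x} \<rho>)) + (\<Sum>p\<in>?D. f (?h p))"
    unfolding eq using finP finb
    by (subst sum.union_disjoint) (auto simp: sum.reindex o_def case_prod_unfold intro!: finite_SigmaI)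
  also have "(\<Sum>p\<in>?D. f (?h p)) = (\<Sum>\<rho>\<in>?P. \<Sum>V\<in>\<rho>. f (insert (insert x V) (\<rho> - {V})))"
    using finP finb by (subst sum.Sigma) (auto simp: case_prod_unfold)
  finally show ?thesis by (simp add: sum.distrib)
qed

text \<open>The value \<open>\<lambda>\<^bsub>\<pi>,1\<^esub>\<close> of the Moebius function at a partition \<open>\<pi>\<close> with \<open>r\<close> blocks.\<close>

definition cumulant_coeff :: "nat \<Rightarrow> complex" where
  "cumulant_coeff r = (-1) ^ (r - 1) * fact (r - 1)"

text \<open>For a fixed partition of the remaining points with r blocks, adding \<open>x\<close>
  gives one partition with r + 1 blocks and r partitions with r blocks, and (-1)^r r! + r (-1)^(r-1)
  (r-1)! = 0. So each summand of the recursion vanishes by itself, unless nothing remains besides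
  \<open>x\<close>.\<close>

lemma sum_cumulant_coeff:
  assumes "finite S" "S \<noteq> {}"
  shows "(\<Sum>\<rho> | partition_on S \<rho>. cumulant_coeff (card \<rho>)) = (if card S = 1 then 1 else 0)"
proof -
  obtain x T where T: "S = insert x T" "x \<notin> T" "finite T"
    using assms by (metis finite_insert mk_disjoint_insert ex_in_conv)
  show ?thesis
  proof (cases "T = {}")
    case True
    then show ?thesis using T
      by (simp add: sum_partition_on_insert partition_on_empty cumulant_coeff_def)
  next
    case False
    have "cumulant_coeff (card (insert {x} \<rho>)) + (\<Sum>V\<in>\<rho>. cumulant_coeff (card (insert (insert x V) (\<rho> - {V})))) = 0"
      if r: "partition_on T \<rho>" for \<rho>
    proof -
      have fin: "finite \<rho>" using finite_elements[OF T(3) r] .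
      have ne: "\<rho> \<noteq> {}" using r False by (auto simp: partition_on_def)
      have "\<And>V. V \<in> \<rho> \<Longrightarrow> x \<notin> V" using T r by (auto simp: partition_on_def)
      then have c: "{x} \<notin> \<rho>" "\<And>V. insert x V \<notin> \<rho>" by blast+
      obtain m where m: "card \<rho> = Suc m" using fin ne by (metis card_eq_0_iff not0_implies_Suc)
      have "card (insert (insert x V) (\<rho> - {V})) = card \<rho>" if "V \<in> \<rho>" for V
        using that fin c by (subst card_insert_disjoint) (auto simp: m)
      then show ?thesis using fin c by (simp add: m cumulant_coeff_def)
    qed
    moreover have "card S \<noteq> 1" using T False by (auto simp: card_Suc_eq)
    ultimately show ?thesis using T(2,3) unfolding T(1)
      by (subst sum_partition_on_insert) (auto intro!: sum.neutral simp del: One_nat_def)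
  qed
qed

section \<open>Refinements, coarsenings and products over blocks\<close>

lemma finite_refines: "finite A \<Longrightarrow> finite {\<rho>. refines A \<rho> \<pi>}" "finite A \<Longrightarrow> finite {\<rho>. refines A \<pi> \<rho>}"
  by (auto intro!: finite_subset[OF _ finitely_many_partition_on[of A]] simp: refines_def)

lemma refines_insert_block:
  assumes r: "refines (G \<union> H) \<rho> (insert G \<pi>)" "K \<in> \<rho>" and \<pi>: "partition_on H \<pi>"
  shows "K \<subseteq> G \<or> K \<subseteq> H" "K \<noteq> {}"
proof -
  obtain Y where "Y \<in> insert G \<pi>" "K \<subseteq> Y" using r unfolding refines_def by blast
  then show "K \<subseteq> G \<or> K \<subseteq> H" using partition_on_subset[OF \<pi>] by blast
  show "K \<noteq> {}" using r partition_on_nonempty by (auto simp: refines_def)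
qed

text \<open>Below a partition with a distinguished block \<open>G\<close>, the part inside
  \<open>G\<close> and the part inside \<open>H\<close> are chosen independently; the inverse sorts
  blocks by the side on which they lie. This is the inductive step of the distributive law that
  follows.\<close>

lemma refines_insert_Un:
  assumes G: "G \<noteq> {}" "G \<inter> H = {}" and \<pi>: "partition_on H \<pi>"
  shows "bij_betw (\<lambda>(\<rho>\<^sub>1, \<rho>\<^sub>2). \<rho>\<^sub>1 \<union> \<rho>\<^sub>2) ({\<rho>. partition_on G \<rho>} \<times> {\<rho>. refines H \<rho> \<pi>})
     {\<rho>. refines (G \<union> H) \<rho> (insert G \<pi>)}"
proof (rule bij_betwI[where g = "\<lambda>\<rho>. ({K\<in>\<rho>. K \<subseteq> G}, {K\<in>\<rho>. K \<subseteq> H})"])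
  have pi': "partition_on (G \<union> H) (insert G \<pi>)"
  proof (rule partition_onI)
    show "\<Union> (insert G \<pi>) = G \<union> H" using \<pi> by (auto simp: partition_on_def)
    show "{} \<notin> insert G \<pi>" using G \<pi> by (auto simp: partition_on_def)
    fix p q assume "p \<in> insert G \<pi>" "q \<in> insert G \<pi>" "p \<noteq> q"
    then show "disjnt p q"
      using partition_on_subset[OF \<pi>, of p] partition_on_subset[OF \<pi>, of q] G(2)
        partition_on_same_block[OF \<pi>, of p q] unfolding disjnt_iff by blast
  qed
  show "(\<lambda>(\<rho>\<^sub>1, \<rho>\<^sub>2). \<rho>\<^sub>1 \<union> \<rho>\<^sub>2) \<in> {\<rho>. partition_on G \<rho>} \<times> {\<rho>. refines H \<rho> \<pi>} \<rightarrow> {\<rho>. refines (G \<union> H) \<rho> (insert G \<pi>)}"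
  proof clarsimp
    fix \<rho>\<^sub>1 \<rho>\<^sub>2 assume a: "partition_on G \<rho>\<^sub>1" "refines H \<rho>\<^sub>2 \<pi>"
    then have 2: "partition_on H \<rho>\<^sub>2" by (simp add: refines_def)
    have "partition_on (G \<union> H) (\<rho>\<^sub>1 \<union> \<rho>\<^sub>2)"
      using a 2 G unfolding partition_on_def by (auto intro!: disjoint_union)
    then show "refines (G \<union> H) (\<rho>\<^sub>1 \<union> \<rho>\<^sub>2) (insert G \<pi>)"
    proof -
      have "\<exists>Y\<in>insert G \<pi>. X \<subseteq> Y" if "X \<in> \<rho>\<^sub>1 \<union> \<rho>\<^sub>2" for X
        using that a partition_on_subset[OF a(1), of X] by (auto simp: refines_def)
      then show ?thesis using \<open>partition_on (G \<union> H) (\<rho>\<^sub>1 \<union> \<rho>\<^sub>2)\<close> pi' by (auto simp: refines_def)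
    qed
  qed
  note blk = refines_insert_block[OF _ _ \<pi>]
  show "(\<lambda>\<rho>. ({K\<in>\<rho>. K \<subseteq> G}, {K\<in>\<rho>. K \<subseteq> H})) \<in> {\<rho>. refines (G \<union> H) \<rho> (insert G \<pi>)} \<rightarrow> {\<rho>. partition_on G \<rho>} \<times> {\<rho>. refines H \<rho> \<pi>}"
  proof clarsimp
    fix \<rho> assume r: "refines (G \<union> H) \<rho> (insert G \<pi>)"
    have p: "partition_on (G \<union> H) \<rho>" using r by (simp add: refines_def)
    have b: "\<forall>K\<in>\<rho>. K \<subseteq> G \<or> K \<subseteq> H" using blk r by blast
    have 1: "partition_on G {K\<in>\<rho>. K \<subseteq> G}" by (rule partition_on_split[OF p G(2) b])
    have 2: "partition_on H {K\<in>\<rho>. K \<subseteq> H}"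
      by (rule partition_on_split[of H G]) (use p b G(2) in \<open>auto simp: Un_commute\<close>)
    have "\<exists>Y\<in>\<pi>. K \<subseteq> Y" if K: "K \<in> \<rho>" "K \<subseteq> H" for K
    proof -
      obtain Y where "Y \<in> insert G \<pi>" "K \<subseteq> Y" using r K unfolding refines_def by blast
      moreover have "K \<noteq> {}" using K partition_on_nonempty[OF p] by blast
      ultimately show ?thesis using K G(2) by blast
    qed
    then show "partition_on G {K\<in>\<rho>. K \<subseteq> G} \<and> refines H {K\<in>\<rho>. K \<subseteq> H} \<pi>"
      using 1 2 \<pi> by (auto simp: refines_def)
  qed
  fix x assume "x \<in> {\<rho>. partition_on G \<rho>} \<times> {\<rho>. refines H \<rho> \<pi>}"
  then obtain \<rho>\<^sub>1 \<rho>\<^sub>2 where x: "x = (\<rho>\<^sub>1, \<rho>\<^sub>2)" and a: "partition_on G \<rho>\<^sub>1" "partition_on H \<rho>\<^sub>2"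
    by (auto simp: refines_def)
  have "{K \<in> \<rho>\<^sub>1 \<union> \<rho>\<^sub>2. K \<subseteq> G} = \<rho>\<^sub>1"
  proof -
    have "K \<subseteq> G" if "K \<in> \<rho>\<^sub>1" for K using a that by (auto simp: partition_on_def)
    moreover have "\<not> K \<subseteq> G" if "K \<in> \<rho>\<^sub>2" for K
    proof -
      have "K \<noteq> {}" "K \<subseteq> H" using a that by (auto simp: partition_on_def)
      then show ?thesis using G(2) by blast
    qed
    ultimately show ?thesis by blast
  qed
  moreover have "{K \<in> \<rho>\<^sub>1 \<union> \<rho>\<^sub>2. K \<subseteq> H} = \<rho>\<^sub>2"
  proof -
    have "K \<subseteq> H" if "K \<in> \<rho>\<^sub>2" for K using a that by (auto simp: partition_on_def)
    moreover have "\<not> K \<subseteq> H" if "K \<in> \<rho>\<^sub>1" for K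
    proof -
      have "K \<noteq> {}" "K \<subseteq> G" using a that by (auto simp: partition_on_def)
      then show ?thesis using G(2) by blast
    qed
    ultimately show ?thesis by blast
  qed
  ultimately show "({K \<in> case x of (\<rho>\<^sub>1, \<rho>\<^sub>2) \<Rightarrow> \<rho>\<^sub>1 \<union> \<rho>\<^sub>2. K \<subseteq> G}, {K \<in> case x of (\<rho>\<^sub>1, \<rho>\<^sub>2) \<Rightarrow> \<rho>\<^sub>1 \<union> \<rho>\<^sub>2. K \<subseteq> H}) = x"
    by (simp add: x)
next
  fix \<rho> assume "\<rho> \<in> {\<rho>. refines (G \<union> H) \<rho> (insert G \<pi>)}"
  then have "K \<subseteq> G \<or> K \<subseteq> H" if "K \<in> \<rho>" for K
    using that refines_insert_block(1)[OF _ _ \<pi>] by blast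
  then show "(case ({K \<in> \<rho>. K \<subseteq> G}, {K \<in> \<rho>. K \<subseteq> H}) of (\<rho>\<^sub>1, \<rho>\<^sub>2) \<Rightarrow> \<rho>\<^sub>1 \<union> \<rho>\<^sub>2) = \<rho>" by auto
qed

text \<open>Distributive law: choosing a partition inside every block of \<pi> amounts to choosing a
  refinement of \<pi>. Induction splits off one block at a time.\<close>

lemma prod_sum_partitions:
  fixes F :: "'a set \<Rightarrow> 'b::comm_semiring_1"
  assumes "finite H" "partition_on H \<pi>"
  shows "(\<Prod>G\<in>\<pi>. \<Sum>\<rho> | partition_on G \<rho>. \<Prod>K\<in>\<rho>. F K) = (\<Sum>\<rho> | refines H \<rho> \<pi>. \<Prod>K\<in>\<rho>. F K)"
proof -
  have "finite \<pi>" using assms finite_elements by blast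
  then show ?thesis using assms
  proof (induction \<pi> arbitrary: H)
    case empty
    then have "H = {}" by (simp add: partition_on_def)
    then have "{\<rho>. refines H \<rho> {}} = {{}}" by (auto simp: refines_def partition_on_empty)
    then show ?case by simp
  next
    case (insert G \<pi>)
    define H' where "H' = \<Union>\<pi>"
    have G: "G \<noteq> {}" "G \<inter> H' = {}" and pi: "partition_on H' \<pi>" and H: "H = G \<union> H'"
    proof -
      have p: "partition_on H (insert G \<pi>)" using insert.prems by simp
      show "G \<noteq> {}" using partition_on_nonempty[OF p] by blast
      have d: "G \<inter> K = {}" if "K \<in> \<pi>" for K
        using partition_on_same_block[OF p, of G K] that insert.hyps by blast
      then show "G \<inter> H' = {}" by (auto simp: H'_def)
      show "H = G \<union> H'" using p by (simp add: H'_def partition_on_def)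
      show "partition_on H' \<pi>"
      proof (rule partition_onI)
        show "\<Union>\<pi> = H'" by (simp add: H'_def)
        show "{} \<notin> \<pi>" using partition_on_nonempty[OF p] by blast
        fix X Y assume "X \<in> \<pi>" "Y \<in> \<pi>" "X \<noteq> Y"
        then show "disjnt X Y" using partition_on_same_block[OF p, of X Y] by (auto simp: disjnt_iff)
      qed
    qed
    have fin: "finite G" "finite H'" using insert.prems H by auto
    have "(\<Sum>\<rho> | refines H \<rho> (insert G \<pi>). \<Prod>K\<in>\<rho>. F K)
        = (\<Sum>(\<rho>\<^sub>1, \<rho>\<^sub>2)\<in>{\<rho>. partition_on G \<rho>} \<times> {\<rho>. refines H' \<rho> \<pi>}. \<Prod>K\<in>\<rho>\<^sub>1 \<union> \<rho>\<^sub>2. F K)"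
      unfolding H by (subst sum.reindex_bij_betw[OF refines_insert_Un[OF G pi], symmetric])
        (simp add: case_prod_unfold)
    also have "\<dots> = (\<Sum>(\<rho>\<^sub>1, \<rho>\<^sub>2)\<in>{\<rho>. partition_on G \<rho>} \<times> {\<rho>. refines H' \<rho> \<pi>}. (\<Prod>K\<in>\<rho>\<^sub>1. F K) * (\<Prod>K\<in>\<rho>\<^sub>2. F K))"
    proof (rule sum.cong, simp, clarify)
      fix \<rho>\<^sub>1 \<rho>\<^sub>2 assume a: "partition_on G \<rho>\<^sub>1" "refines H' \<rho>\<^sub>2 \<pi>"
      then have 2: "partition_on H' \<rho>\<^sub>2" by (simp add: refines_def)
      have "finite \<rho>\<^sub>1" "finite \<rho>\<^sub>2" using a 2 fin finite_elements by blast+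
      moreover have "\<rho>\<^sub>1 \<inter> \<rho>\<^sub>2 = {}"
      proof -
        have False if "K \<in> \<rho>\<^sub>1" "K \<in> \<rho>\<^sub>2" for K
        proof -
          have "K \<noteq> {}" "K \<subseteq> G" "K \<subseteq> H'" using that a 2 by (auto simp: partition_on_def)
          then show False using G(2) by blast
        qed
        then show ?thesis by blast
      qed
      ultimately show "(\<Prod>K\<in>\<rho>\<^sub>1 \<union> \<rho>\<^sub>2. F K) = (\<Prod>K\<in>\<rho>\<^sub>1. F K) * (\<Prod>K\<in>\<rho>\<^sub>2. F K)"
        by (rule prod.union_disjoint)
    qed
    also have "\<dots> = (\<Sum>\<rho> | partition_on G \<rho>. \<Prod>K\<in>\<rho>. F K) * (\<Sum>\<rho> | refines H' \<rho> \<pi>. \<Prod>K\<in>\<rho>. F K)"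
      by (simp add: sum_product sum.cartesian_product)
    finally show ?case using insert.IH[OF fin(2) pi] insert.hyps by simp
  qed
qed

text \<open>To coarsen \<beta> is to group its blocks, so the coarsenings form the partition lattice
  of the set \<beta> itself. The inverse map sends a block to the members of \<beta> that it
  contains.\<close>

lemma bij_betw_coarsenings:
  assumes \<beta>: "partition_on H \<beta>"
  shows "bij_betw (\<lambda>\<rho>. Union ` \<rho>) {\<rho>. partition_on \<beta> \<rho>} {\<rho>. refines H \<beta> \<rho>}"
proof (rule bij_betwI[where g = "\<lambda>\<rho>. (\<lambda>K. {b\<in>\<beta>. b \<subseteq> K}) ` \<rho>"])
  have ne: "b \<noteq> {}" if "b \<in> \<beta>" for b using that \<beta> by (auto simp: partition_on_def)
  have dj: "b = b'" if "b \<in> \<beta>" "b' \<in> \<beta>" "x \<in> b" "x \<in> b'" for b b' x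
    using partition_on_same_block[OF \<beta>] that by blast
  have sub: "{b\<in>\<beta>. b \<subseteq> \<Union>V} = V" if "V \<subseteq> \<beta>" for V
  proof -
    have "b \<in> V" if b: "b \<in> \<beta>" "b \<subseteq> \<Union>V" for b
    proof -
      obtain x where "x \<in> b" using ne b by blast
      then obtain b' where "b' \<in> V" "x \<in> b'" using b by blast
      then have "b = b'" using dj[of b b' x] b \<open>x \<in> b\<close> \<open>V \<subseteq> \<beta>\<close> by blast
      then show ?thesis using \<open>b' \<in> V\<close> by simp
    qed
    then show ?thesis using that by blast
  qed
  show "(\<lambda>\<rho>. Union ` \<rho>) \<in> {\<rho>. partition_on \<beta> \<rho>} \<rightarrow> {\<rho>. refines H \<beta> \<rho>}"
  proof clarify
    fix \<rho> assume r: "partition_on \<beta> \<rho>"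
    have "partition_on H (Union ` \<rho>)"
    proof (rule partition_onI)
      have "\<Union> (Union ` \<rho>) = \<Union> (\<Union> \<rho>)" by blast
      then show "\<Union> (Union ` \<rho>) = H" using r \<beta> by (simp add: partition_on_def)
      show "{} \<notin> Union ` \<rho>"
      proof
        assume "{} \<in> Union ` \<rho>"
        then obtain V where V: "V \<in> \<rho>" "\<Union>V = {}" by auto
        moreover have "V \<noteq> {}" using V r by (auto simp: partition_on_def)
        ultimately obtain b where "b \<in> V" by blast
        then have "b \<in> \<beta>" "b = {}" using V r by (auto simp: partition_on_def)
        then show False using ne by blast
      qed
      fix p q assume "p \<in> Union ` \<rho>" "q \<in> Union ` \<rho>" and pq: "p \<noteq> q"
      then obtain V W where VW: "V \<in> \<rho>" "W \<in> \<rho>" "p = \<Union>V" "q = \<Union>W" by auto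
      then have "V \<inter> W = {}" using pq r by (auto simp: partition_on_def disjoint_def)
      moreover have "V \<subseteq> \<beta>" "W \<subseteq> \<beta>" using VW r by (auto simp: partition_on_def)
      ultimately show "disjnt p q" using VW dj unfolding disjnt_def by blast
    qed
    moreover have "\<exists>Y\<in>Union ` \<rho>. b \<subseteq> Y" if "b \<in> \<beta>" for b
      using r that by (auto simp: partition_on_def)
    ultimately show "refines H \<beta> (Union ` \<rho>)" using \<beta> by (auto simp: refines_def)
  qed
  have Usub: "\<Union>{b\<in>\<beta>. b \<subseteq> K} = K" if "refines H \<beta> \<rho>" "K \<in> \<rho>" for K \<rho>
  proof -
    have "x \<in> \<Union>{b\<in>\<beta>. b \<subseteq> K}" if "x \<in> K" for x
    proof -
      have "x \<in> H" using \<open>K \<in> \<rho>\<close> \<open>x \<in> K\<close> \<open>refines H \<beta> \<rho>\<close> by (auto simp: refines_def partition_on_def)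
      then obtain b where b: "b \<in> \<beta>" "x \<in> b" using \<beta> by (auto simp: partition_on_def)
      then obtain K' where K': "K' \<in> \<rho>" "b \<subseteq> K'" using \<open>refines H \<beta> \<rho>\<close> by (auto simp: refines_def)
      then have "K' = K" using \<open>K \<in> \<rho>\<close> \<open>x \<in> K\<close> b \<open>refines H \<beta> \<rho>\<close>
        partition_on_same_block[of H \<rho> K' K x] unfolding refines_def by blast
      then show ?thesis using b K' by blast
    qed
    then show ?thesis by blast
  qed
  show "(\<lambda>\<rho>. (\<lambda>K. {b \<in> \<beta>. b \<subseteq> K}) ` \<rho>) \<in> {\<rho>. refines H \<beta> \<rho>} \<rightarrow> {\<rho>. partition_on \<beta> \<rho>}"
  proof clarify
    fix \<rho> assume r: "refines H \<beta> \<rho>"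
    then have p: "partition_on H \<rho>" by (simp add: refines_def)
    show "partition_on \<beta> ((\<lambda>K. {b \<in> \<beta>. b \<subseteq> K}) ` \<rho>)"
    proof (rule partition_onI)
      show "\<Union> ((\<lambda>K. {b \<in> \<beta>. b \<subseteq> K}) ` \<rho>) = \<beta>" using r by (auto simp: refines_def)
      show "{} \<notin> (\<lambda>K. {b \<in> \<beta>. b \<subseteq> K}) ` \<rho>"
      proof
        assume "{} \<in> (\<lambda>K. {b \<in> \<beta>. b \<subseteq> K}) ` \<rho>"
        then obtain K where "K \<in> \<rho>" "{b\<in>\<beta>. b \<subseteq> K} = {}" by auto
        then have "K = {}" using Usub[OF r, of K] by (metis Union_empty)
        then show False using \<open>K \<in> \<rho>\<close> p by (auto simp: partition_on_def)
      qed
      fix P Q assume "P \<in> (\<lambda>K. {b \<in> \<beta>. b \<subseteq> K}) ` \<rho>" "Q \<in> (\<lambda>K. {b \<in> \<beta>. b \<subseteq> K}) ` \<rho>" "P \<noteq> Q"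
      then obtain K L where KL: "K \<in> \<rho>" "L \<in> \<rho>" "P = {b \<in> \<beta>. b \<subseteq> K}" "Q = {b \<in> \<beta>. b \<subseteq> L}" by blast
      then have "K \<noteq> L" using \<open>P \<noteq> Q\<close> by blast
      with KL show "disjnt P Q" using partition_on_same_block[OF p, of K L] ne unfolding disjnt_iff by blast
    qed
  qed
  fix \<rho> assume "\<rho> \<in> {\<rho>. partition_on \<beta> \<rho>}"
  then have "V \<subseteq> \<beta>" if "V \<in> \<rho>" for V using that by (auto simp: partition_on_def)
  then show "(\<lambda>K. {b \<in> \<beta>. b \<subseteq> K}) ` Union ` \<rho> = \<rho>"
    using sub by (simp add: image_image)
next
  fix \<rho> assume "\<rho> \<in> {\<rho>. refines H \<beta> \<rho>}"
  then have r: "refines H \<beta> \<rho>" by simp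
  have "\<Union>{b\<in>\<beta>. b \<subseteq> K} = K" if K: "K \<in> \<rho>" for K
  proof -
    have "x \<in> \<Union>{b\<in>\<beta>. b \<subseteq> K}" if "x \<in> K" for x
    proof -
      have "x \<in> H" using \<open>K \<in> \<rho>\<close> \<open>x \<in> K\<close> \<open>refines H \<beta> \<rho>\<close> by (auto simp: refines_def partition_on_def)
      then obtain b where b: "b \<in> \<beta>" "x \<in> b" using \<beta> by (auto simp: partition_on_def)
      then obtain K' where K': "K' \<in> \<rho>" "b \<subseteq> K'" using \<open>refines H \<beta> \<rho>\<close> by (auto simp: refines_def)
      then have "K' = K" using \<open>K \<in> \<rho>\<close> \<open>x \<in> K\<close> b \<open>refines H \<beta> \<rho>\<close>
        partition_on_same_block[of H \<rho> K' K x] unfolding refines_def by blast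
      then show ?thesis using b K' by blast
    qed
    then show ?thesis by blast
  qed
  then show "Union ` (\<lambda>K. {b \<in> \<beta>. b \<subseteq> K}) ` \<rho> = \<rho>"
    by (simp add: image_image)
qed

text \<open>Distinct groups of disjoint nonempty blocks have different unions, so block counts and
  products over blocks survive the reindexing by \<open>Union\<close>.\<close>

lemma inj_on_Union_partition:
  assumes \<beta>: "partition_on H \<beta>" and r: "partition_on \<beta> \<rho>"
  shows "inj_on Union \<rho>"
proof (rule inj_onI, rule ccontr)
  fix V W assume a: "V \<in> \<rho>" "W \<in> \<rho>" "\<Union>V = \<Union>W" "V \<noteq> W"
  then have d: "V \<inter> W = {}" using r by (auto simp: partition_on_def disjoint_def)
  have "V \<noteq> {}" "V \<subseteq> \<beta>" using a r by (auto simp: partition_on_def)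
  then obtain b where b: "b \<in> V" "b \<in> \<beta>" by blast
  have "b \<noteq> {}" using b \<beta> by (auto simp: partition_on_def)
  then obtain x where x: "x \<in> b" by blast
  then obtain b' where b': "b' \<in> W" "x \<in> b'" using a b by blast
  have "b' \<in> \<beta>" using b' a r by (auto simp: partition_on_def)
  then have "b = b'" using partition_on_same_block[OF \<beta>] b x b' by blast
  then show False using b b' d by blast
qed

lemma sum_coarsenings:
  assumes \<beta>: "partition_on H \<beta>"
  shows "(\<Sum>\<rho> | refines H \<beta> \<rho>. f \<rho>) = (\<Sum>\<rho> | partition_on \<beta> \<rho>. f (Union ` \<rho>))"
  by (rule sum.reindex_bij_betw[OF bij_betw_coarsenings[OF \<beta>], symmetric])

text \<open>Under \<open>bij_betw_coarsenings\<close> this is the sum over all partitions of the set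
  \<beta>, which vanishes unless \<beta> has a single element. It later turns a sum over common
  coarsenings into the indicator of connectedness.\<close>

lemma sum_cumulant_coeff_coarsenings:
  assumes "finite H" "H \<noteq> {}" and \<beta>: "partition_on H \<beta>"
  shows "(\<Sum>\<rho> | refines H \<beta> \<rho>. cumulant_coeff (card \<rho>)) = (if \<beta> = {H} then 1 else 0)"
proof -
  have fin: "finite \<beta>" using assms finite_elements by blast
  have ne: "\<beta> \<noteq> {}" using assms by (auto simp: partition_on_def)
  have "(\<Sum>\<rho> | refines H \<beta> \<rho>. cumulant_coeff (card \<rho>)) = (\<Sum>\<rho> | partition_on \<beta> \<rho>. cumulant_coeff (card (Union ` \<rho>)))"
    by (rule sum_coarsenings[OF \<beta>])
  also have "\<dots> = (\<Sum>\<rho> | partition_on \<beta> \<rho>. cumulant_coeff (card \<rho>))"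
    by (intro sum.cong refl) (simp add: card_image inj_on_Union_partition[OF \<beta>])
  also have "\<dots> = (if card \<beta> = 1 then 1 else 0)" by (rule sum_cumulant_coeff[OF fin ne])
  also have "card \<beta> = 1 \<longleftrightarrow> \<beta> = {H}"
    using \<beta> by (auto simp: card_1_singleton_iff partition_on_def)
  finally show ?thesis .
qed

section \<open>The Moebius function at the one-block partition\<close>

lemma sum_moebius:
  assumes "finite A" "refines A \<pi> \<rho>"
  shows "(\<Sum>\<tau> | refines A \<pi> \<tau> \<and> refines A \<tau> \<rho>. moebius A \<pi> \<tau>) = (if \<pi> = \<rho> then 1 else 0)"
proof -
  let ?S = "{\<tau>. refines A \<pi> \<tau> \<and> refines A \<tau> \<rho>}"
  let ?T = "{\<tau>. refines A \<pi> \<tau> \<and> refines A \<tau> \<rho> \<and> \<tau> \<noteq> \<rho>}"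
  have fin: "finite ?T" by (rule finite_subset[OF _ finite_refines(2)[OF assms(1), of \<pi>]]) auto
  have "refines A \<rho> \<rho>" using assms(2) by (simp add: refines_def refines_refl) (metis order_refl)
  then have "?S = insert \<rho> ?T" using assms(2) by auto
  then have "(\<Sum>\<tau>\<in>?S. moebius A \<pi> \<tau>) = moebius A \<pi> \<rho> + (\<Sum>\<tau>\<in>?T. moebius A \<pi> \<tau>)"
    using fin by simp
  moreover have "sum (moebius A \<pi>) ?T = 0" if "\<pi> = \<rho>"
  proof -
    have "?T = {}" using that refines_asym by blast
    then show ?thesis by (simp only: sum.empty)
  qed
  ultimately show ?thesis using assms
    by (cases "\<pi> = \<rho>") (simp_all add: moebius.simps[of A \<pi> \<rho>] moebius.simps[of A \<rho> \<rho>])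
qed

text \<open>The recursion makes \<open>moebius\<close> an inverse of the zeta function in its upper
  argument, while zeta applied to \<open>cumulant_coeff\<close> is the indicator of the top element.
  Evaluating the resulting double sum in both orders identifies the two.\<close>

lemma moebius_top:
  assumes "finite A" "A \<noteq> {}" and \<pi>: "partition_on A \<pi>"
  shows "complex_of_int (moebius A \<pi> {A}) = cumulant_coeff (card \<pi>)"
proof -
  let ?U = "{\<tau>. refines A \<pi> \<tau>}"
  have top: "refines A \<tau> {A}" if "partition_on A \<tau>" for \<tau>
    using that assms(2) by (auto simp: refines_def partition_on_space) (auto simp: partition_on_def)
  have finU: "finite ?U" using assms finite_refines by blast
  have "complex_of_int (moebius A \<pi> {A})
      = (\<Sum>\<tau>\<in>?U. of_int (moebius A \<pi> \<tau>) * (if \<tau> = {A} then 1 else 0))"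
    using finU top[OF \<pi>] by (simp add: sum.delta if_distrib[where f="\<lambda>x. _ * x"] cong: if_cong)
  also have "\<dots> = (\<Sum>\<tau>\<in>?U. of_int (moebius A \<pi> \<tau>) * (\<Sum>\<rho> | refines A \<tau> \<rho>. cumulant_coeff (card \<rho>)))"
    by (intro sum.cong refl, subst sum_cumulant_coeff_coarsenings[OF assms(1,2)]) (auto simp: refines_def)
  also have "\<dots> = (\<Sum>\<tau>\<in>?U. \<Sum>\<rho>\<in>?U. if refines A \<tau> \<rho> then of_int (moebius A \<pi> \<tau>) * cumulant_coeff (card \<rho>) else 0)"
  proof (intro sum.cong refl)
    fix \<tau> assume "\<tau> \<in> ?U"
    then have "{\<rho>\<in>?U. refines A \<tau> \<rho>} = {\<rho>. refines A \<tau> \<rho>}" using refines_trans by blast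
    then show "of_int (moebius A \<pi> \<tau>) * (\<Sum>\<rho> | refines A \<tau> \<rho>. cumulant_coeff (card \<rho>)) =
       (\<Sum>\<rho>\<in>?U. if refines A \<tau> \<rho> then of_int (moebius A \<pi> \<tau>) * cumulant_coeff (card \<rho>) else 0)"
      using sum.inter_filter[OF finU, of "\<lambda>\<rho>. of_int (moebius A \<pi> \<tau>) * cumulant_coeff (card \<rho>)" "\<lambda>\<rho>. refines A \<tau> \<rho>"]
      by (simp add: sum_distrib_left)
  qed
  also have "\<dots> = (\<Sum>\<rho>\<in>?U. \<Sum>\<tau>\<in>?U. if refines A \<tau> \<rho> then of_int (moebius A \<pi> \<tau>) * cumulant_coeff (card \<rho>) else 0)"
    by (rule sum.swap)
  also have "\<dots> = (\<Sum>\<rho>\<in>?U. cumulant_coeff (card \<rho>) * of_int (\<Sum>\<tau> | refines A \<pi> \<tau> \<and> refines A \<tau> \<rho>. moebius A \<pi> \<tau>))"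
    using sum.inter_filter[OF finU]
    by (intro sum.cong refl) (simp add: sum_distrib_left mult.commute sum.inter_filter[OF finU, symmetric])
  also have "\<dots> = (\<Sum>\<rho>\<in>?U. cumulant_coeff (card \<rho>) * (if \<rho> = \<pi> then 1 else 0))"
    using sum_moebius[OF assms(1)] by (intro sum.cong refl) auto
  also have "\<dots> = cumulant_coeff (card \<pi>)"
    using finU refines_refl[OF \<pi>] by (simp add: sum.delta if_distrib[where f="\<lambda>x. _ * x"] cong: if_cong)
  finally show ?thesis .
qed

text \<open>Defined by recursion so that the moment-cumulant formula is immediate; the closed form \<open>cumulant\<close> is
  identified with it because a solution of the moment-cumulant formula is unique.\<close>

function rec_cumulant :: "('a set \<Rightarrow> complex) \<Rightarrow> 'a set \<Rightarrow> complex" where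
  "rec_cumulant g S = (if finite S then g S - (\<Sum>\<rho> | partition_on S \<rho> \<and> \<rho> \<noteq> {S}. \<Prod>V\<in>\<rho>. rec_cumulant g V) else 0)"
  by pat_completeness auto
termination
proof (relation "Wellfounded.measure (\<lambda>(g, S). card S)")
  fix g :: "'a set \<Rightarrow> complex" and S \<rho> V
  assume fin: "finite S" and r: "\<rho> \<in> {\<rho>. partition_on S \<rho> \<and> \<rho> \<noteq> {S}}" and V: "V \<in> \<rho>"
  have "V \<subseteq> S" using r V by (auto simp: partition_on_def)
  moreover have "V \<noteq> S"
  proof
    assume "V = S"
    have p: "partition_on S \<rho>" using r by simp
    have all: "W = S" if W: "W \<in> \<rho>" for W
    proof -
      obtain x where "x \<in> W" using partition_on_nonempty[OF p W] by blast
      then show ?thesis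
        using partition_on_same_block[OF p W V] partition_on_subset[OF p W] \<open>V = S\<close> by blast
    qed
    have "\<rho> = {S}" using all V \<open>V = S\<close> by blast
    then show False using r by simp
  qed
  ultimately show "((g, V), (g, S)) \<in> Wellfounded.measure (\<lambda>(g, S). card S)"
    using fin by (simp add: psubset_card_mono)
qed simp

declare rec_cumulant.simps [simp del]

section \<open>Moment-cumulant inversion for set functions\<close>

definition cumulant :: "('a set \<Rightarrow> complex) \<Rightarrow> 'a set \<Rightarrow> complex" where
  "cumulant g S = (\<Sum>\<rho> | partition_on S \<rho>. cumulant_coeff (card \<rho>) * (\<Prod>V\<in>\<rho>. g V))"

lemma moment_rec_cumulant:
  assumes "finite S" "S \<noteq> {}"
  shows "g S = (\<Sum>\<rho> | partition_on S \<rho>. \<Prod>V\<in>\<rho>. rec_cumulant g V)"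
proof -
  have "{\<rho>. partition_on S \<rho>} = insert {S} {\<rho>. partition_on S \<rho> \<and> \<rho> \<noteq> {S}}"
    using partition_on_space[OF assms(2)] by blast
  moreover have "finite {\<rho>. partition_on S \<rho> \<and> \<rho> \<noteq> {S}}"
    using finitely_many_partition_on[OF assms(1)] by (rule rev_finite_subset) auto
  ultimately show ?thesis using assms by (simp add: rec_cumulant.simps[of g S])
qed

text \<open>Expanding every \<open>g G\<close> over the partitions of \<open>G\<close> and
  multiplying out gives the refinements \<rho> of \<pi>; exchanging the sums leaves the total weight
  of the coarsenings of \<rho> that \<open>Q\<close> allows. With \<open>Q\<close> trivial this
  inverts the moment-cumulant relation; with \<open>Q\<close> demanding a partition coarser than
  given cycles it produces a connectedness condition.\<close>

lemma weighted_sum_prod_moments: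
  fixes k :: "'a set \<Rightarrow> 'b::comm_ring_1"
  assumes fin: "finite S" and m: "\<And>G. finite G \<Longrightarrow> G \<noteq> {} \<Longrightarrow> G \<subseteq> S \<Longrightarrow> g G = (\<Sum>\<rho> | partition_on G \<rho>. \<Prod>V\<in>\<rho>. k V)"
  shows "(\<Sum>\<pi> | partition_on S \<pi> \<and> Q \<pi>. w \<pi> * (\<Prod>G\<in>\<pi>. g G))
    = (\<Sum>\<rho> | partition_on S \<rho>. (\<Prod>V\<in>\<rho>. k V) * (\<Sum>\<pi> | refines S \<rho> \<pi> \<and> Q \<pi>. w \<pi>))"
proof -
  let ?P = "{\<pi>. partition_on S \<pi>}"
  let ?Q = "{\<pi>. partition_on S \<pi> \<and> Q \<pi>}"
  have finP: "finite ?P" using finitely_many_partition_on[OF fin] .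
  have finQ: "finite ?Q" using finP by (rule rev_finite_subset) auto
  have "(\<Sum>\<pi>\<in>?Q. w \<pi> * (\<Prod>G\<in>\<pi>. g G)) = (\<Sum>\<pi>\<in>?Q. w \<pi> * (\<Sum>\<rho> | refines S \<rho> \<pi>. \<Prod>V\<in>\<rho>. k V))"
  proof (intro sum.cong refl)
    fix \<pi> assume "\<pi> \<in> ?Q"
    then have p: "partition_on S \<pi>" by simp
    have "(\<Prod>G\<in>\<pi>. g G) = (\<Prod>G\<in>\<pi>. \<Sum>\<rho> | partition_on G \<rho>. \<Prod>V\<in>\<rho>. k V)"
    proof (intro prod.cong refl m)
      fix G assume "G \<in> \<pi>"
      then show "G \<noteq> {}" "G \<subseteq> S" using p by (auto simp: partition_on_def)
      then show "finite G" using fin finite_subset by blast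
    qed
    then show "w \<pi> * (\<Prod>G\<in>\<pi>. g G) = w \<pi> * (\<Sum>\<rho> | refines S \<rho> \<pi>. \<Prod>V\<in>\<rho>. k V)"
      by (simp add: prod_sum_partitions[OF fin p])
  qed
  also have "\<dots> = (\<Sum>\<pi>\<in>?Q. \<Sum>\<rho>\<in>?P. if refines S \<rho> \<pi> then w \<pi> * (\<Prod>V\<in>\<rho>. k V) else 0)"
  proof (intro sum.cong refl)
    fix \<pi>
    have "{\<rho>\<in>?P. refines S \<rho> \<pi>} = {\<rho>. refines S \<rho> \<pi>}" by (auto simp: refines_def)
    then show "w \<pi> * (\<Sum>\<rho> | refines S \<rho> \<pi>. \<Prod>V\<in>\<rho>. k V) = (\<Sum>\<rho>\<in>?P. if refines S \<rho> \<pi> then w \<pi> * (\<Prod>V\<in>\<rho>. k V) else 0)"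
      by (simp add: sum_distrib_left sum.inter_filter[OF finP, symmetric])
  qed
  also have "\<dots> = (\<Sum>\<rho>\<in>?P. \<Sum>\<pi>\<in>?Q. if refines S \<rho> \<pi> then w \<pi> * (\<Prod>V\<in>\<rho>. k V) else 0)"
    by (rule sum.swap)
  also have "\<dots> = (\<Sum>\<rho>\<in>?P. (\<Prod>V\<in>\<rho>. k V) * (\<Sum>\<pi> | refines S \<rho> \<pi> \<and> Q \<pi>. w \<pi>))"
  proof (intro sum.cong refl)
    fix \<rho>
    have "{\<pi>\<in>?Q. refines S \<rho> \<pi>} = {\<pi>. refines S \<rho> \<pi> \<and> Q \<pi>}" by (auto simp: refines_def)
    then show "(\<Sum>\<pi>\<in>?Q. if refines S \<rho> \<pi> then w \<pi> * (\<Prod>V\<in>\<rho>. k V) else 0) = (\<Prod>V\<in>\<rho>. k V) * (\<Sum>\<pi> | refines S \<rho> \<pi> \<and> Q \<pi>. w \<pi>)"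
      by (simp add: sum_distrib_left sum.inter_filter[OF finQ, symmetric] mult.commute)
  qed
  finally show ?thesis .
qed

text \<open>Only \<rho> = {S} survives, because the coefficients sum to zero over the coarsenings of
  any other partition. The relation is assumed for all nonempty subsets since the blocks of the
  outer partition are expanded with it.\<close>

lemma cumulant_unique:
  assumes fin: "finite S" "S \<noteq> {}"
    and m: "\<And>G. finite G \<Longrightarrow> G \<noteq> {} \<Longrightarrow> G \<subseteq> S \<Longrightarrow> g G = (\<Sum>\<rho> | partition_on G \<rho>. \<Prod>V\<in>\<rho>. k V)"
  shows "cumulant g S = k S"
proof -
  have "cumulant g S = (\<Sum>\<pi> | partition_on S \<pi> \<and> True. cumulant_coeff (card \<pi>) * (\<Prod>G\<in>\<pi>. g G))"
    by (simp add: cumulant_def)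
  also have "\<dots> = (\<Sum>\<rho> | partition_on S \<rho>. (\<Prod>V\<in>\<rho>. k V) * (\<Sum>\<pi> | refines S \<rho> \<pi> \<and> True. cumulant_coeff (card \<pi>)))"
    by (rule weighted_sum_prod_moments[OF fin(1) m])
  also have "\<dots> = (\<Sum>\<rho> | partition_on S \<rho>. (\<Prod>V\<in>\<rho>. k V) * (if \<rho> = {S} then 1 else 0))"
    by (intro sum.cong refl) (simp add: sum_cumulant_coeff_coarsenings[OF fin])
  also have "\<dots> = k S"
    using finitely_many_partition_on[OF fin(1)] partition_on_space[OF fin(2)]
    by (simp add: sum.delta if_distrib[where f="\<lambda>x. _ * x"] cong: if_cong)
  finally show ?thesis .
qed

lemma moment_cumulant:
  assumes "finite S" "S \<noteq> {}"
  shows "g S = (\<Sum>\<rho> | partition_on S \<rho>. \<Prod>V\<in>\<rho>. cumulant g V)"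
proof -
  have c: "cumulant g V = rec_cumulant g V" if "finite V" "V \<noteq> {}" for V
    by (rule cumulant_unique[OF that]) (rule moment_rec_cumulant)
  have "(\<Sum>\<rho> | partition_on S \<rho>. \<Prod>V\<in>\<rho>. cumulant g V) = (\<Sum>\<rho> | partition_on S \<rho>. \<Prod>V\<in>\<rho>. rec_cumulant g V)"
  proof (intro sum.cong prod.cong refl c)
    fix \<rho> V assume "\<rho> \<in> {\<rho>. partition_on S \<rho>}" "V \<in> \<rho>"
    then show "V \<noteq> {}" "finite V"
      using assms(1) partition_on_nonempty[of S \<rho> V] partition_on_subset[of S \<rho> V] finite_subset by auto
  qed
  then show ?thesis using moment_rec_cumulant[OF assms] by simp
qed

section \<open>Cycles and conjugacy of permutations\<close>

lemma permutes_permutation: "finite H \<Longrightarrow> \<sigma> permutes H \<Longrightarrow> permutation \<sigma>"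
  by (auto simp: permutation_permutes)

lemma self_in_orbit: "finite H \<Longrightarrow> \<sigma> permutes H \<Longrightarrow> x \<in> orbit \<sigma> x"
  by (rule permutation_self_in_orbit[OF permutes_permutation])

lemma orbit_eq_of_mem: "finite H \<Longrightarrow> \<sigma> permutes H \<Longrightarrow> z \<in> orbit \<sigma> x \<Longrightarrow> orbit \<sigma> z = orbit \<sigma> x"
  by (rule orbit_cyclic_eq3[OF cyclic_on_orbit])

lemma orbit_subset_invariant: "\<sigma> ` K \<subseteq> K \<Longrightarrow> x \<in> K \<Longrightarrow> orbit \<sigma> x \<subseteq> K"
proof
  fix y assume "\<sigma> ` K \<subseteq> K" "x \<in> K" "y \<in> orbit \<sigma> x"
  from this(3,1,2) show "y \<in> K" by induction auto
qed

lemma partition_on_cycles: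
  assumes "finite H" "\<sigma> permutes H"
  shows "partition_on H (cycles_on H \<sigma>)"
proof (rule partition_onI)
  show "\<Union> (cycles_on H \<sigma>) = H"
    using permutes_orbit_subset[OF assms(2)] self_in_orbit[OF assms] by (auto simp: cycles_on_def)
  show "{} \<notin> cycles_on H \<sigma>" using self_in_orbit[OF assms] by (auto simp: cycles_on_def)
  fix p q assume "p \<in> cycles_on H \<sigma>" "q \<in> cycles_on H \<sigma>" "p \<noteq> q"
  then show "disjnt p q"
    unfolding cycles_on_def disjnt_iff using orbit_eq_of_mem[OF assms] by (metis imageE)
qed

lemma finite_cycles_on: "finite H \<Longrightarrow> finite (cycles_on H \<sigma>)"
  by (simp add: cycles_on_def)

lemma permutes_image_eq:
  assumes "finite K" "\<sigma> permutes H" "\<sigma> ` K \<subseteq> K"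
  shows "\<sigma> ` K = K"
  using endo_inj_surj[OF assms(1,3)] permutes_inj_on[OF assms(2)] by blast

text \<open>Being coarser than the cycle partition becomes invariance of every block. This form is
  local in the blocks, hence compatible with products over them.\<close>

lemma refines_cycles_iff:
  assumes "finite H" "\<sigma> permutes H"
  shows "refines H (cycles_on H \<sigma>) \<rho> \<longleftrightarrow> partition_on H \<rho> \<and> (\<forall>K\<in>\<rho>. \<sigma> ` K = K)"
proof (intro iffI conjI ballI)
  assume r: "refines H (cycles_on H \<sigma>) \<rho>"
  then show p: "partition_on H \<rho>" by (simp add: refines_def)
  fix K assume K: "K \<in> \<rho>"
  then have KH: "K \<subseteq> H" using p partition_on_subset by blast
  have "\<sigma> x \<in> K" if x: "x \<in> K" for x
  proof -
    have "orbit \<sigma> x \<in> cycles_on H \<sigma>" using x KH by (auto simp: cycles_on_def)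
    then obtain Y where Y: "Y \<in> \<rho>" "orbit \<sigma> x \<subseteq> Y" using r unfolding refines_def by blast
    have "x \<in> Y" using Y(2) self_in_orbit[OF assms, of x] by (rule subsetD)
    then have "Y = K" using partition_on_same_block[OF p Y(1) K _ x] by simp
    then show ?thesis using Y(2) orbit.base[of \<sigma> x] by (simp add: subset_iff)
  qed
  then have "\<sigma> ` K \<subseteq> K" by (rule image_subsetI)
  with finite_subset[OF KH assms(1)] assms(2) show "\<sigma> ` K = K" by (rule permutes_image_eq)
next
  assume a: "partition_on H \<rho> \<and> (\<forall>K\<in>\<rho>. \<sigma> ` K = K)"
  have "\<exists>Y\<in>\<rho>. X \<subseteq> Y" if X: "X \<in> cycles_on H \<sigma>" for X
  proof -
    obtain x where x: "x \<in> H" "X = orbit \<sigma> x" using X by (auto simp: cycles_on_def)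
    then obtain K where "K \<in> \<rho>" "x \<in> K" using a partition_on_ex[of H \<rho> x] by blast
    moreover have "orbit \<sigma> x \<subseteq> K" by (rule orbit_subset_invariant) (use a calculation in auto)
    ultimately show ?thesis using x by blast
  qed
  then show "refines H (cycles_on H \<sigma>) \<rho>" using a partition_on_cycles[OF assms] by (simp add: refines_def)
qed

lemma cycles_on_cong:
  assumes "\<sigma> ` K \<subseteq> K" "\<And>x. x \<in> K \<Longrightarrow> \<sigma> x = \<sigma>' x"
  shows "cycles_on K \<sigma> = cycles_on K \<sigma>'"
  unfolding cycles_on_def using assms by (intro image_cong refl orbit_cong0[of _ K]) auto

lemma perm_restrict_permutes:
  assumes "finite K" "\<sigma> permutes H" "\<sigma> ` K = K"
  shows "perm_restrict \<sigma> K permutes K"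
proof (rule bij_imp_permutes)
  have "bij_betw \<sigma> K K" using assms permutes_inj_on[OF assms(2)] by (auto simp: bij_betw_def)
  then show "bij_betw (perm_restrict \<sigma> K) K K" by (rule bij_betw_cong[THEN iffD1, rotated]) (simp add: perm_restrict_simps)
qed (simp add: perm_restrict_simps)

lemma cycles_on_perm_restrict:
  assumes "\<sigma> ` K = K"
  shows "cycles_on K (perm_restrict \<sigma> K) = cycles_on K \<sigma>"
  using assms by (intro cycles_on_cong[symmetric]) (auto simp: perm_restrict_simps)

lemma cycles_on_invariant:
  assumes "finite H" "\<sigma> permutes H" "K \<subseteq> H" "\<sigma> ` K = K"
  shows "cycles_on K \<sigma> = {b \<in> cycles_on H \<sigma>. b \<subseteq> K}"
proof
  show "cycles_on K \<sigma> \<subseteq> {b \<in> cycles_on H \<sigma>. b \<subseteq> K}"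
    using assms orbit_subset_invariant[of \<sigma> K] by (auto simp: cycles_on_def)
  show "{b \<in> cycles_on H \<sigma>. b \<subseteq> K} \<subseteq> cycles_on K \<sigma>"
    using self_in_orbit[OF assms(1,2)] by (auto simp: cycles_on_def)
qed

lemma partition_on_cycles_invariant:
  assumes "finite H" "\<sigma> permutes H" "K \<subseteq> H" "\<sigma> ` K = K"
  shows "partition_on K (cycles_on K \<sigma>)"
  using partition_on_cycles[OF finite_subset[OF assms(3,1)] perm_restrict_permutes[OF finite_subset[OF assms(3,1)] assms(2,4)]]
    cycles_on_perm_restrict[OF assms(4)] by simp

lemma cycle_type_cong: "cycles_on K \<sigma> = cycles_on K \<sigma>' \<Longrightarrow> cycle_type K \<sigma> = cycle_type K \<sigma>'"
  by (simp add: cycle_type_def)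

lemma size_cycle_type: "size (cycle_type H \<sigma>) = card (cycles_on H \<sigma>)"
  by (simp add: cycle_type_def)

lemma sum_cycle_type:
  assumes "finite H" "partition_on H (cycles_on H \<sigma>)"
  shows "sum_mset (cycle_type H \<sigma>) = card H"
proof -
  have "card H = (\<Sum>p\<in>cycles_on H \<sigma>. card p)"
    using product_partition[OF assms(2)] assms finite_subset partition_on_subset by metis
  then show ?thesis by (simp add: cycle_type_def sum_unfold_sum_mset)
qed

lemma cycle_type_pos:
  assumes "finite H" "partition_on H (cycles_on H \<sigma>)" "a \<in># cycle_type H \<sigma>"
  shows "a \<ge> 1"
proof -
  obtain c where c: "c \<in> cycles_on H \<sigma>" "a = card c"
    using assms(3) finite_cycles_on[OF assms(1), of \<sigma>] by (auto simp: cycle_type_def)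
  then have "finite c" "c \<noteq> {}" using assms finite_subset partition_on_subset partition_on_nonempty by metis+
  then show ?thesis using c by (simp add: Suc_le_eq card_gt_0_iff)
qed

lemma cycles_on_transport:
  assumes "finite H" "\<sigma> permutes H" "\<And>x. x \<in> H \<Longrightarrow> \<sigma>' (f x) = f (\<sigma> x)"
  shows "cycles_on (f ` H) \<sigma>' = (`) f ` cycles_on H \<sigma>"
proof -
  have "orbit \<sigma>' (f x) = f ` orbit \<sigma> x" if "x \<in> H" for x
    using orbit_inverse[OF self_in_orbit[OF assms(1,2)], of x \<sigma>' f] assms(3)
      permutes_orbit_subset[OF assms(2) that] by (auto simp: subset_iff)
  then show ?thesis by (auto simp: cycles_on_def image_image intro!: image_cong)
qed

lemma inj_on_image_partition: "partition_on H \<beta> \<Longrightarrow> inj_on f H \<Longrightarrow> inj_on ((`) f) \<beta>"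
  using inj_on_image_eq_iff[of f H] partition_on_subset[of H \<beta>] by (intro inj_onI) blast

lemma cycle_type_transport:
  assumes "finite H" "\<sigma> permutes H" "\<And>x. x \<in> H \<Longrightarrow> \<sigma>' (f x) = f (\<sigma> x)" "inj_on f H"
  shows "cycle_type (f ` H) \<sigma>' = cycle_type H \<sigma>"
proof -
  have p: "partition_on H (cycles_on H \<sigma>)" by (rule partition_on_cycles[OF assms(1,2)])
  have i: "inj_on ((`) f) (cycles_on H \<sigma>)" by (rule inj_on_image_partition[OF p assms(4)])
  have "cycle_type (f ` H) \<sigma>' = image_mset card (image_mset ((`) f) (mset_set (cycles_on H \<sigma>)))"
    using cycles_on_transport[of H \<sigma> \<sigma>' f, OF assms(1-3)] i by (simp add: cycle_type_def image_mset_mset_set)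
  also have "\<dots> = image_mset (\<lambda>c. card (f ` c)) (mset_set (cycles_on H \<sigma>))"
    by (simp add: multiset.map_comp o_def)
  also have "\<dots> = cycle_type H \<sigma>" unfolding cycle_type_def
  proof (rule image_mset_cong)
    fix c assume "c \<in># mset_set (cycles_on H \<sigma>)"
    then have "c \<subseteq> H" using p partition_on_subset finite_cycles_on[OF assms(1)] by auto
    then show "card (f ` c) = card c" using assms(4) by (meson card_image inj_on_subset)
  qed
  finally show ?thesis .
qed

lemma card_cycles_on_conj:
  assumes "finite H" "\<alpha> permutes H" "\<mu> permutes H"
  shows "card (cycles_on H (\<alpha> \<circ> \<mu> \<circ> inv_into UNIV \<alpha>)) = card (cycles_on H \<mu>)"
proof -
  have "cycle_type (\<alpha> ` H) (\<alpha> \<circ> \<mu> \<circ> inv_into UNIV \<alpha>) = cycle_type H \<mu>"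
    by (rule cycle_type_transport[OF assms(1,3)])
      (simp_all add: permutes_inverses[OF assms(2)] permutes_inj_on[OF assms(2)])
  then show ?thesis using permutes_image[OF assms(2)] by (metis size_cycle_type)
qed

lemma cycles_on_inv:
  assumes "finite H" "\<sigma> permutes H"
  shows "cycles_on H (inv_into UNIV \<sigma>) = cycles_on H \<sigma>"
  unfolding cycles_on_def using orbit_inv_eq[OF permutes_permutation[OF assms]] by simp

lemma card_cycles_le: "finite H \<Longrightarrow> card (cycles_on H \<sigma>) \<le> card H"
  unfolding cycles_on_def by (rule card_image_le)

lemma cycles_on_id: "cycles_on H id = (\<lambda>x. {x}) ` H"
  unfolding cycles_on_def by (intro image_cong refl) (simp add: orbit_eq_singleton_iff)

lemma card_cycles_id: "card (cycles_on H id) = card H"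
  by (simp add: cycles_on_id card_image)

text \<open>With as many cycles as points, the map from points to cycles is injective, while a point
  shares its cycle with its image. This strictness gives both the diagonal dominance of the
  cycle-count matrix and the triangularity of the limiting system.\<close>

lemma card_cycles_eq_card:
  assumes "finite H" "\<sigma> permutes H" "card (cycles_on H \<sigma>) = card H"
  shows "\<sigma> = id"
proof
  fix x show "\<sigma> x = id x"
  proof (cases "x \<in> H")
    case True
    have "inj_on (orbit \<sigma>) H" using assms(1,3) by (simp add: cycles_on_def eq_card_imp_inj_on)
    moreover have "orbit \<sigma> (\<sigma> x) = orbit \<sigma> x"
      by (rule orbit_eq_of_mem[OF assms(1,2)]) (rule orbit.base)
    ultimately show ?thesis using True permutes_in_image[OF assms(2)] by (auto dest: inj_onD)
  qed (use permutes_not_in[OF assms(2)] in auto)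
qed

text \<open>Companion of \<open>refines_insert_Un\<close> for permutations: the restrictions to
  \<open>G\<close> and to \<open>H\<close> can be prescribed independently because their supports
  are disjoint.\<close>

lemma permutes_preserving_insert:
  assumes fin: "finite G" "finite H" and GH: "G \<inter> H = {}" and \<pi>: "partition_on H \<pi>"
  shows "bij_betw (\<lambda>(\<sigma>\<^sub>1, \<sigma>\<^sub>2). \<sigma>\<^sub>1 \<circ> \<sigma>\<^sub>2)
     ({\<sigma>. \<sigma> permutes G} \<times> {\<sigma>. \<sigma> permutes H \<and> (\<forall>K\<in>\<pi>. \<sigma> ` K = K)})
     {\<sigma>. \<sigma> permutes (G \<union> H) \<and> (\<forall>K\<in>insert G \<pi>. \<sigma> ` K = K)}"
proof (rule bij_betwI[where g = "\<lambda>\<sigma>. (perm_restrict \<sigma> G, perm_restrict \<sigma> H)"])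
  have sub: "K \<subseteq> H" if "K \<in> \<pi>" for K using partition_on_subset[OF \<pi> that] .
  have UH: "\<Union>\<pi> = H" using \<pi> by (simp add: partition_on_def)
  show "(\<lambda>(\<sigma>\<^sub>1, \<sigma>\<^sub>2). \<sigma>\<^sub>1 \<circ> \<sigma>\<^sub>2) \<in> {\<sigma>. \<sigma> permutes G} \<times> {\<sigma>. \<sigma> permutes H \<and> (\<forall>K\<in>\<pi>. \<sigma> ` K = K)}
     \<rightarrow> {\<sigma>. \<sigma> permutes (G \<union> H) \<and> (\<forall>K\<in>insert G \<pi>. \<sigma> ` K = K)}"
  proof clarsimp
    fix \<sigma>\<^sub>1 \<sigma>\<^sub>2 assume a: "\<sigma>\<^sub>1 permutes G" "\<sigma>\<^sub>2 permutes H" "\<forall>K\<in>\<pi>. \<sigma>\<^sub>2 ` K = K"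
    have "\<sigma>\<^sub>1 \<circ> \<sigma>\<^sub>2 permutes G \<union> H"
      using a by (meson permutes_compose permutes_subset sup_ge1 sup_ge2)
    moreover have "(\<lambda>x. \<sigma>\<^sub>1 (\<sigma>\<^sub>2 x)) ` G = G"
    proof -
      have "(\<lambda>x. \<sigma>\<^sub>1 (\<sigma>\<^sub>2 x)) ` G = \<sigma>\<^sub>1 ` G"
        using GH permutes_not_in[OF a(2)] by (intro image_cong refl) (metis IntI empty_iff)
      then show ?thesis using permutes_image[OF a(1)] by simp
    qed
    moreover have "(\<lambda>x. \<sigma>\<^sub>1 (\<sigma>\<^sub>2 x)) ` K = K" if K: "K \<in> \<pi>" for K
    proof -
      have "\<sigma>\<^sub>2 ` K \<subseteq> H" using a(3) K sub by auto
      then have "\<sigma>\<^sub>1 y = y" if "y \<in> \<sigma>\<^sub>2 ` K" for y using that GH permutes_not_in[OF a(1)] by blast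
      then have "(\<lambda>x. \<sigma>\<^sub>1 (\<sigma>\<^sub>2 x)) ` K = \<sigma>\<^sub>2 ` K" by (intro image_cong refl) blast
      then show ?thesis using a(3) K by simp
    qed
    ultimately show "\<sigma>\<^sub>1 \<circ> \<sigma>\<^sub>2 permutes G \<union> H \<and> (\<lambda>x. \<sigma>\<^sub>1 (\<sigma>\<^sub>2 x)) ` G = G \<and> (\<forall>K\<in>\<pi>. (\<lambda>x. \<sigma>\<^sub>1 (\<sigma>\<^sub>2 x)) ` K = K)"
      by blast
  qed
  show "(\<lambda>\<sigma>. (perm_restrict \<sigma> G, perm_restrict \<sigma> H)) \<in> {\<sigma>. \<sigma> permutes (G \<union> H) \<and> (\<forall>K\<in>insert G \<pi>. \<sigma> ` K = K)}
    \<rightarrow> {\<sigma>. \<sigma> permutes G} \<times> {\<sigma>. \<sigma> permutes H \<and> (\<forall>K\<in>\<pi>. \<sigma> ` K = K)}"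
  proof clarsimp
    fix \<sigma> assume a: "\<sigma> permutes (G \<union> H)" "\<sigma> ` G = G" "\<forall>K\<in>\<pi>. \<sigma> ` K = K"
    have "\<sigma> ` \<Union>\<pi> = \<Union>\<pi>" using a(3) by (simp add: image_Union)
    then have "\<sigma> ` H = H" by (simp add: UH)
    moreover have "perm_restrict \<sigma> H ` K = K" if "K \<in> \<pi>" for K
    proof -
      have "perm_restrict \<sigma> H ` K = \<sigma> ` K" using sub[OF that] by (intro image_cong refl) (auto simp: perm_restrict_simps)
      then show ?thesis using a(3) that by simp
    qed
    ultimately show "perm_restrict \<sigma> G permutes G \<and> perm_restrict \<sigma> H permutes H \<and> (\<forall>K\<in>\<pi>. perm_restrict \<sigma> H ` K = K)"
      using perm_restrict_permutes[OF fin(1) a(1,2)] perm_restrict_permutes[OF fin(2) a(1)] by blast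
  qed
  fix p assume "p \<in> {\<sigma>. \<sigma> permutes G} \<times> {\<sigma>. \<sigma> permutes H \<and> (\<forall>K\<in>\<pi>. \<sigma> ` K = K)}"
  then obtain \<sigma>\<^sub>1 \<sigma>\<^sub>2 where p: "p = (\<sigma>\<^sub>1, \<sigma>\<^sub>2)" "\<sigma>\<^sub>1 permutes G" "\<sigma>\<^sub>2 permutes H" by auto
  have "perm_restrict (\<sigma>\<^sub>1 \<circ> \<sigma>\<^sub>2) G = \<sigma>\<^sub>1"
  proof
    fix x show "perm_restrict (\<sigma>\<^sub>1 \<circ> \<sigma>\<^sub>2) G x = \<sigma>\<^sub>1 x"
      using permutes_not_in[OF p(3), of x] permutes_not_in[OF p(2), of x] disjoint_iff[THEN iffD1, OF GH]
      by (cases "x \<in> G") (simp_all add: perm_restrict_simps)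
  qed
  moreover have "perm_restrict (\<sigma>\<^sub>1 \<circ> \<sigma>\<^sub>2) H = \<sigma>\<^sub>2"
  proof
    fix x show "perm_restrict (\<sigma>\<^sub>1 \<circ> \<sigma>\<^sub>2) H x = \<sigma>\<^sub>2 x"
      using permutes_not_in[OF p(3), of x] permutes_not_in[OF p(2), of "\<sigma>\<^sub>2 x"] permutes_in_image[OF p(3), of x] GH
      by (cases "x \<in> H") (auto simp: perm_restrict_simps)
  qed
  ultimately show "(perm_restrict (case p of (\<sigma>\<^sub>1, \<sigma>\<^sub>2) \<Rightarrow> \<sigma>\<^sub>1 \<circ> \<sigma>\<^sub>2) G, perm_restrict (case p of (\<sigma>\<^sub>1, \<sigma>\<^sub>2) \<Rightarrow> \<sigma>\<^sub>1 \<circ> \<sigma>\<^sub>2) H) = p"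
    by (simp add: p)
next
  fix \<sigma> assume "\<sigma> \<in> {\<sigma>. \<sigma> permutes (G \<union> H) \<and> (\<forall>K\<in>insert G \<pi>. \<sigma> ` K = K)}"
  then have a: "\<sigma> permutes (G \<union> H)" "\<sigma> ` G = G" "\<forall>K\<in>\<pi>. \<sigma> ` K = K" by auto
  have "\<sigma> ` \<Union>\<pi> = \<Union>\<pi>" using a(3) by (simp add: image_Union)
  then have H: "\<sigma> ` H = H" using \<pi> by (simp add: partition_on_def)
  show "(case (perm_restrict \<sigma> G, perm_restrict \<sigma> H) of (\<sigma>\<^sub>1, \<sigma>\<^sub>2) \<Rightarrow> \<sigma>\<^sub>1 \<circ> \<sigma>\<^sub>2) = \<sigma>"
  proof
    fix x
    have "x \<in> H \<Longrightarrow> \<sigma> x \<in> H" using H by blast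
    then show "(case (perm_restrict \<sigma> G, perm_restrict \<sigma> H) of (\<sigma>\<^sub>1, \<sigma>\<^sub>2) \<Rightarrow> \<sigma>\<^sub>1 \<circ> \<sigma>\<^sub>2) x = \<sigma> x"
      using permutes_not_in[OF a(1), of x] GH by (auto simp: perm_restrict_def)
  qed
qed

lemma partition_on_insertD:
  assumes p: "partition_on H (insert G \<pi>)" and "G \<notin> \<pi>"
  shows "G \<noteq> {}" "G \<inter> \<Union>\<pi> = {}" "H = G \<union> \<Union>\<pi>" "partition_on (\<Union>\<pi>) \<pi>"
proof -
  show "G \<noteq> {}" using partition_on_nonempty[OF p] by blast
  have d: "G \<inter> K = {}" if "K \<in> \<pi>" for K
    using partition_on_same_block[OF p, of G K] that assms(2) by blast
  then show "G \<inter> \<Union>\<pi> = {}" by auto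
  show "H = G \<union> \<Union>\<pi>" using p by (simp add: partition_on_def)
  show "partition_on (\<Union>\<pi>) \<pi>"
  proof (rule partition_onI)
    show "{} \<notin> \<pi>" using partition_on_nonempty[OF p] by blast
    fix X Y assume "X \<in> \<pi>" "Y \<in> \<pi>" "X \<noteq> Y"
    then show "disjnt X Y" using partition_on_same_block[OF p, of X Y] by (auto simp: disjnt_iff)
  qed simp
qed

text \<open>Distributive law for permutations: a block-preserving permutation is a family of
  permutations of the blocks. It lets convolutions over the permutations of \<open>H\<close> factor
  over the blocks of \<pi>.\<close>

lemma prod_sum_permutes:
  fixes F :: "'a set \<Rightarrow> ('a \<Rightarrow> 'a) \<Rightarrow> 'b::comm_semiring_1"
  assumes "finite H" "partition_on H \<pi>"
  shows "(\<Prod>G\<in>\<pi>. \<Sum>\<sigma> | \<sigma> permutes G. F G \<sigma>) =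
    (\<Sum>\<sigma> | \<sigma> permutes H \<and> (\<forall>K\<in>\<pi>. \<sigma> ` K = K). \<Prod>G\<in>\<pi>. F G (perm_restrict \<sigma> G))"
proof -
  have "finite \<pi>" using assms finite_elements by blast
  then show ?thesis using assms
  proof (induction \<pi> arbitrary: H)
    case empty
    then have "H = {}" by (simp add: partition_on_def)
    then show ?case by simp
  next
    case (insert G \<pi>)
    define H' where "H' = \<Union>\<pi>"
    have G: "G \<noteq> {}" "G \<inter> H' = {}" and pi: "partition_on H' \<pi>" and H: "H = G \<union> H'"
      using partition_on_insertD[OF insert.prems(2) insert.hyps(2)] by (simp_all add: H'_def)
    have fin: "finite G" "finite H'" using insert.prems H by auto
    let ?A = "{\<sigma>. \<sigma> permutes G}" and ?B = "{\<sigma>. \<sigma> permutes H' \<and> (\<forall>K\<in>\<pi>. \<sigma> ` K = K)}"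
    have "(\<Sum>\<sigma> | \<sigma> permutes H \<and> (\<forall>K\<in>insert G \<pi>. \<sigma> ` K = K). \<Prod>L\<in>insert G \<pi>. F L (perm_restrict \<sigma> L))
        = (\<Sum>(\<sigma>\<^sub>1, \<sigma>\<^sub>2)\<in>?A \<times> ?B. \<Prod>L\<in>insert G \<pi>. F L (perm_restrict (\<sigma>\<^sub>1 \<circ> \<sigma>\<^sub>2) L))"
      unfolding H by (subst sum.reindex_bij_betw[OF permutes_preserving_insert[OF fin G(2) pi], symmetric])
        (simp add: case_prod_unfold)
    also have "\<dots> = (\<Sum>(\<sigma>\<^sub>1, \<sigma>\<^sub>2)\<in>?A \<times> ?B. F G \<sigma>\<^sub>1 * (\<Prod>L\<in>\<pi>. F L (perm_restrict \<sigma>\<^sub>2 L)))"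
    proof (rule sum.cong, simp, clarify)
      fix \<sigma>\<^sub>1 \<sigma>\<^sub>2 assume a: "\<sigma>\<^sub>1 permutes G" "\<sigma>\<^sub>2 permutes H'" "\<forall>K\<in>\<pi>. \<sigma>\<^sub>2 ` K = K"
      have "perm_restrict (\<sigma>\<^sub>1 \<circ> \<sigma>\<^sub>2) G = \<sigma>\<^sub>1"
      proof
        fix x show "perm_restrict (\<sigma>\<^sub>1 \<circ> \<sigma>\<^sub>2) G x = \<sigma>\<^sub>1 x"
          using permutes_not_in[OF a(2), of x] permutes_not_in[OF a(1), of x] disjoint_iff[THEN iffD1, OF G(2)]
          by (cases "x \<in> G") (simp_all add: perm_restrict_simps)
      qed
      moreover have "perm_restrict (\<sigma>\<^sub>1 \<circ> \<sigma>\<^sub>2) L = perm_restrict \<sigma>\<^sub>2 L" if L: "L \<in> \<pi>" for L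
      proof
        fix x
        have "L \<subseteq> H'" using partition_on_subset[OF pi L] .
        then show "perm_restrict (\<sigma>\<^sub>1 \<circ> \<sigma>\<^sub>2) L x = perm_restrict \<sigma>\<^sub>2 L x"
          using permutes_not_in[OF a(1), of "\<sigma>\<^sub>2 x"] permutes_in_image[OF a(2), of x] G(2)
          by (cases "x \<in> L") (auto simp: perm_restrict_simps)
      qed
      ultimately show "(\<Prod>L\<in>insert G \<pi>. F L (perm_restrict (\<sigma>\<^sub>1 \<circ> \<sigma>\<^sub>2) L)) = F G \<sigma>\<^sub>1 * (\<Prod>L\<in>\<pi>. F L (perm_restrict \<sigma>\<^sub>2 L))"
        using insert.hyps by simp
    qed
    also have "\<dots> = (\<Sum>\<sigma>\<in>?A. F G \<sigma>) * (\<Sum>\<sigma>\<in>?B. \<Prod>L\<in>\<pi>. F L (perm_restrict \<sigma> L))"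
      by (simp add: sum_product sum.cartesian_product)
    finally show ?case using insert.IH[OF fin(2) pi] insert.hyps by simp
  qed
qed

section \<open>Conjugacy and cycle type\<close>

lemma image_mset_eq_imp_bij:
  assumes "finite A" "finite B" "image_mset f (mset_set A) = image_mset g (mset_set B)"
  shows "\<exists>h. bij_betw h A B \<and> (\<forall>x\<in>A. g (h x) = f x)"
  using assms
proof (induction A arbitrary: B)
  case empty
  then have "B = {}" by (metis image_mset_is_empty_iff mset_set.empty mset_set_empty_iff)
  then show ?case by (auto simp: bij_betw_def)
next
  case (insert a A)
  have "f a \<in># image_mset g (mset_set B)" using insert by (metis finite_insert finite_set_mset_mset_set image_eqI insertI1 set_image_mset)
  then obtain b where b: "b \<in> B" "g b = f a" using insert.prems(1) by auto
  define B' where "B' = B - {b}"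
  have B: "B = insert b B'" "b \<notin> B'" "finite B'" using b insert.prems by (auto simp: B'_def)
  have "image_mset f (mset_set A) = image_mset g (mset_set B')"
    using insert.prems insert.hyps B b by simp
  then obtain h where h: "bij_betw h A B'" "\<forall>x\<in>A. g (h x) = f x" using insert.IH[OF B(3)] by blast
  have e: "\<And>x. x \<in> A \<Longrightarrow> (h(a := b)) x = h x" using insert.hyps by auto
  have "bij_betw (h(a := b)) A B'" using bij_betw_cong[of A "h(a := b)" h B', OF e] h(1) by simp
  then have "bij_betw (h(a := b)) (A \<union> {a}) (B' \<union> {b})"
    using insert.hyps B by (intro bij_betw_combine) (auto simp: bij_betw_def)
  then have "bij_betw (h(a := b)) (insert a A) B" by (simp add: B(1))
  moreover have "\<forall>x\<in>insert a A. g ((h(a := b)) x) = f x" using h(2) b e by auto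
  ultimately show ?case by blast
qed

lemma orbit_bij_betw_funpow:
  assumes "x \<in> orbit f x"
  shows "bij_betw (\<lambda>i. (f ^^ i) x) {..<card (orbit f x)} (orbit f x)" "(f ^^ card (orbit f x)) x = x"
    "card (orbit f x) > 0"
proof -
  let ?n = "funpow_dist1 f x x"
  have b: "bij_betw (\<lambda>i. (f ^^ i) x) {0..<?n} (orbit f x)"
    using inj_on_funpow_dist1[OF assms] orbit_conv_funpow_dist1[OF assms] by (simp add: bij_betw_def)
  then have c: "card (orbit f x) = ?n" using bij_betw_same_card[OF b] by simp
  show "bij_betw (\<lambda>i. (f ^^ i) x) {..<card (orbit f x)} (orbit f x)"
    using b unfolding c by (simp add: lessThan_atLeast0)
  show "(f ^^ card (orbit f x)) x = x" unfolding c by (rule funpow_dist1_prop[OF assms])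
  show "card (orbit f x) > 0" unfolding c by simp
qed

text \<open>The i-th iterate of \<open>x\<close> is sent to the i-th iterate of \<open>y\<close>;
  equal cycle lengths make this a bijection.\<close>

lemma orbit_conjugation:
  assumes x: "x \<in> orbit \<sigma> x" and y: "y \<in> orbit \<sigma>' y" and c: "card (orbit \<sigma> x) = card (orbit \<sigma>' y)"
  shows "\<exists>f. bij_betw f (orbit \<sigma> x) (orbit \<sigma>' y) \<and> (\<forall>z\<in>orbit \<sigma> x. \<sigma>' (f z) = f (\<sigma> z))"
proof -
  let ?n = "card (orbit \<sigma> x)"
  let ?u = "\<lambda>i. (\<sigma> ^^ i) x" and ?v = "\<lambda>i. (\<sigma>' ^^ i) y"
  have u: "bij_betw ?u {..<?n} (orbit \<sigma> x)" "?u ?n = x" "?n > 0"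
    using orbit_bij_betw_funpow[OF x] by simp_all
  have v: "bij_betw ?v {..<?n} (orbit \<sigma>' y)" "?v ?n = y"
    using orbit_bij_betw_funpow[OF y] c by simp_all
  define f where "f = ?v \<circ> inv_into {..<?n} ?u"
  have b: "bij_betw f (orbit \<sigma> x) (orbit \<sigma>' y)"
    unfolding f_def by (rule bij_betw_trans[OF bij_betw_inv_into[OF u(1)] v(1)])
  have fu: "f (?u i) = ?v i" if "i < ?n" for i
  proof -
    have "inj_on ?u {..<?n}" using u(1) by (simp add: bij_betw_def)
    then have "inv_into {..<?n} ?u (?u i) = i" by (rule inv_into_f_f) (use that in simp)
    then show ?thesis unfolding f_def o_def by (rule arg_cong)
  qed
  have "\<sigma>' (f z) = f (\<sigma> z)" if z: "z \<in> orbit \<sigma> x" for z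
  proof -
    obtain i where i: "i < ?n" "z = ?u i" using u(1) z by (auto simp: bij_betw_def)
    show ?thesis
    proof (cases "Suc i < ?n")
      case True
      then show ?thesis using fu[OF True] fu[OF i(1)] i(2) by simp
    next
      \<comment> \<open>At the last index both cycles close up: \<sigma> leads back to
        \<open>x\<close> and \<sigma>' back to \<open>y\<close>.\<close>
      case False
      then have s: "Suc i = ?n" using i by simp
      have "\<sigma> z = x" using u(2) i(2) unfolding s[symmetric] by simp
      moreover have "\<sigma>' (f z) = y" using v(2) fu[OF i(1)] i(2) unfolding s[symmetric] by simp
      moreover have "f x = y" using fu[of 0] u(3) by simp
      ultimately show ?thesis by simp
    qed
  qed
  then show ?thesis using b by blast
qed

text \<open>Cycles of equal length are matched and then conjugated one by one; \<open>f\<close> acts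
  on a point through the map chosen for its cycle, and disjointness of the cycles makes the pieces
  fit together.\<close>

lemma cycle_type_eq_imp_conjugate:
  assumes H: "finite H" "\<sigma> permutes H" and H': "finite H'" "\<sigma>' permutes H'"
    and ct: "cycle_type H \<sigma> = cycle_type H' \<sigma>'"
  shows "\<exists>f. bij_betw f H H' \<and> (\<forall>x\<in>H. \<sigma>' (f x) = f (\<sigma> x))"
proof -
  obtain h where h: "bij_betw h (cycles_on H \<sigma>) (cycles_on H' \<sigma>')"
      "\<forall>c\<in>cycles_on H \<sigma>. card (h c) = card c"
    using image_mset_eq_imp_bij[OF finite_cycles_on[OF H(1)] finite_cycles_on[OF H'(1)] ct[unfolded cycle_type_def]]
    by blast
  have "\<exists>f. bij_betw f c (h c) \<and> (\<forall>z\<in>c. \<sigma>' (f z) = f (\<sigma> z))" if c: "c \<in> cycles_on H \<sigma>" for c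
  proof -
    obtain x where x: "c = orbit \<sigma> x" using c by (auto simp: cycles_on_def)
    have "h c \<in> cycles_on H' \<sigma>'" using h(1) c by (auto simp: bij_betw_def)
    then obtain y where y: "h c = orbit \<sigma>' y" by (auto simp: cycles_on_def)
    show ?thesis
      using orbit_conjugation[OF self_in_orbit[OF H] self_in_orbit[OF H'], of x y] h(2) c x y by auto
  qed
  then obtain F where F: "\<And>c. c \<in> cycles_on H \<sigma> \<Longrightarrow> bij_betw (F c) c (h c)"
      "\<And>c z. c \<in> cycles_on H \<sigma> \<Longrightarrow> z \<in> c \<Longrightarrow> \<sigma>' (F c z) = F c (\<sigma> z)" by metis
  define f where "f = (\<lambda>z. F (orbit \<sigma> z) z)"
  have p: "partition_on H (cycles_on H \<sigma>)" "partition_on H' (cycles_on H' \<sigma>')"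
    using partition_on_cycles H H' by blast+
  have oc: "orbit \<sigma> z = c" if "c \<in> cycles_on H \<sigma>" "z \<in> c" for c z
    using that orbit_eq_of_mem[OF H] by (auto simp: cycles_on_def)
  have fb: "bij_betw f c (h c)" if "c \<in> cycles_on H \<sigma>" for c
    using F(1)[OF that] bij_betw_cong[of c f "F c"] oc[OF that] by (simp add: f_def)
  have "bij_betw f (\<Union>c\<in>cycles_on H \<sigma>. c) (\<Union>c\<in>cycles_on H \<sigma>. h c)"
  proof (rule bij_betw_UNION_disjoint[OF _ fb])
    show "disjoint_family_on h (cycles_on H \<sigma>)"
      unfolding disjoint_family_on_def
    proof (intro ballI impI)
      fix c d assume cd: "c \<in> cycles_on H \<sigma>" "d \<in> cycles_on H \<sigma>" "c \<noteq> d"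
      then have "h c \<noteq> h d" "h c \<in> cycles_on H' \<sigma>'" "h d \<in> cycles_on H' \<sigma>'"
        using h(1) by (auto simp: bij_betw_def inj_on_def)
      then show "h c \<inter> h d = {}" using partition_on_same_block[OF p(2)] by blast
    qed
  qed
  moreover have "(\<Union>c\<in>cycles_on H \<sigma>. c) = H" using p(1) by (simp add: partition_on_def)
  moreover have "(\<Union>c\<in>cycles_on H \<sigma>. h c) = H'"
    using h(1) p(2) by (simp add: bij_betw_def partition_on_def)
  ultimately have "bij_betw f H H'" by simp
  moreover have "\<sigma>' (f x) = f (\<sigma> x)" if "x \<in> H" for x
  proof -
    have c: "orbit \<sigma> x \<in> cycles_on H \<sigma>" using that by (auto simp: cycles_on_def)
    have "orbit \<sigma> (\<sigma> x) = orbit \<sigma> x" by (rule oc[OF c]) (rule orbit.base)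
    then show ?thesis using F(2)[OF c self_in_orbit[OF H]] by (simp add: f_def)
  qed
  ultimately show ?thesis by blast
qed

section \<open>Cycles of the standard permutation \<open>gamma\<close>\<close>

lemma cycles_on_comp_disjoint:
  assumes "finite A" "finite B" "\<sigma>\<^sub>1 permutes A" "\<sigma>\<^sub>2 permutes B" "A \<inter> B = {}"
  shows "cycles_on (A \<union> B) (\<sigma>\<^sub>1 \<circ> \<sigma>\<^sub>2) = cycles_on A \<sigma>\<^sub>1 \<union> cycles_on B \<sigma>\<^sub>2"
proof -
  have 1: "\<sigma>\<^sub>1 x = (\<sigma>\<^sub>1 \<circ> \<sigma>\<^sub>2) x" if "x \<in> A" for x
    using that permutes_not_in[OF assms(4), of x] disjoint_iff[THEN iffD1, OF assms(5)] by simp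
  have 2: "\<sigma>\<^sub>2 x = (\<sigma>\<^sub>1 \<circ> \<sigma>\<^sub>2) x" if "x \<in> B" for x
  proof -
    have "\<sigma>\<^sub>2 x \<in> B" using that permutes_in_image[OF assms(4)] by simp
    then have "\<sigma>\<^sub>2 x \<notin> A" using assms(5) by blast
    then show ?thesis using permutes_not_in[OF assms(3)] by simp
  qed
  have "cycles_on A \<sigma>\<^sub>1 = cycles_on A (\<sigma>\<^sub>1 \<circ> \<sigma>\<^sub>2)"
    by (rule cycles_on_cong[OF _ 1]) (simp_all add: permutes_image[OF assms(3)])
  moreover have "cycles_on B \<sigma>\<^sub>2 = cycles_on B (\<sigma>\<^sub>1 \<circ> \<sigma>\<^sub>2)"
    by (rule cycles_on_cong[OF _ 2]) (simp_all add: permutes_image[OF assms(4)])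
  ultimately show ?thesis by (simp add: cycles_on_def image_Un)
qed

lemma cycles_on_cycle_of_list:
  assumes "distinct cs" "cs \<noteq> []"
  shows "cycles_on (set cs) (cycle_of_list cs) = {set cs}"
proof -
  let ?f = "cycle_of_list cs"
  have perm: "?f permutes set cs" by (rule cycle_permutes)
  have "(?f ^^ n) (cs ! 0) \<in> orbit ?f (cs ! 0)" for n
    using self_in_orbit[OF finite_set perm] by (intro funpow_in_orbit)
  moreover have "(?f ^^ n) (cs ! 0) = cs ! n" if "n < length cs" for n
  proof -
    have "map (?f ^^ n) cs ! 0 = rotate n cs ! 0" using cyclic_rotation[of cs n] assms(1) by simp
    then show ?thesis using that assms(2) by (simp add: nth_rotate)
  qed
  ultimately have "set cs \<subseteq> orbit ?f (cs ! 0)" by (metis in_set_conv_nth subsetI)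
  then have o: "orbit ?f (cs ! 0) = set cs"
    using permutes_orbit_subset[OF perm, of "cs ! 0"] assms(2) by auto
  then have "orbit ?f x = set cs" if "x \<in> set cs" for x
    using orbit_eq_of_mem[OF finite_set perm, of x "cs ! 0"] that by simp
  then have "cycles_on (set cs) ?f = (\<lambda>x. set cs) ` set cs" by (simp add: cycles_on_def)
  then show ?thesis using assms(2) by (simp add: image_constant_conv)
qed

lemma gamma_from_properties:
  assumes "\<forall>l\<in>set ls. l \<ge> 1"
  shows "gamma_from s ls permutes {Suc s..s + sum_list ls} \<and>
    cycle_type {Suc s..s + sum_list ls} (gamma_from s ls) = mset ls"
  using assms
proof (induction ls arbitrary: s)
  case Nil
  then show ?case by (simp add: cycle_type_def cycles_on_def id_def[symmetric])
next
  case (Cons l ls)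
  let ?cs = "[Suc s..<Suc (s + l)]"
  let ?A = "{Suc s..s + l}" and ?B = "{Suc (s + l)..s + l + sum_list ls}"
  have l: "l \<ge> 1" using Cons.prems by simp
  have IH: "gamma_from (s + l) ls permutes ?B" "cycle_type ?B (gamma_from (s + l) ls) = mset ls"
    using Cons.IH[of "s + l"] Cons.prems by simp_all
  have set: "set ?cs = ?A" by auto
  have c: "cycle_of_list ?cs permutes ?A" using cycle_permutes[of ?cs] by (simp only: set)
  have AB: "{Suc s..s + sum_list (l # ls)} = ?A \<union> ?B" by auto
  have dj: "?A \<inter> ?B = {}" by auto
  have "cycles_on ?A (cycle_of_list ?cs) = {?A}"
    using cycles_on_cycle_of_list[of ?cs] l by (simp only: set) simp
  then have cyc: "cycles_on (?A \<union> ?B) (gamma_from s (l # ls)) = insert ?A (cycles_on ?B (gamma_from (s + l) ls))"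
    using cycles_on_comp_disjoint[OF _ _ c IH(1) dj] by simp
  have nin: "?A \<notin> cycles_on ?B (gamma_from (s + l) ls)"
  proof
    assume "?A \<in> cycles_on ?B (gamma_from (s + l) ls)"
    then have "?A \<subseteq> ?B" using partition_on_subset[OF partition_on_cycles[OF _ IH(1)]] by blast
    then show False using dj l by auto
  qed
  have "gamma_from s (l # ls) permutes ?A \<union> ?B"
    using permutes_compose[OF permutes_subset[OF IH(1)] permutes_subset[OF c]] by simp
  moreover have "cycle_type (?A \<union> ?B) (gamma_from s (l # ls)) = mset (l # ls)"
    unfolding cycle_type_def cyc using nin finite_cycles_on[of ?B] IH(2) by (simp add: cycle_type_def)
  ultimately show ?case by (simp only: AB)
qed

lemma gamma_permutes: "\<forall>l\<in>set ls. l \<ge> 1 \<Longrightarrow> gamma ls permutes {1..sum_list ls}"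
  using gamma_from_properties[of ls 0] by (simp add: gamma_def)

lemma cycle_type_gamma: "\<forall>l\<in>set ls. l \<ge> 1 \<Longrightarrow> cycle_type {1..sum_list ls} (gamma ls) = mset ls"
  using gamma_from_properties[of ls 0] by (simp add: gamma_def)

section \<open>Weingarten functions\<close>

lemma det_mat_nonzero:
  fixes A :: "'a \<Rightarrow> 'a \<Rightarrow> complex"
  assumes e: "bij_betw e {0..<m} X"
    and ker: "\<And>v. (\<forall>x\<in>X. (\<Sum>y\<in>X. A x y * v y) = 0) \<Longrightarrow> \<forall>x\<in>X. v x = 0"
  shows "Determinant.det (Matrix.mat m m (\<lambda>(i, j). A (e i) (e j))) \<noteq> 0"
proof
  let ?M = "Matrix.mat m m (\<lambda>(i, j). A (e i) (e j))"
  have M: "?M \<in> carrier_mat m m" by simp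
  assume "Determinant.det ?M = 0"
  then obtain w where w: "w \<in> carrier_vec m" "w \<noteq> 0\<^sub>v m" "?M *\<^sub>v w = 0\<^sub>v m"
    using det_0_iff_vec_prod_zero_field[OF M] by blast
  define v where "v = (\<lambda>x. vec_index w (inv_into {0..<m} e x))"
  have ve: "v (e i) = vec_index w i" if "i < m" for i
    unfolding v_def using e that by (simp add: bij_betw_def)
  have X: "X = e ` {0..<m}" using e by (simp add: bij_betw_def)
  have "(\<Sum>y\<in>X. A (e i) y * v y) = 0" if "i < m" for i
  proof -
    have "(\<Sum>y\<in>X. A (e i) y * v y) = (\<Sum>j\<in>{0..<m}. A (e i) (e j) * v (e j))"
      by (rule sum.reindex_bij_betw[OF e, symmetric])
    also have "\<dots> = (\<Sum>j\<in>{0..<m}. A (e i) (e j) * vec_index w j)"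
      by (intro sum.cong refl) (simp add: ve)
    also have "\<dots> = vec_index (?M *\<^sub>v w) i"
      using that w(1) by (simp add: scalar_prod_def)
    also have "\<dots> = 0" using w(3) that by simp
    finally show ?thesis .
  qed
  then have "\<forall>x\<in>X. (\<Sum>y\<in>X. A x y * v y) = 0" by (auto simp: X)
  then have "\<forall>x\<in>X. v x = 0" by (rule ker)
  then have "vec_index w i = 0" if "i < m" for i using ve[OF that] that by (auto simp: X)
  then have "w = 0\<^sub>v m" using w(1) by (intro eq_vecI) auto
  then show False using w(2) by simp
qed

lemma smult_one_mult_vec:
  fixes v :: "'a::comm_ring_1 Matrix.vec"
  assumes "v \<in> carrier_vec m"
  shows "(c \<cdot>\<^sub>m 1\<^sub>m m) *\<^sub>v v = c \<cdot>\<^sub>v v"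
proof (rule eq_vecI)
  fix i assume "i < dim_vec (c \<cdot>\<^sub>v v)"
  then have i: "i < m" using assms by simp
  have "vec_index ((c \<cdot>\<^sub>m 1\<^sub>m m) *\<^sub>v v) i = (\<Sum>j\<in>{0..<m}. c * (if j = i then 1 else 0) * vec_index v j)"
    using i assms by (simp add: scalar_prod_def)
  also have "\<dots> = (\<Sum>j\<in>{0..<m}. if j = i then c * vec_index v j else 0)"
    by (intro sum.cong refl) auto
  also have "\<dots> = c * vec_index v i" using i by (simp add: sum.delta)
  finally have X: "vec_index ((c \<cdot>\<^sub>m 1\<^sub>m m) *\<^sub>v v) i = c * vec_index v i" .
  have Y: "vec_index (c \<cdot>\<^sub>v v) i = c * vec_index v i" using i assms by simp
  show "vec_index ((c \<cdot>\<^sub>m 1\<^sub>m m) *\<^sub>v v) i = vec_index (c \<cdot>\<^sub>v v) i" by (simp only: X Y)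
qed (use assms in simp)

text \<open>Multiplying the system by the adjugate matrix gives Cramer's rule. The determinant stays
  on the left, so that division is postponed to where it is known to be nonzero.\<close>

lemma linear_system_cramer:
  fixes A :: "'a \<Rightarrow> 'a \<Rightarrow> complex"
  assumes e: "bij_betw e {0..<m} X"
    and eq: "\<And>x. x \<in> X \<Longrightarrow> (\<Sum>y\<in>X. A x y * v y) = b x" and j: "j < m"
  shows "Determinant.det (Matrix.mat m m (\<lambda>(i, j). A (e i) (e j))) * v (e j) =
    (\<Sum>i\<in>{0..<m}. adj_mat (Matrix.mat m m (\<lambda>(i, j). A (e i) (e j))) $$ (j, i) * b (e i))"
proof -
  let ?M = "Matrix.mat m m (\<lambda>(i, j). A (e i) (e j))"
  let ?v = "Matrix.vec m (\<lambda>i. v (e i))" and ?b = "Matrix.vec m (\<lambda>i. b (e i))"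
  have M: "?M \<in> carrier_mat m m" by simp
  note adj = adj_mat[OF M]
  have "?M *\<^sub>v ?v = ?b"
  proof (rule eq_vecI)
    fix i assume "i < dim_vec ?b"
    then have i: "i < m" by simp
    have "vec_index (?M *\<^sub>v ?v) i = (\<Sum>j\<in>{0..<m}. A (e i) (e j) * v (e j))" using i by (simp add: scalar_prod_def)
    also have "\<dots> = (\<Sum>y\<in>X. A (e i) y * v y)" by (rule sum.reindex_bij_betw[OF e])
    also have "\<dots> = b (e i)" using i e by (intro eq) (auto simp: bij_betw_def)
    finally show "vec_index (?M *\<^sub>v ?v) i = vec_index ?b i" using i by simp
  qed simp
  then have "adj_mat ?M *\<^sub>v ?b = (adj_mat ?M * ?M) *\<^sub>v ?v"
    by (simp add: assoc_mult_mat_vec[OF adj(1) M, of ?v])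
  also have "\<dots> = (Determinant.det ?M \<cdot>\<^sub>m 1\<^sub>m m) *\<^sub>v ?v" by (simp only: adj(3))
  also have "\<dots> = Determinant.det ?M \<cdot>\<^sub>v ?v" by (rule smult_one_mult_vec) simp
  finally have "vec_index (adj_mat ?M *\<^sub>v ?b) j = vec_index (Determinant.det ?M \<cdot>\<^sub>v ?v) j" by simp
  moreover have "vec_index (adj_mat ?M *\<^sub>v ?b) j = (\<Sum>i\<in>{0..<m}. adj_mat ?M $$ (j, i) * b (e i))"
    using j adj(1) by (auto simp: scalar_prod_def intro!: sum.cong)
  ultimately show ?thesis using j by simp
qed

text \<open>An injective square system is solvable for every right-hand side: the adjugate divided
  by the determinant yields the solution.\<close>

lemma linear_system_solvable:
  fixes A :: "'a \<Rightarrow> 'a \<Rightarrow> complex"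
  assumes fin: "finite X"
    and ker: "\<And>v. (\<forall>x\<in>X. (\<Sum>y\<in>X. A x y * v y) = 0) \<Longrightarrow> \<forall>x\<in>X. v x = 0"
  shows "\<exists>v. \<forall>x\<in>X. (\<Sum>y\<in>X. A x y * v y) = b x"
proof -
  obtain e where e: "bij_betw e {0..<card X} X" using ex_bij_betw_nat_finite[OF fin] by blast
  define m where "m = card X"
  note e = e[folded m_def]
  let ?M = "Matrix.mat m m (\<lambda>(i, j). A (e i) (e j))"
  let ?b = "Matrix.vec m (\<lambda>i. b (e i))"
  have M: "?M \<in> carrier_mat m m" by simp
  note adj = adj_mat[OF M]
  have d: "Determinant.det ?M \<noteq> 0" by (rule det_mat_nonzero[OF e ker])
  define w where "w = (1 / Determinant.det ?M) \<cdot>\<^sub>v (adj_mat ?M *\<^sub>v ?b)"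
  have u: "adj_mat ?M *\<^sub>v ?b \<in> carrier_vec m" by (rule mult_mat_vec_carrier[OF adj(1)]) simp
  have w: "w \<in> carrier_vec m" unfolding w_def by (rule smult_carrier_vec[THEN iffD2, OF u])
  have "?M *\<^sub>v w = (1 / Determinant.det ?M) \<cdot>\<^sub>v (?M *\<^sub>v (adj_mat ?M *\<^sub>v ?b))"
    unfolding w_def by (rule mult_mat_vec[OF M u])
  also have "?M *\<^sub>v (adj_mat ?M *\<^sub>v ?b) = (?M * adj_mat ?M) *\<^sub>v ?b"
    by (rule assoc_mult_mat_vec[OF M adj(1), symmetric]) simp
  also have "(?M * adj_mat ?M) *\<^sub>v ?b = Determinant.det ?M \<cdot>\<^sub>v ?b"
    by (simp only: adj(2) smult_one_mult_vec[OF vec_carrier])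
  also have "(1 / Determinant.det ?M) \<cdot>\<^sub>v (Determinant.det ?M \<cdot>\<^sub>v ?b) = ?b" using d by (auto simp: smult_smult_assoc)
  finally have Mw: "?M *\<^sub>v w = ?b" .
  define v where "v = (\<lambda>x. vec_index w (inv_into {0..<m} e x))"
  have ve: "v (e i) = vec_index w i" if "i < m" for i
    unfolding v_def using e that by (simp add: bij_betw_def)
  have "(\<Sum>y\<in>X. A x y * v y) = b x" if x: "x \<in> X" for x
  proof -
    obtain i where i: "i < m" "x = e i" using e x by (auto simp: bij_betw_def)
    have "(\<Sum>y\<in>X. A (e i) y * v y) = (\<Sum>j\<in>{0..<m}. A (e i) (e j) * v (e j))"
      by (rule sum.reindex_bij_betw[OF e, symmetric])
    also have "\<dots> = (\<Sum>j\<in>{0..<m}. A (e i) (e j) * vec_index w j)"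
      by (intro sum.cong refl) (simp add: ve)
    also have "\<dots> = vec_index (?M *\<^sub>v w) i" using i w by (simp add: scalar_prod_def)
    finally show ?thesis using Mw i by simp
  qed
  then show ?thesis by blast
qed

text \<open>By the Leibniz formula the determinant is a polynomial in the entries.\<close>

lemma tendsto_det_mat:
  fixes A :: "nat \<Rightarrow> nat \<Rightarrow> nat \<Rightarrow> complex"
  assumes "\<And>i j. i < m \<Longrightarrow> j < m \<Longrightarrow> (\<lambda>N. A N i j) \<longlonglongrightarrow> A' i j"
  shows "(\<lambda>N. Determinant.det (Matrix.mat m m (\<lambda>(i, j). A N i j))) \<longlonglongrightarrow> Determinant.det (Matrix.mat m m (\<lambda>(i, j). A' i j))"
proof -
  have d: "Determinant.det (Matrix.mat m m (\<lambda>(i, j). F i j)) = (\<Sum>p | p permutes {0..<m}. signof p * (\<Prod>i = 0..<m. F i (p i)))"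
    for F :: "nat \<Rightarrow> nat \<Rightarrow> complex"
  proof -
    have "(\<Prod>i = 0..<m. Matrix.mat m m (\<lambda>(i, j). F i j) $$ (i, p i)) = (\<Prod>i = 0..<m. F i (p i))"
      if "p permutes {0..<m}" for p
      using permutes_in_image[OF that] by (intro prod.cong refl) auto
    then show ?thesis by (simp add: Determinant.det_def)
  qed
  show ?thesis unfolding d
  proof (intro tendsto_sum tendsto_mult tendsto_const tendsto_prod)
    fix p i assume "p \<in> {p. p permutes {0..<m}}" "i \<in> {0..<m}"
    then show "(\<lambda>N. A N i (p i)) \<longlonglongrightarrow> A' i (p i)"
      using permutes_in_image[of p "{0..<m}" i] by (intro assms) auto
  qed
qed

text \<open>Up to sign an entry of the adjugate is a determinant of size m - 1, so the limit of
  determinants applies to it.\<close>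

lemma convergent_adj_mat:
  fixes A :: "nat \<Rightarrow> nat \<Rightarrow> nat \<Rightarrow> complex"
  assumes A: "\<And>i j. i < m \<Longrightarrow> j < m \<Longrightarrow> (\<lambda>N. A N i j) \<longlonglongrightarrow> A' i j" and ij: "i < m" "j < m"
  shows "convergent (\<lambda>N. adj_mat (Matrix.mat m m (\<lambda>(i, j). A N i j)) $$ (i, j))"
proof -
  \<comment> \<open>\<open>?s l r\<close> is the position in the full matrix of the row or column
    \<open>r\<close> that remains after deletion of \<open>l\<close>.\<close>
  let ?s = "\<lambda>l r. if r < l then r else Suc r"
  have eq: "adj_mat (Matrix.mat m m (\<lambda>(i, j). A N i j)) $$ (i, j) =
     (-1) ^ (j + i) * Determinant.det (Matrix.mat (m - 1) (m - 1) (\<lambda>(r, c). A N (?s j r) (?s i c)))" for N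
  proof -
    have "mat_delete (Matrix.mat m m (\<lambda>(i, j). A N i j)) j i = Matrix.mat (m - 1) (m - 1) (\<lambda>(r, c). A N (?s j r) (?s i c))"
      by (rule eq_matI) (auto simp: mat_delete_def)
    then show ?thesis using ij by (simp add: adj_mat_def cofactor_def)
  qed
  have "(\<lambda>N. (-1) ^ (j + i) * Determinant.det (Matrix.mat (m - 1) (m - 1) (\<lambda>(r, c). A N (?s j r) (?s i c))))
      \<longlonglongrightarrow> (-1) ^ (j + i) * Determinant.det (Matrix.mat (m - 1) (m - 1) (\<lambda>(r, c). A' (?s j r) (?s i c)))"
    by (intro tendsto_mult tendsto_const tendsto_det_mat A) auto
  then show ?thesis unfolding eq by (rule convergentI)
qed

text \<open>The unknowns \<open>v N\<close> are known only as solutions of the system. Once the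
  determinant is close to its nonzero limit, Cramer's rule writes each of them as a quotient of
  convergent sequences. Hence the kernel condition concerns the limiting matrix, and the equations
  are asked for only eventually.\<close>

lemma linear_system_convergent:
  fixes A :: "nat \<Rightarrow> 'a \<Rightarrow> 'a \<Rightarrow> complex"
  assumes fin: "finite X"
    and A: "\<And>x y. x \<in> X \<Longrightarrow> y \<in> X \<Longrightarrow> (\<lambda>N. A N x y) \<longlonglongrightarrow> A' x y"
    and ker: "\<And>v. (\<forall>x\<in>X. (\<Sum>y\<in>X. A' x y * v y) = 0) \<Longrightarrow> \<forall>x\<in>X. v x = 0"
    and eq: "\<And>x. x \<in> X \<Longrightarrow> \<forall>\<^sub>F N in sequentially. (\<Sum>y\<in>X. A N x y * v N y) = b N x"
    and b: "\<And>x. x \<in> X \<Longrightarrow> convergent (\<lambda>N. b N x)"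
    and x: "x \<in> X"
  shows "convergent (\<lambda>N. v N x)"
proof -
  obtain e where e: "bij_betw e {0..<card X} X" using ex_bij_betw_nat_finite[OF fin] by blast
  define m where "m = card X"
  note e = e[folded m_def]
  obtain j where j: "j < m" "x = e j" using e x by (auto simp: bij_betw_def)
  have eX: "e i \<in> X" if "i < m" for i using e that by (auto simp: bij_betw_def)
  let ?M = "\<lambda>N. Matrix.mat m m (\<lambda>(i, j). A N (e i) (e j))"
  let ?M' = "Matrix.mat m m (\<lambda>(i, j). A' (e i) (e j))"
  have d: "Determinant.det ?M' \<noteq> 0" by (rule det_mat_nonzero[OF e ker])
  have lim: "(\<lambda>N. Determinant.det (?M N)) \<longlonglongrightarrow> Determinant.det ?M'" by (rule tendsto_det_mat) (auto intro: A eX)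
  then have nz: "\<forall>\<^sub>F N in sequentially. Determinant.det (?M N) \<noteq> 0" using d by (rule tendsto_imp_eventually_ne)
  have "\<forall>\<^sub>F N in sequentially. \<forall>x\<in>X. (\<Sum>y\<in>X. A N x y * v N y) = b N x"
    by (rule eventually_ball_finite[OF fin]) (use eq in blast)
  then have ev: "\<forall>\<^sub>F N in sequentially. (\<Sum>i\<in>{0..<m}. adj_mat (?M N) $$ (j, i) * b N (e i)) / Determinant.det (?M N) = v N x"
    using nz
  proof eventually_elim
    case (elim N)
    then show ?case
      using linear_system_cramer[OF e, of "A N" "v N" "b N" j] j by (simp add: divide_eq_eq mult.commute)
  qed
  have cv: "convergent (\<lambda>N. adj_mat (?M N) $$ (j, i) * b N (e i))" if "i < m" for i
  proof -
    have "convergent (\<lambda>N. adj_mat (?M N) $$ (j, i))"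
      by (rule convergent_adj_mat[OF _ j(1) that, where A = "\<lambda>N i j. A N (e i) (e j)" and A' = "\<lambda>i j. A' (e i) (e j)"])
        (auto intro: A eX)
    moreover have "convergent (\<lambda>N. b N (e i))" by (intro b eX that)
    ultimately obtain a c where "(\<lambda>N. adj_mat (?M N) $$ (j, i)) \<longlonglongrightarrow> a" "(\<lambda>N. b N (e i)) \<longlonglongrightarrow> c"
      unfolding convergent_def by blast
    from tendsto_mult[OF this] show ?thesis by (rule convergentI)
  qed
  define c where "c i = lim (\<lambda>N. adj_mat (?M N) $$ (j, i) * b N (e i))" for i
  have "(\<lambda>N. adj_mat (?M N) $$ (j, i) * b N (e i)) \<longlonglongrightarrow> c i" if "i < m" for i
    using cv[OF that] by (simp add: c_def convergent_LIMSEQ_iff)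
  then have "(\<lambda>N. (\<Sum>i\<in>{0..<m}. adj_mat (?M N) $$ (j, i) * b N (e i)) / Determinant.det (?M N)) \<longlonglongrightarrow> (\<Sum>i\<in>{0..<m}. c i) / Determinant.det ?M'"
    using d lim by (intro tendsto_divide tendsto_sum) auto
  then have "(\<lambda>N. v N x) \<longlonglongrightarrow> (\<Sum>i\<in>{0..<m}. c i) / Determinant.det ?M'"
    by (rule Lim_transform_eventually) (rule ev)
  then show ?thesis by (auto simp: convergent_def)
qed

text \<open>For \<open>N \<ge> n!\<close> the matrix is strictly diagonally dominant.\<close>

lemma cycle_matrix_kernel:
  fixes v :: "('a \<Rightarrow> 'a) \<Rightarrow> complex"
  assumes fin: "finite G" and N: "fact (card G) \<le> N"
    and v: "\<forall>\<nu>. \<nu> permutes G \<longrightarrow> (\<Sum>\<mu> | \<mu> permutes G. of_nat N ^ card (cycles_on G (\<mu> \<circ> inv_into UNIV \<nu>)) * v \<mu>) = 0"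
    and \<mu>: "\<mu> permutes G"
  shows "v \<mu> = 0"
proof -
  let ?P = "{\<mu>. \<mu> permutes G}" and ?n = "card G"
  let ?K = "\<lambda>\<nu> \<mu>. of_nat N ^ card (cycles_on G (\<mu> \<circ> inv_into UNIV \<nu>)) :: complex"
  have finP: "finite ?P" using finite_permutations[OF fin] .
  have ne: "?P \<noteq> {}" using \<mu> by blast
  \<comment> \<open>The row to look at is one where the modulus of \<open>v\<close> attains its
    maximum \<open>B\<close>.\<close>
  define B where "B = Max ((\<lambda>\<mu>. norm (v \<mu>)) ` ?P)"
  have Bge: "norm (v \<mu>) \<le> B" if "\<mu> permutes G" for \<mu> unfolding B_def using that finP by (intro Max_ge) auto
  have "B \<in> (\<lambda>\<mu>. norm (v \<mu>)) ` ?P" unfolding B_def using finP ne by (intro Max_in) auto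
  then obtain \<nu> where \<nu>: "\<nu> permutes G" "norm (v \<nu>) = B" by auto
  have N1: "1 \<le> N" using N by (meson fact_ge_1 order_trans)
  have B0: "0 \<le> B" using \<nu>(2) norm_ge_zero by metis
  show ?thesis
  proof (cases "?n = 0")
    case True
    then have "G = {}" using fin by simp
    then have P: "?P = {id}" by auto
    have "(\<Sum>\<mu>\<in>?P. ?K id \<mu> * v \<mu>) = 0" using v permutes_id[of G] by blast
    then show ?thesis using P \<mu> \<open>G = {}\<close> by (simp add: cycles_on_def)
  next
    case False
    have diag: "?K \<nu> \<nu> = of_nat N ^ ?n" using permutes_inv_o(1)[OF \<nu>(1)] by (simp add: card_cycles_id)
    \<comment> \<open>The quotient of two different permutations has at most n - 1 cycles, so an
      off-diagonal entry is at most N^(n-1).\<close>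
    have off: "norm (?K \<nu> \<mu> * v \<mu>) \<le> real N ^ (?n - 1) * B" if m: "\<mu> permutes G" "\<mu> \<noteq> \<nu>" for \<mu>
    proof -
      have p: "\<mu> \<circ> inv_into UNIV \<nu> permutes G" using m \<nu> permutes_compose permutes_inv by blast
      have "card (cycles_on G (\<mu> \<circ> inv_into UNIV \<nu>)) \<noteq> ?n"
      proof
        assume "card (cycles_on G (\<mu> \<circ> inv_into UNIV \<nu>)) = ?n"
        then have "\<mu> \<circ> inv_into UNIV \<nu> = id" by (rule card_cycles_eq_card[OF fin p])
        then have "\<mu> \<circ> inv_into UNIV \<nu> \<circ> \<nu> = \<nu>" by simp
        then have "\<mu> = \<nu>" using permutes_inv_o(2)[OF \<nu>(1)] by (simp add: comp_assoc)
        then show False using m by simp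
      qed
      then have "card (cycles_on G (\<mu> \<circ> inv_into UNIV \<nu>)) \<le> ?n - 1"
        using card_cycles_le[OF fin, of "\<mu> \<circ> inv_into UNIV \<nu>"] by linarith
      then have "real N ^ card (cycles_on G (\<mu> \<circ> inv_into UNIV \<nu>)) \<le> real N ^ (?n - 1)"
        using N1 by (intro power_increasing) auto
      then show ?thesis using Bge[OF m(1)] by (simp add: norm_mult norm_power mult_mono)
    qed
    have "(\<Sum>\<mu>\<in>?P. ?K \<nu> \<mu> * v \<mu>) = 0" using v \<nu>(1) by blast
    moreover have "(\<Sum>\<mu>\<in>?P. ?K \<nu> \<mu> * v \<mu>) = ?K \<nu> \<nu> * v \<nu> + (\<Sum>\<mu>\<in>?P - {\<nu>}. ?K \<nu> \<mu> * v \<mu>)"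
      by (rule sum.remove[OF finP]) (simp add: \<nu>(1))
    ultimately have "?K \<nu> \<nu> * v \<nu> + (\<Sum>\<mu>\<in>?P - {\<nu>}. ?K \<nu> \<mu> * v \<mu>) = 0" by (simp only:)
    then have "?K \<nu> \<nu> * v \<nu> = - (\<Sum>\<mu>\<in>?P - {\<nu>}. ?K \<nu> \<mu> * v \<mu>)" by (simp add: add_eq_0_iff)
    then have "norm (?K \<nu> \<nu> * v \<nu>) = norm (\<Sum>\<mu>\<in>?P - {\<nu>}. ?K \<nu> \<mu> * v \<mu>)" by (simp only: norm_minus_cancel)
    also have "\<dots> \<le> (\<Sum>\<mu>\<in>?P - {\<nu>}. real N ^ (?n - 1) * B)"
      by (intro sum_norm_le off) auto
    also have "\<dots> = (real (fact ?n) - 1) * (real N ^ (?n - 1) * B)"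
      using finP \<nu>(1) card_permutations[OF refl fin] by (simp add: card_Diff_singleton of_nat_diff)
    finally have "real N ^ ?n * B \<le> (real (fact ?n) - 1) * (real N ^ (?n - 1) * B)"
      using diag \<nu>(2) by (simp add: norm_mult norm_power)
    \<comment> \<open>There are n! - 1 <= N - 1 off-diagonal entries. Their joint bound falls short
      of the diagonal term N^n B by N^(n-1) B, which forces \<open>B\<close> to be 0.\<close>
    also have "\<dots> \<le> (real N - 1) * (real N ^ (?n - 1) * B)"
    proof (intro mult_right_mono)
      have "real (fact ?n) \<le> real N" using N by (simp only: of_nat_le_iff)
      then show "real (fact ?n) - 1 \<le> real N - 1" by simp
    qed (use B0 in simp)
    also have "\<dots> = real N ^ ?n * B - real N ^ (?n - 1) * B"
      using False by (cases ?n) (simp_all add: algebra_simps)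
    finally have "real N ^ (?n - 1) * B \<le> 0" by simp
    moreover have "real N ^ (?n - 1) > 0" using N1 by simp
    ultimately have "B \<le> 0" using mult_pos_pos[of "real N ^ (?n - 1)" B] by linarith
    then have "norm (v \<mu>) \<le> 0" using Bge[OF \<mu>] by linarith
    then show ?thesis by simp
  qed
qed

section \<open>Existence and uniqueness of the Weingarten function\<close>

lemma cycle_matrix_unique:
  fixes v w :: "('a \<Rightarrow> 'a) \<Rightarrow> complex"
  assumes fin: "finite G" and N: "fact (card G) \<le> N"
    and e: "\<And>\<nu>. \<nu> permutes G \<Longrightarrow> (\<Sum>\<mu> | \<mu> permutes G. of_nat N ^ card (cycles_on G (\<mu> \<circ> inv_into UNIV \<nu>)) * v \<mu>)
         = (\<Sum>\<mu> | \<mu> permutes G. of_nat N ^ card (cycles_on G (\<mu> \<circ> inv_into UNIV \<nu>)) * w \<mu>)"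
    and \<mu>: "\<mu> permutes G"
  shows "v \<mu> = w \<mu>"
proof -
  have "(\<lambda>\<mu>. v \<mu> - w \<mu>) \<mu> = 0"
    by (rule cycle_matrix_kernel[OF fin N _ \<mu>]) (simp add: e right_diff_distrib sum_subtractf)
  then show ?thesis by simp
qed

lemma sum_permutes_inv_comp:
  fixes f :: "('a \<Rightarrow> 'a) \<Rightarrow> 'b::comm_monoid_add"
  assumes "\<nu> permutes G"
  shows "(\<Sum>\<mu> | \<mu> permutes G. f (\<nu> \<circ> inv_into UNIV \<mu>)) = (\<Sum>\<mu> | \<mu> permutes G. f \<mu>)"
  using setum_permutations_compose_left[OF assms, of f] sum_permutations_inverse[of "\<lambda>p. f (\<nu> \<circ> p)" G]
  by simp

text \<open>Replacing \<mu> by \<open>\<nu> \<circ> inv_into UNIV \<mu>\<close> turns the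
  convolution into a matrix product; the exponent survives because the number of cycles is invariant
  under inversion and conjugation.\<close>

lemma weingarten_sum_iff:
  fixes w :: "('a \<Rightarrow> 'a) \<Rightarrow> complex"
  assumes fin: "finite G" and \<nu>: "\<nu> permutes G"
  shows "(\<Sum>\<mu> | \<mu> permutes G. w (\<nu> \<circ> inv_into UNIV \<mu>) * of_nat N ^ card (cycles_on G \<mu>)) =
    (\<Sum>\<mu> | \<mu> permutes G. of_nat N ^ card (cycles_on G (\<mu> \<circ> inv_into UNIV \<nu>)) * w \<mu>)"
proof -
  have "(\<Sum>\<mu> | \<mu> permutes G. w (\<nu> \<circ> inv_into UNIV \<mu>) * of_nat N ^ card (cycles_on G \<mu>)) =
    (\<Sum>\<mu> | \<mu> permutes G. w (\<nu> \<circ> inv_into UNIV \<mu>) * of_nat N ^ card (cycles_on G ((\<nu> \<circ> inv_into UNIV \<mu>) \<circ> inv_into UNIV \<nu>)))"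
  proof (intro sum.cong refl)
    fix \<mu> assume "\<mu> \<in> {\<mu>. \<mu> permutes G}"
    then have m: "\<mu> permutes G" by simp
    have "card (cycles_on G (\<nu> \<circ> inv_into UNIV \<mu> \<circ> inv_into UNIV \<nu>)) = card (cycles_on G \<mu>)"
      using card_cycles_on_conj[OF fin \<nu> permutes_inv[OF m]] cycles_on_inv[OF fin m] by simp
    then show "w (\<nu> \<circ> inv_into UNIV \<mu>) * of_nat N ^ card (cycles_on G \<mu>) =
      w (\<nu> \<circ> inv_into UNIV \<mu>) * of_nat N ^ card (cycles_on G ((\<nu> \<circ> inv_into UNIV \<mu>) \<circ> inv_into UNIV \<nu>))" by simp
  qed
  also have "\<dots> = (\<Sum>\<mu> | \<mu> permutes G. w \<mu> * of_nat N ^ card (cycles_on G (\<mu> \<circ> inv_into UNIV \<nu>)))"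
    by (rule sum_permutes_inv_comp[OF \<nu>])
  finally show ?thesis by (simp add: mult.commute)
qed

text \<open>For N >= n! the description in \<open>weingarten\<close> denotes: existence and
  uniqueness both follow from the trivial kernel of the cycle-count matrix. The convention that the
  function vanishes off the permutations of \<open>G\<close> makes uniqueness hold for total
  functions.\<close>

lemma weingarten_inverse:
  fixes G :: "'a set"
  assumes fin: "finite G" and N: "fact (card G) \<le> N" and \<nu>: "\<nu> permutes G"
  shows "(\<Sum>\<mu> | \<mu> permutes G. of_nat N ^ card (cycles_on G (\<mu> \<circ> inv_into UNIV \<nu>)) * weingarten N G \<mu>)
    = (if \<nu> = id then 1 else 0)"
proof -
  let ?K = "\<lambda>\<nu> \<mu>. of_nat N ^ card (cycles_on G (\<mu> \<circ> inv_into UNIV \<nu>)) :: complex"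
  let ?P = "\<lambda>w :: ('a \<Rightarrow> 'a) \<Rightarrow> complex. (\<forall>\<nu>. \<not> \<nu> permutes G \<longrightarrow> w \<nu> = 0) \<and>
    (\<forall>\<nu>. \<nu> permutes G \<longrightarrow>
      (\<Sum>\<mu> | \<mu> permutes G. w (\<nu> \<circ> inv_into UNIV \<mu>) * of_nat N ^ card (cycles_on G \<mu>))
        = (if \<nu> = id then 1 else 0))"
  have "\<exists>v. \<forall>\<nu>\<in>{\<nu>. \<nu> permutes G}. (\<Sum>\<mu>\<in>{\<mu>. \<mu> permutes G}. ?K \<nu> \<mu> * v \<mu>) = (if \<nu> = id then 1 else 0)"
  proof (rule linear_system_solvable[OF finite_permutations[OF fin]])
    fix v assume "\<forall>\<nu>\<in>{\<nu>. \<nu> permutes G}. (\<Sum>\<mu>\<in>{\<mu>. \<mu> permutes G}. ?K \<nu> \<mu> * v \<mu>) = 0"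
    then show "\<forall>\<mu>\<in>{\<mu>. \<mu> permutes G}. v \<mu> = 0" using cycle_matrix_kernel[OF fin N, of v] by blast
  qed
  then obtain v where v: "\<And>\<nu>. \<nu> permutes G \<Longrightarrow> (\<Sum>\<mu> | \<mu> permutes G. ?K \<nu> \<mu> * v \<mu>) = (if \<nu> = id then 1 else 0)"
    by blast
  define w where "w = (\<lambda>\<mu>. if \<mu> permutes G then v \<mu> else 0)"
  have w: "(\<Sum>\<mu> | \<mu> permutes G. ?K \<nu> \<mu> * w \<mu>) = (if \<nu> = id then 1 else 0)" if "\<nu> permutes G" for \<nu>
    using v[OF that] by (simp add: w_def)
  have ex: "?P w"
    using w weingarten_sum_iff[OF fin, where w = w] by (auto simp: w_def)
  have uniq: "w' = w" if w': "?P w'" for w'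
  proof
    fix \<mu> show "w' \<mu> = w \<mu>"
    proof (cases "\<mu> permutes G")
      case True
      show ?thesis
      proof (rule cycle_matrix_unique[OF fin N _ True])
        fix \<nu> assume n: "\<nu> permutes G"
        show "(\<Sum>\<mu> | \<mu> permutes G. ?K \<nu> \<mu> * w' \<mu>) = (\<Sum>\<mu> | \<mu> permutes G. ?K \<nu> \<mu> * w \<mu>)"
          unfolding w[OF n] weingarten_sum_iff[OF fin n, symmetric] using w' n by blast
      qed
    qed (use w' in \<open>auto simp: w_def\<close>)
  qed
  have "weingarten N G = w" unfolding weingarten_def
  proof (rule the_equality)
    show "?P w" by (rule ex)
    fix w' assume "?P w'" then show "w' = w" by (rule uniq)
  qed
  then show ?thesis using w[OF \<nu>] by simp
qed

section \<open>The exact moment-cumulant formula\<close>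

lemma bij_betw_partitions:
  assumes h: "bij_betw h A B"
  shows "bij_betw (\<lambda>\<rho>. (`) h ` \<rho>) {\<rho>. partition_on A \<rho>} {\<rho>. partition_on B \<rho>}"
proof -
  have img: "partition_on B ((`) h ` \<rho>)" if "partition_on A \<rho>" "bij_betw h A B" for h :: "'x \<Rightarrow> 'y" and A B \<rho>
  proof -
    have "{} \<notin> (`) h ` \<rho>" using partition_on_nonempty[OF that(1)] by auto
    then show ?thesis using partition_on_inj_image[OF that(1), of h] that(2) by (simp add: bij_betw_def)
  qed
  let ?k = "inv_into A h"
  have k: "bij_betw ?k B A" by (rule bij_betw_inv_into[OF h])
  have inv: "(`) ?k ` (`) h ` \<rho> = \<rho>" if p: "partition_on A \<rho>" for \<rho>
  proof -
    have "?k ` h ` V = V" if "V \<in> \<rho>" for V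
      using partition_on_subset[OF p that] h by (simp add: bij_betw_def inv_into_image_cancel)
    then show ?thesis by (simp add: image_image)
  qed
  have inv': "(`) h ` (`) ?k ` \<rho> = \<rho>" if p: "partition_on B \<rho>" for \<rho>
  proof -
    have "h ` ?k ` V = V" if "V \<in> \<rho>" for V
      using partition_on_subset[OF p that] h by (simp add: bij_betw_def image_inv_into_cancel)
    then show ?thesis by (simp add: image_image)
  qed
  show ?thesis
    by (rule bij_betwI[where g = "\<lambda>\<rho>. (`) ?k ` \<rho>"]) (use img h k inv inv' in auto)
qed

lemma cumulant_bij:
  assumes h: "bij_betw h A B" and g: "\<And>V. V \<subseteq> A \<Longrightarrow> g V = g' (h ` V)"
  shows "cumulant g A = cumulant g' B"
proof -
  have "cumulant g' B = (\<Sum>\<rho> | partition_on A \<rho>. cumulant_coeff (card ((`) h ` \<rho>)) * (\<Prod>V\<in>(`) h ` \<rho>. g' V))"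
    unfolding cumulant_def by (rule sum.reindex_bij_betw[OF bij_betw_partitions[OF h], symmetric])
  also have "\<dots> = cumulant g A" unfolding cumulant_def
  proof (intro sum.cong refl)
    fix \<rho> assume "\<rho> \<in> {\<rho>. partition_on A \<rho>}"
    then have p: "partition_on A \<rho>" by simp
    have "inj_on h A" using h by (simp add: bij_betw_def)
    then have i: "inj_on ((`) h) \<rho>" by (rule inj_on_image_partition[OF p])
    have "(\<Prod>V\<in>(`) h ` \<rho>. g' V) = (\<Prod>V\<in>\<rho>. g V)"
      using g partition_on_subset[OF p] by (simp add: prod.reindex[OF i])
    then show "cumulant_coeff (card ((`) h ` \<rho>)) * (\<Prod>V\<in>(`) h ` \<rho>. g' V) = cumulant_coeff (card \<rho>) * (\<Prod>V\<in>\<rho>. g V)"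
      by (simp add: card_image[OF i])
  qed
  finally show ?thesis by simp
qed

text \<open>The indices of the parts of \<open>\<mu>\<close> serve as the underlying set.\<close>

definition mset_cumulant :: "(nat multiset \<Rightarrow> complex) \<Rightarrow> nat multiset \<Rightarrow> complex" where
  "mset_cumulant f \<mu> = cumulant (\<lambda>V. f (image_mset (\<lambda>i. parts_list \<mu> ! i) (mset_set V))) {..<size \<mu>}"

lemma mset_parts_list [simp]: "mset (parts_list \<mu>) = \<mu>"
  by (simp add: parts_list_def)

text \<open>Cumulants are invariant under relabelling, and two index sets carrying the same multiset
  of values can be matched value by value. So any set labelled by the parts of \<mu> may replace the
  standard one.\<close>

lemma mset_cumulant_eq:
  assumes fin: "finite S" and \<mu>: "image_mset l (mset_set S) = \<mu>"
  shows "cumulant (\<lambda>V. f (image_mset l (mset_set V))) S = mset_cumulant f \<mu>"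
proof -
  let ?xs = "parts_list \<mu>"
  have len: "length ?xs = size \<mu>" by (metis mset_parts_list size_mset)
  have "image_mset ((!) ?xs) (mset_set {..<length ?xs}) = image_mset ((!) ?xs) (mset [0..<length ?xs])"
    by (simp add: lessThan_atLeast0 mset_upt)
  also have "\<dots> = mset (map ((!) ?xs) [0..<length ?xs])" by (simp only: mset_map)
  also have "\<dots> = \<mu>" by (simp only: map_nth mset_parts_list)
  finally have e: "image_mset l (mset_set S) = image_mset ((!) ?xs) (mset_set {..<size \<mu>})"
    using \<mu> len by simp
  obtain h where h: "bij_betw h S {..<size \<mu>}" "\<And>x. x \<in> S \<Longrightarrow> ?xs ! h x = l x"
    using image_mset_eq_imp_bij[OF fin finite_lessThan e] by blast
  show ?thesis unfolding mset_cumulant_def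
  proof (rule cumulant_bij[OF h(1)])
    fix V assume V: "V \<subseteq> S"
    have "inj_on h V" using h(1) V by (meson bij_betw_def inj_on_subset)
    then have "image_mset ((!) ?xs) (mset_set (h ` V)) = image_mset (\<lambda>x. ?xs ! h x) (mset_set V)"
      by (simp add: image_mset_mset_set[symmetric] multiset.map_comp o_def)
    also have "\<dots> = image_mset l (mset_set V)"
      using V h(2) finite_subset[OF V fin] by (intro image_mset_cong) auto
    finally show "f (image_mset l (mset_set V)) = f (image_mset ((!) ?xs) (mset_set (h ` V)))" by simp
  qed
qed

text \<open>Extension by zero to the sets that are not invariant under \<open>\<tau>\<close>; it turns sums over partitions
  coarser than \<open>\<Pi>(\<tau>)\<close> into sums over all partitions.\<close>

definition invariant_extension :: "(nat multiset \<Rightarrow> complex) \<Rightarrow> ('a \<Rightarrow> 'a) \<Rightarrow> 'a set \<Rightarrow> complex" where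
  "invariant_extension f \<tau> K = (if \<tau> ` K = K then f (cycle_type K \<tau>) else 0)"

lemma invariant_Union: "partition_on K \<rho> \<Longrightarrow> \<forall>V\<in>\<rho>. \<tau> ` V = V \<Longrightarrow> \<tau> ` K = K"
  by (auto simp: partition_on_def image_Union)

lemma sum_prod_invariant_extension:
  assumes fin: "finite H" and \<tau>: "\<tau> permutes H"
  shows "(\<Sum>\<rho> | partition_on H \<rho> \<and> Q \<rho>. w \<rho> * (\<Prod>V\<in>\<rho>. invariant_extension f \<tau> V))
    = (\<Sum>\<rho> | refines H (cycles_on H \<tau>) \<rho> \<and> Q \<rho>. w \<rho> * (\<Prod>V\<in>\<rho>. f (cycle_type V \<tau>)))"
proof (rule sum.mono_neutral_cong_right)
  show "finite {\<rho>. partition_on H \<rho> \<and> Q \<rho>}"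
    by (rule finite_subset[OF _ finitely_many_partition_on[OF fin]]) auto
  show "{\<rho>. refines H (cycles_on H \<tau>) \<rho> \<and> Q \<rho>} \<subseteq> {\<rho>. partition_on H \<rho> \<and> Q \<rho>}"
    by (auto simp: refines_def)
  show "\<forall>\<rho>\<in>{\<rho>. partition_on H \<rho> \<and> Q \<rho>} - {\<rho>. refines H (cycles_on H \<tau>) \<rho> \<and> Q \<rho>}.
      w \<rho> * (\<Prod>V\<in>\<rho>. invariant_extension f \<tau> V) = 0"
  proof
    fix \<rho> assume a: "\<rho> \<in> {\<rho>. partition_on H \<rho> \<and> Q \<rho>} - {\<rho>. refines H (cycles_on H \<tau>) \<rho> \<and> Q \<rho>}"
    then have p: "partition_on H \<rho>" by simp
    have "\<exists>V\<in>\<rho>. \<tau> ` V \<noteq> V" using a by (auto simp: refines_cycles_iff[OF fin \<tau>])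
    then have "(\<Prod>V\<in>\<rho>. invariant_extension f \<tau> V) = 0"
      using finite_elements[OF fin p] by (auto simp: invariant_extension_def)
    then show "w \<rho> * (\<Prod>V\<in>\<rho>. invariant_extension f \<tau> V) = 0" by simp
  qed
  fix \<rho> assume "\<rho> \<in> {\<rho>. refines H (cycles_on H \<tau>) \<rho> \<and> Q \<rho>}"
  then have "\<forall>V\<in>\<rho>. \<tau> ` V = V" by (simp add: refines_cycles_iff[OF fin \<tau>])
  then show "w \<rho> * (\<Prod>V\<in>\<rho>. invariant_extension f \<tau> V) = w \<rho> * (\<Prod>V\<in>\<rho>. f (cycle_type V \<tau>))"
    by (simp add: invariant_extension_def)
qed

lemma cycles_on_Union:
  assumes "finite H" "\<tau> permutes H" "V \<subseteq> cycles_on H \<tau>"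
  shows "cycles_on (\<Union>V) \<tau> = V"
proof -
  have o: "orbit \<tau> x = c" if "c \<in> V" "x \<in> c" for c x
  proof -
    have "c \<in> cycles_on H \<tau>" using that assms(3) by blast
    then show ?thesis using that orbit_eq_of_mem[OF assms(1,2)] by (auto simp: cycles_on_def)
  qed
  have ne: "c \<noteq> {}" if "c \<in> V" for c
    using that assms(3) partition_on_nonempty[OF partition_on_cycles[OF assms(1,2)]] by blast
  show ?thesis
  proof
    show "cycles_on (\<Union>V) \<tau> \<subseteq> V" using o by (auto simp: cycles_on_def)
    show "V \<subseteq> cycles_on (\<Union>V) \<tau>"
    proof
      fix c assume c: "c \<in> V"
      then obtain x where "x \<in> c" using ne by blast
      then show "c \<in> cycles_on (\<Union>V) \<tau>" using o c by (auto simp: cycles_on_def image_iff)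
    qed
  qed
qed

text \<open>The coarsenings of the cycle partition are the partitions of the set of cycles, and
  labelling each cycle by its length turns this set into an index set for the cycle type.\<close>

lemma cumulant_coarsenings:
  assumes fin: "finite H" and \<tau>: "\<tau> permutes H"
  shows "(\<Sum>\<rho> | refines H (cycles_on H \<tau>) \<rho>. cumulant_coeff (card \<rho>) * (\<Prod>V\<in>\<rho>. f (cycle_type V \<tau>)))
    = mset_cumulant f (cycle_type H \<tau>)"
proof -
  let ?\<beta> = "cycles_on H \<tau>"
  have p: "partition_on H ?\<beta>" by (rule partition_on_cycles[OF fin \<tau>])
  have "(\<Sum>\<rho> | refines H ?\<beta> \<rho>. cumulant_coeff (card \<rho>) * (\<Prod>V\<in>\<rho>. f (cycle_type V \<tau>)))
    = (\<Sum>\<rho> | partition_on ?\<beta> \<rho>. cumulant_coeff (card (Union ` \<rho>)) * (\<Prod>V\<in>Union ` \<rho>. f (cycle_type V \<tau>)))"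
    by (rule sum_coarsenings[OF p])
  also have "\<dots> = cumulant (\<lambda>V. f (image_mset card (mset_set V))) ?\<beta>"
    unfolding cumulant_def
  proof (intro sum.cong refl)
    fix \<rho> assume "\<rho> \<in> {\<rho>. partition_on ?\<beta> \<rho>}"
    then have r: "partition_on ?\<beta> \<rho>" by simp
    note i = inj_on_Union_partition[OF p r]
    have "cycle_type (\<Union>V) \<tau> = image_mset card (mset_set V)" if "V \<in> \<rho>" for V
      using cycles_on_Union[OF fin \<tau> partition_on_subset[OF r that]] by (simp add: cycle_type_def)
    then show "cumulant_coeff (card (Union ` \<rho>)) * (\<Prod>V\<in>Union ` \<rho>. f (cycle_type V \<tau>)) =
        cumulant_coeff (card \<rho>) * (\<Prod>V\<in>\<rho>. f (image_mset card (mset_set V)))"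
      by (simp add: card_image[OF i] prod.reindex[OF i])
  qed
  also have "\<dots> = mset_cumulant f (cycle_type H \<tau>)"
    by (rule mset_cumulant_eq[OF finite_cycles_on[OF fin]]) (simp add: cycle_type_def)
  finally show ?thesis .
qed

text \<open>Taking cumulants commutes with extension by zero. If \<open>K\<close> is invariant,
  \<tau> may be replaced by its restriction and \<open>cumulant_coarsenings\<close> applies; if not,
  every partition of \<open>K\<close> has a block that is not invariant and all terms
  vanish.\<close>

lemma cumulant_invariant_extension:
  assumes fin: "finite H" and \<tau>: "\<tau> permutes H" and K: "K \<subseteq> H" "K \<noteq> {}"
  shows "cumulant (invariant_extension f \<tau>) K = invariant_extension (mset_cumulant f) \<tau> K"
proof (cases "\<tau> ` K = K")
  case True
  let ?t = "perm_restrict \<tau> K"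
  have finK: "finite K" using K fin finite_subset by blast
  have t: "?t permutes K" by (rule perm_restrict_permutes[OF finK \<tau> True])
  have im: "?t ` V = \<tau> ` V" if "V \<subseteq> K" for V
    using that by (intro image_cong refl) (auto simp: perm_restrict_simps)
  have ct: "cycle_type V ?t = cycle_type V \<tau>" if "V \<subseteq> K" "\<tau> ` V = V" for V
    using that by (intro cycle_type_cong cycles_on_cong) (auto simp: im perm_restrict_simps)
  have e: "invariant_extension f \<tau> V = invariant_extension f ?t V" if "V \<subseteq> K" for V
    using that by (simp add: invariant_extension_def im ct)
  have "cumulant (invariant_extension f \<tau>) K = (\<Sum>\<rho> | partition_on K \<rho> \<and> True. cumulant_coeff (card \<rho>) * (\<Prod>V\<in>\<rho>. invariant_extension f ?t V))"
  proof -
    have "(\<Prod>V\<in>\<rho>. invariant_extension f \<tau> V) = (\<Prod>V\<in>\<rho>. invariant_extension f ?t V)" if "partition_on K \<rho>" for \<rho>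
      using partition_on_subset[OF that] by (intro prod.cong refl e)
    then show ?thesis unfolding cumulant_def by simp
  qed
  also have "\<dots> = (\<Sum>\<rho> | refines K (cycles_on K ?t) \<rho> \<and> True. cumulant_coeff (card \<rho>) * (\<Prod>V\<in>\<rho>. f (cycle_type V ?t)))"
    by (rule sum_prod_invariant_extension[OF finK t])
  also have "\<dots> = mset_cumulant f (cycle_type K ?t)" using cumulant_coarsenings[OF finK t] by simp
  also have "\<dots> = invariant_extension (mset_cumulant f) \<tau> K" using True by (simp add: invariant_extension_def ct)
  finally show ?thesis .
next
  case False
  have finK: "finite K" using K fin finite_subset by blast
  have "(\<Prod>V\<in>\<rho>. invariant_extension f \<tau> V) = 0" if p: "partition_on K \<rho>" for \<rho>
  proof -
    have "\<exists>V\<in>\<rho>. \<tau> ` V \<noteq> V" by (rule ccontr) (use invariant_Union[OF p, of \<tau>] False in simp)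
    then show ?thesis using finite_elements[OF finK p] by (auto simp: invariant_extension_def)
  qed
  then show ?thesis using False by (simp add: cumulant_def invariant_extension_def)
qed

text \<open>A form of the moment-cumulant formula that holds whether or not \<open>G\<close> is a
  union of cycles. It can therefore be used inside sums over permutations and partitions not yet
  known to be compatible.\<close>

lemma moment_invariant_extension:
  assumes fin: "finite H" and \<tau>: "\<tau> permutes H" and G: "G \<noteq> {}" "G \<subseteq> H"
  shows "invariant_extension f \<tau> G = (\<Sum>\<rho> | partition_on G \<rho>. \<Prod>V\<in>\<rho>. invariant_extension (mset_cumulant f) \<tau> V)"
proof -
  have finG: "finite G" using G fin finite_subset by blast
  have "invariant_extension f \<tau> G = (\<Sum>\<rho> | partition_on G \<rho>. \<Prod>V\<in>\<rho>. cumulant (invariant_extension f \<tau>) V)"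
    by (rule moment_cumulant[OF finG G(1)])
  also have "\<dots> = (\<Sum>\<rho> | partition_on G \<rho>. \<Prod>V\<in>\<rho>. invariant_extension (mset_cumulant f) \<tau> V)"
  proof (intro sum.cong prod.cong refl)
    fix \<rho> V assume "\<rho> \<in> {\<rho>. partition_on G \<rho>}" "V \<in> \<rho>"
    then have "V \<subseteq> H" "V \<noteq> {}" using partition_on_subset[of G \<rho> V] partition_on_nonempty[of G \<rho> V] G by auto
    then show "cumulant (invariant_extension f \<tau>) V = invariant_extension (mset_cumulant f) \<tau> V" by (rule cumulant_invariant_extension[OF fin \<tau>])
  qed
  finally show ?thesis .
qed

section \<open>Trace moments and their Weingarten duals\<close>

definition trace_moment :: "'w measure \<Rightarrow> ('w \<Rightarrow> complex Matrix.mat) \<Rightarrow> nat multiset \<Rightarrow> complex" where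
  "trace_moment M X \<mu> = (LINT \<omega>|M. (\<Prod>a\<in>#\<mu>. tr (X \<omega> ^\<^sub>m a)))"

lemma joint_cumulant_eq_mset_cumulant:
  assumes "finite G"
  shows "joint_cumulant M (cycles_on G \<tau>) (\<lambda>V \<omega>. tr (X \<omega> ^\<^sub>m card V)) = mset_cumulant (trace_moment M X) (cycle_type G \<tau>)"
proof -
  have "joint_cumulant M (cycles_on G \<tau>) (\<lambda>V \<omega>. tr (X \<omega> ^\<^sub>m card V))
      = cumulant (\<lambda>V. trace_moment M X (image_mset card (mset_set V))) (cycles_on G \<tau>)"
    by (simp add: joint_cumulant_def cumulant_def cumulant_coeff_def trace_moment_def prod_unfold_prod_mset multiset.map_comp o_def)
  also have "\<dots> = mset_cumulant (trace_moment M X) (cycle_type G \<tau>)"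
    by (rule mset_cumulant_eq[OF finite_cycles_on[OF assms]]) (simp add: cycle_type_def)
  finally show ?thesis .
qed

lemma phi_eq:
  assumes "finite H" "partition_on H \<pi>"
  shows "phi M X \<pi> \<tau> = (\<Prod>G\<in>\<pi>. mset_cumulant (trace_moment M X) (cycle_type G \<tau>))"
  unfolding phi_def
proof (intro prod.cong refl joint_cumulant_eq_mset_cumulant)
  fix G assume "G \<in> \<pi>"
  then show "finite G" using partition_on_subset[OF assms(2)] assms(1) finite_subset by blast
qed

text \<open>The convolution of trace moments with the Weingarten function, at the stage before
  cumulants are taken. \<open>kappa_one_part\<close> identifies its classical cumulants with the
  finite-N free cumulants.\<close>

definition dual_moment :: "'w measure \<Rightarrow> ('w \<Rightarrow> complex Matrix.mat) \<Rightarrow> nat \<Rightarrow> nat set \<Rightarrow> (nat \<Rightarrow> nat) \<Rightarrow> complex" where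
  "dual_moment M X N G \<sigma> = (\<Sum>\<tau> | \<tau> permutes G. trace_moment M X (cycle_type G \<tau>) * weingarten N G (\<sigma> \<circ> inv_into UNIV \<tau>))"

text \<open>After inserting the definition and translating \<sigma> on the right by \<alpha>, the
  inner sum is the defining relation of the Weingarten function and selects \<alpha> =
  \<tau>.\<close>

lemma dual_moment_inversion:
  assumes fin: "finite G" and N: "fact (card G) \<le> N" and \<tau>: "\<tau> permutes G"
  shows "(\<Sum>\<sigma> | \<sigma> permutes G. of_nat N ^ card (cycles_on G (\<sigma> \<circ> inv_into UNIV \<tau>)) * dual_moment M X N G \<sigma>)
    = trace_moment M X (cycle_type G \<tau>)"
proof -
  let ?P = "{\<sigma>. \<sigma> permutes G}" and ?W = "weingarten N G"
  let ?K = "\<lambda>\<sigma>. of_nat N ^ card (cycles_on G \<sigma>) :: complex"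
  have finP: "finite ?P" using finite_permutations[OF fin] .
  have "(\<Sum>\<sigma>\<in>?P. ?K (\<sigma> \<circ> inv_into UNIV \<tau>) * dual_moment M X N G \<sigma>)
     = (\<Sum>\<sigma>\<in>?P. \<Sum>\<alpha>\<in>?P. trace_moment M X (cycle_type G \<alpha>) * (?K (\<sigma> \<circ> inv_into UNIV \<tau>) * ?W (\<sigma> \<circ> inv_into UNIV \<alpha>)))"
    by (simp add: dual_moment_def sum_distrib_left mult_ac)
  also have "\<dots> = (\<Sum>\<alpha>\<in>?P. \<Sum>\<sigma>\<in>?P. trace_moment M X (cycle_type G \<alpha>) * (?K (\<sigma> \<circ> inv_into UNIV \<tau>) * ?W (\<sigma> \<circ> inv_into UNIV \<alpha>)))"
    by (rule sum.swap)
  also have "\<dots> = (\<Sum>\<alpha>\<in>?P. trace_moment M X (cycle_type G \<alpha>) * (if \<alpha> = \<tau> then 1 else 0))"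
  proof (intro sum.cong refl)
    fix \<alpha> assume "\<alpha> \<in> ?P"
    then have \<alpha>: "\<alpha> permutes G" by simp
    have b: "bij \<alpha>" "bij \<tau>" using \<alpha> \<tau> permutes_bij by blast+
    have \<nu>: "\<tau> \<circ> inv_into UNIV \<alpha> permutes G" using \<alpha> \<tau> permutes_compose permutes_inv by blast
    have i: "inv_into UNIV (\<tau> \<circ> inv_into UNIV \<alpha>) = \<alpha> \<circ> inv_into UNIV \<tau>"
      using b by (simp add: o_inv_distrib bij_imp_bij_inv inv_inv_eq)
    have "(\<Sum>\<sigma>\<in>?P. ?K (\<sigma> \<circ> inv_into UNIV \<tau>) * ?W (\<sigma> \<circ> inv_into UNIV \<alpha>))
        = (\<Sum>\<sigma>\<in>?P. ?K (\<sigma> \<circ> \<alpha> \<circ> inv_into UNIV \<tau>) * ?W (\<sigma> \<circ> \<alpha> \<circ> inv_into UNIV \<alpha>))"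
      by (rule sum_permutations_compose_right[OF \<alpha>])
    also have "\<dots> = (\<Sum>\<sigma>\<in>?P. ?K (\<sigma> \<circ> inv_into UNIV (\<tau> \<circ> inv_into UNIV \<alpha>)) * ?W \<sigma>)"
      using permutes_inv_o(1)[OF \<alpha>] by (simp add: i comp_assoc)
    also have "\<dots> = (if \<tau> \<circ> inv_into UNIV \<alpha> = id then 1 else 0)"
      by (rule weingarten_inverse[OF fin N \<nu>])
    also have "(\<tau> \<circ> inv_into UNIV \<alpha> = id) = (\<alpha> = \<tau>)"
    proof
      assume "\<tau> \<circ> inv_into UNIV \<alpha> = id"
      then have "\<tau> \<circ> inv_into UNIV \<alpha> \<circ> \<alpha> = \<alpha>" by simp
      then show "\<alpha> = \<tau>" using permutes_inv_o(2)[OF \<alpha>] by (simp add: comp_assoc)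
    next
      assume "\<alpha> = \<tau>" then show "\<tau> \<circ> inv_into UNIV \<alpha> = id" using permutes_inv_o(1)[OF \<tau>] by simp
    qed
    finally show "(\<Sum>\<sigma>\<in>?P. trace_moment M X (cycle_type G \<alpha>) * (?K (\<sigma> \<circ> inv_into UNIV \<tau>) * ?W (\<sigma> \<circ> inv_into UNIV \<alpha>)))
        = trace_moment M X (cycle_type G \<alpha>) * (if \<alpha> = \<tau> then 1 else 0)"
      by (simp only: sum_distrib_left[symmetric])
  qed
  also have "\<dots> = trace_moment M X (cycle_type G \<tau>)"
    using finP \<tau> by (simp add: sum.delta if_distrib[where f="\<lambda>x. _ * x"] cong: if_cong)
  finally show ?thesis .
qed

lemma map_permutation_bij:
  assumes f: "bij_betw f G G'"
  shows "bij_betw (map_permutation G f) {\<sigma>. \<sigma> permutes G} {\<sigma>. \<sigma> permutes G'}"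
proof (rule bij_betwI[where g = "map_permutation G' (inv_into G f)"])
  have k: "bij_betw (inv_into G f) G' G" by (rule bij_betw_inv_into[OF f])
  show "map_permutation G f \<in> {\<sigma>. \<sigma> permutes G} \<rightarrow> {\<sigma>. \<sigma> permutes G'}"
    using map_permutation_permutes[OF f] by auto
  show "map_permutation G' (inv_into G f) \<in> {\<sigma>. \<sigma> permutes G'} \<rightarrow> {\<sigma>. \<sigma> permutes G}"
    using map_permutation_permutes[OF k] by auto
  show "map_permutation G' (inv_into G f) (map_permutation G f \<sigma>) = \<sigma>" if "\<sigma> \<in> {\<sigma>. \<sigma> permutes G}" for \<sigma>
    using that map_permutation_compose_inv[OF f, of \<sigma> "inv_into G f"] f by (simp add: bij_betw_def)
  show "map_permutation G f (map_permutation G' (inv_into G f) \<sigma>) = \<sigma>" if "\<sigma> \<in> {\<sigma>. \<sigma> permutes G'}" for \<sigma>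
    using that map_permutation_compose_inv[OF k, of \<sigma> f] f by (simp add: bij_betw_def f_inv_into_f)
qed

lemma map_permutation_inv:
  assumes f: "bij_betw f G G'" and \<nu>: "\<nu> permutes G"
  shows "map_permutation G f (inv_into UNIV \<nu>) = inv_into UNIV (map_permutation G f \<nu>)"
proof -
  have i: "inj_on f G" using f by (simp add: bij_betw_def)
  have n: "inv_into UNIV \<nu> permutes G" by (rule permutes_inv[OF \<nu>])
  have "map_permutation G f \<nu> \<circ> map_permutation G f (inv_into UNIV \<nu>) = id"
    using map_permutation_compose'[OF i n, of \<nu>] permutes_inv_o(1)[OF \<nu>] map_permutation_id'[OF i] by simp
  moreover have "map_permutation G f (inv_into UNIV \<nu>) \<circ> map_permutation G f \<nu> = id"
    using map_permutation_compose'[OF i \<nu>, of "inv_into UNIV \<nu>"] permutes_inv_o(2)[OF \<nu>] map_permutation_id'[OF i] by simp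
  ultimately show ?thesis using inv_unique_comp by metis
qed

lemma cycle_type_map_permutation:
  assumes "finite G" "bij_betw f G G'" "\<sigma> permutes G"
  shows "cycle_type G' (map_permutation G f \<sigma>) = cycle_type G \<sigma>"
  using cycle_type_transport[OF assms(1,3), of "map_permutation G f \<sigma>" f] assms(2)
    map_permutation_apply[of f G] by (simp add: bij_betw_def)

text \<open>Conjugation by \<open>f\<close> transports the dual moments of \<open>G'\<close> to a
  solution of the linear system that determines those of \<open>G\<close>: the right-hand sides
  agree since trace moments see only cycle types. Uniqueness of the solution for N >= n! gives
  equality.\<close>

lemma dual_moment_class_function:
  assumes G: "finite G" "\<sigma> permutes G" and G': "finite G'" "\<sigma>' permutes G'"
    and N: "fact (card G) \<le> N" and ct: "cycle_type G \<sigma> = cycle_type G' \<sigma>'"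
  shows "dual_moment M X N G \<sigma> = dual_moment M X N G' \<sigma>'"
proof -
  obtain f where f: "bij_betw f G G'" "\<And>x. x \<in> G \<Longrightarrow> \<sigma>' (f x) = f (\<sigma> x)"
    using cycle_type_eq_imp_conjugate[OF G G' ct] by blast
  let ?m = "map_permutation G f"
  have i: "inj_on f G" using f(1) by (simp add: bij_betw_def)
  have fG: "G' = f ` G" using f(1) by (simp add: bij_betw_def)
  have N': "fact (card G') \<le> N" using N bij_betw_same_card[OF f(1)] by simp
  have mp: "?m \<mu> permutes G'" if "\<mu> permutes G" for \<mu> by (rule map_permutation_permutes[OF f(1) that])
  have "?m \<sigma> = \<sigma>'"
  proof
    fix y show "?m \<sigma> y = \<sigma>' y"
    proof (cases "y \<in> G'")
      case True
      then obtain x where "x \<in> G" "y = f x" using fG by blast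
      then show ?thesis using f(2) map_permutation_apply[OF i] by simp
    next
      case False
      then show ?thesis using permutes_not_in[OF mp[OF G(2)]] permutes_not_in[OF G'(2)] by simp
    qed
  qed
  moreover have "dual_moment M X N G \<sigma> = dual_moment M X N G' (?m \<sigma>)"
  proof (rule cycle_matrix_unique[OF G(1) N _ G(2)])
    fix \<nu> assume \<nu>: "\<nu> permutes G"
    have c: "card (cycles_on G (\<mu> \<circ> inv_into UNIV \<nu>)) = card (cycles_on G' (?m \<mu> \<circ> inv_into UNIV (?m \<nu>)))"
      if \<mu>: "\<mu> permutes G" for \<mu>
    proof -
      have "\<mu> \<circ> inv_into UNIV \<nu> permutes G" using \<mu> \<nu> permutes_compose permutes_inv by blast
      then have "cycle_type G' (?m (\<mu> \<circ> inv_into UNIV \<nu>)) = cycle_type G (\<mu> \<circ> inv_into UNIV \<nu>)"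
        by (rule cycle_type_map_permutation[OF G(1) f(1)])
      then have "card (cycles_on G (\<mu> \<circ> inv_into UNIV \<nu>)) = card (cycles_on G' (?m (\<mu> \<circ> inv_into UNIV \<nu>)))"
        by (metis size_cycle_type)
      then show ?thesis
        by (simp add: map_permutation_compose'[OF i permutes_inv[OF \<nu>]] map_permutation_inv[OF f(1) \<nu>])
    qed
    have "(\<Sum>\<mu> | \<mu> permutes G. of_nat N ^ card (cycles_on G (\<mu> \<circ> inv_into UNIV \<nu>)) * dual_moment M X N G' (?m \<mu>))
      = (\<Sum>\<mu> | \<mu> permutes G. of_nat N ^ card (cycles_on G' (?m \<mu> \<circ> inv_into UNIV (?m \<nu>))) * dual_moment M X N G' (?m \<mu>))"
      using c by (intro sum.cong refl) simp
    also have "\<dots> = (\<Sum>\<mu> | \<mu> permutes G'. of_nat N ^ card (cycles_on G' (\<mu> \<circ> inv_into UNIV (?m \<nu>))) * dual_moment M X N G' \<mu>)"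
      by (rule sum.reindex_bij_betw[OF map_permutation_bij[OF f(1)]])
    also have "\<dots> = trace_moment M X (cycle_type G' (?m \<nu>))"
      by (rule dual_moment_inversion[OF G'(1) N' mp[OF \<nu>]])
    also have "\<dots> = (\<Sum>\<mu> | \<mu> permutes G. of_nat N ^ card (cycles_on G (\<mu> \<circ> inv_into UNIV \<nu>)) * dual_moment M X N G \<mu>)"
      by (simp only: dual_moment_inversion[OF G(1) N \<nu>] cycle_type_map_permutation[OF G(1) f(1) \<nu>])
    finally show "(\<Sum>\<mu> | \<mu> permutes G. of_nat N ^ card (cycles_on G (\<mu> \<circ> inv_into UNIV \<nu>)) * dual_moment M X N G \<mu>) =
      (\<Sum>\<mu> | \<mu> permutes G. of_nat N ^ card (cycles_on G (\<mu> \<circ> inv_into UNIV \<nu>)) * dual_moment M X N G' (?m \<mu>))" by simp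
  qed
  ultimately show ?thesis by simp
qed

text \<open>A fixed representative of each cycle type, on an initial segment of the positive
  integers; \<open>dual_moment_eq_mset\<close> removes the dependence on this choice once N >=
  n!.\<close>

definition mset_dual_moment :: "'w measure \<Rightarrow> ('w \<Rightarrow> complex Matrix.mat) \<Rightarrow> nat \<Rightarrow> nat multiset \<Rightarrow> complex" where
  "mset_dual_moment M X N \<mu> = dual_moment M X N {1..sum_mset \<mu>} (gamma (parts_list \<mu>))"

lemma gamma_parts_list:
  assumes "\<forall>a\<in>#\<mu>. a \<ge> 1"
  shows "gamma (parts_list \<mu>) permutes {1..sum_mset \<mu>}" "cycle_type {1..sum_mset \<mu>} (gamma (parts_list \<mu>)) = \<mu>"
proof -
  have s: "sum_list (parts_list \<mu>) = sum_mset \<mu>" by (metis mset_parts_list sum_mset_sum_list)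
  have "set (parts_list \<mu>) = set_mset \<mu>" by (metis mset_parts_list set_mset_mset)
  then have a: "\<forall>l\<in>set (parts_list \<mu>). l \<ge> 1" using assms by simp
  show "gamma (parts_list \<mu>) permutes {1..sum_mset \<mu>}" "cycle_type {1..sum_mset \<mu>} (gamma (parts_list \<mu>)) = \<mu>"
    using gamma_permutes[OF a] cycle_type_gamma[OF a] by (simp_all add: s)
qed

lemma dual_moment_eq_mset:
  assumes "finite G" "\<sigma> permutes G" "fact (card G) \<le> N"
  shows "dual_moment M X N G \<sigma> = mset_dual_moment M X N (cycle_type G \<sigma>)"
proof -
  have "\<forall>a\<in>#cycle_type G \<sigma>. a \<ge> 1"
    using cycle_type_pos[OF assms(1) partition_on_cycles[OF assms(1,2)]] by blast
  note g = gamma_parts_list[OF this]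
  show ?thesis unfolding mset_dual_moment_def
    by (rule dual_moment_class_function[OF assms(1,2) finite_atLeastAtMost g(1) assms(3) g(2)[symmetric]])
qed

lemma perm_restrict_comp_inv:
  assumes "finite G" "\<sigma> permutes H" "\<tau> permutes H" "\<sigma> ` G = G" "\<tau> ` G = G"
  shows "perm_restrict (\<sigma> \<circ> inv_into UNIV \<tau>) G = perm_restrict \<sigma> G \<circ> inv_into UNIV (perm_restrict \<tau> G)"
proof
  fix x
  have t: "perm_restrict \<tau> G permutes G" by (rule perm_restrict_permutes[OF assms(1,3,5)])
  show "perm_restrict (\<sigma> \<circ> inv_into UNIV \<tau>) G x = (perm_restrict \<sigma> G \<circ> inv_into UNIV (perm_restrict \<tau> G)) x"
  proof (cases "x \<in> G")
    case True
    then obtain y where y: "y \<in> G" "x = \<tau> y" using assms(5) by blast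
    have 1: "inv_into UNIV \<tau> x = y" using y permutes_inverses(2)[OF assms(3)] by simp
    have "inv_into UNIV (perm_restrict \<tau> G) x = y"
      using y permutes_inverses(2)[OF t, of y] by (simp add: perm_restrict_simps)
    then show ?thesis using True 1 y by (simp add: perm_restrict_simps)
  next
    case False
    then show ?thesis using permutes_not_in[OF permutes_inv[OF t] False] by (simp add: perm_restrict_simps)
  qed
qed

lemma card_cycles_on_sum:
  assumes "finite H" "\<sigma> permutes H" "partition_on H \<pi>" "\<forall>G\<in>\<pi>. \<sigma> ` G = G"
  shows "card (cycles_on H \<sigma>) = (\<Sum>G\<in>\<pi>. card (cycles_on G \<sigma>))"
proof -
  have U: "cycles_on H \<sigma> = (\<Union>G\<in>\<pi>. cycles_on G \<sigma>)"
    using assms(3) by (auto simp: cycles_on_def partition_on_def)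
  have finG: "finite G" if "G \<in> \<pi>" for G
    using that assms partition_on_subset finite_subset by metis
  have "cycles_on G \<sigma> \<inter> cycles_on G' \<sigma> = {}" if a: "G \<in> \<pi>" "G' \<in> \<pi>" "G \<noteq> G'" for G G'
  proof -
    have False if c: "c \<in> cycles_on G \<sigma>" "c \<in> cycles_on G' \<sigma>" for c
    proof -
      obtain x where x: "x \<in> G" "c = orbit \<sigma> x" using c by (auto simp: cycles_on_def)
      have "x \<in> c" using x self_in_orbit[OF assms(1,2)] by simp
      moreover have "c \<subseteq> G'" using c(2) orbit_subset_invariant[of \<sigma> G'] assms(4) a(2) by (auto simp: cycles_on_def)
      ultimately show False using partition_on_same_block[OF assms(3) a(1,2) x(1)] a(3) by blast
    qed
    then show ?thesis by blast
  qed
  then show ?thesis unfolding U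
    using finite_elements[OF assms(1,3)] finite_cycles_on[OF finG] by (intro card_UN_disjoint) auto
qed

text \<open>With the sum over \<pi> outermost, the sum over the partitions between the cycles of
  \<tau> and \<pi> recombines joint cumulants of traces into trace moments of the blocks of \<pi>.
  The sum over \<tau> then factors over these blocks into dual moments, and the Moebius values turn
  what remains into a classical cumulant.\<close>

lemma kappa_one_part:
  assumes n: "n \<ge> 1" and N: "fact n \<le> N" and \<sigma>: "\<sigma> permutes {1..n}"
  shows "kappa M X N n (one_part n) \<sigma> = mset_cumulant (mset_dual_moment M X N) (cycle_type {1..n} \<sigma>)"
proof -
  let ?A = "{1..n}" and ?\<Pi> = "cycles_on {1..n}" and ?W = "weingarten N"
  have fin: "finite ?A" and ne: "?A \<noteq> {}" using n by auto
  have top: "refines ?A \<pi> {?A} \<longleftrightarrow> partition_on ?A \<pi>" for \<pi>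
    using partition_on_space[OF ne] partition_on_subset[of ?A \<pi>] by (auto simp: refines_def)
  let ?T = "{\<tau>. \<tau> permutes ?A}" and ?S = "{\<pi>. refines ?A (?\<Pi> \<sigma>) \<pi>}"
  let ?R = "\<lambda>\<tau>. {\<pi>. refines ?A (?\<Pi> \<tau>) \<pi>}"
  let ?w = "\<lambda>\<tau> \<pi>. (\<Prod>G\<in>\<pi>. ?W G (perm_restrict (\<sigma> \<circ> inv_into UNIV \<tau>) G))"
  let ?F = "mset_cumulant (trace_moment M X)"
  have finT: "finite ?T" using finite_permutations[OF fin] .
  have finS: "finite ?S" by (rule finite_refines(2)[OF fin])
  have pc: "partition_on ?A (?\<Pi> \<tau>)" if "\<tau> permutes ?A" for \<tau> by (rule partition_on_cycles[OF fin that])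
  \<comment> \<open>Lying above a join means lying above both terms; this decouples \<pi>' from
    \<sigma>.\<close>
  have join: "refines ?A (join_part ?A (?\<Pi> \<sigma>) \<pi>') \<pi> \<longleftrightarrow> refines ?A (?\<Pi> \<sigma>) \<pi> \<and> refines ?A \<pi>' \<pi>"
    if p: "partition_on ?A \<pi>'" for \<pi> \<pi>'
    using refines_join_part[OF pc[OF \<sigma>] p] join_part_least refines_trans by blast
  have "kappa M X N n (one_part n) \<sigma> = (\<Sum>\<tau>\<in>?T. \<Sum>\<pi>'\<in>?R \<tau>. phi M X \<pi>' \<tau> *
      (\<Sum>\<pi> | refines ?A (?\<Pi> \<sigma>) \<pi> \<and> refines ?A \<pi>' \<pi>. cumulant_coeff (card \<pi>) * ?w \<tau> \<pi>))"
    unfolding kappa_def one_part_def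
  proof (intro sum.cong refl)
    fix \<tau> assume "\<tau> \<in> ?T"
    show "{\<pi>'. refines ?A (?\<Pi> \<tau>) \<pi>' \<and> refines ?A \<pi>' {?A}} = ?R \<tau>" using top by (auto simp: refines_def)
    fix \<pi>' assume "\<pi>' \<in> ?R \<tau>"
    then have p: "partition_on ?A \<pi>'" by (simp add: refines_def)
    have "(\<Sum>\<pi> | refines ?A (join_part ?A (?\<Pi> \<sigma>) \<pi>') \<pi> \<and> refines ?A \<pi> {?A}. of_int (moebius ?A \<pi> {?A}) * ?w \<tau> \<pi>)
       = (\<Sum>\<pi> | refines ?A (?\<Pi> \<sigma>) \<pi> \<and> refines ?A \<pi>' \<pi>. cumulant_coeff (card \<pi>) * ?w \<tau> \<pi>)"
    proof (rule sum.cong)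
      show "{\<pi>. refines ?A (join_part ?A (?\<Pi> \<sigma>) \<pi>') \<pi> \<and> refines ?A \<pi> {?A}} = {\<pi>. refines ?A (?\<Pi> \<sigma>) \<pi> \<and> refines ?A \<pi>' \<pi>}"
        using join[OF p] top by (auto simp: refines_def)
      fix \<pi> assume "\<pi> \<in> {\<pi>. refines ?A (?\<Pi> \<sigma>) \<pi> \<and> refines ?A \<pi>' \<pi>}"
      then have "partition_on ?A \<pi>" by (simp add: refines_def)
      from moebius_top[OF fin ne this]
      show "of_int (moebius ?A \<pi> {?A}) * ?w \<tau> \<pi> = cumulant_coeff (card \<pi>) * ?w \<tau> \<pi>" by (simp only:)
    qed
    then show "phi M X \<pi>' \<tau> * (\<Sum>\<pi> | refines ?A (join_part ?A (?\<Pi> \<sigma>) \<pi>') \<pi> \<and> refines ?A \<pi> {?A}. of_int (moebius ?A \<pi> {?A}) * ?w \<tau> \<pi>)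
      = phi M X \<pi>' \<tau> * (\<Sum>\<pi> | refines ?A (?\<Pi> \<sigma>) \<pi> \<and> refines ?A \<pi>' \<pi>. cumulant_coeff (card \<pi>) * ?w \<tau> \<pi>)" by (rule arg_cong)
  qed
  also have "\<dots> = (\<Sum>\<tau>\<in>?T. \<Sum>\<pi>'\<in>?R \<tau>. \<Sum>\<pi>\<in>?S. if refines ?A \<pi>' \<pi> then phi M X \<pi>' \<tau> * (cumulant_coeff (card \<pi>) * ?w \<tau> \<pi>) else 0)"
  proof (intro sum.cong refl)
    fix \<tau> \<pi>'
    have e: "{\<pi>\<in>?S. refines ?A \<pi>' \<pi>} = {\<pi>. refines ?A (?\<Pi> \<sigma>) \<pi> \<and> refines ?A \<pi>' \<pi>}" by auto
    show "phi M X \<pi>' \<tau> * (\<Sum>\<pi> | refines ?A (?\<Pi> \<sigma>) \<pi> \<and> refines ?A \<pi>' \<pi>. cumulant_coeff (card \<pi>) * ?w \<tau> \<pi>)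
      = (\<Sum>\<pi>\<in>?S. if refines ?A \<pi>' \<pi> then phi M X \<pi>' \<tau> * (cumulant_coeff (card \<pi>) * ?w \<tau> \<pi>) else 0)"
      by (simp only: e sum_distrib_left sum.inter_filter[OF finS, symmetric])
  qed
  also have "\<dots> = (\<Sum>\<tau>\<in>?T. \<Sum>\<pi>\<in>?S. \<Sum>\<pi>'\<in>?R \<tau>. if refines ?A \<pi>' \<pi> then phi M X \<pi>' \<tau> * (cumulant_coeff (card \<pi>) * ?w \<tau> \<pi>) else 0)"
    by (intro sum.cong refl sum.swap)
  also have "\<dots> = (\<Sum>\<pi>\<in>?S. \<Sum>\<tau>\<in>?T. \<Sum>\<pi>'\<in>?R \<tau>. if refines ?A \<pi>' \<pi> then phi M X \<pi>' \<tau> * (cumulant_coeff (card \<pi>) * ?w \<tau> \<pi>) else 0)"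
    by (rule sum.swap)
  also have "\<dots> = (\<Sum>\<pi>\<in>?S. cumulant_coeff (card \<pi>) * (\<Prod>G\<in>\<pi>. mset_dual_moment M X N (cycle_type G \<sigma>)))"
  proof (intro sum.cong refl)
    fix \<pi> assume "\<pi> \<in> ?S"
    then have p: "partition_on ?A \<pi>" and sp: "\<forall>G\<in>\<pi>. \<sigma> ` G = G"
      using refines_cycles_iff[OF fin \<sigma>] by auto
    have Gsub: "G \<subseteq> ?A" if "G \<in> \<pi>" for G using partition_on_subset[OF p that] .
    have finG: "finite G" if "G \<in> \<pi>" for G using finite_subset[OF Gsub[OF that] fin] .
    have NG: "fact (card G) \<le> N" if "G \<in> \<pi>" for G
    proof -
      have "card G \<le> n" using card_mono[OF fin Gsub[OF that]] by simp
      then show ?thesis using N fact_mono_nat le_trans by blast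
    qed
    \<comment> \<open>Extension by zero lets \<pi>' run over all refinements of \<pi>; the
      distributive law and the moment-cumulant formula in each block then collapse the sum.\<close>
    have inner: "(\<Sum>\<pi>'\<in>?R \<tau>. if refines ?A \<pi>' \<pi> then phi M X \<pi>' \<tau> * (cumulant_coeff (card \<pi>) * ?w \<tau> \<pi>) else 0)
      = cumulant_coeff (card \<pi>) * (\<Prod>G\<in>\<pi>. invariant_extension (trace_moment M X) \<tau> G) * ?w \<tau> \<pi>" if \<tau>: "\<tau> permutes ?A" for \<tau>
    proof -
      have finR: "finite (?R \<tau>)" by (rule finite_refines(2)[OF fin])
      have "(\<Sum>\<pi>'\<in>?R \<tau>. if refines ?A \<pi>' \<pi> then phi M X \<pi>' \<tau> * (cumulant_coeff (card \<pi>) * ?w \<tau> \<pi>) else 0)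
        = (\<Sum>\<pi>' | refines ?A (?\<Pi> \<tau>) \<pi>' \<and> refines ?A \<pi>' \<pi>. cumulant_coeff (card \<pi>) * ?w \<tau> \<pi> * (\<Prod>G\<in>\<pi>'. ?F (cycle_type G \<tau>)))"
        unfolding sum.inter_filter[OF finR, symmetric]
        by (rule sum.cong) (auto simp: phi_eq[OF fin] refines_def)
      also have "\<dots> = (\<Sum>\<pi>' | partition_on ?A \<pi>' \<and> refines ?A \<pi>' \<pi>. cumulant_coeff (card \<pi>) * ?w \<tau> \<pi> * (\<Prod>G\<in>\<pi>'. invariant_extension ?F \<tau> G))"
        by (rule sum_prod_invariant_extension[OF fin \<tau>, symmetric])
      also have "\<dots> = cumulant_coeff (card \<pi>) * ?w \<tau> \<pi> * (\<Sum>\<pi>' | refines ?A \<pi>' \<pi>. \<Prod>G\<in>\<pi>'. invariant_extension ?F \<tau> G)"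
        by (simp add: sum_distrib_left) (rule sum.cong, auto simp: refines_def)
      also have "(\<Sum>\<pi>' | refines ?A \<pi>' \<pi>. \<Prod>G\<in>\<pi>'. invariant_extension ?F \<tau> G) = (\<Prod>G\<in>\<pi>. \<Sum>\<rho> | partition_on G \<rho>. \<Prod>V\<in>\<rho>. invariant_extension ?F \<tau> V)"
        by (rule prod_sum_partitions[OF fin p, symmetric])
      also have "\<dots> = (\<Prod>G\<in>\<pi>. invariant_extension (trace_moment M X) \<tau> G)"
        using partition_on_nonempty[OF p] Gsub by (intro prod.cong refl moment_invariant_extension[OF fin \<tau>, symmetric])
      finally show ?thesis by (simp only: mult_ac)
    qed
    have "(\<Sum>\<tau>\<in>?T. \<Sum>\<pi>'\<in>?R \<tau>. if refines ?A \<pi>' \<pi> then phi M X \<pi>' \<tau> * (cumulant_coeff (card \<pi>) * ?w \<tau> \<pi>) else 0)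
      = (\<Sum>\<tau>\<in>?T. cumulant_coeff (card \<pi>) * (\<Prod>G\<in>\<pi>. invariant_extension (trace_moment M X) \<tau> G) * ?w \<tau> \<pi>)"
      using inner by (intro sum.cong refl) blast
    also have "\<dots> = (\<Sum>\<tau> | \<tau> permutes ?A \<and> (\<forall>G\<in>\<pi>. \<tau> ` G = G).
        cumulant_coeff (card \<pi>) * (\<Prod>G\<in>\<pi>. trace_moment M X (cycle_type G (perm_restrict \<tau> G)) * ?W G (perm_restrict \<sigma> G \<circ> inv_into UNIV (perm_restrict \<tau> G))))"
    \<comment> \<open>A permutation \<tau> that moves some block of \<pi> drops out, as the
      extension by zero vanishes there; the others are families of permutations of the
      blocks.\<close>
    proof (rule sum.mono_neutral_cong_right[OF finT])
      show "\<forall>\<tau>\<in>?T - {\<tau>. \<tau> permutes ?A \<and> (\<forall>G\<in>\<pi>. \<tau> ` G = G)}. cumulant_coeff (card \<pi>) * (\<Prod>G\<in>\<pi>. invariant_extension (trace_moment M X) \<tau> G) * ?w \<tau> \<pi> = 0"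
        using finite_elements[OF fin p] by (auto simp: invariant_extension_def)
      fix \<tau> assume "\<tau> \<in> {\<tau>. \<tau> permutes ?A \<and> (\<forall>G\<in>\<pi>. \<tau> ` G = G)}"
      then have \<tau>: "\<tau> permutes ?A" and tp: "\<forall>G\<in>\<pi>. \<tau> ` G = G" by auto
      have "(\<Prod>G\<in>\<pi>. invariant_extension (trace_moment M X) \<tau> G) * ?w \<tau> \<pi> =
          (\<Prod>G\<in>\<pi>. invariant_extension (trace_moment M X) \<tau> G * ?W G (perm_restrict (\<sigma> \<circ> inv_into UNIV \<tau>) G))"
        by (simp add: prod.distrib)
      also have "\<dots> = (\<Prod>G\<in>\<pi>. trace_moment M X (cycle_type G (perm_restrict \<tau> G)) * ?W G (perm_restrict \<sigma> G \<circ> inv_into UNIV (perm_restrict \<tau> G)))"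
      proof (intro prod.cong refl)
        fix G assume G: "G \<in> \<pi>"
        have "cycle_type G (perm_restrict \<tau> G) = cycle_type G \<tau>"
          using tp G by (intro cycle_type_cong cycles_on_perm_restrict) blast
        moreover have "perm_restrict (\<sigma> \<circ> inv_into UNIV \<tau>) G = perm_restrict \<sigma> G \<circ> inv_into UNIV (perm_restrict \<tau> G)"
          using sp tp G by (intro perm_restrict_comp_inv[OF finG[OF G] \<sigma> \<tau>]) auto
        ultimately show "invariant_extension (trace_moment M X) \<tau> G * ?W G (perm_restrict (\<sigma> \<circ> inv_into UNIV \<tau>) G) =
          trace_moment M X (cycle_type G (perm_restrict \<tau> G)) * ?W G (perm_restrict \<sigma> G \<circ> inv_into UNIV (perm_restrict \<tau> G))"
          using tp G by (simp add: invariant_extension_def)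
      qed
      finally show "cumulant_coeff (card \<pi>) * (\<Prod>G\<in>\<pi>. invariant_extension (trace_moment M X) \<tau> G) * ?w \<tau> \<pi> = cumulant_coeff (card \<pi>) *
          (\<Prod>G\<in>\<pi>. trace_moment M X (cycle_type G (perm_restrict \<tau> G)) * ?W G (perm_restrict \<sigma> G \<circ> inv_into UNIV (perm_restrict \<tau> G)))"
        by (simp only: mult.assoc)
    qed auto
    also have "\<dots> = cumulant_coeff (card \<pi>) * (\<Prod>G\<in>\<pi>. \<Sum>\<tau> | \<tau> permutes G. trace_moment M X (cycle_type G \<tau>) * ?W G (perm_restrict \<sigma> G \<circ> inv_into UNIV \<tau>))"
      by (simp only: sum_distrib_left[symmetric]
        prod_sum_permutes[OF fin p, of "\<lambda>G \<tau>. trace_moment M X (cycle_type G \<tau>) * ?W G (perm_restrict \<sigma> G \<circ> inv_into UNIV \<tau>)"])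
    also have "(\<Prod>G\<in>\<pi>. \<Sum>\<tau> | \<tau> permutes G. trace_moment M X (cycle_type G \<tau>) * ?W G (perm_restrict \<sigma> G \<circ> inv_into UNIV \<tau>))
      = (\<Prod>G\<in>\<pi>. mset_dual_moment M X N (cycle_type G \<sigma>))"
    proof (intro prod.cong refl)
      fix G assume G: "G \<in> \<pi>"
      have sG: "\<sigma> ` G = G" using sp G by blast
      have "dual_moment M X N G (perm_restrict \<sigma> G) = mset_dual_moment M X N (cycle_type G (perm_restrict \<sigma> G))"
        by (rule dual_moment_eq_mset[OF finG[OF G] perm_restrict_permutes[OF finG[OF G] \<sigma> sG] NG[OF G]])
      then show "(\<Sum>\<tau> | \<tau> permutes G. trace_moment M X (cycle_type G \<tau>) * ?W G (perm_restrict \<sigma> G \<circ> inv_into UNIV \<tau>)) = mset_dual_moment M X N (cycle_type G \<sigma>)"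
        using cycle_type_cong[OF cycles_on_perm_restrict[OF sG]] by (simp add: dual_moment_def)
    qed
    finally show "(\<Sum>\<tau>\<in>?T. \<Sum>\<pi>'\<in>?R \<tau>. if refines ?A \<pi>' \<pi> then phi M X \<pi>' \<tau> * (cumulant_coeff (card \<pi>) * ?w \<tau> \<pi>) else 0)
      = cumulant_coeff (card \<pi>) * (\<Prod>G\<in>\<pi>. mset_dual_moment M X N (cycle_type G \<sigma>))" .
  qed
  also have "\<dots> = mset_cumulant (mset_dual_moment M X N) (cycle_type ?A \<sigma>)" by (rule cumulant_coarsenings[OF fin \<sigma>])
  finally show ?thesis .
qed

lemma join_part_eq_top_iff:
  assumes ne: "A \<noteq> {}" and p: "partition_on A \<pi>" "partition_on A \<rho>"
  shows "join_part A \<pi> \<rho> = {A} \<longleftrightarrow> (\<forall>\<upsilon>. refines A \<pi> \<upsilon> \<and> refines A \<rho> \<upsilon> \<longrightarrow> \<upsilon> = {A})"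
proof
  assume j: "join_part A \<pi> \<rho> = {A}"
  show "\<forall>\<upsilon>. refines A \<pi> \<upsilon> \<and> refines A \<rho> \<upsilon> \<longrightarrow> \<upsilon> = {A}"
  proof (intro allI impI)
    fix \<upsilon> assume "refines A \<pi> \<upsilon> \<and> refines A \<rho> \<upsilon>"
    then have r: "refines A {A} \<upsilon>" using join_part_least[of A \<pi> \<upsilon> \<rho>] j by simp
    moreover have "refines A \<upsilon> {A}"
      using r ne partition_on_subset[of A \<upsilon>] partition_on_space[OF ne] by (auto simp: refines_def)
    ultimately show "\<upsilon> = {A}" using refines_asym by blast
  qed
next
  assume "\<forall>\<upsilon>. refines A \<pi> \<upsilon> \<and> refines A \<rho> \<upsilon> \<longrightarrow> \<upsilon> = {A}"
  then show "join_part A \<pi> \<rho> = {A}" using refines_join_part[OF p] by blast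
qed

text \<open>Write the cumulant as an alternating sum over \<pi> above the cycles of \<tau>, invert
  the Weingarten convolution in every block of \<pi>, and expand the dual moments into their
  cumulants over \<rho> below \<pi>. For given \<rho> the coefficients are summed over the common
  coarsenings of \<rho> and the cycles of \<tau>; this gives 1 if their join is the one-block
  partition and 0 otherwise.\<close>

lemma exact_moment_formula:
  fixes H :: "nat set"
  assumes fin: "finite H" and ne: "H \<noteq> {}" and \<tau>: "\<tau> permutes H" and N: "fact (card H) \<le> N"
  shows "mset_cumulant (trace_moment M X) (cycle_type H \<tau>) =
    (\<Sum>\<sigma> | \<sigma> permutes H. of_nat N ^ card (cycles_on H (\<sigma> \<circ> inv_into UNIV \<tau>)) *
      (\<Sum>\<rho> | refines H (cycles_on H \<sigma>) \<rho> \<and> join_part H \<rho> (cycles_on H \<tau>) = {H}.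
        \<Prod>V\<in>\<rho>. mset_cumulant (mset_dual_moment M X N) (cycle_type V \<sigma>)))"
proof -
  let ?T = "{\<sigma>. \<sigma> permutes H}" and ?S = "{\<pi>. refines H (cycles_on H \<tau>) \<pi>}"
  let ?K = "\<lambda>\<sigma>. of_nat N ^ card (cycles_on H (\<sigma> \<circ> inv_into UNIV \<tau>)) :: complex"
  have finT: "finite ?T" using finite_permutations[OF fin] .
  have pt: "partition_on H (cycles_on H \<tau>)" by (rule partition_on_cycles[OF fin \<tau>])
  have "mset_cumulant (trace_moment M X) (cycle_type H \<tau>) = (\<Sum>\<pi>\<in>?S. cumulant_coeff (card \<pi>) * (\<Prod>G\<in>\<pi>. trace_moment M X (cycle_type G \<tau>)))"
    by (rule cumulant_coarsenings[OF fin \<tau>, symmetric])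
  also have "\<dots> = (\<Sum>\<pi>\<in>?S. \<Sum>\<sigma>\<in>?T. ?K \<sigma> * (cumulant_coeff (card \<pi>) * (\<Prod>G\<in>\<pi>. invariant_extension (mset_dual_moment M X N) \<sigma> G)))"
  proof (intro sum.cong refl)
    fix \<pi> assume "\<pi> \<in> ?S"
    then have p: "partition_on H \<pi>" and tp: "\<forall>G\<in>\<pi>. \<tau> ` G = G"
      using refines_cycles_iff[OF fin \<tau>] by auto
    have Gsub: "G \<subseteq> H" if "G \<in> \<pi>" for G using partition_on_subset[OF p that] .
    have finG: "finite G" if "G \<in> \<pi>" for G using finite_subset[OF Gsub[OF that] fin] .
    have NG: "fact (card G) \<le> N" if "G \<in> \<pi>" for G
    proof -
      have "card G \<le> card H" using card_mono[OF fin Gsub[OF that]] by simp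
      then show ?thesis using N fact_mono_nat le_trans by blast
    qed
    let ?f = "\<lambda>G \<sigma>. of_nat N ^ card (cycles_on G (\<sigma> \<circ> inv_into UNIV (perm_restrict \<tau> G))) * mset_dual_moment M X N (cycle_type G \<sigma>)"
    have "(\<Prod>G\<in>\<pi>. trace_moment M X (cycle_type G \<tau>)) = (\<Prod>G\<in>\<pi>. \<Sum>\<sigma> | \<sigma> permutes G. ?f G \<sigma>)"
    proof (intro prod.cong refl)
      fix G assume G: "G \<in> \<pi>"
      have tG: "\<tau> ` G = G" using tp G by blast
      have t: "perm_restrict \<tau> G permutes G" by (rule perm_restrict_permutes[OF finG[OF G] \<tau> tG])
      have "trace_moment M X (cycle_type G \<tau>) = trace_moment M X (cycle_type G (perm_restrict \<tau> G))"
        using cycle_type_cong[OF cycles_on_perm_restrict[OF tG]] by simp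
      also have "\<dots> = (\<Sum>\<sigma> | \<sigma> permutes G. of_nat N ^ card (cycles_on G (\<sigma> \<circ> inv_into UNIV (perm_restrict \<tau> G))) * dual_moment M X N G \<sigma>)"
        by (rule dual_moment_inversion[OF finG[OF G] NG[OF G] t, symmetric])
      also have "\<dots> = (\<Sum>\<sigma> | \<sigma> permutes G. ?f G \<sigma>)"
        by (intro sum.cong refl) (simp add: dual_moment_eq_mset[OF finG[OF G] _ NG[OF G]])
      finally show "trace_moment M X (cycle_type G \<tau>) = (\<Sum>\<sigma> | \<sigma> permutes G. ?f G \<sigma>)" .
    qed
    also have "\<dots> = (\<Sum>\<sigma> | \<sigma> permutes H \<and> (\<forall>G\<in>\<pi>. \<sigma> ` G = G). \<Prod>G\<in>\<pi>. ?f G (perm_restrict \<sigma> G))"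
      by (rule prod_sum_permutes[OF fin p])
    also have "\<dots> = (\<Sum>\<sigma>\<in>?T. ?K \<sigma> * (\<Prod>G\<in>\<pi>. invariant_extension (mset_dual_moment M X N) \<sigma> G))"
    proof (rule sum.mono_neutral_cong_left[OF finT])
      show "\<forall>\<sigma>\<in>?T - {\<sigma>. \<sigma> permutes H \<and> (\<forall>G\<in>\<pi>. \<sigma> ` G = G)}. ?K \<sigma> * (\<Prod>G\<in>\<pi>. invariant_extension (mset_dual_moment M X N) \<sigma> G) = 0"
        using finite_elements[OF fin p] by (auto simp: invariant_extension_def)
      fix \<sigma> assume "\<sigma> \<in> {\<sigma>. \<sigma> permutes H \<and> (\<forall>G\<in>\<pi>. \<sigma> ` G = G)}"
      then have \<sigma>: "\<sigma> permutes H" and sp: "\<forall>G\<in>\<pi>. \<sigma> ` G = G" by auto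
      have pi: "\<sigma> \<circ> inv_into UNIV \<tau> permutes H" using \<sigma> \<tau> permutes_compose permutes_inv by blast
      have inv: "(\<sigma> \<circ> inv_into UNIV \<tau>) ` G = G" if G: "G \<in> \<pi>" for G
      proof -
        have "inv_into UNIV \<tau> ` \<tau> ` G = G" by (simp add: image_image permutes_inverses(2)[OF \<tau>])
        then have "inv_into UNIV \<tau> ` G = G" using tp G by simp
        then have "\<sigma> ` inv_into UNIV \<tau> ` G = G" using sp G by simp
        then show ?thesis by (simp only: image_comp)
      qed
      \<comment> \<open>The power of N is multiplicative over the blocks because the cycles of the
        quotient stay inside them.\<close>
      have "card (cycles_on H (\<sigma> \<circ> inv_into UNIV \<tau>)) = (\<Sum>G\<in>\<pi>. card (cycles_on G (\<sigma> \<circ> inv_into UNIV \<tau>)))"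
        by (rule card_cycles_on_sum[OF fin pi p]) (use inv in blast)
      then have "?K \<sigma> * (\<Prod>G\<in>\<pi>. invariant_extension (mset_dual_moment M X N) \<sigma> G) =
          (\<Prod>G\<in>\<pi>. of_nat N ^ card (cycles_on G (\<sigma> \<circ> inv_into UNIV \<tau>)) * invariant_extension (mset_dual_moment M X N) \<sigma> G)"
        by (simp add: prod.distrib power_sum)
      also have "\<dots> = (\<Prod>G\<in>\<pi>. ?f G (perm_restrict \<sigma> G))"
      proof (intro prod.cong refl)
        fix G assume G: "G \<in> \<pi>"
        have "cycle_type G (perm_restrict \<sigma> G) = cycle_type G \<sigma>"
          using sp G by (intro cycle_type_cong cycles_on_perm_restrict) blast
        moreover have "perm_restrict \<sigma> G \<circ> inv_into UNIV (perm_restrict \<tau> G) = perm_restrict (\<sigma> \<circ> inv_into UNIV \<tau>) G"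
          using sp tp G by (intro perm_restrict_comp_inv[OF finG[OF G] \<sigma> \<tau>, symmetric]) auto
        moreover have "cycles_on G (perm_restrict (\<sigma> \<circ> inv_into UNIV \<tau>) G) = cycles_on G (\<sigma> \<circ> inv_into UNIV \<tau>)"
          by (rule cycles_on_perm_restrict[OF inv[OF G]])
        ultimately show "of_nat N ^ card (cycles_on G (\<sigma> \<circ> inv_into UNIV \<tau>)) * invariant_extension (mset_dual_moment M X N) \<sigma> G = ?f G (perm_restrict \<sigma> G)"
          using sp G by (simp add: invariant_extension_def)
      qed
      finally show "(\<Prod>G\<in>\<pi>. ?f G (perm_restrict \<sigma> G)) = ?K \<sigma> * (\<Prod>G\<in>\<pi>. invariant_extension (mset_dual_moment M X N) \<sigma> G)" by simp
    qed auto
    finally show "cumulant_coeff (card \<pi>) * (\<Prod>G\<in>\<pi>. trace_moment M X (cycle_type G \<tau>)) =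
      (\<Sum>\<sigma>\<in>?T. ?K \<sigma> * (cumulant_coeff (card \<pi>) * (\<Prod>G\<in>\<pi>. invariant_extension (mset_dual_moment M X N) \<sigma> G)))"
      by (simp add: sum_distrib_left mult_ac)
  qed
  also have "\<dots> = (\<Sum>\<sigma>\<in>?T. \<Sum>\<pi>\<in>?S. ?K \<sigma> * (cumulant_coeff (card \<pi>) * (\<Prod>G\<in>\<pi>. invariant_extension (mset_dual_moment M X N) \<sigma> G)))"
    by (rule sum.swap)
  also have "\<dots> = (\<Sum>\<sigma>\<in>?T. ?K \<sigma> *
      (\<Sum>\<rho> | refines H (cycles_on H \<sigma>) \<rho> \<and> join_part H \<rho> (cycles_on H \<tau>) = {H}.
        \<Prod>V\<in>\<rho>. mset_cumulant (mset_dual_moment M X N) (cycle_type V \<sigma>)))"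
  proof (intro sum.cong refl)
    fix \<sigma> assume "\<sigma> \<in> ?T"
    then have \<sigma>: "\<sigma> permutes H" by simp
    let ?k = "invariant_extension (mset_cumulant (mset_dual_moment M X N)) \<sigma>"
    have "(\<Sum>\<pi>\<in>?S. cumulant_coeff (card \<pi>) * (\<Prod>G\<in>\<pi>. invariant_extension (mset_dual_moment M X N) \<sigma> G))
       = (\<Sum>\<pi> | partition_on H \<pi> \<and> refines H (cycles_on H \<tau>) \<pi>. cumulant_coeff (card \<pi>) * (\<Prod>G\<in>\<pi>. invariant_extension (mset_dual_moment M X N) \<sigma> G))"
      by (rule sum.cong) (auto simp: refines_def)
    also have "\<dots> = (\<Sum>\<rho> | partition_on H \<rho>. (\<Prod>V\<in>\<rho>. ?k V) *
        (\<Sum>\<pi> | refines H \<rho> \<pi> \<and> refines H (cycles_on H \<tau>) \<pi>. cumulant_coeff (card \<pi>)))"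
      by (rule weighted_sum_prod_moments[OF fin]) (rule moment_invariant_extension[OF fin \<sigma>])
    also have "\<dots> = (\<Sum>\<rho> | partition_on H \<rho>. (\<Prod>V\<in>\<rho>. ?k V) * (if join_part H \<rho> (cycles_on H \<tau>) = {H} then 1 else 0))"
    proof (intro sum.cong refl)
      fix \<rho> assume "\<rho> \<in> {\<rho>. partition_on H \<rho>}"
      then have p: "partition_on H \<rho>" by simp
      have pj: "partition_on H (join_part H \<rho> (cycles_on H \<tau>))"
        using refines_join_part(1)[OF p pt] by (simp add: refines_def)
      have "{\<pi>. refines H \<rho> \<pi> \<and> refines H (cycles_on H \<tau>) \<pi>} = {\<pi>. refines H (join_part H \<rho> (cycles_on H \<tau>)) \<pi>}"
        using refines_join_part[OF p pt] join_part_least refines_trans by blast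
      then have "(\<Sum>\<pi> | refines H \<rho> \<pi> \<and> refines H (cycles_on H \<tau>) \<pi>. cumulant_coeff (card \<pi>)) = (if join_part H \<rho> (cycles_on H \<tau>) = {H} then 1 else 0)"
        by (simp add: sum_cumulant_coeff_coarsenings[OF fin ne pj])
      then show "(\<Prod>V\<in>\<rho>. ?k V) * (\<Sum>\<pi> | refines H \<rho> \<pi> \<and> refines H (cycles_on H \<tau>) \<pi>. cumulant_coeff (card \<pi>))
        = (\<Prod>V\<in>\<rho>. ?k V) * (if join_part H \<rho> (cycles_on H \<tau>) = {H} then 1 else 0)" by simp
    qed
    also have "\<dots> = (\<Sum>\<rho> | partition_on H \<rho> \<and> join_part H \<rho> (cycles_on H \<tau>) = {H}. 1 * (\<Prod>V\<in>\<rho>. ?k V))"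
      by (rule sum.mono_neutral_cong_right) (auto simp: finitely_many_partition_on[OF fin])
    also have "\<dots> = (\<Sum>\<rho> | refines H (cycles_on H \<sigma>) \<rho> \<and> join_part H \<rho> (cycles_on H \<tau>) = {H}.
        1 * (\<Prod>V\<in>\<rho>. mset_cumulant (mset_dual_moment M X N) (cycle_type V \<sigma>)))"
      by (rule sum_prod_invariant_extension[OF fin \<sigma>])
    finally show "(\<Sum>\<pi>\<in>?S. ?K \<sigma> * (cumulant_coeff (card \<pi>) * (\<Prod>G\<in>\<pi>. invariant_extension (mset_dual_moment M X N) \<sigma> G))) = ?K \<sigma> *
      (\<Sum>\<rho> | refines H (cycles_on H \<sigma>) \<rho> \<and> join_part H \<rho> (cycles_on H \<tau>) = {H}.
        \<Prod>V\<in>\<rho>. mset_cumulant (mset_dual_moment M X N) (cycle_type V \<sigma>))" by (simp only: sum_distrib_left[symmetric] mult_1_left)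
  qed
  finally show ?thesis .
qed

section \<open>Genus and connectedness\<close>

text \<open>The connected components of the undirected graph underlying \<open>R\<close>. Joins are
  recast in this form because the effect of a single edge on the number of components can be
  controlled.\<close>

definition components :: "'a set \<Rightarrow> ('a \<times> 'a) set \<Rightarrow> 'a set set" where
  "components H R = (\<lambda>x. {y. (x, y) \<in> (R \<union> R\<inverse>)\<^sup>*}) ` H"

lemma sym_closure: "(x, y) \<in> (R \<union> R\<inverse>)\<^sup>* \<Longrightarrow> (y, x) \<in> (R \<union> R\<inverse>)\<^sup>*"
  by (rule symD[OF sym_rtrancl]) (auto simp: sym_def)

lemma closure_in_set:
  assumes "R \<subseteq> H \<times> H" "(x, y) \<in> (R \<union> R\<inverse>)\<^sup>*" "x \<in> H"
  shows "y \<in> H"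
  using assms(2,1,3) by (induction rule: rtrancl_induct) auto

lemma partition_on_components:
  assumes "R \<subseteq> H \<times> H"
  shows "partition_on H (components H R)"
proof (rule partition_onI)
  show "\<Union> (components H R) = H" using closure_in_set[OF assms] by (auto simp: components_def)
  show "{} \<notin> components H R" by (auto simp: components_def)
  fix p q assume "p \<in> components H R" "q \<in> components H R" "p \<noteq> q"
  then obtain x y where xy: "p = {z. (x, z) \<in> (R \<union> R\<inverse>)\<^sup>*}" "q = {z. (y, z) \<in> (R \<union> R\<inverse>)\<^sup>*}"
    by (auto simp: components_def)
  show "disjnt p q"
  proof (rule ccontr)
    assume "\<not> disjnt p q"
    then obtain z where z: "(x, z) \<in> (R \<union> R\<inverse>)\<^sup>*" "(y, z) \<in> (R \<union> R\<inverse>)\<^sup>*" by (auto simp: disjnt_iff xy)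
    then have "(x, y) \<in> (R \<union> R\<inverse>)\<^sup>*" "(y, x) \<in> (R \<union> R\<inverse>)\<^sup>*" using sym_closure rtrancl_trans by metis+
    then have "p = q" unfolding xy by (auto intro: rtrancl_trans)
    then show False using \<open>p \<noteq> q\<close> by simp
  qed
qed

definition in_same :: "'a set set \<Rightarrow> 'a \<Rightarrow> 'a \<Rightarrow> bool" where
  "in_same P x y \<longleftrightarrow> (\<exists>X\<in>P. x \<in> X \<and> y \<in> X)"

lemma in_same_sym: "in_same P x y \<Longrightarrow> in_same P y x" by (auto simp: in_same_def)

lemma in_same_refl: "partition_on H P \<Longrightarrow> x \<in> H \<Longrightarrow> in_same P x x"
  using partition_on_ex[of H P x] by (auto simp: in_same_def)

lemma in_same_trans:
  assumes "partition_on H P" "in_same P x y" "in_same P y z" shows "in_same P x z"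
proof -
  obtain X Y where XY: "X \<in> P" "x \<in> X" "y \<in> X" "Y \<in> P" "y \<in> Y" "z \<in> Y"
    using assms(2,3) by (auto simp: in_same_def)
  then have "X = Y" using partition_on_same_block[OF assms(1)] by simp
  then show ?thesis using XY by (auto simp: in_same_def)
qed

lemma in_same_components: "R \<subseteq> H \<times> H \<Longrightarrow> in_same (components H R) x y \<longleftrightarrow> x \<in> H \<and> (x, y) \<in> (R \<union> R\<inverse>)\<^sup>*"
proof
  assume R: "R \<subseteq> H \<times> H" and "in_same (components H R) x y"
  then obtain z where z: "z \<in> H" "(z, x) \<in> (R \<union> R\<inverse>)\<^sup>*" "(z, y) \<in> (R \<union> R\<inverse>)\<^sup>*" by (auto simp: in_same_def components_def)
  then show "x \<in> H \<and> (x, y) \<in> (R \<union> R\<inverse>)\<^sup>*"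
    using closure_in_set[OF R z(2,1)] rtrancl_trans[OF sym_closure[OF z(2)] z(3)] by blast
qed (auto simp: in_same_def components_def)

lemma in_same_refines:
  assumes "refines H P Q" "in_same P x y" shows "in_same Q x y"
proof -
  obtain X where X: "X \<in> P" "x \<in> X" "y \<in> X" using assms(2) by (auto simp: in_same_def)
  then obtain Y where "Y \<in> Q" "X \<subseteq> Y" using assms(1) by (auto simp: refines_def)
  then show ?thesis using X by (auto simp: in_same_def)
qed

lemma refines_in_same:
  assumes P: "partition_on H P" and Q: "partition_on H Q" and s: "\<And>x y. in_same P x y \<Longrightarrow> in_same Q x y"
  shows "refines H P Q"
  unfolding refines_def
proof (intro conjI P Q ballI)
  fix X assume X: "X \<in> P"
  then obtain x where x: "x \<in> X" using partition_on_nonempty[OF P] by blast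
  then have "x \<in> H" using partition_on_subset[OF P X] by blast
  then obtain Y where Y: "Y \<in> Q" "x \<in> Y" using partition_on_ex[OF Q] by blast
  have "y \<in> Y" if y: "y \<in> X" for y
  proof -
    have "in_same Q x y" using X x y by (intro s) (auto simp: in_same_def)
    then obtain Z where "Z \<in> Q" "x \<in> Z" "y \<in> Z" by (auto simp: in_same_def)
    then show ?thesis using partition_on_same_block[OF Q, of Z Y x] Y by simp
  qed
  then show "\<exists>Y\<in>Q. X \<subseteq> Y" using Y by blast
qed

lemma components_least:
  assumes R: "R \<subseteq> H \<times> H" and Q: "partition_on H Q" and e: "\<And>x y. (x, y) \<in> R \<Longrightarrow> in_same Q x y"
  shows "refines H (components H R) Q"
proof (rule refines_in_same[OF partition_on_components[OF R] Q])
  fix x y assume "in_same (components H R) x y"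
  then have "(x, y) \<in> (R \<union> R\<inverse>)\<^sup>*" and x: "x \<in> H" by (auto simp: in_same_components[OF R])
  then show "in_same Q x y"
  proof (induction rule: rtrancl_induct)
    case base then show ?case by (rule in_same_refl[OF Q])
  next
    case (step y z)
    have "in_same Q y z" using step.hyps(2) e[of y z] in_same_sym[OF e[of z y]] by auto
    with step.IH[OF step.prems] show ?case by (rule in_same_trans[OF Q])
  qed
qed

lemma edge_in_same_components: "R \<subseteq> H \<times> H \<Longrightarrow> (x, y) \<in> R \<Longrightarrow> in_same (components H R) x y"
  by (auto simp: in_same_components)

lemma components_eqI:
  assumes "R \<subseteq> H \<times> H" "R' \<subseteq> H \<times> H"
    and "\<And>x y. (x, y) \<in> R \<Longrightarrow> in_same (components H R') x y" "\<And>x y. (x, y) \<in> R' \<Longrightarrow> in_same (components H R) x y"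
  shows "components H R = components H R'"
  using components_least[OF assms(1) partition_on_components[OF assms(2)] assms(3)]
    components_least[OF assms(2) partition_on_components[OF assms(1)] assms(4)] refines_asym by blast

lemma card_components_insert:
  assumes fin: "finite H" and R: "R \<subseteq> H \<times> H" and ab: "a \<in> H" "b \<in> H"
  shows "in_same (components H R) a b \<Longrightarrow> components H (insert (a, b) R) = components H R"
    "\<not> in_same (components H R) a b \<Longrightarrow> card (components H R) = Suc (card (components H (insert (a, b) R)))"
proof -
  let ?P = "components H R"
  have R': "insert (a, b) R \<subseteq> H \<times> H" using R ab by blast
  have p: "partition_on H ?P" by (rule partition_on_components[OF R])
  show "components H (insert (a, b) R) = ?P" if "in_same ?P a b"
    by (rule components_eqI[OF R' R]) (use that edge_in_same_components[OF R] edge_in_same_components[OF R'] in auto)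
  assume ns: "\<not> in_same ?P a b"
  obtain A where A: "A \<in> ?P" "a \<in> A" using partition_on_ex[OF p ab(1)] by blast
  obtain B where B: "B \<in> ?P" "b \<in> B" using partition_on_ex[OF p ab(2)] by blast
  have AB: "A \<noteq> B" using ns A B by (auto simp: in_same_def)
  \<comment> \<open>The new edge fuses the blocks of \<open>a\<close> and \<open>b\<close> and
    leaves the others alone.\<close>
  let ?Q = "insert (A \<union> B) (?P - {A, B})"
  have q: "partition_on H ?Q"
  proof (rule partition_onI)
    have "\<Union> ?Q = \<Union> ?P" using A B by auto
    then show "\<Union> ?Q = H" using p by (simp add: partition_on_def)
    show "{} \<notin> ?Q" using partition_on_nonempty[OF p] A by auto
    fix X Y assume XY: "X \<in> ?Q" "Y \<in> ?Q" "X \<noteq> Y"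
    have d: "disjnt Z W" if "Z \<in> ?P" "W \<in> ?P" "Z \<noteq> W" for Z W
      using partition_on_same_block[OF p that(1,2)] that(3) by (auto simp: disjnt_iff)
    have d2: "disjnt (A \<union> B) Z" "disjnt Z (A \<union> B)" if "Z \<in> ?P" "Z \<noteq> A" "Z \<noteq> B" for Z
      using d[OF A(1) that(1)] d[OF B(1) that(1)] that(2,3) by (auto simp: disjnt_iff)
    show "disjnt X Y"
    proof (cases "X = A \<union> B")
      case True
      then show ?thesis using XY d2(1)[of Y] by blast
    next
      case False
      then have X: "X \<in> ?P" "X \<noteq> A" "X \<noteq> B" using XY by auto
      show ?thesis using XY d2(2)[OF X] d[OF X(1), of Y] by blast
    qed
  qed
  have AQ: "in_same ?Q x y" if "x \<in> A \<union> B" "y \<in> A \<union> B" for x y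
    unfolding in_same_def by (rule bexI[of _ "A \<union> B"]) (use that in auto)
  have PQ: "in_same ?Q x y" if s: "in_same ?P x y" for x y
  proof -
    obtain X where X: "X \<in> ?P" "x \<in> X" "y \<in> X" using s by (auto simp: in_same_def)
    show ?thesis
    proof (cases "X = A \<or> X = B")
      case True then show ?thesis using X by (intro AQ) auto
    next
      case False then show ?thesis using X by (auto simp: in_same_def)
    qed
  qed
  have "components H (insert (a, b) R) = ?Q"
  proof (rule refines_asym)
    show "refines H (components H (insert (a, b) R)) ?Q"
    proof (rule components_least[OF R' q])
      fix x y assume "(x, y) \<in> insert (a, b) R"
      then show "in_same ?Q x y" using AQ[of a b] A B PQ edge_in_same_components[OF R] by auto
    qed
    have PR': "in_same (components H (insert (a, b) R)) x y" if "in_same ?P x y" for x y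
      by (rule in_same_refines[OF components_least[OF R partition_on_components[OF R']] that])
        (auto intro: edge_in_same_components[OF R'])
    note tr = in_same_trans[OF partition_on_components[OF R']]
    have aS: "in_same (components H (insert (a, b) R)) a x" if "x \<in> A \<union> B" for x
    proof -
      have "x \<in> A \<Longrightarrow> in_same ?P a x" "x \<in> B \<Longrightarrow> in_same ?P b x" using A B by (auto simp: in_same_def)
      moreover have "in_same (components H (insert (a, b) R)) a b" by (rule edge_in_same_components[OF R']) simp
      ultimately show ?thesis using that PR' tr by blast
    qed
    show "refines H ?Q (components H (insert (a, b) R))"
    proof (rule refines_in_same[OF q partition_on_components[OF R']])
      fix x y assume "in_same ?Q x y"
      then obtain X where X: "X \<in> ?Q" "x \<in> X" "y \<in> X" by (auto simp: in_same_def)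
      show "in_same (components H (insert (a, b) R)) x y"
      proof (cases "X = A \<union> B")
        case True
        then show ?thesis using tr[OF in_same_sym[OF aS] aS] X by blast
      next
        case False
        then have "in_same ?P x y" using X by (auto simp: in_same_def)
        then show ?thesis by (rule PR')
      qed
    qed
  qed
  moreover have "A \<union> B \<notin> ?P - {A, B}"
  proof
    assume c: "A \<union> B \<in> ?P - {A, B}"
    then have "A \<union> B = A" using partition_on_same_block[OF p, of "A \<union> B" A a] A by blast
    then show False using c by blast
  qed
  moreover have "finite ?P" by (rule finite_elements[OF fin p])
  moreover have "card ?P \<ge> 2"
  proof -
    have "card {A, B} \<le> card ?P" using A B \<open>finite ?P\<close> by (intro card_mono) auto
    then show ?thesis using AB by simp
  qed
  ultimately show "card ?P = Suc (card (components H (insert (a, b) R)))"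
    using A(1) B(1) AB by (simp add: card_Diff_subset)
qed

section \<open>Permutation graphs, transpositions and the genus inequality\<close>

definition perm_graph :: "'a set \<Rightarrow> ('a \<Rightarrow> 'a) \<Rightarrow> ('a \<times> 'a) set" where
  "perm_graph H \<sigma> = (\<lambda>x. (x, \<sigma> x)) ` H"

lemma perm_graph_subset: "\<sigma> permutes H \<Longrightarrow> perm_graph H \<sigma> \<subseteq> H \<times> H"
  by (auto simp: perm_graph_def permutes_in_image)

lemma in_same_cycle:
  assumes "finite H" "\<sigma> permutes H"
  shows "in_same (cycles_on H \<sigma>) x y \<longleftrightarrow> x \<in> H \<and> y \<in> orbit \<sigma> x"
proof
  assume "in_same (cycles_on H \<sigma>) x y"
  then obtain z where z: "z \<in> H" "x \<in> orbit \<sigma> z" "y \<in> orbit \<sigma> z" by (auto simp: in_same_def cycles_on_def)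
  then show "x \<in> H \<and> y \<in> orbit \<sigma> x"
    using orbit_eq_of_mem[OF assms z(2)] permutes_orbit_subset[OF assms(2) z(1)] by blast
next
  assume "x \<in> H \<and> y \<in> orbit \<sigma> x"
  then show "in_same (cycles_on H \<sigma>) x y"
    using self_in_orbit[OF assms, of x] by (auto simp: in_same_def cycles_on_def)
qed

lemma cycles_eq_components:
  assumes "finite H" "\<sigma> permutes H"
  shows "cycles_on H \<sigma> = components H (perm_graph H \<sigma>)"
proof (rule refines_asym)
  note g = perm_graph_subset[OF assms(2)]
  have inv: "\<sigma> ` X = X" if "X \<in> components H (perm_graph H \<sigma>)" for X
  proof -
    have XH: "X \<subseteq> H" using partition_on_subset[OF partition_on_components[OF g] that] .
    have "\<sigma> x \<in> X" if x: "x \<in> X" for x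
    proof -
      have "(x, \<sigma> x) \<in> perm_graph H \<sigma>" using x XH by (auto simp: perm_graph_def)
      then have "in_same (components H (perm_graph H \<sigma>)) x (\<sigma> x)" by (rule edge_in_same_components[OF g])
      then obtain Y where Y: "Y \<in> components H (perm_graph H \<sigma>)" "x \<in> Y" "\<sigma> x \<in> Y" by (auto simp: in_same_def)
      then have "Y = X" using partition_on_same_block[OF partition_on_components[OF g] Y(1) \<open>X \<in> _\<close> _ x] by simp
      then show ?thesis using Y by simp
    qed
    then have "\<sigma> ` X \<subseteq> X" by (rule image_subsetI)
    then show ?thesis by (rule permutes_image_eq[OF finite_subset[OF XH assms(1)] assms(2)])
  qed
  then show "refines H (cycles_on H \<sigma>) (components H (perm_graph H \<sigma>))"
    by (subst refines_cycles_iff[OF assms]) (use partition_on_components[OF g] in simp)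
  show "refines H (components H (perm_graph H \<sigma>)) (cycles_on H \<sigma>)"
    by (rule components_least[OF g partition_on_cycles[OF assms]])
      (auto simp: perm_graph_def in_same_cycle[OF assms] orbit.base)
qed

text \<open>Both sides are the least partition in which every arrow of either permutation stays
  within a block.\<close>

lemma join_cycles_eq_components:
  assumes "finite H" "\<sigma> permutes H" "\<tau> permutes H"
  shows "join_part H (cycles_on H \<sigma>) (cycles_on H \<tau>) = components H (perm_graph H \<sigma> \<union> perm_graph H \<tau>)"
proof (rule refines_asym)
  let ?R = "perm_graph H \<sigma> \<union> perm_graph H \<tau>"
  have R: "?R \<subseteq> H \<times> H" using perm_graph_subset[OF assms(2)] perm_graph_subset[OF assms(3)] by blast
  have p: "partition_on H (components H ?R)" by (rule partition_on_components[OF R])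
  note pc = partition_on_cycles[OF assms(1,2)] partition_on_cycles[OF assms(1,3)]
  note r = refines_join_part[OF pc]
  have "refines H (cycles_on H \<sigma>) (components H ?R)" "refines H (cycles_on H \<tau>) (components H ?R)"
    unfolding cycles_eq_components[OF assms(1,2)] cycles_eq_components[OF assms(1,3)]
    by (rule components_least[OF perm_graph_subset p], fact, rule edge_in_same_components[OF R], blast)+
  then show "refines H (join_part H (cycles_on H \<sigma>) (cycles_on H \<tau>)) (components H ?R)" by (rule join_part_least)
  have j: "partition_on H (join_part H (cycles_on H \<sigma>) (cycles_on H \<tau>))" using r by (simp add: refines_def)
  show "refines H (components H ?R) (join_part H (cycles_on H \<sigma>) (cycles_on H \<tau>))"
  proof (rule components_least[OF R j])
    fix x y assume "(x, y) \<in> ?R"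
    then have "in_same (cycles_on H \<sigma>) x y \<or> in_same (cycles_on H \<tau>) x y"
      by (auto simp: perm_graph_def in_same_cycle[OF assms(1,2)] in_same_cycle[OF assms(1,3)] orbit.base)
    then show "in_same (join_part H (cycles_on H \<sigma>) (cycles_on H \<tau>)) x y"
      using in_same_refines[OF r(1), of x y] in_same_refines[OF r(2), of x y] by blast
  qed
qed

text \<open>Once the edge between \<open>a\<close> and \<open>b\<close> is present, redirecting an
  arrow from one of them to the other does not change connectivity. As the transposition is an
  involution, one inclusion, applied to both permutations, suffices.\<close>

lemma components_transpose:
  assumes "finite H" "\<sigma> permutes H" "a \<in> H" "b \<in> H" and R: "R \<subseteq> H \<times> H"
  shows "components H (insert (a, b) (R \<union> perm_graph H (Transposition.transpose a b \<circ> \<sigma>))) = components H (insert (a, b) (R \<union> perm_graph H \<sigma>))"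
proof -
  have gen: "in_same (components H (insert (a, b) (R \<union> perm_graph H \<alpha>))) x y"
    if al: "\<alpha> permutes H" and xy: "(x, y) \<in> insert (a, b) (R \<union> perm_graph H (Transposition.transpose a b \<circ> \<alpha>))" for \<alpha> x y
  proof -
    let ?S = "insert (a, b) (R \<union> perm_graph H \<alpha>)"
    have S: "?S \<subseteq> H \<times> H" using R perm_graph_subset[OF al] assms by blast
    note tr = in_same_trans[OF partition_on_components[OF S]]
    have ab: "in_same (components H ?S) a b" by (rule edge_in_same_components[OF S]) simp
    have t: "in_same (components H ?S) z (Transposition.transpose a b z)" if "z \<in> H" for z
      using ab in_same_sym[OF ab] in_same_refl[OF partition_on_components[OF S] that] by (auto simp: Transposition.transpose_def)
    consider "(x, y) = (a, b)" | "(x, y) \<in> R" | "x \<in> H" "y = Transposition.transpose a b (\<alpha> x)" using xy by (auto simp: perm_graph_def)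
    then show ?thesis
    proof cases
      case 3
      have "in_same (components H ?S) x (\<alpha> x)" by (rule edge_in_same_components[OF S]) (use 3 in \<open>auto simp: perm_graph_def\<close>)
      moreover have "\<alpha> x \<in> H" using 3 permutes_in_image[OF al] by simp
      ultimately show ?thesis using t tr 3 by blast
    qed (use ab edge_in_same_components[OF S] in auto)
  qed
  have t: "Transposition.transpose a b permutes H" by (rule permutes_swap_id[OF assms(3,4)])
  have s': "Transposition.transpose a b \<circ> \<sigma> permutes H" by (rule permutes_compose[OF assms(2) t])
  have tt: "Transposition.transpose a b \<circ> (Transposition.transpose a b \<circ> \<sigma>) = \<sigma>" by (simp add: o_assoc)
  show ?thesis
  proof (rule components_eqI)
    show "insert (a, b) (R \<union> perm_graph H (Transposition.transpose a b \<circ> \<sigma>)) \<subseteq> H \<times> H" "insert (a, b) (R \<union> perm_graph H \<sigma>) \<subseteq> H \<times> H"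
      using R perm_graph_subset[OF assms(2)] perm_graph_subset[OF s'] assms(3,4) by blast+
    show "in_same (components H (insert (a, b) (R \<union> perm_graph H \<sigma>))) x y" if "(x, y) \<in> insert (a, b) (R \<union> perm_graph H (Transposition.transpose a b \<circ> \<sigma>))" for x y
      by (rule gen[OF assms(2) that])
    show "in_same (components H (insert (a, b) (R \<union> perm_graph H (Transposition.transpose a b \<circ> \<sigma>)))) x y" if "(x, y) \<in> insert (a, b) (R \<union> perm_graph H \<sigma>)" for x y
      using gen[OF s'] that unfolding tt by blast
  qed
qed

text \<open>Starting from \<open>a\<close>, the modified permutation follows the cycle of
  \<open>a\<close> under \<sigma>, which avoids \<open>b\<close>, up to its last point; that point
  is sent to \<open>b\<close> instead of back to \<open>a\<close>.\<close>

lemma orbit_transpose_merge: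
  assumes "finite H" "\<sigma> permutes H" "a \<in> H" "b \<in> H" and ab: "b \<notin> orbit \<sigma> a"
  shows "in_same (cycles_on H (Transposition.transpose a b \<circ> \<sigma>)) a b"
proof -
  define s where "s = Transposition.transpose a b \<circ> \<sigma>"
  have s: "s permutes H" unfolding s_def by (rule permutes_compose[OF assms(2) permutes_swap_id[OF assms(3,4)]])
  note o = orbit_bij_betw_funpow[OF self_in_orbit[OF assms(1,2)], of a]
  let ?n = "card (orbit \<sigma> a)"
  \<comment> \<open>No iterate before the return hits \<open>a\<close> or \<open>b\<close>, so the
    transposition does not act on it.\<close>
  have pw: "(s ^^ i) a = (\<sigma> ^^ i) a" if "i < ?n" for i
    using that
  proof (induction i)
    case (Suc i)
    have IH: "(s ^^ i) a = (\<sigma> ^^ i) a" using Suc by simp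
    have "(s ^^ Suc i) a = s ((s ^^ i) a)" by simp
    also have "\<dots> = Transposition.transpose a b ((\<sigma> ^^ Suc i) a)" unfolding IH by (simp add: s_def)
    finally have "(s ^^ Suc i) a = Transposition.transpose a b ((\<sigma> ^^ Suc i) a)" .
    moreover have "(\<sigma> ^^ Suc i) a \<noteq> a"
    proof
      assume "(\<sigma> ^^ Suc i) a = a"
      then have "(\<sigma> ^^ Suc i) a = (\<sigma> ^^ 0) a" by simp
      then have "Suc i = 0" using o(1) Suc.prems by (intro inj_onD[of "\<lambda>i. (\<sigma> ^^ i) a" "{..<?n}"]) (auto simp: bij_betw_def)
      then show False by simp
    qed
    moreover have "(\<sigma> ^^ Suc i) a \<noteq> b"
      using ab funpow_in_orbit[OF self_in_orbit[OF assms(1,2)], of "Suc i" a] by auto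
    ultimately show ?case by (simp add: Transposition.transpose_def)
  qed simp
  then have "(s ^^ (?n - 1)) a = (\<sigma> ^^ (?n - 1)) a" using o(3) by simp
  moreover have "\<sigma> ((\<sigma> ^^ (?n - 1)) a) = a" using o(2,3) by (metis Suc_diff_1 funpow.simps(2) o_apply)
  ultimately have "(s ^^ Suc (?n - 1)) a = b" by (simp add: s_def)
  then have "b \<in> orbit s a" using funpow_in_orbit[OF self_in_orbit[OF assms(1) s]] by metis
  then show ?thesis using assms(3) by (simp add: in_same_cycle[OF assms(1) s] s_def[symmetric])
qed

text \<open>Both cycle counts are compared with the number of components after adding the edge (a,
  b), which is the same for \<sigma> and for its product with the transposition; adding an edge
  lowers a count by at most one. Points in different cycles of \<sigma> end up in a common cycle, so
  there the loss is exactly one.\<close>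

lemma card_cycles_transpose:
  assumes "finite H" "\<sigma> permutes H" "a \<in> H" "b \<in> H"
  shows "card (cycles_on H (Transposition.transpose a b \<circ> \<sigma>)) \<le> card (cycles_on H \<sigma>) + 1"
    "\<not> in_same (cycles_on H \<sigma>) a b \<Longrightarrow> card (cycles_on H \<sigma>) = Suc (card (cycles_on H (Transposition.transpose a b \<circ> \<sigma>)))"
proof -
  let ?s = "Transposition.transpose a b \<circ> \<sigma>"
  have s: "?s permutes H" by (rule permutes_compose[OF assms(2) permutes_swap_id[OF assms(3,4)]])
  have e: "components H (insert (a, b) (perm_graph H ?s)) = components H (insert (a, b) (perm_graph H \<sigma>))"
    using components_transpose[OF assms, of "{}"] by simp
  note c = card_components_insert[OF assms(1) perm_graph_subset[OF assms(2)] assms(3,4), folded cycles_eq_components[OF assms(1,2)]]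
  note c' = card_components_insert[OF assms(1) perm_graph_subset[OF s] assms(3,4), folded cycles_eq_components[OF assms(1) s]]
  have "card (components H (insert (a, b) (perm_graph H \<sigma>))) \<le> card (cycles_on H \<sigma>)"
    using c by (cases "in_same (cycles_on H \<sigma>) a b") simp_all
  moreover have "card (cycles_on H ?s) \<le> card (components H (insert (a, b) (perm_graph H ?s))) + 1"
    using c' by (cases "in_same (cycles_on H ?s) a b") simp_all
  ultimately show "card (cycles_on H ?s) \<le> card (cycles_on H \<sigma>) + 1" using e by simp
  assume ns: "\<not> in_same (cycles_on H \<sigma>) a b"
  then have "b \<notin> orbit \<sigma> a" using in_same_cycle[OF assms(1,2)] assms(3) by blast
  then have "in_same (cycles_on H ?s) a b" by (rule orbit_transpose_merge[OF assms])
  then show "card (cycles_on H \<sigma>) = Suc (card (cycles_on H ?s))" using c(2)[OF ns] c'(1) e by simp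
qed

text \<open>Write \<open>\<tau> = (x b) p\<close> with \<open>x\<close> a fixed point of \<open>p\<close>. Passing from \<open>p\<close> to \<open>\<tau>\<close> lowers \<open>#(p)\<close> by one and
  changes \<open>#(p \<sigma>)\<close> by one; it also lowers \<open>#(p \<sigma>)\<close> whenever the number of joint blocks drops.\<close>

lemma genus_nonneg:
  assumes fin: "finite H" and \<sigma>: "\<sigma> permutes H" and \<tau>: "\<tau> permutes H"
  shows "card (cycles_on H \<sigma>) + card (cycles_on H \<tau>) + card (cycles_on H (\<tau> \<circ> \<sigma>))
    \<le> card H + 2 * card (join_part H (cycles_on H \<sigma>) (cycles_on H \<tau>))"
proof -
  \<comment> \<open>Induction on a set \<open>F\<close> containing the support of \<tau>: each new
    point \<open>x\<close> costs at most one transposition.\<close>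
  have "finite F \<Longrightarrow> F \<subseteq> H \<Longrightarrow> \<tau> permutes F \<Longrightarrow>
    card (cycles_on H \<sigma>) + card (cycles_on H \<tau>) + card (cycles_on H (\<tau> \<circ> \<sigma>))
      \<le> card H + 2 * card (components H (perm_graph H \<sigma> \<union> perm_graph H \<tau>))" for F \<tau>
  proof (induction F arbitrary: \<tau> rule: finite_induct)
    case empty
    then have t: "\<tau> = id" by simp
    have "components H (perm_graph H \<sigma> \<union> perm_graph H id) = cycles_on H \<sigma>"
      unfolding join_cycles_eq_components[OF fin \<sigma> permutes_id, symmetric]
    proof (rule refines_asym)
      note pc = partition_on_cycles[OF fin \<sigma>] partition_on_cycles[OF fin permutes_id]
      show "refines H (cycles_on H \<sigma>) (join_part H (cycles_on H \<sigma>) (cycles_on H id))" by (rule refines_join_part(1)[OF pc])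
      have "refines H (cycles_on H id) (cycles_on H \<sigma>)" using refines_cycles_iff[OF fin permutes_id] pc(1) by simp
      then show "refines H (join_part H (cycles_on H \<sigma>) (cycles_on H id)) (cycles_on H \<sigma>)"
        by (intro join_part_least refines_refl[OF pc(1)])
    qed
    then show ?case unfolding t by (simp only: id_o card_cycles_id)
  next
    case (insert x F)
    obtain b p where bp: "\<tau> = Transposition.transpose x b \<circ> p" "b \<in> insert x F" "p permutes F"
    proof
      show "\<tau> = Transposition.transpose x (\<tau> x) \<circ> (Transposition.transpose x (\<tau> x) \<circ> \<tau>)" by (simp add: o_assoc)
      show "\<tau> x \<in> insert x F" using permutes_in_image[OF insert.prems(2), of x] by blast
      show "Transposition.transpose x (\<tau> x) \<circ> \<tau> permutes F" by (rule permutes_insert_lemma[OF insert.prems(2)])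
    qed
    have FH: "F \<subseteq> H" "x \<in> H" "b \<in> H" using insert.prems(1) bp(2) by auto
    have pH: "p permutes H" by (rule permutes_subset[OF bp(3) FH(1)])
    have tH: "\<tau> permutes H" unfolding bp(1) by (rule permutes_compose[OF pH permutes_swap_id[OF FH(2,3)]])
    note IH = insert.IH[OF FH(1) bp(3)]
    show ?case
    proof (cases "b = x")
      case True
      then have "\<tau> = p" using bp(1) by simp
      then show ?thesis using IH by simp
    next
      case False
      have px: "p x = x" using permutes_not_in[OF bp(3) insert.hyps(2)] .
      have "orbit p x = {x}" using px by (simp add: orbit_eq_singleton_iff)
      then have ns: "\<not> in_same (cycles_on H p) x b" using False by (simp add: in_same_cycle[OF fin pH])
      have c1: "card (cycles_on H p) = Suc (card (cycles_on H \<tau>))"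
        unfolding bp(1) by (rule card_cycles_transpose(2)[OF fin pH FH(2,3) ns])
      let ?R = "perm_graph H \<sigma> \<union> perm_graph H p" and ?R' = "perm_graph H \<sigma> \<union> perm_graph H \<tau>"
      have R: "?R \<subseteq> H \<times> H" "?R' \<subseteq> H \<times> H" using perm_graph_subset[OF \<sigma>] perm_graph_subset[OF pH] perm_graph_subset[OF tH] by blast+
      have "in_same (cycles_on H \<tau>) x b"
        unfolding bp(1) using \<open>orbit p x = {x}\<close> False by (intro orbit_transpose_merge[OF fin pH FH(2,3)]) simp
      then have "in_same (join_part H (cycles_on H \<sigma>) (cycles_on H \<tau>)) x b"
        using in_same_refines[OF refines_join_part(2)[OF partition_on_cycles[OF fin \<sigma>] partition_on_cycles[OF fin tH]]] by blast
      then have "in_same (components H ?R') x b" by (simp add: join_cycles_eq_components[OF fin \<sigma> tH])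
      then have "components H ?R' = components H (insert (x, b) ?R')" by (rule card_components_insert(1)[OF fin R(2) FH(2,3), symmetric])
      also have "\<dots> = components H (insert (x, b) ?R)"
        unfolding bp(1) by (rule components_transpose[OF fin pH FH(2,3) perm_graph_subset[OF \<sigma>]])
      finally have e: "components H ?R' = components H (insert (x, b) ?R)" .
      have ps: "p \<circ> \<sigma> permutes H" by (rule permutes_compose[OF \<sigma> pH])
      have ts: "\<tau> \<circ> \<sigma> = Transposition.transpose x b \<circ> (p \<circ> \<sigma>)" by (simp add: bp(1) comp_assoc)
      show ?thesis
      proof (cases "in_same (components H ?R) x b")
        case True
        have "card (components H ?R') = card (components H ?R)" using e card_components_insert(1)[OF fin R(1) FH(2,3) True] by simp
        moreover have "card (cycles_on H (\<tau> \<circ> \<sigma>)) \<le> card (cycles_on H (p \<circ> \<sigma>)) + 1"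
          unfolding ts by (rule card_cycles_transpose(1)[OF fin ps FH(2,3)])
        ultimately show ?thesis using IH c1 by linarith
      next
        case nsj: False
        \<comment> \<open>Each cycle of the product stays within a joint component of \<sigma> and
          \<open>p\<close>, so points in different components lie in different cycles. Joining two
          components therefore costs a cycle of the product too.\<close>
        have rf: "refines H (cycles_on H (p \<circ> \<sigma>)) (components H ?R)"
          unfolding cycles_eq_components[OF fin ps]
        proof (rule components_least[OF perm_graph_subset[OF ps] partition_on_components[OF R(1)]])
          fix y z assume "(y, z) \<in> perm_graph H (p \<circ> \<sigma>)"
          then have yz: "y \<in> H" "z = p (\<sigma> y)" by (auto simp: perm_graph_def)
          have "in_same (components H ?R) y (\<sigma> y)" using yz by (intro edge_in_same_components[OF R(1)]) (auto simp: perm_graph_def)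
          moreover have "in_same (components H ?R) (\<sigma> y) z"
            using yz permutes_in_image[OF \<sigma>] by (intro edge_in_same_components[OF R(1)]) (auto simp: perm_graph_def)
          ultimately show "in_same (components H ?R) y z" by (rule in_same_trans[OF partition_on_components[OF R(1)]])
        qed
        have "\<not> in_same (cycles_on H (p \<circ> \<sigma>)) x b" using nsj in_same_refines[OF rf, of x b] by blast
        then have "card (cycles_on H (p \<circ> \<sigma>)) = Suc (card (cycles_on H (\<tau> \<circ> \<sigma>)))"
          unfolding ts by (rule card_cycles_transpose(2)[OF fin ps FH(2,3)])
        moreover have "card (components H ?R) = Suc (card (components H ?R'))"
          unfolding e by (rule card_components_insert(2)[OF fin R(1) FH(2,3) nsj])
        ultimately show ?thesis using IH c1 by linarith
      qed
    qed
  qed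
  then show ?thesis using fin \<tau> by (simp add: join_cycles_eq_components[OF fin \<sigma> \<tau>])
qed

text \<open>Take a largest set \<open>S\<close> that contains a family \<open>F\<close> of
  hyperedges for which the bound holds. As long as \<open>S\<close> is not all of \<open>V\<close>,
  connectedness provides a hyperedge that meets \<open>S\<close> and leaves it; adding it gains at
  most its size minus one vertices, against maximality. Hyperedges are indexed by \<open>R\<close>,
  so repeated ones count with multiplicity.\<close>

lemma connected_hypergraph_card:
  assumes V: "finite V" "V \<noteq> {}" and R: "finite R" and I: "\<And>r. r \<in> R \<Longrightarrow> I r \<subseteq> V"
    and conn: "\<And>S. S \<subseteq> V \<Longrightarrow> S \<noteq> {} \<Longrightarrow> (\<And>r. r \<in> R \<Longrightarrow> I r \<inter> S \<noteq> {} \<Longrightarrow> I r \<subseteq> S) \<Longrightarrow> S = V"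
  shows "card V \<le> 1 + (\<Sum>r\<in>R. card (I r) - 1)"
proof -
  define \<S> where "\<S> = {S. S \<subseteq> V \<and> S \<noteq> {} \<and> (\<exists>F\<subseteq>R. (\<forall>r\<in>F. I r \<subseteq> S) \<and> card S \<le> 1 + (\<Sum>r\<in>F. card (I r) - 1))}"
  have finS: "finite \<S>" by (rule finite_subset[of _ "Pow V"]) (use V in \<open>auto simp: \<S>_def\<close>)
  obtain v where v: "v \<in> V" using V by blast
  \<comment> \<open>A single vertex without hyperedges satisfies the bound, so the maximum
    exists.\<close>
  have "{v} \<in> \<S>" unfolding \<S>_def using v by (auto intro!: exI[of _ "{}"])
  then have ne: "\<S> \<noteq> {}" by blast
  have "Max (card ` \<S>) \<in> card ` \<S>" using finS ne by (intro Max_in) auto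
  then obtain S where S: "S \<in> \<S>" "card S = Max (card ` \<S>)" by auto
  have mx: "card T \<le> card S" if "T \<in> \<S>" for T unfolding S(2) using that finS by (intro Max_ge) auto
  obtain F where F: "F \<subseteq> R" "\<forall>r\<in>F. I r \<subseteq> S" "card S \<le> 1 + (\<Sum>r\<in>F. card (I r) - 1)" and SV: "S \<subseteq> V" "S \<noteq> {}"
    using S(1) by (auto simp: \<S>_def)
  have finF: "finite F" using F(1) R finite_subset by blast
  have finS': "finite S" using SV V finite_subset by blast
  have "S = V"
  proof (rule conn[OF SV])
    fix r assume r: "r \<in> R" "I r \<inter> S \<noteq> {}"
    show "I r \<subseteq> S"
    proof (rule ccontr)
      assume n: "\<not> I r \<subseteq> S"
      have finI: "finite (I r)" using I[OF r(1)] V finite_subset by blast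
      have rF: "r \<notin> F" using F(2) n by blast
      have "card (S \<union> I r) + card (S \<inter> I r) = card S + card (I r)" using finS' finI card_Un_Int by fastforce
      moreover have "card (S \<inter> I r) \<ge> 1" using r(2) finS' by (simp add: Suc_le_eq card_gt_0_iff Int_commute)
      ultimately have c: "card (S \<union> I r) \<le> card S + (card (I r) - 1)" by linarith
      have "S \<union> I r \<in> \<S>"
        unfolding \<S>_def mem_Collect_eq
      proof (intro conjI exI[of _ "insert r F"])
        show "card (S \<union> I r) \<le> 1 + (\<Sum>r\<in>insert r F. card (I r) - 1)" using c F(3) rF finF by simp
      qed (use SV I r(1) F in auto)
      then have "card (S \<union> I r) \<le> card S" by (rule mx)
      then have "S \<union> I r = S" using card_subset_eq[of "S \<union> I r" S] finS' finI card_mono[of "S \<union> I r" S] by (metis Un_upper1 finite_UnI le_antisym)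
      then show False using n by blast
    qed
  qed
  then show ?thesis using F(3) sum_mono2[OF R F(1), of "\<lambda>r. card (I r) - 1"] by simp
qed

text \<open>A nonempty proper \<open>U\<close> that is a union of blocks of both partitions gives
  the common upper bound {U, A - U}; conversely every block of the join is saturated for
  both.\<close>

lemma join_top_iff_saturated:
  assumes ne: "A \<noteq> {}" and p: "partition_on A \<pi>" "partition_on A \<rho>"
  shows "join_part A \<pi> \<rho> = {A} \<longleftrightarrow>
    (\<forall>U\<subseteq>A. U \<noteq> {} \<and> (\<forall>X\<in>\<pi> \<union> \<rho>. X \<inter> U \<noteq> {} \<longrightarrow> X \<subseteq> U) \<longrightarrow> U = A)"
proof
  assume j: "join_part A \<pi> \<rho> = {A}"
  show "\<forall>U\<subseteq>A. U \<noteq> {} \<and> (\<forall>X\<in>\<pi> \<union> \<rho>. X \<inter> U \<noteq> {} \<longrightarrow> X \<subseteq> U) \<longrightarrow> U = A"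
  proof (intro allI impI, rule ccontr)
    fix U assume U: "U \<subseteq> A" "U \<noteq> {} \<and> (\<forall>X\<in>\<pi> \<union> \<rho>. X \<inter> U \<noteq> {} \<longrightarrow> X \<subseteq> U)" "U \<noteq> A"
    have q: "partition_on A {U, A - U}" using U by (auto simp: partition_on_def disjoint_def)
    have "\<exists>Y\<in>{U, A - U}. X \<subseteq> Y" if "X \<in> \<pi> \<union> \<rho>" for X
    proof -
      have "X \<subseteq> A" using that partition_on_subset[OF p(1)] partition_on_subset[OF p(2)] by blast
      then show ?thesis using U(2) that by (cases "X \<inter> U = {}") auto
    qed
    then have "refines A \<pi> {U, A - U}" "refines A \<rho> {U, A - U}" using p q by (auto simp: refines_def)
    then have "{U, A - U} = {A}" using j join_part_eq_top_iff[OF ne p] by blast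
    then show False using U by blast
  qed
next
  assume s: "\<forall>U\<subseteq>A. U \<noteq> {} \<and> (\<forall>X\<in>\<pi> \<union> \<rho>. X \<inter> U \<noteq> {} \<longrightarrow> X \<subseteq> U) \<longrightarrow> U = A"
  let ?J = "join_part A \<pi> \<rho>"
  note r = refines_join_part[OF p]
  have pj: "partition_on A ?J" using r by (simp add: refines_def)
  have all: "Y = A" if Y: "Y \<in> ?J" for Y
  proof -
    have "X \<subseteq> Y" if X: "X \<in> \<pi> \<union> \<rho>" "X \<inter> Y \<noteq> {}" for X
    proof -
      obtain Z where Z: "Z \<in> ?J" "X \<subseteq> Z" using X(1) r unfolding refines_def by blast
      obtain x where "x \<in> X" "x \<in> Y" using X(2) by blast
      then have "Z = Y" using partition_on_same_block[OF pj Z(1) Y, of x] Z(2) by blast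
      then show ?thesis using Z by simp
    qed
    then have "\<forall>X\<in>\<pi> \<union> \<rho>. X \<inter> Y \<noteq> {} \<longrightarrow> X \<subseteq> Y" by blast
    with partition_on_nonempty[OF pj Y] show ?thesis
      using s[THEN spec, THEN mp, OF partition_on_subset[OF pj Y]] by simp
  qed
  moreover have "?J \<noteq> {}" using pj ne by (auto simp: partition_on_def)
  ultimately show "?J = {A}" by blast
qed

text \<open>The hyperedge that \<open>K\<close> spans on the vertex set \<pi>; with these hyperedges
  a trivial join becomes connectedness of a hypergraph.\<close>

definition blocks_meeting :: "'a set set \<Rightarrow> 'a set \<Rightarrow> 'a set set" where
  "blocks_meeting \<pi> K = {G\<in>\<pi>. K \<inter> G \<noteq> {}}"

text \<open>A saturated set of points is a union of blocks of \<pi>, hence corresponds to a set of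
  vertices closed under hyperedges.\<close>

lemma join_top_iff_hypergraph:
  assumes ne: "A \<noteq> {}" and p: "partition_on A \<rho>" "partition_on A \<pi>"
  shows "join_part A \<rho> \<pi> = {A} \<longleftrightarrow>
    (\<forall>S\<subseteq>\<pi>. S \<noteq> {} \<and> (\<forall>K\<in>\<rho>. blocks_meeting \<pi> K \<inter> S \<noteq> {} \<longrightarrow> blocks_meeting \<pi> K \<subseteq> S) \<longrightarrow> S = \<pi>)"
  unfolding join_top_iff_saturated[OF ne p]
proof
  assume s: "\<forall>U\<subseteq>A. U \<noteq> {} \<and> (\<forall>X\<in>\<rho> \<union> \<pi>. X \<inter> U \<noteq> {} \<longrightarrow> X \<subseteq> U) \<longrightarrow> U = A"
  show "\<forall>S\<subseteq>\<pi>. S \<noteq> {} \<and> (\<forall>K\<in>\<rho>. blocks_meeting \<pi> K \<inter> S \<noteq> {} \<longrightarrow> blocks_meeting \<pi> K \<subseteq> S) \<longrightarrow> S = \<pi>"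
  proof (intro allI impI)
    fix S assume S: "S \<subseteq> \<pi>" "S \<noteq> {} \<and> (\<forall>K\<in>\<rho>. blocks_meeting \<pi> K \<inter> S \<noteq> {} \<longrightarrow> blocks_meeting \<pi> K \<subseteq> S)"
    have 1: "\<Union>S \<subseteq> A" using S(1) partition_on_subset[OF p(2)] by blast
    have 2: "\<Union>S \<noteq> {}" using S partition_on_nonempty[OF p(2)] by blast
    have 3: "X \<subseteq> \<Union>S" if X: "X \<in> \<rho>" "X \<inter> \<Union>S \<noteq> {}" for X
    proof
      fix x assume x: "x \<in> X"
      have "blocks_meeting \<pi> X \<inter> S \<noteq> {}" using X(2) S(1) by (auto simp: blocks_meeting_def)
      then have m: "blocks_meeting \<pi> X \<subseteq> S" using S X(1) by blast
      have "x \<in> A" using x partition_on_subset[OF p(1) X(1)] by blast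
      then obtain G where "G \<in> \<pi>" "x \<in> G" using partition_on_ex[OF p(2)] by blast
      then show "x \<in> \<Union>S" using m x by (auto simp: blocks_meeting_def)
    qed
    have 4: "X \<subseteq> \<Union>S" if X: "X \<in> \<pi>" "X \<inter> \<Union>S \<noteq> {}" for X
    proof -
      obtain x G where "x \<in> X" "x \<in> G" "G \<in> S" using X(2) by blast
      then have "X = G" using partition_on_same_block[OF p(2) X(1), of G x] S(1) by blast
      then show ?thesis using \<open>G \<in> S\<close> by blast
    qed
    have "\<forall>X\<in>\<rho> \<union> \<pi>. X \<inter> \<Union>S \<noteq> {} \<longrightarrow> X \<subseteq> \<Union>S" using 3 4 by (metis UnE)
    then have U: "\<Union>S = A" by (rule s[THEN spec, THEN mp, OF 1, THEN mp, OF conjI[OF 2]])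
    have "G \<in> S" if G: "G \<in> \<pi>" for G
    proof -
      obtain x where x: "x \<in> G" using partition_on_nonempty[OF p(2) G] by blast
      then have "x \<in> \<Union>S" using U partition_on_subset[OF p(2) G] by blast
      then obtain G' where "G' \<in> S" "x \<in> G'" by blast
      then have "G = G'" using partition_on_same_block[OF p(2) G, of G' x] S(1) x by blast
      then show ?thesis using \<open>G' \<in> S\<close> by simp
    qed
    then show "S = \<pi>" using S(1) by blast
  qed
next
  assume s: "\<forall>S\<subseteq>\<pi>. S \<noteq> {} \<and> (\<forall>K\<in>\<rho>. blocks_meeting \<pi> K \<inter> S \<noteq> {} \<longrightarrow> blocks_meeting \<pi> K \<subseteq> S) \<longrightarrow> S = \<pi>"
  show "\<forall>U\<subseteq>A. U \<noteq> {} \<and> (\<forall>X\<in>\<rho> \<union> \<pi>. X \<inter> U \<noteq> {} \<longrightarrow> X \<subseteq> U) \<longrightarrow> U = A"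
  proof (intro allI impI)
    fix U assume U: "U \<subseteq> A" "U \<noteq> {} \<and> (\<forall>X\<in>\<rho> \<union> \<pi>. X \<inter> U \<noteq> {} \<longrightarrow> X \<subseteq> U)"
    let ?S = "{G\<in>\<pi>. G \<inter> U \<noteq> {}}"
    obtain x where x: "x \<in> U" "x \<in> A" using U by blast
    then obtain G where "G \<in> \<pi>" "x \<in> G" using partition_on_ex[OF p(2)] by blast
    then have ne': "?S \<noteq> {}" using x by blast
    have "blocks_meeting \<pi> K \<subseteq> ?S" if K: "K \<in> \<rho>" "blocks_meeting \<pi> K \<inter> ?S \<noteq> {}" for K
    proof -
      obtain G where G: "G \<in> \<pi>" "K \<inter> G \<noteq> {}" "G \<inter> U \<noteq> {}" using K(2) by (auto simp: blocks_meeting_def)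
      then have "G \<subseteq> U" using U(2) by blast
      then have "K \<inter> U \<noteq> {}" using G(2) by blast
      then have "K \<subseteq> U" using U(2) K(1) by blast
      then show ?thesis by (auto simp: blocks_meeting_def)
    qed
    then have "\<forall>K\<in>\<rho>. blocks_meeting \<pi> K \<inter> ?S \<noteq> {} \<longrightarrow> blocks_meeting \<pi> K \<subseteq> ?S" by blast
    moreover have "?S \<subseteq> \<pi>" by blast
    ultimately have "?S = \<pi>" using s[THEN spec, of ?S] ne' by simp
    have "G \<subseteq> U" if G: "G \<in> \<pi>" for G
    proof -
      have "G \<inter> U \<noteq> {}" using G \<open>?S = \<pi>\<close> by auto
      then show ?thesis using U(2) G by blast
    qed
    then show "U = A" using U(1) p(2) by (auto simp: partition_on_def)
  qed
qed

section \<open>Counting blocks: nonpositivity of the exponent\<close>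

lemma sum_card_blocks:
  assumes fin: "finite H" and r: "refines H \<beta> \<rho>"
  shows "(\<Sum>K\<in>\<rho>. card {b\<in>\<beta>. b \<subseteq> K}) = card \<beta>"
proof -
  have pb: "partition_on H \<beta>" and pr: "partition_on H \<rho>" using r by (auto simp: refines_def)
  have U: "\<beta> = (\<Union>K\<in>\<rho>. {b\<in>\<beta>. b \<subseteq> K})" using r unfolding refines_def by blast
  have "{b\<in>\<beta>. b \<subseteq> K} \<inter> {b\<in>\<beta>. b \<subseteq> L} = {}" if KL: "K \<in> \<rho>" "L \<in> \<rho>" "K \<noteq> L" for K L
  proof -
    have False if b: "b \<in> \<beta>" "b \<subseteq> K" "b \<subseteq> L" for b
    proof -
      obtain x where "x \<in> b" using partition_on_nonempty[OF pb b(1)] by blast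
      then show False using partition_on_same_block[OF pr KL(1,2), of x] b KL(3) by blast
    qed
    then show ?thesis by blast
  qed
  then have "card (\<Union>K\<in>\<rho>. {b\<in>\<beta>. b \<subseteq> K}) = (\<Sum>K\<in>\<rho>. card {b\<in>\<beta>. b \<subseteq> K})"
    using finite_elements[OF fin pr] finite_elements[OF fin pb] by (intro card_UN_disjoint) auto
  then show ?thesis using U by simp
qed

lemma refines_nonempty_blocks:
  assumes r: "refines H \<beta> \<rho>" and K: "K \<in> \<rho>" and x: "x \<in> K"
  shows "\<exists>b\<in>\<beta>. b \<subseteq> K \<and> x \<in> b"
proof -
  have pb: "partition_on H \<beta>" and pr: "partition_on H \<rho>" using r by (auto simp: refines_def)
  have "x \<in> H" using partition_on_subset[OF pr K] x by blast
  then obtain b where b: "b \<in> \<beta>" "x \<in> b" using partition_on_ex[OF pb] by blast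
  then obtain L where L: "L \<in> \<rho>" "b \<subseteq> L" using r unfolding refines_def by blast
  then have "L = K" using partition_on_same_block[OF pr L(1) K _ x] b by blast
  then show ?thesis using b L by blast
qed

text \<open>Every block of \<rho> contains a block of \<beta>, so the truncated subtraction is
  exact.\<close>

lemma sum_card_blocks_minus:
  assumes fin: "finite H" and r: "refines H \<beta> \<rho>"
  shows "(\<Sum>K\<in>\<rho>. card {b\<in>\<beta>. b \<subseteq> K} - 1) + card \<rho> = card \<beta>"
proof -
  have pb: "partition_on H \<beta>" and pr: "partition_on H \<rho>" using r by (auto simp: refines_def)
  have pos: "card {b\<in>\<beta>. b \<subseteq> K} \<ge> 1" if K: "K \<in> \<rho>" for K
  proof -
    obtain x where "x \<in> K" using partition_on_nonempty[OF pr K] by blast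
    then obtain b where "b \<in> \<beta>" "b \<subseteq> K" using refines_nonempty_blocks[OF r K] by blast
    then have "{b\<in>\<beta>. b \<subseteq> K} \<noteq> {}" by blast
    then show ?thesis using finite_elements[OF fin pb] by (simp add: Suc_le_eq card_gt_0_iff)
  qed
  have "(\<Sum>K\<in>\<rho>. card {b\<in>\<beta>. b \<subseteq> K} - 1) + card \<rho> = (\<Sum>K\<in>\<rho>. (card {b\<in>\<beta>. b \<subseteq> K} - 1) + 1)"
    unfolding sum.distrib by simp
  also have "\<dots> = (\<Sum>K\<in>\<rho>. card {b\<in>\<beta>. b \<subseteq> K})" using pos by (intro sum.cong refl le_add_diff_inverse2)
  finally show ?thesis using sum_card_blocks[OF fin r] by simp
qed

text \<open>A block of \<pi> that meets \<open>K\<close> shares with it a whole block of \<beta>,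
  since both are unions of such; different blocks of \<pi> receive different ones.\<close>

lemma card_blocks_meeting_le:
  assumes fin: "finite H" and r: "refines H \<beta> \<rho>" "refines H \<beta> \<pi>" and K: "K \<in> \<rho>"
  shows "card (blocks_meeting \<pi> K) \<le> card {b\<in>\<beta>. b \<subseteq> K}"
proof -
  have pb: "partition_on H \<beta>" and pr: "partition_on H \<rho>" and pp: "partition_on H \<pi>" using r by (auto simp: refines_def)
  have "\<forall>G\<in>blocks_meeting \<pi> K. \<exists>b. b \<in> \<beta> \<and> b \<subseteq> K \<and> b \<subseteq> G"
  proof
    fix G assume "G \<in> blocks_meeting \<pi> K"
    then obtain x where G: "G \<in> \<pi>" and x: "x \<in> K" "x \<in> G" by (auto simp: blocks_meeting_def)
    obtain b where b: "b \<in> \<beta>" "b \<subseteq> K" "x \<in> b" using refines_nonempty_blocks[OF r(1) K x(1)] by blast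
    obtain b' where b': "b' \<in> \<beta>" "b' \<subseteq> G" "x \<in> b'" using refines_nonempty_blocks[OF r(2) G x(2)] by blast
    have "b = b'" using partition_on_same_block[OF pb b(1) b'(1) b(3) b'(3)] .
    then show "\<exists>b. b \<in> \<beta> \<and> b \<subseteq> K \<and> b \<subseteq> G" using b b' by blast
  qed
  then obtain h where h: "\<And>G. G \<in> blocks_meeting \<pi> K \<Longrightarrow> h G \<in> \<beta> \<and> h G \<subseteq> K \<and> h G \<subseteq> G" by metis
  have "inj_on h (blocks_meeting \<pi> K)"
  proof (rule inj_onI)
    fix G G' assume G: "G \<in> blocks_meeting \<pi> K" "G' \<in> blocks_meeting \<pi> K" "h G = h G'"
    obtain x where "x \<in> h G" using h[OF G(1)] partition_on_nonempty[OF pb] by blast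
    then have "x \<in> G" "x \<in> G'" using h[OF G(1)] h[OF G(2)] G(3) by auto
    then show "G = G'" using partition_on_same_block[OF pp, of G G' x] G by (auto simp: blocks_meeting_def)
  qed
  moreover have "h ` blocks_meeting \<pi> K \<subseteq> {b\<in>\<beta>. b \<subseteq> K}" using h by blast
  moreover have "finite {b\<in>\<beta>. b \<subseteq> K}" using finite_elements[OF fin pb] by simp
  ultimately show ?thesis by (rule card_inj_on_le)
qed

text \<open>The blocks of \<rho> span a connected hypergraph on \<pi>, so #(\<pi>) - 1 is at most
  the sum of hyperedge sizes minus one. Replacing each hyperedge size by the number of blocks of
  \<beta> in \<open>K\<close> only increases the sum, to #(\<beta>) - #(\<rho>).\<close>

lemma card_join_top:
  assumes fin: "finite H" "H \<noteq> {}" and r: "refines H \<beta> \<rho>" "refines H \<beta> \<pi>" and j: "join_part H \<rho> \<pi> = {H}"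
  shows "card \<pi> + card \<rho> \<le> card \<beta> + 1"
    "card \<pi> \<le> 1 + (\<Sum>K\<in>\<rho>. card (blocks_meeting \<pi> K) - 1)"
proof -
  have pb: "partition_on H \<beta>" and pr: "partition_on H \<rho>" and pp: "partition_on H \<pi>" using r by (auto simp: refines_def)
  have ne: "\<pi> \<noteq> {}" using pp fin by (auto simp: partition_on_def)
  show 2: "card \<pi> \<le> 1 + (\<Sum>K\<in>\<rho>. card (blocks_meeting \<pi> K) - 1)"
  proof (rule connected_hypergraph_card[OF finite_elements[OF fin(1) pp] ne finite_elements[OF fin(1) pr]])
    show "blocks_meeting \<pi> K \<subseteq> \<pi>" for K by (auto simp: blocks_meeting_def)
    fix S assume "S \<subseteq> \<pi>" "S \<noteq> {}" "\<And>K. K \<in> \<rho> \<Longrightarrow> blocks_meeting \<pi> K \<inter> S \<noteq> {} \<Longrightarrow> blocks_meeting \<pi> K \<subseteq> S"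
    then show "S = \<pi>" using j join_top_iff_hypergraph[OF fin(2) pr pp] by blast
  qed
  also have "(\<Sum>K\<in>\<rho>. card (blocks_meeting \<pi> K) - 1) \<le> (\<Sum>K\<in>\<rho>. card {b\<in>\<beta>. b \<subseteq> K} - 1)"
    using card_blocks_meeting_le[OF fin(1) r] by (intro sum_mono diff_le_mono)
  finally show "card \<pi> + card \<rho> \<le> card \<beta> + 1" using sum_card_blocks_minus[OF fin(1) r(1)] by linarith
qed

text \<open>The hypergraph bound is used with \<beta> the cycles of \<sigma>; for it, connectedness
  of \<rho> with the cycles of \<tau> is passed on to the coarser \<pi>. The last inequality is the
  genus bound.\<close>

lemma exponent_nonpos:
  assumes fin: "finite H" "H \<noteq> {}" and \<sigma>: "\<sigma> permutes H" and \<tau>: "\<tau> permutes H"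
    and r: "refines H (cycles_on H \<sigma>) \<rho>" and j: "join_part H \<rho> (cycles_on H \<tau>) = {H}"
  defines "\<pi> \<equiv> join_part H (cycles_on H \<sigma>) (cycles_on H \<tau>)"
  shows "join_part H \<rho> \<pi> = {H}" "card \<pi> + card \<rho> \<le> card (cycles_on H \<sigma>) + 1"
    "card (cycles_on H \<sigma>) + card (cycles_on H \<tau>) + card (cycles_on H (\<sigma> \<circ> inv_into UNIV \<tau>)) \<le> card H + 2 * card \<pi>"
proof -
  note pc = partition_on_cycles[OF fin(1) \<sigma>] partition_on_cycles[OF fin(1) \<tau>]
  note rj = refines_join_part[OF pc, folded \<pi>_def]
  have pr: "partition_on H \<rho>" using r by (simp add: refines_def)
  have pp: "partition_on H \<pi>" using rj by (simp add: refines_def)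
  show j': "join_part H \<rho> \<pi> = {H}"
    unfolding join_part_eq_top_iff[OF fin(2) pr pp]
    using j[unfolded join_part_eq_top_iff[OF fin(2) pr pc(2)]] refines_trans[OF rj(2)] by blast
  show "card \<pi> + card \<rho> \<le> card (cycles_on H \<sigma>) + 1" by (rule card_join_top(1)[OF fin r rj(1) j'])
  \<comment> \<open>The genus inequality composes its second permutation after the first, so it is
    applied to the inverse of \<tau> followed by \<sigma>; inversion changes no cycle
    partition.\<close>
  have i: "inv_into UNIV \<tau> permutes H" by (rule permutes_inv[OF \<tau>])
  have e: "cycles_on H (inv_into UNIV \<tau>) = cycles_on H \<tau>" by (rule cycles_on_inv[OF fin(1) \<tau>])
  have "card (cycles_on H (inv_into UNIV \<tau>)) + card (cycles_on H \<sigma>) + card (cycles_on H (\<sigma> \<circ> inv_into UNIV \<tau>))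
    \<le> card H + 2 * card (join_part H (cycles_on H (inv_into UNIV \<tau>)) (cycles_on H \<sigma>))"
    by (rule genus_nonneg[OF fin(1) i \<sigma>])
  moreover have "join_part H (cycles_on H \<tau>) (cycles_on H \<sigma>) = \<pi>"
    unfolding \<pi>_def join_part_def by (simp add: Un_commute)
  ultimately show "card (cycles_on H \<sigma>) + card (cycles_on H \<tau>) + card (cycles_on H (\<sigma> \<circ> inv_into UNIV \<tau>)) \<le> card H + 2 * card \<pi>"
    by (simp add: e)
qed

section \<open>Large-dimension limits\<close>

text \<open>The powers of N here and in \<open>kappa_mset\<close> are the normalisations at the
  one-block partition, where \<open>size \<mu>\<close> is the number of cycles and
  \<open>sum_mset \<mu>\<close> the size of the ground set.\<close>

definition phi_mset :: "(nat \<Rightarrow> 'w measure) \<Rightarrow> (nat \<Rightarrow> 'w \<Rightarrow> complex Matrix.mat) \<Rightarrow> nat \<Rightarrow> nat multiset \<Rightarrow> complex" where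
  "phi_mset P B N \<mu> = of_nat N powi (int (size \<mu>) - 2) * mset_cumulant (trace_moment (P N) (B N)) \<mu>"

definition kappa_mset :: "(nat \<Rightarrow> 'w measure) \<Rightarrow> (nat \<Rightarrow> 'w \<Rightarrow> complex Matrix.mat) \<Rightarrow> nat \<Rightarrow> nat multiset \<Rightarrow> complex" where
  "kappa_mset P B N \<mu> = of_nat N powi (int (size \<mu>) + int (sum_mset \<mu>) - 2) * mset_cumulant (mset_dual_moment (P N) (B N) N) \<mu>"

definition kappa_limit :: "(nat \<Rightarrow> 'w measure) \<Rightarrow> (nat \<Rightarrow> 'w \<Rightarrow> complex Matrix.mat) \<Rightarrow> nat multiset \<Rightarrow> complex" where
  "kappa_limit P B \<mu> = lim (\<lambda>N. kappa_mset P B N \<mu>)"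

text \<open>The power of N left over when the exact formula is rewritten in normalised quantities.
  With \<pi> the join of the two cycle partitions it is the sum of #(\<sigma>) + #(\<tau>) +
  #(\<sigma> \<tau>^-1) - |H| - 2 #(\<pi>) and of 2 (#(\<pi>) + #(\<rho>) - #(\<sigma>) -
  1).\<close>

definition leading_exponent :: "'a set \<Rightarrow> ('a \<Rightarrow> 'a) \<Rightarrow> ('a \<Rightarrow> 'a) \<Rightarrow> 'a set set \<Rightarrow> int" where
  "leading_exponent H \<tau> \<sigma> \<rho> = int (card (cycles_on H \<tau>)) + int (card (cycles_on H (\<sigma> \<circ> inv_into UNIV \<tau>))) + 2 * int (card \<rho>)
    - 2 - int (card (cycles_on H \<sigma>)) - int (card H)"

definition connecting_partitions :: "'a set \<Rightarrow> ('a \<Rightarrow> 'a) \<Rightarrow> ('a \<Rightarrow> 'a) \<Rightarrow> 'a set set set" where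
  "connecting_partitions H \<tau> \<sigma> = {\<rho>. refines H (cycles_on H \<sigma>) \<rho> \<and> join_part H \<rho> (cycles_on H \<tau>) = {H}}"

lemma phi_scaled_gamma:
  assumes "\<forall>l\<in>set ls. l \<ge> 1"
  shows "phi_scaled P B (sum_list ls) (one_part (sum_list ls)) (gamma ls) N = phi_mset P B N (mset ls)"
proof -
  have c: "card (cycles_on {1..sum_list ls} (gamma ls)) = size (mset ls)"
    using cycle_type_gamma[OF assms] size_cycle_type by metis
  have "phi (P N) (B N) (one_part (sum_list ls)) (gamma ls) = mset_cumulant (trace_moment (P N) (B N)) (mset ls)"
    using joint_cumulant_eq_mset_cumulant[of "{1..sum_list ls}" "P N" "gamma ls" "B N"] cycle_type_gamma[OF assms]
    by (simp add: phi_def one_part_def)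
  then show ?thesis using c by (simp add: phi_scaled_def phi_mset_def one_part_def)
qed

lemma kappa_scaled_gamma:
  assumes "\<forall>l\<in>set ls. l \<ge> 1" "sum_list ls \<ge> 1" "fact (sum_list ls) \<le> N"
  shows "kappa_scaled P B (sum_list ls) (one_part (sum_list ls)) (gamma ls) N = kappa_mset P B N (mset ls)"
proof -
  have c: "card (cycles_on {1..sum_list ls} (gamma ls)) = size (mset ls)"
    using cycle_type_gamma[OF assms(1)] size_cycle_type by metis
  have "kappa (P N) (B N) N (sum_list ls) (one_part (sum_list ls)) (gamma ls) = mset_cumulant (mset_dual_moment (P N) (B N) N) (mset ls)"
    using kappa_one_part[OF assms(2,3) gamma_permutes[OF assms(1)]] cycle_type_gamma[OF assms(1)] by simp
  then show ?thesis using c by (simp add: kappa_scaled_def kappa_mset_def one_part_def sum_mset_sum_list)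
qed

section \<open>From limits of moments to limits of cumulants\<close>

lemma refines_top:
  assumes "H \<noteq> {}" "partition_on H \<beta>"
  shows "refines H \<beta> {H}"
  using partition_on_space[OF assms(1)] partition_on_subset[OF assms(2)] assms(2) by (auto simp: refines_def)

lemma phi_mset_convergent:
  assumes ex: "phi_limits_exist P B" and \<mu>: "\<forall>a\<in>#\<mu>. a \<ge> 1" "\<mu> \<noteq> {#}"
  shows "convergent (\<lambda>N. phi_mset P B N \<mu>)"
proof -
  let ?ls = "parts_list \<mu>"
  have "set ?ls = set_mset \<mu>" by (metis mset_parts_list set_mset_mset)
  then have ls: "\<forall>l\<in>set ?ls. l \<ge> 1" using \<mu> by simp
  obtain a where "a \<in># \<mu>" using \<mu>(2) by blast
  then have a: "a \<in> set ?ls" "a \<ge> 1" using \<open>set ?ls = _\<close> \<mu>(1) by auto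
  then have n: "sum_list ?ls \<ge> 1" using member_le_sum_list[OF a(1)] by linarith
  let ?H = "{1..sum_list ?ls}"
  have ne: "?H \<noteq> {}" using n by auto
  have g: "gamma ?ls permutes ?H" by (rule gamma_permutes[OF ls])
  have "refines ?H (cycles_on ?H (gamma ?ls)) (one_part (sum_list ?ls))"
    unfolding one_part_def by (rule refines_top[OF ne partition_on_cycles[OF _ g]]) simp
  then have "convergent (phi_scaled P B (sum_list ?ls) (one_part (sum_list ?ls)) (gamma ?ls))"
    using ex g unfolding phi_limits_exist_def by blast
  moreover have "phi_scaled P B (sum_list ?ls) (one_part (sum_list ?ls)) (gamma ?ls) = (\<lambda>N. phi_mset P B N \<mu>)"
    using phi_scaled_gamma[OF ls] by (intro ext) simp
  ultimately show ?thesis by simp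
qed

lemma powi_tendsto:
  fixes e :: int
  assumes "e \<le> 0"
  shows "(\<lambda>N. (of_nat N :: complex) powi e) \<longlonglongrightarrow> (if e = 0 then 1 else 0)"
proof (cases "e = 0")
  case False
  define k where "k = nat (- e) - 1"
  have e: "e = - int (Suc k)" using assms False by (simp add: k_def)
  have "(\<lambda>N. inverse (of_nat N :: complex) ^ Suc k) \<longlonglongrightarrow> 0 ^ Suc k"
    by (intro tendsto_power lim_inverse_n)
  then have "(\<lambda>N. inverse (of_nat N :: complex) ^ Suc k) \<longlonglongrightarrow> 0" by simp
  moreover have "(of_nat N :: complex) powi e = inverse (of_nat N) ^ Suc k" for N
    unfolding e power_int_minus by (simp only: power_int_of_nat power_inverse)
  ultimately show ?thesis using False by (simp only: if_False)
qed simp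

lemma leading_exponent_nonpos:
  assumes "finite H" "H \<noteq> {}" "\<sigma> permutes H" "\<tau> permutes H" "\<rho> \<in> connecting_partitions H \<tau> \<sigma>"
  shows "leading_exponent H \<tau> \<sigma> \<rho> \<le> 0"
  using exponent_nonpos(2,3)[OF assms(1-4), of \<rho>] assms(5) by (simp add: leading_exponent_def connecting_partitions_def)

text \<open>A sum of two nonpositive terms vanishes only if both do: one equation is the tree
  condition on \<rho>, the other is planarity of \<sigma>.\<close>

lemma leading_exponent_zero_iff:
  assumes "finite H" "H \<noteq> {}" "\<sigma> permutes H" "\<tau> permutes H" "\<rho> \<in> connecting_partitions H \<tau> \<sigma>"
  defines "\<pi> \<equiv> join_part H (cycles_on H \<sigma>) (cycles_on H \<tau>)"
  shows "leading_exponent H \<tau> \<sigma> \<rho> = 0 \<longleftrightarrow> card \<pi> + card \<rho> = card (cycles_on H \<sigma>) + 1 \<and>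
    card (cycles_on H \<sigma>) + card (cycles_on H \<tau>) + card (cycles_on H (\<sigma> \<circ> inv_into UNIV \<tau>)) = card H + 2 * card \<pi>"
  using exponent_nonpos(2,3)[OF assms(1-4), of \<rho>] assms(5) unfolding \<pi>_def by (auto simp: leading_exponent_def connecting_partitions_def)

lemma finite_connecting_partitions: "finite H \<Longrightarrow> finite (connecting_partitions H \<tau> \<sigma>)"
  unfolding connecting_partitions_def by (rule finite_subset[OF _ finite_refines(2)]) auto

text \<open>Cycles and points are additive over blocks, so the normalising powers in the blocks of
  \<rho> multiply to the exponent #(\<sigma>) + |H| - 2 #(\<rho>). What this leaves of the powers in
  the exact formula is \<open>leading_exponent\<close>.\<close>

lemma scaled_moment_formula:
  fixes H :: "nat set"
  assumes fin: "finite H" and ne: "H \<noteq> {}" and \<tau>: "\<tau> permutes H" and N: "fact (card H) \<le> N"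
  shows "phi_mset P B N (cycle_type H \<tau>) = (\<Sum>\<sigma> | \<sigma> permutes H. \<Sum>\<rho>\<in>connecting_partitions H \<tau> \<sigma>.
      of_nat N powi (leading_exponent H \<tau> \<sigma> \<rho>) * (\<Prod>V\<in>\<rho>. kappa_mset P B N (cycle_type V \<sigma>)))"
proof -
  let ?g = "mset_cumulant (mset_dual_moment (P N) (B N) N)"
  let ?z = "of_nat N :: complex"
  have "1 \<le> N" using N fact_ge_1 order_trans by (metis of_nat_1 of_nat_le_iff)
  then have z: "?z \<noteq> 0" by simp
  have "phi_mset P B N (cycle_type H \<tau>) = (\<Sum>\<sigma> | \<sigma> permutes H. \<Sum>\<rho>\<in>connecting_partitions H \<tau> \<sigma>.
      ?z powi (int (card (cycles_on H \<tau>)) - 2) * (?z ^ card (cycles_on H (\<sigma> \<circ> inv_into UNIV \<tau>)) * (\<Prod>V\<in>\<rho>. ?g (cycle_type V \<sigma>))))"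
    unfolding phi_mset_def exact_moment_formula[OF fin ne \<tau> N] by (simp add: sum_distrib_left size_cycle_type connecting_partitions_def)
  also have "\<dots> = (\<Sum>\<sigma> | \<sigma> permutes H. \<Sum>\<rho>\<in>connecting_partitions H \<tau> \<sigma>.
      ?z powi (leading_exponent H \<tau> \<sigma> \<rho>) * (\<Prod>V\<in>\<rho>. kappa_mset P B N (cycle_type V \<sigma>)))"
  proof (intro sum.cong refl)
    fix \<sigma> \<rho> assume "\<sigma> \<in> {\<sigma>. \<sigma> permutes H}" and "\<rho> \<in> connecting_partitions H \<tau> \<sigma>"
    then have \<sigma>: "\<sigma> permutes H" and r: "refines H (cycles_on H \<sigma>) \<rho>" by (auto simp: connecting_partitions_def)
    have p: "partition_on H \<rho>" and inv: "\<forall>V\<in>\<rho>. \<sigma> ` V = V" using r refines_cycles_iff[OF fin \<sigma>] by auto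
    let ?e = "\<lambda>V. int (card (cycles_on V \<sigma>)) + int (card V) - 2"
    have "kappa_mset P B N (cycle_type V \<sigma>) = ?z powi ?e V * ?g (cycle_type V \<sigma>)" if V: "V \<in> \<rho>" for V
    proof -
      have "V \<subseteq> H" by (rule partition_on_subset[OF p V])
      then have "finite V" "partition_on V (cycles_on V \<sigma>)"
        using fin finite_subset partition_on_cycles_invariant[OF fin \<sigma>] inv V by auto
      then show ?thesis by (simp add: kappa_mset_def size_cycle_type sum_cycle_type)
    qed
    then have "(\<Prod>V\<in>\<rho>. kappa_mset P B N (cycle_type V \<sigma>)) = (\<Prod>V\<in>\<rho>. ?z powi ?e V) * (\<Prod>V\<in>\<rho>. ?g (cycle_type V \<sigma>))"
      by (simp add: prod.distrib)
    also have "(\<Prod>V\<in>\<rho>. ?z powi ?e V) = ?z powi (\<Sum>V\<in>\<rho>. ?e V)"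
      using finite_elements[OF fin p] by (induction rule: finite_induct) (auto simp: power_int_add[OF disjI1[OF z]])
    also have "(\<Sum>V\<in>\<rho>. ?e V) = int (card (cycles_on H \<sigma>)) + int (card H) - 2 * int (card \<rho>)"
    proof -
      have "card H = (\<Sum>V\<in>\<rho>. card V)"
        using product_partition[OF p] partition_on_subset[OF p] fin finite_subset by metis
      then show ?thesis
        using card_cycles_on_sum[OF fin \<sigma> p inv] by (simp add: sum.distrib sum_subtractf)
    qed
    finally have "?z powi (leading_exponent H \<tau> \<sigma> \<rho>) * (\<Prod>V\<in>\<rho>. kappa_mset P B N (cycle_type V \<sigma>)) =
      (?z powi (leading_exponent H \<tau> \<sigma> \<rho>) * ?z powi (int (card (cycles_on H \<sigma>)) + int (card H) - 2 * int (card \<rho>))) *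
        (\<Prod>V\<in>\<rho>. ?g (cycle_type V \<sigma>))" by (simp only: mult.assoc)
    also have "?z powi (leading_exponent H \<tau> \<sigma> \<rho>) * ?z powi (int (card (cycles_on H \<sigma>)) + int (card H) - 2 * int (card \<rho>))
      = ?z powi (leading_exponent H \<tau> \<sigma> \<rho> + (int (card (cycles_on H \<sigma>)) + int (card H) - 2 * int (card \<rho>)))"
      by (rule power_int_add[OF disjI1[OF z], symmetric])
    also have "leading_exponent H \<tau> \<sigma> \<rho> + (int (card (cycles_on H \<sigma>)) + int (card H) - 2 * int (card \<rho>))
      = (int (card (cycles_on H \<tau>)) - 2) + int (card (cycles_on H (\<sigma> \<circ> inv_into UNIV \<tau>)))" by (simp add: leading_exponent_def)
    also have "?z powi \<dots> = ?z powi (int (card (cycles_on H \<tau>)) - 2) * ?z ^ card (cycles_on H (\<sigma> \<circ> inv_into UNIV \<tau>))"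
      using z by (simp add: power_int_add)
    finally show "?z powi (int (card (cycles_on H \<tau>)) - 2) * (?z ^ card (cycles_on H (\<sigma> \<circ> inv_into UNIV \<tau>)) * (\<Prod>V\<in>\<rho>. ?g (cycle_type V \<sigma>)))
      = ?z powi (leading_exponent H \<tau> \<sigma> \<rho>) * (\<Prod>V\<in>\<rho>. kappa_mset P B N (cycle_type V \<sigma>))" by (simp only: mult.assoc)
  qed
  finally show ?thesis .
qed

lemma eventually_fact_le: "\<forall>\<^sub>F N in sequentially. fact n \<le> (N::nat)"
  by (rule eventually_ge_at_top)

lemma join_top_left:
  assumes "H \<noteq> {}" "partition_on H \<beta>"
  shows "join_part H {H} \<beta> = {H}"
proof -
  have p: "partition_on H {H}" by (rule partition_on_space[OF assms(1)])
  show ?thesis unfolding join_top_iff_saturated[OF assms(1) p assms(2)] by blast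
qed

lemma top_in_connecting_partitions:
  assumes "finite H" "H \<noteq> {}" "\<sigma> permutes H" "\<tau> permutes H"
  shows "{H} \<in> connecting_partitions H \<tau> \<sigma>"
  using refines_top[OF assms(2) partition_on_cycles[OF assms(1,3)]] join_top_left[OF assms(2) partition_on_cycles[OF assms(1,4)]]
  by (simp add: connecting_partitions_def)

lemma convergent_sum_fun:
  fixes f :: "'i \<Rightarrow> nat \<Rightarrow> complex"
  assumes "\<And>i. i \<in> I \<Longrightarrow> convergent (f i)"
  shows "convergent (\<lambda>N. \<Sum>i\<in>I. f i N)"
proof (rule convergentI)
  show "(\<lambda>N. \<Sum>i\<in>I. f i N) \<longlonglongrightarrow> (\<Sum>i\<in>I. lim (f i))"
    by (intro tendsto_sum) (use assms in \<open>simp add: convergent_LIMSEQ_iff\<close>)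
qed

text \<open>The term \<open>\<rho> = {H}\<close> of the moment formula is linear in the cumulants of full size. Its limiting matrix is
  triangular with respect to the number of cycles, since exponent zero with \<open>\<sigma> \<noteq> \<tau>\<close> forces
  \<open>#(\<sigma>) < #(\<tau>)\<close>.\<close>

lemma kappa_mset_convergent:
  assumes ex: "phi_limits_exist P B" and \<mu>: "\<forall>a\<in>#\<mu>. a \<ge> 1" "\<mu> \<noteq> {#}"
  shows "convergent (\<lambda>N. kappa_mset P B N \<mu>)"
  using \<mu>
proof (induction "sum_mset \<mu>" arbitrary: \<mu> rule: less_induct)
  case less
  define n where "n = sum_mset \<mu>"
  let ?H = "{1..n}"
  obtain a where a: "a \<in># \<mu>" using less.prems(2) by blast
  then have "a \<ge> 1" "a \<le> n" using less.prems(1) by (auto simp: n_def sum_mset.remove)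
  then have n: "n \<ge> 1" by simp
  have fin: "finite ?H" and ne: "?H \<noteq> {}" using n by auto
  let ?X = "{\<sigma>. \<sigma> permutes ?H}"
  let ?\<sigma>0 = "gamma (parts_list \<mu>)"
  have s0: "?\<sigma>0 \<in> ?X" "cycle_type ?H ?\<sigma>0 = \<mu>" using gamma_parts_list[OF less.prems(1)] by (simp_all add: n_def)
  let ?v = "\<lambda>N \<sigma>. kappa_mset P B N (cycle_type ?H \<sigma>)"
  let ?A = "\<lambda>N \<tau> \<sigma>. (of_nat N :: complex) powi (leading_exponent ?H \<tau> \<sigma> {?H})"
  let ?A' = "\<lambda>\<tau> \<sigma>. if leading_exponent ?H \<tau> \<sigma> {?H} = 0 then 1 else 0 :: complex"
  let ?t = "\<lambda>N \<tau> \<sigma> \<rho>. (of_nat N :: complex) powi (leading_exponent ?H \<tau> \<sigma> \<rho>) * (\<Prod>V\<in>\<rho>. kappa_mset P B N (cycle_type V \<sigma>))"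
  \<comment> \<open>Everything except the term \<rho> = {H} goes to the right-hand side; it involves
    only cumulants of smaller total size.\<close>
  let ?b = "\<lambda>N \<tau>. phi_mset P B N (cycle_type ?H \<tau>) - (\<Sum>\<sigma>\<in>?X. \<Sum>\<rho>\<in>connecting_partitions ?H \<tau> \<sigma> - {{?H}}. ?t N \<tau> \<sigma> \<rho>)"
  have ct: "\<forall>a\<in>#cycle_type ?H \<tau>. a \<ge> 1" "cycle_type ?H \<tau> \<noteq> {#}" if \<tau>: "\<tau> permutes ?H" for \<tau>
  proof -
    note p = partition_on_cycles[OF fin \<tau>]
    show "\<forall>a\<in>#cycle_type ?H \<tau>. a \<ge> 1" using cycle_type_pos[OF fin p] by blast
    show "cycle_type ?H \<tau> \<noteq> {#}" using sum_cycle_type[OF fin p] n by auto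
  qed
  have "convergent (\<lambda>N. ?v N ?\<sigma>0)"
  proof (rule linear_system_convergent[where X = ?X and A = ?A and A' = ?A' and b = ?b and v = ?v])
    show "finite ?X" by (rule finite_permutations[OF fin])
    show "(\<lambda>N. ?A N \<tau> \<sigma>) \<longlonglongrightarrow> ?A' \<tau> \<sigma>" if "\<tau> \<in> ?X" "\<sigma> \<in> ?X" for \<tau> \<sigma>
      by (rule powi_tendsto) (rule leading_exponent_nonpos[OF fin ne _ _ top_in_connecting_partitions[OF fin ne]], use that in auto)
    show "\<forall>\<tau>\<in>?X. v \<tau> = 0" if v: "\<forall>\<tau>\<in>?X. (\<Sum>\<sigma>\<in>?X. ?A' \<tau> \<sigma> * v \<sigma>) = 0" for v
    proof
      fix \<tau> assume "\<tau> \<in> ?X"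
      then show "v \<tau> = 0"
      \<comment> \<open>In the limit, row \<tau> contains \<open>v \<tau>\<close> with coefficient 1
        and otherwise only \<open>v \<sigma>\<close> for \<sigma> with fewer cycles, already known
        to vanish.\<close>
      proof (induction "card (cycles_on ?H \<tau>)" arbitrary: \<tau> rule: less_induct)
        case (less \<tau>)
        then have \<tau>: "\<tau> permutes ?H" by simp
        have z: "?A' \<tau> \<sigma> * v \<sigma> = (if \<sigma> = \<tau> then v \<tau> else 0)" if s: "\<sigma> \<in> ?X" for \<sigma>
        proof (cases "\<sigma> = \<tau>")
          case True
          have "leading_exponent ?H \<tau> \<tau> {?H} = 0" using permutes_inv_o(1)[OF \<tau>] by (simp add: leading_exponent_def card_cycles_id)
          then show ?thesis using True by simp
        next
          case False
          have \<sigma>: "\<sigma> permutes ?H" using s by simp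
          show ?thesis
          proof (cases "leading_exponent ?H \<tau> \<sigma> {?H} = 0")
            case True
            have pm: "\<sigma> \<circ> inv_into UNIV \<tau> permutes ?H" using \<sigma> \<tau> permutes_compose permutes_inv by blast
            have "card (cycles_on ?H (\<sigma> \<circ> inv_into UNIV \<tau>)) \<noteq> card ?H"
            proof
              assume "card (cycles_on ?H (\<sigma> \<circ> inv_into UNIV \<tau>)) = card ?H"
              then have "\<sigma> \<circ> inv_into UNIV \<tau> = id" by (rule card_cycles_eq_card[OF fin pm])
              then have "\<sigma> \<circ> inv_into UNIV \<tau> \<circ> \<tau> = \<tau>" by simp
              then show False using permutes_inv_o(2)[OF \<tau>] False by (simp add: comp_assoc)
            qed
            then have "card (cycles_on ?H (\<sigma> \<circ> inv_into UNIV \<tau>)) < card ?H"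
              using card_cycles_le[OF fin, of "\<sigma> \<circ> inv_into UNIV \<tau>"] by linarith
            then have "card (cycles_on ?H \<sigma>) < card (cycles_on ?H \<tau>)" using True by (simp add: leading_exponent_def)
            then have "v \<sigma> = 0" using less.hyps s by blast
            then show ?thesis using False by simp
          qed (use False in simp)
        qed
        have "(\<Sum>\<sigma>\<in>?X. ?A' \<tau> \<sigma> * v \<sigma>) = (\<Sum>\<sigma>\<in>?X. if \<sigma> = \<tau> then v \<tau> else 0)"
          by (rule sum.cong[OF refl z])
        also have "\<dots> = v \<tau>" using finite_permutations[OF fin] \<tau> by (simp add: sum.delta)
        finally show "v \<tau> = 0" using v less.prems by auto
      qed
    qed
    show "\<forall>\<^sub>F N in sequentially. (\<Sum>\<sigma>\<in>?X. ?A N \<tau> \<sigma> * ?v N \<sigma>) = ?b N \<tau>" if t: "\<tau> \<in> ?X" for \<tau>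
      using eventually_fact_le[of "card ?H"]
    proof eventually_elim
      case (elim N)
      have \<tau>: "\<tau> permutes ?H" using t by simp
      have "phi_mset P B N (cycle_type ?H \<tau>) = (\<Sum>\<sigma>\<in>?X. \<Sum>\<rho>\<in>connecting_partitions ?H \<tau> \<sigma>. ?t N \<tau> \<sigma> \<rho>)"
        by (rule scaled_moment_formula[OF fin ne \<tau> elim])
      also have "\<dots> = (\<Sum>\<sigma>\<in>?X. ?A N \<tau> \<sigma> * ?v N \<sigma> + (\<Sum>\<rho>\<in>connecting_partitions ?H \<tau> \<sigma> - {{?H}}. ?t N \<tau> \<sigma> \<rho>))"
      proof (intro sum.cong refl)
        fix \<sigma> assume "\<sigma> \<in> ?X"
        then have \<sigma>: "\<sigma> permutes ?H" by simp
        have "(\<Sum>\<rho>\<in>connecting_partitions ?H \<tau> \<sigma>. ?t N \<tau> \<sigma> \<rho>) = ?t N \<tau> \<sigma> {?H} + (\<Sum>\<rho>\<in>connecting_partitions ?H \<tau> \<sigma> - {{?H}}. ?t N \<tau> \<sigma> \<rho>)"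
          by (rule sum.remove[OF finite_connecting_partitions[OF fin] top_in_connecting_partitions[OF fin ne \<sigma> \<tau>]])
        then show "(\<Sum>\<rho>\<in>connecting_partitions ?H \<tau> \<sigma>. ?t N \<tau> \<sigma> \<rho>) = ?A N \<tau> \<sigma> * ?v N \<sigma> + (\<Sum>\<rho>\<in>connecting_partitions ?H \<tau> \<sigma> - {{?H}}. ?t N \<tau> \<sigma> \<rho>)"
          by simp
      qed
      finally show ?case by (simp add: sum.distrib)
    qed
    show "convergent (\<lambda>N. ?b N \<tau>)" if t: "\<tau> \<in> ?X" for \<tau>
    proof (intro convergent_diff convergent_sum_fun)
      have \<tau>: "\<tau> permutes ?H" using t by simp
      show "convergent (\<lambda>N. phi_mset P B N (cycle_type ?H \<tau>))" by (rule phi_mset_convergent[OF ex ct[OF \<tau>]])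
      fix \<sigma> \<rho> assume "\<sigma> \<in> ?X" and r: "\<rho> \<in> connecting_partitions ?H \<tau> \<sigma> - {{?H}}"
      then have \<sigma>: "\<sigma> permutes ?H" by simp
      have p: "partition_on ?H \<rho>" and inv: "\<forall>V\<in>\<rho>. \<sigma> ` V = V"
        using r refines_cycles_iff[OF fin \<sigma>, of \<rho>] by (auto simp: connecting_partitions_def)
      have "convergent (\<lambda>N. kappa_mset P B N (cycle_type V \<sigma>))" if V: "V \<in> \<rho>" for V
      proof (rule less.hyps)
        have VH: "V \<subseteq> ?H" by (rule partition_on_subset[OF p V])
        \<comment> \<open>A block equal to the whole set would be the only one, but the one-block
          partition was removed. So \<open>V\<close> is smaller and the outer induction
          applies.\<close>
        have "V \<noteq> ?H"
        proof
          assume e: "V = ?H"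
          have "W = ?H" if W: "W \<in> \<rho>" for W
          proof -
            obtain x where x: "x \<in> W" using partition_on_nonempty[OF p W] by blast
            then have "x \<in> V" using partition_on_subset[OF p W] e by blast
            then show ?thesis using partition_on_same_block[OF p W V x] e by simp
          qed
          then have "\<rho> = {?H}" using V e by blast
          then show False using r by simp
        qed
        then have c: "card V < card ?H" using VH fin by (intro psubset_card_mono) auto
        have pV: "partition_on V (cycles_on V \<sigma>)" by (rule partition_on_cycles_invariant[OF fin \<sigma> VH]) (use inv V in blast)
        have finV: "finite V" using VH fin finite_subset by blast
        show "sum_mset (cycle_type V \<sigma>) < sum_mset \<mu>" using c sum_cycle_type[OF finV pV] by (simp add: n_def)
        show "\<forall>a\<in>#cycle_type V \<sigma>. a \<ge> 1" using cycle_type_pos[OF finV pV] by blast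
        have "card V > 0" using partition_on_nonempty[OF p V] finV by (simp add: card_gt_0_iff)
        then show "cycle_type V \<sigma> \<noteq> {#}" using sum_cycle_type[OF finV pV] by auto
      qed
      then have "(\<lambda>N. kappa_mset P B N (cycle_type V \<sigma>)) \<longlonglongrightarrow> lim (\<lambda>N. kappa_mset P B N (cycle_type V \<sigma>))" if "V \<in> \<rho>" for V
        using that by (simp add: convergent_LIMSEQ_iff)
      moreover have "leading_exponent ?H \<tau> \<sigma> \<rho> \<le> 0" by (rule leading_exponent_nonpos[OF fin ne \<sigma> \<tau>]) (use r in blast)
      ultimately have "(\<lambda>N. ?t N \<tau> \<sigma> \<rho>) \<longlonglongrightarrow> (if leading_exponent ?H \<tau> \<sigma> \<rho> = 0 then 1 else 0) * (\<Prod>V\<in>\<rho>. lim (\<lambda>N. kappa_mset P B N (cycle_type V \<sigma>)))"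
        by (intro tendsto_mult powi_tendsto tendsto_prod)
      then show "convergent (\<lambda>N. ?t N \<tau> \<sigma> \<rho>)" by (rule convergentI)
    qed
    show "?\<sigma>0 \<in> ?X" by (rule s0(1))
  qed
  then show ?case by (simp only: s0(2))
qed

text \<open>The multiset form agrees with the definition only from N >= n! on, which is enough for
  the limit. Convergence of \<open>kappa_mset\<close> makes \<open>kappa_limit\<close> a genuine
  limit, and the symmetry of the cumulant in its indices becomes visible.\<close>

lemma free_cumulant_eq:
  assumes ex: "phi_limits_exist P B" and ls: "\<forall>l\<in>set ls. l \<ge> 1" "ls \<noteq> []"
  shows "free_cumulant P B ls = kappa_limit P B (mset ls)"
proof -
  obtain l where l: "l \<in> set ls" using ls(2) by (metis list.set_intros(1) neq_Nil_conv)
  then have s: "sum_list ls \<ge> 1" using member_le_sum_list[OF l] ls(1) by force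
  have "convergent (\<lambda>N. kappa_mset P B N (mset ls))" by (rule kappa_mset_convergent[OF ex]) (use ls in auto)
  then have "(\<lambda>N. kappa_mset P B N (mset ls)) \<longlonglongrightarrow> kappa_limit P B (mset ls)"
    by (simp add: convergent_LIMSEQ_iff kappa_limit_def)
  moreover have "\<forall>\<^sub>F N in sequentially. kappa_mset P B N (mset ls) = kappa_scaled P B (sum_list ls) (one_part (sum_list ls)) (gamma ls) N"
    using eventually_fact_le[of "sum_list ls"] by eventually_elim (simp add: kappa_scaled_gamma[OF ls(1) s])
  ultimately have "kappa_scaled P B (sum_list ls) (one_part (sum_list ls)) (gamma ls) \<longlonglongrightarrow> kappa_limit P B (mset ls)"
    by (rule Lim_transform_eventually)
  then show ?thesis unfolding free_cumulant_def kappa_lim_def by (rule limI)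
qed

lemma moment_leading_terms:
  assumes ex: "phi_limits_exist P B" and ls: "\<forall>l\<in>set ls. l \<ge> 1" "ls \<noteq> []"
  defines "H \<equiv> {1..sum_list ls}"
  shows "moment P B ls = (\<Sum>\<sigma> | \<sigma> permutes H. \<Sum>\<rho> | \<rho> \<in> connecting_partitions H (gamma ls) \<sigma> \<and> leading_exponent H (gamma ls) \<sigma> \<rho> = 0.
      \<Prod>V\<in>\<rho>. kappa_limit P B (cycle_type V \<sigma>))"
proof -
  obtain l where l: "l \<in> set ls" using ls(2) by (metis list.set_intros(1) neq_Nil_conv)
  then have s: "sum_list ls \<ge> 1" using member_le_sum_list[OF l] ls(1) by force
  have fin: "finite H" and ne: "H \<noteq> {}" using s by (auto simp: H_def)
  let ?\<tau> = "gamma ls"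
  have \<tau>: "?\<tau> permutes H" unfolding H_def by (rule gamma_permutes[OF ls(1)])
  have ct: "cycle_type H ?\<tau> = mset ls" unfolding H_def by (rule cycle_type_gamma[OF ls(1)])
  let ?X = "{\<sigma>. \<sigma> permutes H}"
  let ?t = "\<lambda>N \<sigma> \<rho>. (of_nat N :: complex) powi (leading_exponent H ?\<tau> \<sigma> \<rho>) * (\<Prod>V\<in>\<rho>. kappa_mset P B N (cycle_type V \<sigma>))"
  let ?L = "\<Sum>\<sigma>\<in>?X. \<Sum>\<rho>\<in>connecting_partitions H ?\<tau> \<sigma>. (if leading_exponent H ?\<tau> \<sigma> \<rho> = 0 then 1 else 0) * (\<Prod>V\<in>\<rho>. kappa_limit P B (cycle_type V \<sigma>))"
  have "(\<lambda>N. \<Sum>\<sigma>\<in>?X. \<Sum>\<rho>\<in>connecting_partitions H ?\<tau> \<sigma>. ?t N \<sigma> \<rho>) \<longlonglongrightarrow> ?L"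
  proof (intro tendsto_sum tendsto_mult powi_tendsto tendsto_prod)
    fix \<sigma> \<rho> assume "\<sigma> \<in> ?X" and r: "\<rho> \<in> connecting_partitions H ?\<tau> \<sigma>"
    then have \<sigma>: "\<sigma> permutes H" by simp
    show "leading_exponent H ?\<tau> \<sigma> \<rho> \<le> 0" by (rule leading_exponent_nonpos[OF fin ne \<sigma> \<tau> r])
    fix V assume V: "V \<in> \<rho>"
    have p: "partition_on H \<rho>" and inv: "\<forall>V\<in>\<rho>. \<sigma> ` V = V"
      using r refines_cycles_iff[OF fin \<sigma>, of \<rho>] by (auto simp: connecting_partitions_def)
    have VH: "V \<subseteq> H" by (rule partition_on_subset[OF p V])
    have pV: "partition_on V (cycles_on V \<sigma>)" by (rule partition_on_cycles_invariant[OF fin \<sigma> VH]) (use inv V in blast)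
    have finV: "finite V" using VH fin finite_subset by blast
    have a: "\<forall>a\<in>#cycle_type V \<sigma>. a \<ge> 1" using cycle_type_pos[OF finV pV] by blast
    have "card V > 0" using partition_on_nonempty[OF p V] finV by (simp add: card_gt_0_iff)
    then have "cycle_type V \<sigma> \<noteq> {#}" using sum_cycle_type[OF finV pV] by auto
    then have "convergent (\<lambda>N. kappa_mset P B N (cycle_type V \<sigma>))" by (rule kappa_mset_convergent[OF ex a])
    then show "(\<lambda>N. kappa_mset P B N (cycle_type V \<sigma>)) \<longlonglongrightarrow> kappa_limit P B (cycle_type V \<sigma>)"
      by (simp add: convergent_LIMSEQ_iff kappa_limit_def)
  qed
  moreover have "\<forall>\<^sub>F N in sequentially. (\<Sum>\<sigma>\<in>?X. \<Sum>\<rho>\<in>connecting_partitions H ?\<tau> \<sigma>. ?t N \<sigma> \<rho>) =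
      phi_scaled P B (sum_list ls) (one_part (sum_list ls)) ?\<tau> N"
    using eventually_fact_le[of "card H"]
  proof eventually_elim
    case (elim N)
    have "phi_scaled P B (sum_list ls) (one_part (sum_list ls)) ?\<tau> N = phi_mset P B N (cycle_type H ?\<tau>)"
      unfolding ct by (rule phi_scaled_gamma[OF ls(1)])
    also have "\<dots> = (\<Sum>\<sigma>\<in>?X. \<Sum>\<rho>\<in>connecting_partitions H ?\<tau> \<sigma>. ?t N \<sigma> \<rho>)" by (rule scaled_moment_formula[OF fin ne \<tau> elim])
    finally show ?case by simp
  qed
  ultimately have "phi_scaled P B (sum_list ls) (one_part (sum_list ls)) ?\<tau> \<longlonglongrightarrow> ?L"
    by (rule Lim_transform_eventually)
  then have "moment P B ls = ?L" unfolding moment_def phi_lim_def by (rule limI)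
  also have "\<dots> = (\<Sum>\<sigma>\<in>?X. \<Sum>\<rho> | \<rho> \<in> connecting_partitions H ?\<tau> \<sigma> \<and> leading_exponent H ?\<tau> \<sigma> \<rho> = 0. \<Prod>V\<in>\<rho>. kappa_limit P B (cycle_type V \<sigma>))"
    by (intro sum.cong refl sum.mono_neutral_cong_right) (auto simp: finite_connecting_partitions[OF fin])
  finally show ?thesis .
qed

section \<open>Trees of blocks\<close>

text \<open>Eliminates the black vertices: the white vertices reachable from a given one form a set
  closed under hyperedges. Each black vertex is reached through one of its neighbours, which exist
  since neighbourhoods are nonempty subsets of \<open>V\<close>.\<close>

lemma incidence_connected_iff:
  assumes V: "V \<noteq> {}" and I: "\<And>I. I \<in> \<I> \<Longrightarrow> I \<subseteq> V \<and> I \<noteq> {}"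
  shows "incidence_connected V \<I> \<longleftrightarrow> (\<forall>S\<subseteq>V. S \<noteq> {} \<and> (\<forall>I\<in>\<I>. I \<inter> S \<noteq> {} \<longrightarrow> I \<subseteq> S) \<longrightarrow> S = V)"
proof
  let ?E = "incidence_edges \<I>"
  assume c: "incidence_connected V \<I>"
  show "\<forall>S\<subseteq>V. S \<noteq> {} \<and> (\<forall>I\<in>\<I>. I \<inter> S \<noteq> {} \<longrightarrow> I \<subseteq> S) \<longrightarrow> S = V"
  proof (intro allI impI)
    fix S assume S: "S \<subseteq> V" "S \<noteq> {} \<and> (\<forall>I\<in>\<I>. I \<inter> S \<noteq> {} \<longrightarrow> I \<subseteq> S)"
    obtain s where s: "s \<in> S" using S by blast
    have inv: "y \<in> Inl ` S \<union> Inr ` {I\<in>\<I>. I \<subseteq> S}" if "(Inl s, y) \<in> ?E\<^sup>*" for y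
      using that
    proof (induction rule: rtrancl_induct)
      case base then show ?case using s by simp
    next
      case (step y z)
      obtain I i where I: "I \<in> \<I>" "i \<in> I" "(y, z) = (Inl i, Inr I) \<or> (y, z) = (Inr I, Inl i)"
        using step.hyps(2) unfolding incidence_edges_def by blast
      show ?case
      proof (cases "(y, z) = (Inl i, Inr I)")
        case True
        then have "i \<in> S" using step.IH by auto
        then have "I \<subseteq> S" using S(2) I by blast
        then show ?thesis using True I by auto
      next
        case False
        then have "y = Inr I" "z = Inl i" using I(3) by auto
        then show ?thesis using step.IH I by auto
      qed
    qed
    have "v \<in> S" if v: "v \<in> V" for v
    proof -
      have "(Inl s, Inl v) \<in> ?E\<^sup>*" using c s S(1) v unfolding incidence_connected_def by blast
      from inv[OF this] show ?thesis by auto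
    qed
    then show "S = V" using S(1) by blast
  qed
next
  let ?E = "incidence_edges \<I>"
  assume s: "\<forall>S\<subseteq>V. S \<noteq> {} \<and> (\<forall>I\<in>\<I>. I \<inter> S \<noteq> {} \<longrightarrow> I \<subseteq> S) \<longrightarrow> S = V"
  have e: "(Inl i, Inr I) \<in> ?E" "(Inr I, Inl i) \<in> ?E" if "I \<in> \<I>" "i \<in> I" for I i
    using that unfolding incidence_edges_def by blast+
  have ll: "(Inl i, Inl v) \<in> ?E\<^sup>*" if iv: "i \<in> V" "v \<in> V" for i v
  proof -
    let ?S = "{v\<in>V. (Inl i, Inl v) \<in> ?E\<^sup>*}"
    have "I \<subseteq> ?S" if A: "I \<in> \<I>" "I \<inter> ?S \<noteq> {}" for I
    proof
      fix w assume w: "w \<in> I"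
      obtain u where u: "u \<in> I" "(Inl i, Inl u) \<in> ?E\<^sup>*" using A(2) by blast
      have "(Inl i, Inr I) \<in> ?E\<^sup>*" using u(2) e(1)[OF A(1) u(1)] by (rule rtrancl_into_rtrancl)
      then have "(Inl i, Inl w) \<in> ?E\<^sup>*" using e(2)[OF A(1) w] by (rule rtrancl_into_rtrancl)
      then show "w \<in> ?S" using I[OF A(1)] w by blast
    qed
    then have "\<forall>I\<in>\<I>. I \<inter> ?S \<noteq> {} \<longrightarrow> I \<subseteq> ?S" by blast
    moreover have "i \<in> ?S" using iv by simp
    moreover have "?S \<subseteq> V" by blast
    ultimately have "?S = V" using s[THEN spec, of ?S] by blast
    then show ?thesis using iv by blast
  qed
  have lr: "(Inl i, Inr I) \<in> ?E\<^sup>*" "(Inr I, Inl i) \<in> ?E\<^sup>*" if iI: "i \<in> V" "I \<in> \<I>" for i I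
  proof -
    obtain u where u: "u \<in> I" "u \<in> V" using I[OF iI(2)] by blast
    show "(Inl i, Inr I) \<in> ?E\<^sup>*" using ll[OF iI(1) u(2)] e(1)[OF iI(2) u(1)] by (rule rtrancl_into_rtrancl)
    show "(Inr I, Inl i) \<in> ?E\<^sup>*" using e(2)[OF iI(2) u(1)] ll[OF u(2) iI(1)] by (rule converse_rtrancl_into_rtrancl)
  qed
  have rr: "(Inr I, Inr J) \<in> ?E\<^sup>*" if IJ: "I \<in> \<I>" "J \<in> \<I>" for I J
  proof -
    obtain u where u: "u \<in> V" using V by blast
    show ?thesis using lr(2)[OF u IJ(1)] lr(1)[OF u IJ(2)] by (rule rtrancl_trans)
  qed
  show "incidence_connected V \<I>"
    unfolding incidence_connected_def using ll lr rr by auto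
qed

text \<open>An embedding attaches to each edge \<open>(i, I)\<close> of the tree an element of colour \<open>i\<close>, distinct edges at the
  same white vertex receiving distinct elements.\<close>

definition tree_embeddings :: "'b set \<Rightarrow> ('b \<Rightarrow> nat) \<Rightarrow> nat set set \<Rightarrow> (nat set \<Rightarrow> nat \<Rightarrow> 'b) set" where
  "tree_embeddings \<beta> lab T = {h \<in> (\<Pi>\<^sub>E I\<in>T. \<Pi>\<^sub>E i\<in>I. {b\<in>\<beta>. lab b = i}). \<forall>i. inj_on (\<lambda>I. h I i) {I\<in>T. i \<in> I}}"

text \<open>In the application the elements are cycles, \<open>lab\<close> gives the number of the
  \<pi>-block containing a cycle, and \<rho> groups cycles. Injectivity of \<open>lab\<close> makes
  the hyperedge as large as the group; injectivity of the image map excludes parallel hyperedges,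
  which a set of subsets could not record; singletons yield no black vertex, as these have valency
  at least 2.\<close>

definition tree_blocks :: "('b \<Rightarrow> nat) \<Rightarrow> nat \<Rightarrow> 'b set set \<Rightarrow> bool" where
  "tree_blocks lab k \<rho> \<longleftrightarrow> (\<forall>S\<in>\<rho>. inj_on lab S) \<and> inj_on ((`) lab) {S\<in>\<rho>. 2 \<le> card S} \<and>
    (`) lab ` {S\<in>\<rho>. 2 \<le> card S} \<in> bip_trees k"

definition embedding_blocks :: "'b set \<Rightarrow> nat set set \<Rightarrow> (nat set \<Rightarrow> nat \<Rightarrow> 'b) \<Rightarrow> 'b set set" where
  "embedding_blocks \<beta> T h = (\<lambda>I. h I ` I) ` T \<union> (\<lambda>b. {b}) ` (\<beta> - (\<Union>I\<in>T. h I ` I))"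

lemma tree_embeddings_props:
  assumes "T \<in> bip_trees k" "h \<in> tree_embeddings \<beta> lab T" "I \<in> T"
  shows "\<And>i. i \<in> I \<Longrightarrow> h I i \<in> \<beta> \<and> lab (h I i) = i" "inj_on (h I) I" "lab ` h I ` I = I" "card (h I ` I) = card I"
    "2 \<le> card I" "h I ` I \<subseteq> \<beta>" "inj_on lab (h I ` I)"
proof -
  show 1: "h I i \<in> \<beta> \<and> lab (h I i) = i" if "i \<in> I" for i
    using assms(2,3) that by (auto simp: tree_embeddings_def PiE_iff)
  show 2: "inj_on (h I) I" by (rule inj_onI) (metis 1)
  show "lab ` h I ` I = I" using 1 by (auto simp: image_image)
  show "card (h I ` I) = card I" using 2 by (rule card_image)
  show "2 \<le> card I" using assms by (auto simp: bip_trees_def)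
  show "h I ` I \<subseteq> \<beta>" using 1 by blast
  show "inj_on lab (h I ` I)" by (rule inj_onI) (use 1 in auto)
qed

text \<open>The colour of a common element identifies the white vertex, and injectivity at this
  vertex identifies the black one.\<close>

lemma tree_embeddings_disjoint:
  assumes "T \<in> bip_trees k" "h \<in> tree_embeddings \<beta> lab T" "I \<in> T" "J \<in> T" "b \<in> h I ` I" "b \<in> h J ` J"
  shows "I = J"
proof -
  obtain i j where ij: "i \<in> I" "b = h I i" "j \<in> J" "b = h J j" using assms(5,6) by blast
  have "i = j" using tree_embeddings_props(1)[OF assms(1,2,3) ij(1)] tree_embeddings_props(1)[OF assms(1,2,4) ij(3)] ij by metis
  moreover have "inj_on (\<lambda>I. h I i) {I\<in>T. i \<in> I}" using assms(2) by (simp add: tree_embeddings_def)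
  ultimately show ?thesis using ij assms(3,4) by (auto dest: inj_onD)
qed

lemma partition_on_embedding_blocks:
  assumes "T \<in> bip_trees k" "h \<in> tree_embeddings \<beta> lab T"
  shows "partition_on \<beta> (embedding_blocks \<beta> T h)"
proof (rule partition_onI)
  show "\<Union> (embedding_blocks \<beta> T h) = \<beta>" using tree_embeddings_props(6)[OF assms] by (auto simp: embedding_blocks_def)
  have "h I ` I \<noteq> {}" if "I \<in> T" for I using tree_embeddings_props(5)[OF assms that] by auto
  then show "{} \<notin> embedding_blocks \<beta> T h" by (auto simp: embedding_blocks_def)
  fix p q assume pq: "p \<in> embedding_blocks \<beta> T h" "q \<in> embedding_blocks \<beta> T h" "p \<noteq> q"
  let ?U = "\<Union>I\<in>T. h I ` I"
  have e: "(\<exists>I\<in>T. p = h I ` I) \<or> (\<exists>b\<in>\<beta> - ?U. p = {b})" if "p \<in> embedding_blocks \<beta> T h" for p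
    using that unfolding embedding_blocks_def by blast
  show "disjnt p q"
  proof (rule ccontr)
    assume "\<not> disjnt p q"
    then obtain b where b: "b \<in> p" "b \<in> q" by (auto simp: disjnt_iff)
    show False
    proof (cases "b \<in> ?U")
      case True
      then obtain I J where "I \<in> T" "p = h I ` I" "J \<in> T" "q = h J ` J" using e[OF pq(1)] e[OF pq(2)] b by blast
      then show False using tree_embeddings_disjoint[OF assms, of I J b] b pq(3) by blast
    next
      case False
      then have "p = {b}" "q = {b}" using e[OF pq(1)] e[OF pq(2)] b by blast+
      then show False using pq(3) by simp
    qed
  qed
qed

lemma embedding_blocks_large:
  assumes "T \<in> bip_trees k" "h \<in> tree_embeddings \<beta> lab T"
  shows "{S \<in> embedding_blocks \<beta> T h. 2 \<le> card S} = (\<lambda>I. h I ` I) ` T"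
  using tree_embeddings_props(4,5)[OF assms] by (auto simp: embedding_blocks_def)

lemma embedding_blocks_trees:
  assumes "T \<in> bip_trees k" "h \<in> tree_embeddings \<beta> lab T"
  shows "(`) lab ` {S \<in> embedding_blocks \<beta> T h. 2 \<le> card S} = T" "tree_blocks lab k (embedding_blocks \<beta> T h)"
proof -
  have c: "lab ` h I ` I = I" if "I \<in> T" for I by (rule tree_embeddings_props(3)[OF assms that])
  show 1: "(`) lab ` {S \<in> embedding_blocks \<beta> T h. 2 \<le> card S} = T"
    unfolding embedding_blocks_large[OF assms] image_image using c by (simp add: image_image)
  have "inj_on ((`) lab) {S \<in> embedding_blocks \<beta> T h. 2 \<le> card S}"
    unfolding embedding_blocks_large[OF assms]
  proof (rule inj_onI)
    fix X Y assume "X \<in> (\<lambda>I. h I ` I) ` T" "Y \<in> (\<lambda>I. h I ` I) ` T" "lab ` X = lab ` Y"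
    then obtain I J where "I \<in> T" "X = h I ` I" "J \<in> T" "Y = h J ` J" "lab ` h I ` I = lab ` h J ` J" by blast
    then show "X = Y" using c[of I] c[of J] by simp
  qed
  moreover have "inj_on lab S" if "S \<in> embedding_blocks \<beta> T h" for S
    using that tree_embeddings_props(7)[OF assms] by (auto simp: embedding_blocks_def)
  ultimately show "tree_blocks lab k (embedding_blocks \<beta> T h)" using 1 assms(1) by (simp add: tree_blocks_def)
qed

lemma bij_betw_embedding_blocks:
  assumes fin: "finite \<beta>"
  shows "bij_betw (\<lambda>(T, h). embedding_blocks \<beta> T h) (SIGMA T:bip_trees k. tree_embeddings \<beta> lab T)
    {\<rho>. partition_on \<beta> \<rho> \<and> tree_blocks lab k \<rho>}"
  unfolding bij_betw_def
proof
  let ?D = "SIGMA T:bip_trees k. tree_embeddings \<beta> lab T"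
  show "inj_on (\<lambda>(T, h). embedding_blocks \<beta> T h) ?D"
  proof (rule inj_onI, clarify)
    fix T h T' h'
    assume a: "T \<in> bip_trees k" "h \<in> tree_embeddings \<beta> lab T" "T' \<in> bip_trees k" "h' \<in> tree_embeddings \<beta> lab T'"
      and e: "embedding_blocks \<beta> T h = embedding_blocks \<beta> T' h'"
    have T: "T' = T" using embedding_blocks_trees(1)[OF a(1,2)] embedding_blocks_trees(1)[OF a(3,4)] e by simp
    note h' = a(4)[unfolded T]
    have "h I i = h' I i" if Ii: "I \<in> T" "i \<in> I" for I i
    proof -
      have "h I ` I \<in> (\<lambda>I. h' I ` I) ` T"
      proof -
        have "h I ` I \<in> {S \<in> embedding_blocks \<beta> T h. 2 \<le> card S}" unfolding embedding_blocks_large[OF a(1,2)] using Ii(1) by (rule imageI)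
        then show ?thesis unfolding e T embedding_blocks_large[OF a(1) h'] .
      qed
      then obtain J where J: "J \<in> T" "h I ` I = h' J ` J" by blast
      have "J = I" using tree_embeddings_props(3)[OF a(1,2) Ii(1)] tree_embeddings_props(3)[OF a(1) h' J(1)] J(2) by simp
      then obtain i' where i': "i' \<in> I" "h I i = h' I i'" using J(2) Ii(2) by blast
      have "i' = i" using tree_embeddings_props(1)[OF a(1,2) Ii] tree_embeddings_props(1)[OF a(1) h' Ii(1) i'(1)] i'(2) by simp
      then show ?thesis using i'(2) by simp
    qed
    moreover have "h I \<in> extensional I" "h' I \<in> extensional I" if "I \<in> T" for I
      using a(2) h' that by (auto simp: tree_embeddings_def PiE_iff)
    ultimately have "h I = h' I" if "I \<in> T" for I using that by (intro extensionalityI[of _ I]) auto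
    moreover have "h \<in> extensional T" "h' \<in> extensional T" using a(2) h' by (auto simp: tree_embeddings_def PiE_iff)
    ultimately have "h = h'" by (intro extensionalityI[of _ T])
    then show "T = T' \<and> h = h'" using T by simp
  qed
  show "(\<lambda>(T, h). embedding_blocks \<beta> T h) ` ?D = {\<rho>. partition_on \<beta> \<rho> \<and> tree_blocks lab k \<rho>}"
  proof
    show "(\<lambda>(T, h). embedding_blocks \<beta> T h) ` ?D \<subseteq> {\<rho>. partition_on \<beta> \<rho> \<and> tree_blocks lab k \<rho>}"
      by (auto intro: partition_on_embedding_blocks embedding_blocks_trees(2))
    show "{\<rho>. partition_on \<beta> \<rho> \<and> tree_blocks lab k \<rho>} \<subseteq> (\<lambda>(T, h). embedding_blocks \<beta> T h) ` ?D"
    proof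
      fix \<rho> assume "\<rho> \<in> {\<rho>. partition_on \<beta> \<rho> \<and> tree_blocks lab k \<rho>}"
      then have p: "partition_on \<beta> \<rho>" and t: "tree_blocks lab k \<rho>" by auto
      define L where "L = {S\<in>\<rho>. 2 \<le> card S}"
      define T where "T = (`) lab ` L"
      have inj: "inj_on ((`) lab) L" and T: "T \<in> bip_trees k" and ic: "\<And>S. S \<in> \<rho> \<Longrightarrow> inj_on lab S"
        using t by (auto simp: tree_blocks_def L_def T_def)
      define s where "s = inv_into L ((`) lab)"
      have s: "s I \<in> L" "lab ` s I = I" if "I \<in> T" for I
        using that unfolding s_def T_def by (auto simp: inv_into_into f_inv_into_f)
      have sc: "s (lab ` S) = S" if "S \<in> L" for S unfolding s_def by (rule inv_into_f_f[OF inj that])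
      define h where "h = (\<lambda>I\<in>T. \<lambda>i\<in>I. inv_into (s I) lab i)"
      have sr: "s I \<in> \<rho>" if "I \<in> T" for I using s(1)[OF that] by (simp add: L_def)
      have hi: "h I i \<in> s I" "lab (h I i) = i" if "I \<in> T" "i \<in> I" for I i
      proof -
        have "i \<in> lab ` s I" using s(2)[OF that(1)] that(2) by simp
        then show "h I i \<in> s I" "lab (h I i) = i" using that by (simp_all add: h_def inv_into_into f_inv_into_f)
      qed
      have him: "h I ` I = s I" if I: "I \<in> T" for I
      proof
        show "h I ` I \<subseteq> s I" using hi(1)[OF I] by blast
        show "s I \<subseteq> h I ` I"
        proof
          fix b assume b: "b \<in> s I"
          then have i: "lab b \<in> I" using s(2)[OF I] by blast
          have "h I (lab b) = b" using ic[OF sr[OF I]] hi[OF I i] b by (auto dest: inj_onD)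
          then show "b \<in> h I ` I" using i by (metis imageI)
        qed
      qed
      have h: "h \<in> tree_embeddings \<beta> lab T"
        unfolding tree_embeddings_def
      proof (intro CollectI conjI allI)
        show "h \<in> (\<Pi>\<^sub>E I\<in>T. \<Pi>\<^sub>E i\<in>I. {b\<in>\<beta>. lab b = i})"
        proof (rule PiE_I)
          fix I assume I: "I \<in> T"
          show "h I \<in> (\<Pi>\<^sub>E i\<in>I. {b\<in>\<beta>. lab b = i})"
          proof (rule PiE_I)
            fix i assume "i \<in> I"
            then show "h I i \<in> {b\<in>\<beta>. lab b = i}" using hi[OF I] partition_on_subset[OF p sr[OF I]] by blast
          qed (simp add: h_def I)
        qed (simp add: h_def)
        fix i show "inj_on (\<lambda>I. h I i) {I\<in>T. i \<in> I}"
        proof (rule inj_onI)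
          fix I J assume IJ: "I \<in> {I\<in>T. i \<in> I}" "J \<in> {I\<in>T. i \<in> I}" "h I i = h J i"
          then have I: "I \<in> T" "i \<in> I" and J: "J \<in> T" "i \<in> J" by auto
          have "s I = s J"
            using partition_on_same_block[OF p sr[OF I(1)] sr[OF J(1)] hi(1)[OF I]] hi(1)[OF J] IJ(3) by simp
          then have "lab ` s I = lab ` s J" by (rule arg_cong)
          then show "I = J" unfolding s(2)[OF I(1)] s(2)[OF J(1)] .
        qed
      qed
      have sT: "(\<lambda>I. h I ` I) ` T = L"
      proof
        show "(\<lambda>I. h I ` I) ` T \<subseteq> L" using him s(1) by auto
        show "L \<subseteq> (\<lambda>I. h I ` I) ` T"
        proof
          fix S assume S: "S \<in> L"
          then have "lab ` S \<in> T" by (simp add: T_def)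
          then have "h (lab ` S) ` lab ` S = S" using him sc[OF S] by simp
          then show "S \<in> (\<lambda>I. h I ` I) ` T" using \<open>lab ` S \<in> T\<close> by (intro image_eqI[of _ _ "lab ` S"]) auto
        qed
      qed
      have small: "\<exists>b. S = {b}" if S: "S \<in> \<rho>" "S \<notin> L" for S
      proof -
        have "finite S" using partition_on_subset[OF p S(1)] fin finite_subset by blast
        then have "card S \<noteq> 0" using partition_on_nonempty[OF p S(1)] by simp
        then have "card S = 1" using S by (simp add: L_def)
        then show ?thesis by (simp add: card_1_singleton_iff)
      qed
      have U: "(\<Union>I\<in>T. h I ` I) = \<Union>L" using sT by simp
      have "embedding_blocks \<beta> T h = L \<union> (\<lambda>b. {b}) ` (\<beta> - \<Union>L)" unfolding embedding_blocks_def sT U ..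
      also have "\<dots> = \<rho>"
      proof
        show "\<rho> \<subseteq> L \<union> (\<lambda>b. {b}) ` (\<beta> - \<Union>L)"
        proof
          fix S assume S: "S \<in> \<rho>"
          show "S \<in> L \<union> (\<lambda>b. {b}) ` (\<beta> - \<Union>L)"
          proof (cases "S \<in> L")
            case False
            obtain b where b: "S = {b}" using small[OF S False] by blast
            have "b \<notin> X" if X: "X \<in> L" for X
            proof
              assume "b \<in> X"
              then have "X = S" using partition_on_same_block[OF p, of X S b] X S b by (simp add: L_def)
              then show False using X False by simp
            qed
            then show ?thesis using b partition_on_subset[OF p S] by auto
          qed simp
        qed
        show "L \<union> (\<lambda>b. {b}) ` (\<beta> - \<Union>L) \<subseteq> \<rho>"
        proof
          fix S assume S: "S \<in> L \<union> (\<lambda>b. {b}) ` (\<beta> - \<Union>L)"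
          show "S \<in> \<rho>"
          proof (cases "S \<in> L")
            case False
            then obtain b where b: "b \<in> \<beta>" "b \<notin> \<Union>L" "S = {b}" using S by blast
            obtain X where X: "X \<in> \<rho>" "b \<in> X" using partition_on_ex[OF p b(1)] by blast
            then have "X \<notin> L" using b(2) by blast
            then obtain c where "X = {c}" using small X by blast
            then show ?thesis using X b by simp
          qed (simp add: L_def)
        qed
      qed
      finally have "embedding_blocks \<beta> T h = \<rho>" .
      then show "\<rho> \<in> (\<lambda>(T, h). embedding_blocks \<beta> T h) ` ?D" using T h by (intro image_eqI[of _ _ "(T, h)"]) auto
    qed
  qed
qed

lemma finite_bip_trees: "finite (bip_trees k)"
  by (rule finite_subset[of _ "Pow (Pow {1..k})"]) (auto simp: bip_trees_def)

lemma bip_trees_finite: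
  assumes "T \<in> bip_trees k"
  shows "finite T" "\<And>I. I \<in> T \<Longrightarrow> finite I \<and> I \<subseteq> {1..k} \<and> I \<noteq> {}"
proof -
  have s: "I \<subseteq> {1..k}" if "I \<in> T" for I using assms that by (auto simp: bip_trees_def)
  have "T \<subseteq> Pow {1..k}" using s by blast
  then show "finite T" by (rule finite_subset) simp
  show "finite I \<and> I \<subseteq> {1..k} \<and> I \<noteq> {}" if "I \<in> T" for I
    using s[OF that] assms that finite_subset[OF s[OF that]] by (auto simp: bip_trees_def)
qed

lemma finite_tree_embeddings: "finite \<beta> \<Longrightarrow> T \<in> bip_trees k \<Longrightarrow> finite (tree_embeddings \<beta> lab T)"
  unfolding tree_embeddings_def
  by (rule finite_subset[of _ "\<Pi>\<^sub>E I\<in>T. \<Pi>\<^sub>E i\<in>I. {b\<in>\<beta>. lab b = i}"])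
    (auto intro!: finite_PiE simp: bip_trees_finite)

lemma prod_embedding_blocks:
  assumes fin: "finite \<beta>" and Th: "T \<in> bip_trees k" "h \<in> tree_embeddings \<beta> lab T"
  shows "(\<Prod>S\<in>embedding_blocks \<beta> T h. F S) = (\<Prod>I\<in>T. F (h I ` I)) * (\<Prod>b\<in>\<beta> - (\<Union>I\<in>T. h I ` I). F {b})"
proof -
  have i: "inj_on (\<lambda>I. h I ` I) T"
  proof (rule inj_onI)
    fix I J assume IJ: "I \<in> T" "J \<in> T" "h I ` I = h J ` J"
    have "I = lab ` h I ` I" by (rule tree_embeddings_props(3)[OF Th IJ(1), symmetric])
    also have "\<dots> = lab ` h J ` J" using IJ(3) by (rule arg_cong)
    also have "\<dots> = J" by (rule tree_embeddings_props(3)[OF Th IJ(2)])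
    finally show "I = J" .
  qed
  have d: "(\<lambda>I. h I ` I) ` T \<inter> (\<lambda>b. {b}) ` (\<beta> - (\<Union>I\<in>T. h I ` I)) = {}"
  proof -
    have "h I ` I \<noteq> {b}" if "I \<in> T" for I b
    proof
      assume "h I ` I = {b}"
      then have "card (h I ` I) = 1" by simp
      then show False using tree_embeddings_props(4,5)[OF Th that] by linarith
    qed
    then show ?thesis by blast
  qed
  show ?thesis unfolding embedding_blocks_def
    using fin bip_trees_finite(1)[OF Th(1)] i d
    by (subst prod.union_disjoint) (auto simp: prod.reindex o_def)
qed

lemma sum_tree_blocks:
  fixes F :: "'b set \<Rightarrow> complex"
  assumes fin: "finite \<beta>"
  shows "(\<Sum>\<rho> | partition_on \<beta> \<rho> \<and> tree_blocks lab k \<rho>. \<Prod>S\<in>\<rho>. F S) =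
    (\<Sum>T\<in>bip_trees k. \<Sum>h\<in>tree_embeddings \<beta> lab T. (\<Prod>I\<in>T. F (h I ` I)) * (\<Prod>b\<in>\<beta> - (\<Union>I\<in>T. h I ` I). F {b}))"
proof -
  have "(\<Sum>\<rho> | partition_on \<beta> \<rho> \<and> tree_blocks lab k \<rho>. \<Prod>S\<in>\<rho>. F S)
    = (\<Sum>p\<in>(SIGMA T:bip_trees k. tree_embeddings \<beta> lab T). \<Prod>S\<in>(case p of (T, h) \<Rightarrow> embedding_blocks \<beta> T h). F S)"
    by (rule sum.reindex_bij_betw[OF bij_betw_embedding_blocks[OF fin], symmetric])
  also have "\<dots> = (\<Sum>T\<in>bip_trees k. \<Sum>h\<in>tree_embeddings \<beta> lab T. \<Prod>S\<in>embedding_blocks \<beta> T h. F S)"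
    using finite_tree_embeddings[OF fin] by (subst sum.Sigma) (auto simp: finite_bip_trees case_prod_unfold)
  also have "\<dots> = (\<Sum>T\<in>bip_trees k. \<Sum>h\<in>tree_embeddings \<beta> lab T. (\<Prod>I\<in>T. F (h I ` I)) * (\<Prod>b\<in>\<beta> - (\<Union>I\<in>T. h I ` I). F {b}))"
    by (intro sum.cong refl prod_embedding_blocks[OF fin])
  finally show ?thesis .
qed

text \<open>The values in \<open>A\<close> decouple, and each contributes the falling factorial c! /
  (c - q)!, the number of injections of the q positions of that value into the c elements of that
  value. The identity is multiplied out to stay in the naturals; induction on \<open>T\<close>
  places one position at a time.\<close>

lemma card_coloured_injections:
  fixes \<l> :: "'b \<Rightarrow> nat" and j :: "'t \<Rightarrow> nat"
  assumes "finite T" "finite \<beta>" "finite A" "j ` T \<subseteq> A"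
    and "\<And>a. a \<in> A \<Longrightarrow> card {I\<in>T. j I = a} \<le> card {b\<in>\<beta>. \<l> b = a}"
  shows "card {g \<in> T \<rightarrow>\<^sub>E \<beta>. inj_on g T \<and> (\<forall>I\<in>T. \<l> (g I) = j I)} *
      (\<Prod>a\<in>A. fact (card {b\<in>\<beta>. \<l> b = a} - card {I\<in>T. j I = a})) = (\<Prod>a\<in>A. fact (card {b\<in>\<beta>. \<l> b = a}) :: nat)"
  using assms(1,4,5)
proof (induction T rule: finite_induct)
  case empty
  have "{g. g = (\<lambda>x. undefined) \<and> inj_on g {}} = {\<lambda>x::'t. undefined::'b}" by auto
  then show ?case by simp
next
  case (insert I0 T)
  let ?c = "\<lambda>a. card {b\<in>\<beta>. \<l> b = a}" and ?q = "\<lambda>T a. card {I\<in>T. j I = a}"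
  let ?S = "\<lambda>T. {g \<in> T \<rightarrow>\<^sub>E \<beta>. inj_on g T \<and> (\<forall>I\<in>T. \<l> (g I) = j I)}"
  let ?a0 = "j I0"
  have q: "?q (insert I0 T) a = ?q T a + (if a = ?a0 then 1 else 0)" for a
  proof -
    have "{I\<in>insert I0 T. j I = a} = (if a = ?a0 then insert I0 {I\<in>T. j I = a} else {I\<in>T. j I = a})" by auto
    then show ?thesis using insert.hyps by simp
  qed
  have le: "?q T a \<le> ?c a" if "a \<in> A" for a using insert.prems(2)[OF that] q[of a] by linarith
  have lt: "?q T ?a0 < ?c ?a0" using insert.prems(2)[of ?a0] insert.prems(1) q[of ?a0] by simp
  have IH: "card (?S T) * (\<Prod>a\<in>A. fact (?c a - ?q T a)) = (\<Prod>a\<in>A. fact (?c a))"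
    using insert.IH insert.prems(1) le by simp
  have finS: "finite (?S T)"
    by (rule finite_subset[of _ "T \<rightarrow>\<^sub>E \<beta>"]) (use insert.hyps assms(2) in \<open>auto intro: finite_PiE\<close>)
  \<comment> \<open>The admissible images of the new position: elements of the right value not yet
    used. Their number does not depend on \<open>g\<close>.\<close>
  let ?avail = "\<lambda>g. {b\<in>\<beta>. \<l> b = ?a0 \<and> b \<notin> g ` T}"
  have av: "card (?avail g) = ?c ?a0 - ?q T ?a0" if g: "g \<in> ?S T" for g
  proof -
    have "?avail g = {b\<in>\<beta>. \<l> b = ?a0} - g ` {I\<in>T. j I = ?a0}"
      using g by auto
    moreover have "g ` {I\<in>T. j I = ?a0} \<subseteq> {b\<in>\<beta>. \<l> b = ?a0}" using g by (auto simp: PiE_iff)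
    moreover have "card (g ` {I\<in>T. j I = ?a0}) = ?q T ?a0"
      using g by (intro card_image) (auto intro: inj_on_subset)
    ultimately show ?thesis using assms(2) insert.hyps by (simp add: card_Diff_subset)
  qed
  have "bij_betw (\<lambda>(g, b). g(I0 := b)) (SIGMA g:?S T. ?avail g) (?S (insert I0 T))"
  proof (rule bij_betwI[where g = "\<lambda>g. (g(I0 := undefined), g I0)"])
    show "(\<lambda>(g, b). g(I0 := b)) \<in> (SIGMA g:?S T. ?avail g) \<rightarrow> ?S (insert I0 T)"
    proof clarify
      fix g b assume g: "g \<in> T \<rightarrow>\<^sub>E \<beta>" "inj_on g T" "\<forall>I\<in>T. \<l> (g I) = j I" and b: "b \<in> \<beta>" "\<l> b = ?a0" "b \<notin> g ` T"
      have ne: "I0 \<noteq> I" if "I \<in> T" for I using that insert.hyps by blast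
      have "g(I0 := b) \<in> insert I0 T \<rightarrow>\<^sub>E \<beta>" using g(1) b(1) by (auto simp: PiE_iff extensional_def)
      moreover have "inj_on (g(I0 := b)) (insert I0 T)"
        using g(2) b(3) ne by (auto simp: inj_on_def image_iff)
      moreover have "\<forall>I\<in>insert I0 T. \<l> ((g(I0 := b)) I) = j I" using g(3) b(2) ne by auto
      ultimately show "g(I0 := b) \<in> insert I0 T \<rightarrow>\<^sub>E \<beta> \<and> inj_on (g(I0 := b)) (insert I0 T) \<and> (\<forall>I\<in>insert I0 T. \<l> ((g(I0 := b)) I) = j I)" by blast
    qed
    show "(\<lambda>g. (g(I0 := undefined), g I0)) \<in> ?S (insert I0 T) \<rightarrow> (SIGMA g:?S T. ?avail g)"
    proof (rule funcsetI)
      fix g assume "g \<in> ?S (insert I0 T)"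
      then have g: "g \<in> insert I0 T \<rightarrow>\<^sub>E \<beta>" "inj_on g (insert I0 T)" "\<forall>I\<in>insert I0 T. \<l> (g I) = j I" by auto
      have ne: "I0 \<noteq> I" if "I \<in> T" for I using that insert.hyps by blast
      let ?g = "g(I0 := undefined)"
      have e: "?g I = g I" if "I \<in> T" for I using ne[OF that] by simp
      have 1: "?g \<in> T \<rightarrow>\<^sub>E \<beta>"
      proof (rule PiE_I)
        fix I assume "I \<in> T" then show "?g I \<in> \<beta>" using g(1) e by (auto simp: PiE_iff)
      next
        fix I assume "I \<notin> T" then show "?g I = undefined" using g(1) by (cases "I = I0") (auto simp: PiE_iff extensional_def)
      qed
      have 2: "inj_on ?g T"
      proof (rule inj_onI)
        fix I J assume IJ: "I \<in> T" "J \<in> T" "?g I = ?g J"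
        then have "g I = g J" using e by simp
        then show "I = J" using inj_onD[OF g(2)] IJ by blast
      qed
      have 3: "\<forall>I\<in>T. \<l> (?g I) = j I" using g(3) e by simp
      have 4: "g I0 \<notin> ?g ` T"
      proof
        assume "g I0 \<in> ?g ` T"
        then obtain I where "I \<in> T" "g I0 = g I" using e by auto
        then show False using inj_onD[OF g(2), of I0 I] ne by blast
      qed
      have 5: "g I0 \<in> \<beta>" "\<l> (g I0) = ?a0" using g by (auto simp: PiE_iff)
      show "(?g, g I0) \<in> (SIGMA g:?S T. ?avail g)" using 1 2 3 4 5 by blast
    qed
    fix p assume "p \<in> (SIGMA g:?S T. ?avail g)"
    then obtain g b where p: "p = (g, b)" "g \<in> T \<rightarrow>\<^sub>E \<beta>" by blast
    have "g I0 = undefined" using p(2) insert.hyps by (auto simp: PiE_iff extensional_def)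
    then show "((case p of (g, b) \<Rightarrow> g(I0 := b))(I0 := undefined), (case p of (g, b) \<Rightarrow> g(I0 := b)) I0) = p"
      by (auto simp: p fun_eq_iff)
  qed auto
  then have "card (?S (insert I0 T)) = card (SIGMA g:?S T. ?avail g)" by (simp only: bij_betw_same_card)
  also have "\<dots> = (\<Sum>g\<in>?S T. card (?avail g))" using finS assms(2) by (intro card_SigmaI) auto
  also have "\<dots> = card (?S T) * (?c ?a0 - ?q T ?a0)" using av by simp
  finally have c: "card (?S (insert I0 T)) = card (?S T) * (?c ?a0 - ?q T ?a0)" .
  have a0: "?a0 \<in> A" using insert.prems(1) by simp
  have "(?c ?a0 - ?q T ?a0) * (\<Prod>a\<in>A. fact (?c a - ?q (insert I0 T) a)) = (\<Prod>a\<in>A. fact (?c a - ?q T a) :: nat)"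
  proof -
    have f: "(?c ?a0 - ?q T ?a0) * fact (?c ?a0 - ?q (insert I0 T) ?a0) = (fact (?c ?a0 - ?q T ?a0) :: nat)"
    proof -
      obtain m where m: "?c ?a0 - ?q T ?a0 = Suc m" using lt by (metis Suc_diff_Suc)
      then have "?c ?a0 - ?q (insert I0 T) ?a0 = m" using q[of ?a0] by simp
      then show ?thesis by (simp add: m)
    qed
    have r: "(\<Prod>a\<in>A - {?a0}. fact (?c a - ?q (insert I0 T) a)) = (\<Prod>a\<in>A - {?a0}. fact (?c a - ?q T a) :: nat)"
      by (intro prod.cong refl, subst q) simp
    show ?thesis
      unfolding prod.remove[OF assms(3) a0, of "\<lambda>a. fact (?c a - ?q (insert I0 T) a)"]
        prod.remove[OF assms(3) a0, of "\<lambda>a. fact (?c a - ?q T a)"] r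
      by (simp only: mult.assoc[symmetric] f)
  qed
  then show ?case unfolding c using IH by (simp only: mult.assoc)
qed

section \<open>Grouping embeddings by their index families\<close>

lemma prod_by_value:
  fixes F :: "nat \<Rightarrow> 'c::comm_monoid_mult"
  assumes "finite B" "finite A" "\<l> ` B \<subseteq> A"
  shows "(\<Prod>b\<in>B. F (\<l> b)) = (\<Prod>a\<in>A. F a ^ card {b\<in>B. \<l> b = a})"
proof -
  have "(\<Prod>b\<in>B. F (\<l> b)) = (\<Prod>a\<in>A. \<Prod>b\<in>{b\<in>B. \<l> b = a}. F (\<l> b))"
    by (rule prod.group[OF assms, symmetric])
  also have "\<dots> = (\<Prod>a\<in>A. F a ^ card {b\<in>B. \<l> b = a})" by (intro prod.cong refl) simp
  finally show ?thesis .
qed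

lemma sum_by_value:
  fixes \<l> :: "'b \<Rightarrow> nat"
  assumes "finite B" "finite A" "\<l> ` B \<subseteq> A"
  shows "(\<Sum>b\<in>B. \<l> b) = (\<Sum>a\<in>A. a * card {b\<in>B. \<l> b = a})"
proof -
  have "(\<Sum>b\<in>B. \<l> b) = (\<Sum>a\<in>A. \<Sum>b\<in>{b\<in>B. \<l> b = a}. \<l> b)"
    by (rule sum.group[OF assms, symmetric])
  also have "\<dots> = (\<Sum>a\<in>A. a * card {b\<in>B. \<l> b = a})" by (intro sum.cong refl) (simp add: mult.commute)
  finally show ?thesis .
qed

text \<open>In \<open>tree_embeddings\<close> injectivity is required separately at each white
  vertex. Exchanging the two arguments turns the embeddings with prescribed weights into a full
  product over the white vertices of sets of injections, so they can be counted factor by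
  factor.\<close>

lemma bij_betw_emb_transpose:
  fixes j :: "nat set \<Rightarrow> nat \<Rightarrow> nat" and \<l> :: "'b \<Rightarrow> nat"
  assumes T: "T \<in> bip_trees k"
  shows "bij_betw (\<lambda>h. \<lambda>i\<in>{1..k}. \<lambda>I\<in>{I\<in>T. i \<in> I}. h I i)
    {h \<in> tree_embeddings \<beta> lab T. \<forall>I\<in>T. \<forall>i\<in>I. \<l> (h I i) = j I i}
    (\<Pi>\<^sub>E i\<in>{1..k}. {g \<in> {I\<in>T. i \<in> I} \<rightarrow>\<^sub>E {b\<in>\<beta>. lab b = i}. inj_on g {I\<in>T. i \<in> I} \<and> (\<forall>I\<in>{I\<in>T. i \<in> I}. \<l> (g I) = j I i)})"
    (is "bij_betw ?f ?A ?B")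
proof (rule bij_betwI[where g = "\<lambda>g. \<lambda>I\<in>T. \<lambda>i\<in>I. g i I"])
  have Ik: "i \<in> {1..k}" if "I \<in> T" "i \<in> I" for I i using bip_trees_finite(2)[OF T that(1)] that(2) by blast
  show "?f \<in> ?A \<rightarrow> ?B"
  proof (rule funcsetI)
    fix h assume h: "h \<in> ?A"
    have hp: "h I i \<in> {b\<in>\<beta>. lab b = i}" "\<l> (h I i) = j I i" if "I \<in> T" "i \<in> I" for I i
      using h that by (auto simp: tree_embeddings_def PiE_iff)
    have hi: "inj_on (\<lambda>I. h I i) {I\<in>T. i \<in> I}" for i using h by (simp add: tree_embeddings_def)
    show "?f h \<in> ?B"
    proof (rule PiE_I)
      fix i assume i: "i \<in> {1..k}"
      have "(\<lambda>I\<in>{I\<in>T. i \<in> I}. h I i) \<in> {I\<in>T. i \<in> I} \<rightarrow>\<^sub>E {b\<in>\<beta>. lab b = i}" using hp(1) by (intro restrict_PiE_iff[THEN iffD2]) auto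
      moreover have "inj_on (\<lambda>I\<in>{I\<in>T. i \<in> I}. h I i) {I\<in>T. i \<in> I}" using hi[of i] by (auto simp: inj_on_def)
      moreover have "\<forall>I\<in>{I\<in>T. i \<in> I}. \<l> ((\<lambda>I\<in>{I\<in>T. i \<in> I}. h I i) I) = j I i" using hp(2) by auto
      ultimately show "?f h i \<in> {g \<in> {I\<in>T. i \<in> I} \<rightarrow>\<^sub>E {b\<in>\<beta>. lab b = i}. inj_on g {I\<in>T. i \<in> I} \<and> (\<forall>I\<in>{I\<in>T. i \<in> I}. \<l> (g I) = j I i)}"
        using i by simp
    qed auto
  qed
  show "(\<lambda>g. \<lambda>I\<in>T. \<lambda>i\<in>I. g i I) \<in> ?B \<rightarrow> ?A"
  proof (rule funcsetI)
    fix g assume g: "g \<in> ?B"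
    have gi: "g i \<in> {I\<in>T. i \<in> I} \<rightarrow>\<^sub>E {b\<in>\<beta>. lab b = i}" "inj_on (g i) {I\<in>T. i \<in> I}" "\<forall>I\<in>{I\<in>T. i \<in> I}. \<l> (g i I) = j I i"
      if "i \<in> {1..k}" for i using PiE_mem[OF g that] by auto
    have 1: "(\<lambda>I\<in>T. \<lambda>i\<in>I. g i I) \<in> (\<Pi>\<^sub>E I\<in>T. \<Pi>\<^sub>E i\<in>I. {b\<in>\<beta>. lab b = i})"
    proof (rule PiE_I)
      fix I assume I: "I \<in> T"
      have "(\<lambda>i\<in>I. g i I) \<in> (\<Pi>\<^sub>E i\<in>I. {b\<in>\<beta>. lab b = i})"
      proof (rule PiE_I)
        fix i assume i: "i \<in> I"
        have "g i I \<in> {b\<in>\<beta>. lab b = i}" by (rule PiE_mem[OF gi(1)[OF Ik[OF I i]]]) (use I i in simp)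
        then show "(\<lambda>i\<in>I. g i I) i \<in> {b\<in>\<beta>. lab b = i}" using i by simp
      qed simp
      then show "(\<lambda>I\<in>T. \<lambda>i\<in>I. g i I) I \<in> (\<Pi>\<^sub>E i\<in>I. {b\<in>\<beta>. lab b = i})" using I by simp
    qed simp
    have 2: "inj_on (\<lambda>I. (\<lambda>I\<in>T. \<lambda>i\<in>I. g i I) I i) {I\<in>T. i \<in> I}" for i
    proof (cases "i \<in> {1..k}")
      case True
      have "inj_on (\<lambda>I. (\<lambda>I\<in>T. \<lambda>i\<in>I. g i I) I i) {I\<in>T. i \<in> I} \<longleftrightarrow> inj_on (g i) {I\<in>T. i \<in> I}"
        by (rule inj_on_cong) simp
      then show ?thesis using gi(2)[OF True] by simp
    next
      case False
      then have "{I\<in>T. i \<in> I} = {}" using Ik by blast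
      then show ?thesis by (simp only: inj_on_empty)
    qed
    have 3: "\<l> ((\<lambda>I\<in>T. \<lambda>i\<in>I. g i I) I i) = j I i" if "I \<in> T" "i \<in> I" for I i
      using gi(3)[OF Ik[OF that]] that by simp
    show "(\<lambda>I\<in>T. \<lambda>i\<in>I. g i I) \<in> ?A" using 1 2 3 by (simp add: tree_embeddings_def)
  qed
  fix h assume h: "h \<in> ?A"
  then have e: "h \<in> extensional T" "h I \<in> extensional I" if "I \<in> T" for I using that by (auto simp: tree_embeddings_def PiE_iff)
  show "(\<lambda>I\<in>T. \<lambda>i\<in>I. ?f h i I) = h"
  proof
    fix I show "(\<lambda>I\<in>T. \<lambda>i\<in>I. ?f h i I) I = h I"
    proof (cases "I \<in> T")
      case True
      have "(\<lambda>i\<in>I. ?f h i I) = h I"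
        by (rule extensionalityI[of _ I]) (use e[OF True] True Ik in auto)
      then show ?thesis using True by simp
    next
      case False
      have "h \<in> extensional T" using h by (auto simp: tree_embeddings_def PiE_iff)
      then show ?thesis using False by (simp add: extensional_def)
    qed
  qed
next
  have Ik: "i \<in> {1..k}" if "I \<in> T" "i \<in> I" for I i using bip_trees_finite(2)[OF T that(1)] that(2) by blast
  fix g assume g: "g \<in> ?B"
  show "?f (\<lambda>I\<in>T. \<lambda>i\<in>I. g i I) = g"
  proof
    fix i show "?f (\<lambda>I\<in>T. \<lambda>i\<in>I. g i I) i = g i"
    proof (cases "i \<in> {1..k}")
      case True
      have "g i \<in> {I\<in>T. i \<in> I} \<rightarrow>\<^sub>E {b\<in>\<beta>. lab b = i}" using PiE_mem[OF g True] by auto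
      then have "g i \<in> extensional {I\<in>T. i \<in> I}" by (simp add: PiE_iff)
      then have "(\<lambda>I\<in>{I\<in>T. i \<in> I}. (\<lambda>I\<in>T. \<lambda>i\<in>I. g i I) I i) = g i"
        by (intro extensionalityI[of _ "{I\<in>T. i \<in> I}"]) auto
      then show ?thesis using True by simp
    next
      case False
      have "g \<in> extensional {1..k}" using g by (simp add: PiE_iff)
      then show ?thesis using False by (auto simp: extensional_def)
    qed
  qed
qed

text \<open>Restricting in both arguments gives the normal form used by
  \<open>index_families\<close>, so that equality of families is equality of functions.\<close>

definition emb_weights :: "('b \<Rightarrow> nat) \<Rightarrow> nat set set \<Rightarrow> (nat set \<Rightarrow> nat \<Rightarrow> 'b) \<Rightarrow> nat set \<Rightarrow> nat \<Rightarrow> nat" where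
  "emb_weights \<l> T h = (\<lambda>I\<in>T. \<lambda>i\<in>I. \<l> (h I i))"

text \<open>Embeddings are grouped by the weights j of their edges. Then c is forced: it counts the
  elements of colour i and weight a that the tree does not use, and the indicator says that (j, c)
  agrees with the actual numbers of elements. The fibre over such a pair counts the choices of the
  elements used, which is the product of quotients of factorials.\<close>

lemma sum_tree_embeddings_index_families:
  fixes \<l> :: "'b \<Rightarrow> nat" and K :: "nat multiset \<Rightarrow> complex" and G :: "nat \<Rightarrow> nat set"
  assumes fin: "finite \<beta>" and T: "T \<in> bip_trees k"
    and lab: "\<And>b. b \<in> \<beta> \<Longrightarrow> lab b \<in> {1..k}" and pos: "\<And>b. b \<in> \<beta> \<Longrightarrow> \<l> b \<ge> 1"
    and G: "\<And>i. i \<in> {1..k} \<Longrightarrow> card (G i) = (\<Sum>b | b \<in> \<beta> \<and> lab b = i. \<l> b)"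
  shows "(\<Sum>h\<in>tree_embeddings \<beta> lab T. (\<Prod>I\<in>T. K (image_mset \<l> (mset_set (h I ` I)))) * (\<Prod>b\<in>\<beta> - (\<Union>I\<in>T. h I ` I). K {#\<l> b#}))
    = (\<Sum>(j, c)\<in>index_families k G T.
        (if \<forall>i\<in>{1..k}. \<forall>a\<in>{1..card (G i)}. card {b\<in>\<beta>. lab b = i \<and> \<l> b = a} = c i a + q_mult T j i a then 1 else 0) *
        ((\<Prod>I\<in>T. K (image_mset (j I) (mset_set I))) *
         (\<Prod>i = 1..k. \<Prod>a = 1..card (G i). fact (c i a + q_mult T j i a) / fact (c i a) * K {#a#} ^ c i a)))"
proof -
  let ?E = "tree_embeddings \<beta> lab T"
  let ?A = "\<lambda>i. {b\<in>\<beta>. lab b = i}"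
  let ?cnt = "\<lambda>i a. card {b\<in>\<beta>. lab b = i \<and> \<l> b = a}"
  let ?J = "emb_weights \<l> T"
  define C where "C h = (\<lambda>i\<in>{1..k}. \<lambda>a\<in>{1..card (G i)}. ?cnt i a - q_mult T (?J h) i a)" for h
  let ?match = "\<lambda>j c. \<forall>i\<in>{1..k}. \<forall>a\<in>{1..card (G i)}. ?cnt i a = c i a + q_mult T j i a"
  let ?W = "\<lambda>j c. (\<Prod>I\<in>T. K (image_mset (j I) (mset_set I))) * (\<Prod>i = 1..k. \<Prod>a = 1..card (G i). K {#a#} ^ c i a)"
  have finT: "finite T" and TI: "\<And>I. I \<in> T \<Longrightarrow> finite I \<and> I \<subseteq> {1..k} \<and> I \<noteq> {}" using bip_trees_finite[OF T] by auto
  have finA: "finite (?A i)" for i using fin by simp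
  have range: "\<l> ` ?A i \<subseteq> {1..card (G i)}" if i: "i \<in> {1..k}" for i
  proof
    fix a assume "a \<in> \<l> ` ?A i"
    then obtain b where b: "b \<in> ?A i" "a = \<l> b" by blast
    have "\<l> b \<le> (\<Sum>b\<in>?A i. \<l> b)" using b(1) finA by (intro member_le_sum) auto
    then show "a \<in> {1..card (G i)}" using b pos G[OF i] by simp
  qed
  have J: "?J h I i = \<l> (h I i)" if "I \<in> T" "i \<in> I" for h I i using that by (simp add: emb_weights_def)
  have facts: "(\<Prod>I\<in>T. K (image_mset \<l> (mset_set (h I ` I)))) = (\<Prod>I\<in>T. K (image_mset (?J h I) (mset_set I)))"
    "(\<Prod>b\<in>\<beta> - (\<Union>I\<in>T. h I ` I). K {#\<l> b#}) = (\<Prod>i = 1..k. \<Prod>a = 1..card (G i). K {#a#} ^ C h i a)"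
    "(?J h, C h) \<in> index_families k G T" "?match (?J h) (C h)" if h: "h \<in> ?E" for h
  proof -
    note hp = tree_embeddings_props[OF T h]
    have ieq: "image_mset \<l> (mset_set (h I ` I)) = image_mset (?J h I) (mset_set I)" if I: "I \<in> T" for I
    proof -
      have "image_mset \<l> (mset_set (h I ` I)) = image_mset (\<lambda>i. \<l> (h I i)) (mset_set I)"
        using hp(2)[OF I] by (simp add: image_mset_mset_set[symmetric] multiset.map_comp o_def)
      also have "\<dots> = image_mset (?J h I) (mset_set I)" using J[OF I] TI[OF I] by (intro image_mset_cong) simp
      finally show ?thesis .
    qed
    then show "(\<Prod>I\<in>T. K (image_mset \<l> (mset_set (h I ` I)))) = (\<Prod>I\<in>T. K (image_mset (?J h I) (mset_set I)))" by simp
    let ?U = "\<lambda>i. (\<lambda>I. h I i) ` {I\<in>T. i \<in> I}"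
    have UA: "?U i \<subseteq> ?A i" for i using hp(1) by auto
    have inj: "inj_on (\<lambda>I. h I i) {I\<in>T. i \<in> I}" for i using h by (simp add: tree_embeddings_def)
    have un: "?A i - (\<Union>I\<in>T. h I ` I) = ?A i - ?U i" for i
    proof -
      have "b \<in> ?U i" if b: "b \<in> ?A i" "I \<in> T" "b \<in> h I ` I" for b I
      proof -
        obtain i' where i': "i' \<in> I" "b = h I i'" using b(3) by blast
        then have "i' = i" using hp(1)[OF b(2) i'(1)] b(1) by simp
        then show ?thesis using i' b(2) by blast
      qed
      moreover have "?U i \<subseteq> (\<Union>I\<in>T. h I ` I)" by blast
      ultimately show ?thesis by blast
    qed
    have qU: "card {b\<in>?U i. \<l> b = a} = q_mult T (?J h) i a" for i a
    proof -
      have "{b\<in>?U i. \<l> b = a} = (\<lambda>I. h I i) ` {I\<in>T. i \<in> I \<and> ?J h I i = a}" using J by auto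
      moreover have "inj_on (\<lambda>I. h I i) {I\<in>T. i \<in> I \<and> ?J h I i = a}" using inj[of i] by (rule inj_on_subset) auto
      ultimately show ?thesis by (simp add: card_image q_mult_def)
    qed
    have cA: "?cnt i a = card {b\<in>?A i. \<l> b = a}" for i a by (rule arg_cong[where f = card]) auto
    have qle: "q_mult T (?J h) i a \<le> ?cnt i a" for i a
      unfolding qU[symmetric] cA using UA[of i] fin by (intro card_mono) auto
    have cU: "card {b\<in>?A i - ?U i. \<l> b = a} = ?cnt i a - q_mult T (?J h) i a" for i a
    proof -
      have "{b\<in>?A i - ?U i. \<l> b = a} = {b\<in>?A i. \<l> b = a} - {b\<in>?U i. \<l> b = a}" by blast
      then have "card {b\<in>?A i - ?U i. \<l> b = a} = card {b\<in>?A i. \<l> b = a} - card {b\<in>?U i. \<l> b = a}"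
        using UA[of i] finT by (subst card_Diff_subset[symmetric]) auto
      then show ?thesis by (simp only: qU cA)
    qed
    have Cv: "C h i a = card {b\<in>?A i - ?U i. \<l> b = a}" if "i \<in> {1..k}" "a \<in> {1..card (G i)}" for i a
      using that by (simp only: C_def cU restrict_apply if_True)
    show m: "?match (?J h) (C h)" using qle by (simp add: C_def)
    have "(\<Prod>b\<in>\<beta> - (\<Union>I\<in>T. h I ` I). K {#\<l> b#}) = (\<Prod>i = 1..k. \<Prod>b\<in>{b\<in>\<beta> - (\<Union>I\<in>T. h I ` I). lab b = i}. K {#\<l> b#})"
      using fin lab by (intro prod.group[symmetric]) auto
    also have "\<dots> = (\<Prod>i = 1..k. \<Prod>a = 1..card (G i). K {#a#} ^ C h i a)"
    proof (intro prod.cong refl)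
      fix i assume i: "i \<in> {1..k}"
      have "{b\<in>\<beta> - (\<Union>I\<in>T. h I ` I). lab b = i} = ?A i - ?U i" using un[of i] by blast
      then have "(\<Prod>b\<in>{b\<in>\<beta> - (\<Union>I\<in>T. h I ` I). lab b = i}. K {#\<l> b#}) = (\<Prod>b\<in>?A i - ?U i. K {#\<l> b#})" by simp
      also have "\<dots> = (\<Prod>a = 1..card (G i). K {#a#} ^ card {b\<in>?A i - ?U i. \<l> b = a})"
        by (rule prod_by_value[where F = "\<lambda>a. K {#a#}"]) (use finA range[OF i] in auto)
      also have "\<dots> = (\<Prod>a = 1..card (G i). K {#a#} ^ C h i a)" using Cv[OF i] by (intro prod.cong refl) simp
      finally show "(\<Prod>b\<in>{b\<in>\<beta> - (\<Union>I\<in>T. h I ` I). lab b = i}. K {#\<l> b#}) = (\<Prod>a = 1..card (G i). K {#a#} ^ C h i a)" .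
    qed
    finally show "(\<Prod>b\<in>\<beta> - (\<Union>I\<in>T. h I ` I). K {#\<l> b#}) = (\<Prod>i = 1..k. \<Prod>a = 1..card (G i). K {#a#} ^ C h i a)" .
    have "?J h \<in> (\<Pi>\<^sub>E I\<in>T. \<Pi>\<^sub>E i\<in>I. {1..})"
    proof (rule PiE_I)
      fix I assume I: "I \<in> T"
      show "?J h I \<in> (\<Pi>\<^sub>E i\<in>I. {1..})"
      proof (rule PiE_I)
        fix i assume "i \<in> I" then show "?J h I i \<in> {1..}" using J[OF I] hp(1)[OF I] pos by simp
      qed (simp add: emb_weights_def I)
    qed (simp add: emb_weights_def)
    moreover have "C h \<in> (\<Pi>\<^sub>E i\<in>{1..k}. \<Pi>\<^sub>E a\<in>{1..card (G i)}. UNIV)"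
      unfolding C_def by (intro PiE_I) auto
    moreover have "(\<Sum>I | I \<in> T \<and> i \<in> I. ?J h I i) + (\<Sum>a = 1..card (G i). a * C h i a) = card (G i)" if i: "i \<in> {1..k}" for i
    proof -
      have "(\<Sum>I | I \<in> T \<and> i \<in> I. ?J h I i) = (\<Sum>b\<in>?U i. \<l> b)"
        using J by (simp add: sum.reindex[OF inj])
      moreover have "(\<Sum>a = 1..card (G i). a * C h i a) = (\<Sum>b\<in>?A i - ?U i. \<l> b)"
      proof -
        have "(\<Sum>b\<in>?A i - ?U i. \<l> b) = (\<Sum>a = 1..card (G i). a * card {b\<in>?A i - ?U i. \<l> b = a})"
          by (rule sum_by_value) (use finA range[OF i] in auto)
        then show ?thesis using Cv[OF i] by simp
      qed
      moreover have "(\<Sum>b\<in>?U i. \<l> b) + (\<Sum>b\<in>?A i - ?U i. \<l> b) = (\<Sum>b\<in>?A i. \<l> b)"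
        using sum.subset_diff[OF UA[of i] finA[of i], of \<l>] by simp
      ultimately show ?thesis using G[OF i] by simp
    qed
    ultimately show "(?J h, C h) \<in> index_families k G T" unfolding index_families_def by blast
  qed
  have finE: "finite ?E" by (rule finite_tree_embeddings[OF fin T])
  have jr: "j I i \<in> {1..card (G i)}" if jc: "(j, c) \<in> index_families k G T" "I \<in> T" "i \<in> I" for j c I i
  proof -
    have i: "i \<in> {1..k}" using TI jc by blast
    have "j I i \<ge> 1" using jc by (auto simp: index_families_def PiE_iff)
    moreover have "j I i \<le> (\<Sum>I | I \<in> T \<and> i \<in> I. j I i)" using jc finT by (intro member_le_sum) auto
    moreover have "(\<Sum>I | I \<in> T \<and> i \<in> I. j I i) + (\<Sum>a = 1..card (G i). a * c i a) = card (G i)"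
      using jc(1) i unfolding index_families_def by blast
    ultimately show ?thesis by simp
  qed
  \<comment> \<open>Every entry is bounded by a block size because the weights are at least 1;
    finiteness is required for the regrouping.\<close>
  have finF: "finite (index_families k G T)"
  proof (rule finite_subset)
    let ?M = "Suc (\<Sum>i = 1..k. card (G i))"
    have le: "card (G i) < ?M" if "i \<in> {1..k}" for i
      using member_le_sum[OF that, of "\<lambda>i. card (G i)"] by simp
    show "index_families k G T \<subseteq> (\<Pi>\<^sub>E I\<in>T. \<Pi>\<^sub>E i\<in>I. {..<?M}) \<times> (\<Pi>\<^sub>E i\<in>{1..k}. \<Pi>\<^sub>E a\<in>{1..card (G i)}. {..<?M})"
    proof (rule subsetI)
      fix p assume p: "p \<in> index_families k G T"
      obtain j c where jc: "p = (j, c)" by (cases p)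
      note p = p[unfolded jc]
      have j: "j \<in> (\<Pi>\<^sub>E I\<in>T. \<Pi>\<^sub>E i\<in>I. {1..})" and c: "c \<in> (\<Pi>\<^sub>E i\<in>{1..k}. \<Pi>\<^sub>E a\<in>{1..card (G i)}. UNIV)"
        and s: "\<And>i. i \<in> {1..k} \<Longrightarrow> (\<Sum>I | I \<in> T \<and> i \<in> I. j I i) + (\<Sum>a = 1..card (G i). a * c i a) = card (G i)"
        using p by (auto simp: index_families_def)
      have "j I i < ?M" if "I \<in> T" "i \<in> I" for I i
        using jr[OF p that] le[of i] TI[OF that(1)] that(2) by auto
      then have "j \<in> (\<Pi>\<^sub>E I\<in>T. \<Pi>\<^sub>E i\<in>I. {..<?M})" using j by (auto simp: PiE_iff)
      moreover have "c i a < ?M" if ia: "i \<in> {1..k}" "a \<in> {1..card (G i)}" for i a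
      proof -
        have "a * c i a \<le> (\<Sum>a = 1..card (G i). a * c i a)" using ia(2) by (intro member_le_sum[where f = "\<lambda>a. a * c i a"]) auto
        then have "a * c i a \<le> card (G i)" using s[OF ia(1)] by linarith
        moreover have "c i a \<le> a * c i a" using ia(2) by simp
        ultimately show ?thesis using le[OF ia(1)] by linarith
      qed
      then have "c \<in> (\<Pi>\<^sub>E i\<in>{1..k}. \<Pi>\<^sub>E a\<in>{1..card (G i)}. {..<?M})" using c by (auto simp: PiE_iff)
      ultimately show "p \<in> (\<Pi>\<^sub>E I\<in>T. \<Pi>\<^sub>E i\<in>I. {..<?M}) \<times> (\<Pi>\<^sub>E i\<in>{1..k}. \<Pi>\<^sub>E a\<in>{1..card (G i)}. {..<?M})" by (simp add: jc)
    qed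
    show "finite ((\<Pi>\<^sub>E I\<in>T. \<Pi>\<^sub>E i\<in>I. {..<?M}) \<times> (\<Pi>\<^sub>E i\<in>{1..k}. \<Pi>\<^sub>E a\<in>{1..card (G i)}. {..<?M}))"
      using finT TI by (intro finite_cartesian_product finite_PiE) auto
  qed
  \<comment> \<open>An incompatible pair has an empty fibre. Otherwise j determines c, and the
    embeddings with weights j are counted one white vertex at a time.\<close>
  have fiber: "of_nat (card {h \<in> ?E. (?J h, C h) = (j, c)}) * ?W j c =
      (if ?match j c then 1 else 0) * ((\<Prod>I\<in>T. K (image_mset (j I) (mset_set I))) *
         (\<Prod>i = 1..k. \<Prod>a = 1..card (G i). fact (c i a + q_mult T j i a) / fact (c i a) * K {#a#} ^ c i a))"
    if jc: "(j, c) \<in> index_families k G T" for j c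
  proof (cases "?match j c")
    case False
    then have "{h \<in> ?E. (?J h, C h) = (j, c)} = {}" using facts(4) by blast
    then show ?thesis using False by (simp only: card.empty of_nat_0 mult_zero_left if_False)
  next
    case True
    have j: "j \<in> (\<Pi>\<^sub>E I\<in>T. \<Pi>\<^sub>E i\<in>I. {1..})" and c: "c \<in> (\<Pi>\<^sub>E i\<in>{1..k}. \<Pi>\<^sub>E a\<in>{1..card (G i)}. UNIV)"
      using jc by (auto simp: index_families_def)
    have Jj: "?J h = j \<longleftrightarrow> (\<forall>I\<in>T. \<forall>i\<in>I. \<l> (h I i) = j I i)" for h
    proof
      assume "?J h = j" then show "\<forall>I\<in>T. \<forall>i\<in>I. \<l> (h I i) = j I i" using J by metis
    next
      assume a: "\<forall>I\<in>T. \<forall>i\<in>I. \<l> (h I i) = j I i"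
      have "?J h I = j I" if I: "I \<in> T" for I
        by (rule extensionalityI[of _ I]) (use I j a in \<open>auto simp: emb_weights_def PiE_iff\<close>)
      then show "?J h = j" using j by (intro extensionalityI[of _ T]) (auto simp: emb_weights_def PiE_iff)
    qed
    have Cc: "C h = c" if "?J h = j" for h
    proof (rule extensionalityI[of _ "{1..k}"])
      show "C h \<in> extensional {1..k}" by (simp add: C_def)
      show "c \<in> extensional {1..k}" using c by (simp add: PiE_iff)
      fix i assume i: "i \<in> {1..k}"
      show "C h i = c i"
      proof (rule extensionalityI[of _ "{1..card (G i)}"])
        show "C h i \<in> extensional {1..card (G i)}" using i by (simp add: C_def)
        show "c i \<in> extensional {1..card (G i)}" using c i by (simp add: PiE_iff)
        fix a assume a: "a \<in> {1..card (G i)}"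
        have "?cnt i a = c i a + q_mult T j i a" using True i a by blast
        then show "C h i a = c i a" using i a that by (simp add: C_def)
      qed
    qed
    let ?S = "\<lambda>i. {g \<in> {I\<in>T. i \<in> I} \<rightarrow>\<^sub>E ?A i. inj_on g {I\<in>T. i \<in> I} \<and> (\<forall>I\<in>{I\<in>T. i \<in> I}. \<l> (g I) = j I i)}"
    have "{h \<in> ?E. (?J h, C h) = (j, c)} = {h \<in> ?E. \<forall>I\<in>T. \<forall>i\<in>I. \<l> (h I i) = j I i}"
      using Jj Cc by auto
    then have "card {h \<in> ?E. (?J h, C h) = (j, c)} = card (\<Pi>\<^sub>E i\<in>{1..k}. ?S i)"
      using bij_betw_same_card[OF bij_betw_emb_transpose[OF T, of \<beta> lab \<l> j]] by simp
    also have "\<dots> = (\<Prod>i = 1..k. card (?S i))" by (simp add: card_PiE)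
    finally have "of_nat (card {h \<in> ?E. (?J h, C h) = (j, c)}) = (\<Prod>i = 1..k. of_nat (card (?S i)) :: complex)" by simp
    also have "\<dots> = (\<Prod>i = 1..k. \<Prod>a = 1..card (G i). fact (c i a + q_mult T j i a) / fact (c i a))"
    proof (intro prod.cong refl)
      fix i assume i: "i \<in> {1..k}"
      have qi: "card {I\<in>{I\<in>T. i \<in> I}. j I i = a} = q_mult T j i a" for a
        unfolding q_mult_def by (rule arg_cong[where f = card]) auto
      have ci: "card {b\<in>?A i. \<l> b = a} = c i a + q_mult T j i a" if "a \<in> {1..card (G i)}" for a
      proof -
        have "{b\<in>?A i. \<l> b = a} = {b\<in>\<beta>. lab b = i \<and> \<l> b = a}" by auto
        then show ?thesis using True i that by simp
      qed
      have "card (?S i) * (\<Prod>a\<in>{1..card (G i)}. fact (card {b\<in>?A i. \<l> b = a} - card {I\<in>{I\<in>T. i \<in> I}. j I i = a})) =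
          (\<Prod>a\<in>{1..card (G i)}. fact (card {b\<in>?A i. \<l> b = a}) :: nat)"
      proof (rule card_coloured_injections)
        show "(\<lambda>I. j I i) ` {I\<in>T. i \<in> I} \<subseteq> {1..card (G i)}" using jr[OF jc] by auto
        show "card {I\<in>{I\<in>T. i \<in> I}. j I i = a} \<le> card {b\<in>?A i. \<l> b = a}" if "a \<in> {1..card (G i)}" for a
          using ci[OF that] qi[of a] by simp
      qed (use finT fin in auto)
      then have "card (?S i) * (\<Prod>a\<in>{1..card (G i)}. fact (c i a)) = (\<Prod>a\<in>{1..card (G i)}. fact (c i a + q_mult T j i a) :: nat)"
        using ci qi by simp
      then have "of_nat (card (?S i) * (\<Prod>a\<in>{1..card (G i)}. fact (c i a))) = (of_nat (\<Prod>a\<in>{1..card (G i)}. fact (c i a + q_mult T j i a)) :: complex)"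
        by (rule arg_cong)
      then have "of_nat (card (?S i)) * (\<Prod>a\<in>{1..card (G i)}. fact (c i a)) = (\<Prod>a\<in>{1..card (G i)}. fact (c i a + q_mult T j i a) :: complex)"
        by simp
      moreover have "(\<Prod>a\<in>{1..card (G i)}. fact (c i a) :: complex) \<noteq> 0" by simp
      ultimately show "of_nat (card (?S i)) = (\<Prod>a = 1..card (G i). fact (c i a + q_mult T j i a) / fact (c i a) :: complex)"
        by (simp add: prod_dividef eq_divide_eq)
    qed
    finally have cc: "of_nat (card {h \<in> ?E. (?J h, C h) = (j, c)}) =
      (\<Prod>i = 1..k. \<Prod>a = 1..card (G i). fact (c i a + q_mult T j i a) / fact (c i a) :: complex)" .
    show ?thesis unfolding cc if_P[OF True] by (simp only: prod.distrib mult_1_left mult_ac)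
  qed
  have "(\<Sum>h\<in>?E. (\<Prod>I\<in>T. K (image_mset \<l> (mset_set (h I ` I)))) * (\<Prod>b\<in>\<beta> - (\<Union>I\<in>T. h I ` I). K {#\<l> b#}))
     = (\<Sum>h\<in>?E. ?W (?J h) (C h))"
    by (intro sum.cong refl) (simp only: facts(1,2))
  also have "\<dots> = (\<Sum>p\<in>index_families k G T. \<Sum>h | h \<in> ?E \<and> (?J h, C h) = p. ?W (?J h) (C h))"
    by (rule sum.group[OF finE finF, symmetric]) (use facts(3) in blast)
  also have "\<dots> = (\<Sum>(j, c)\<in>index_families k G T. of_nat (card {h \<in> ?E. (?J h, C h) = (j, c)}) * ?W j c)"
  proof (intro sum.cong refl, clarify)
    fix j c
    have "(\<Sum>h | h \<in> ?E \<and> (?J h, C h) = (j, c). ?W (?J h) (C h)) = (\<Sum>h | h \<in> ?E \<and> (?J h, C h) = (j, c). ?W j c)"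
      by (rule sum.cong) auto
    then show "(\<Sum>h | h \<in> ?E \<and> (?J h, C h) = (j, c). ?W (?J h) (C h)) = of_nat (card {h \<in> ?E. (?J h, C h) = (j, c)}) * ?W j c"
      by (simp only: sum_constant)
  qed
  also have "\<dots> = (\<Sum>(j, c)\<in>index_families k G T. (if ?match j c then 1 else 0) *
        ((\<Prod>I\<in>T. K (image_mset (j I) (mset_set I))) *
         (\<Prod>i = 1..k. \<Prod>a = 1..card (G i). fact (c i a + q_mult T j i a) / fact (c i a) * K {#a#} ^ c i a)))"
    by (intro sum.cong refl, clarify) (rule fiber)
  finally show ?thesis .
qed

text \<open>A tree is the case of equality in the hypergraph bound. A connected hypergraph satisfies
  k - 1 <= sum of (|lab S| - 1) <= sum of (|S| - 1) = #(\<beta>) - #(\<rho>), so the numerical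
  condition forces \<open>lab\<close> to be injective on every group. It also excludes parallel
  hyperedges, since one of them could be deleted without disconnecting.\<close>

lemma tree_blocks_iff:
  assumes fin: "finite H" "H \<noteq> {}" and r: "refines H \<beta> \<pi>" and G: "bij_betw G {1..k} \<pi>"
    and lab: "\<And>b. b \<in> \<beta> \<Longrightarrow> lab b \<in> {1..k} \<and> b \<subseteq> G (lab b)" and \<rho>: "partition_on \<beta> \<rho>"
  shows "join_part H (Union ` \<rho>) \<pi> = {H} \<and> k + card \<rho> = card \<beta> + 1 \<longleftrightarrow> tree_blocks lab k \<rho>"
proof -
  have pb: "partition_on H \<beta>" and pp: "partition_on H \<pi>" using r by (auto simp: refines_def)
  have finb: "finite \<beta>" by (rule finite_elements[OF fin(1) pb])
  have finr: "finite \<rho>" by (rule finite_elements[OF finb \<rho>])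
  have "Union ` \<rho> \<in> {\<rho>. refines H \<beta> \<rho>}" using bij_betw_coarsenings[OF pb] \<rho> by (auto simp: bij_betw_def)
  then have pr: "partition_on H (Union ` \<rho>)" by (auto simp: refines_def)
  have Ginj: "inj_on G {1..k}" and Gim: "G ` {1..k} = \<pi>" using G by (auto simp: bij_betw_def)
  have k: "{1..k} \<noteq> {}" using Gim pp fin(2) by (auto simp: partition_on_def)
  have Ssub: "S \<subseteq> \<beta>" and Sne: "S \<noteq> {}" and finS: "finite S" if "S \<in> \<rho>" for S
    using partition_on_subset[OF \<rho> that] partition_on_nonempty[OF \<rho> that] finb finite_subset by auto
  have lS: "lab ` S \<subseteq> {1..k}" if "S \<in> \<rho>" for S using Ssub[OF that] lab by blast
  have m: "blocks_meeting \<pi> (\<Union>S) = G ` lab ` S" if S: "S \<in> \<rho>" for S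
  proof
    show "blocks_meeting \<pi> (\<Union>S) \<subseteq> G ` lab ` S"
    proof
      fix X assume "X \<in> blocks_meeting \<pi> (\<Union>S)"
      then obtain b x where X: "X \<in> \<pi>" and b: "b \<in> S" "x \<in> b" "x \<in> X" by (auto simp: blocks_meeting_def)
      have bb: "b \<in> \<beta>" using Ssub[OF S] b(1) by blast
      have "G (lab b) \<in> \<pi>" using lab[OF bb] Gim by blast
      then have "X = G (lab b)" using partition_on_same_block[OF pp X, of "G (lab b)" x] b(2,3) lab[OF bb] by blast
      then show "X \<in> G ` lab ` S" using b(1) by blast
    qed
    show "G ` lab ` S \<subseteq> blocks_meeting \<pi> (\<Union>S)"
    proof
      fix X assume "X \<in> G ` lab ` S"
      then obtain b where b: "b \<in> S" "X = G (lab b)" by blast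
      have bb: "b \<in> \<beta>" using Ssub[OF S] b(1) by blast
      obtain x where "x \<in> b" using partition_on_nonempty[OF pb bb] by blast
      then show "X \<in> blocks_meeting \<pi> (\<Union>S)" using b lab[OF bb] Gim unfolding blocks_meeting_def by blast
    qed
  qed
  have conn: "join_part H (Union ` \<rho>) \<pi> = {H} \<longleftrightarrow>
    (\<forall>U\<subseteq>{1..k}. U \<noteq> {} \<and> (\<forall>S\<in>\<rho>. lab ` S \<inter> U \<noteq> {} \<longrightarrow> lab ` S \<subseteq> U) \<longrightarrow> U = {1..k})"
    unfolding join_top_iff_hypergraph[OF fin(2) pr pp]
  proof
    assume a: "\<forall>\<S>\<subseteq>\<pi>. \<S> \<noteq> {} \<and> (\<forall>K\<in>Union ` \<rho>. blocks_meeting \<pi> K \<inter> \<S> \<noteq> {} \<longrightarrow> blocks_meeting \<pi> K \<subseteq> \<S>) \<longrightarrow> \<S> = \<pi>"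
    show "\<forall>U\<subseteq>{1..k}. U \<noteq> {} \<and> (\<forall>S\<in>\<rho>. lab ` S \<inter> U \<noteq> {} \<longrightarrow> lab ` S \<subseteq> U) \<longrightarrow> U = {1..k}"
    proof (intro allI impI)
      fix U assume U: "U \<subseteq> {1..k}" "U \<noteq> {} \<and> (\<forall>S\<in>\<rho>. lab ` S \<inter> U \<noteq> {} \<longrightarrow> lab ` S \<subseteq> U)"
      have "blocks_meeting \<pi> K \<subseteq> G ` U" if K: "K \<in> Union ` \<rho>" "blocks_meeting \<pi> K \<inter> G ` U \<noteq> {}" for K
      proof -
        obtain S where S: "S \<in> \<rho>" "K = \<Union>S" using K(1) by blast
        have "G ` (lab ` S \<inter> U) \<noteq> {}" using K(2) unfolding S(2) m[OF S(1)] inj_on_image_Int[OF Ginj lS[OF S(1)] U(1)] .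
        then have "lab ` S \<subseteq> U" using U(2) S(1) by blast
        then show ?thesis unfolding S(2) m[OF S(1)] by blast
      qed
      then have "\<forall>K\<in>Union ` \<rho>. blocks_meeting \<pi> K \<inter> G ` U \<noteq> {} \<longrightarrow> blocks_meeting \<pi> K \<subseteq> G ` U" by blast
      moreover have "G ` U \<subseteq> \<pi>" using U(1) Gim by blast
      ultimately have "G ` U = \<pi>" using a[THEN spec, of "G ` U"] U(2) by simp
      then have "G ` U = G ` {1..k}" using Gim by simp
      then show "U = {1..k}" using inj_on_image_eq_iff[OF Ginj U(1) order_refl] by simp
    qed
  next
    assume a: "\<forall>U\<subseteq>{1..k}. U \<noteq> {} \<and> (\<forall>S\<in>\<rho>. lab ` S \<inter> U \<noteq> {} \<longrightarrow> lab ` S \<subseteq> U) \<longrightarrow> U = {1..k}"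
    show "\<forall>\<S>\<subseteq>\<pi>. \<S> \<noteq> {} \<and> (\<forall>K\<in>Union ` \<rho>. blocks_meeting \<pi> K \<inter> \<S> \<noteq> {} \<longrightarrow> blocks_meeting \<pi> K \<subseteq> \<S>) \<longrightarrow> \<S> = \<pi>"
    proof (intro allI impI)
      fix \<S> assume s: "\<S> \<subseteq> \<pi>" "\<S> \<noteq> {} \<and> (\<forall>K\<in>Union ` \<rho>. blocks_meeting \<pi> K \<inter> \<S> \<noteq> {} \<longrightarrow> blocks_meeting \<pi> K \<subseteq> \<S>)"
      let ?U = "{i\<in>{1..k}. G i \<in> \<S>}"
      have GU: "G ` ?U = \<S>" using s(1) Gim by auto
      have "lab ` S \<subseteq> ?U" if S: "S \<in> \<rho>" "lab ` S \<inter> ?U \<noteq> {}" for S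
      proof -
        have "blocks_meeting \<pi> (\<Union>S) \<inter> \<S> \<noteq> {}" unfolding m[OF S(1)] using S(2) by blast
        then have "G ` lab ` S \<subseteq> \<S>" using s(2) S(1) unfolding m[OF S(1), symmetric] by blast
        then show ?thesis using lS[OF S(1)] by blast
      qed
      then have "\<forall>S\<in>\<rho>. lab ` S \<inter> ?U \<noteq> {} \<longrightarrow> lab ` S \<subseteq> ?U" by blast
      moreover have "?U \<noteq> {}" using GU s(2) by blast
      moreover have "?U \<subseteq> {1..k}" by blast
      ultimately have "?U = {1..k}" using a[THEN spec, of ?U] by simp
      then show "\<S> = \<pi>" using GU Gim by simp
    qed
  qed
  have Spos: "card S \<ge> 1" if "S \<in> \<rho>" for S using Sne[OF that] finS[OF that] by (simp add: Suc_le_eq card_gt_0_iff)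
  have ssum: "(\<Sum>S\<in>\<rho>. card S - 1) + card \<rho> = card \<beta>"
  proof -
    have "(\<Sum>S\<in>\<rho>. card S - 1) + card \<rho> = (\<Sum>S\<in>\<rho>. (card S - 1) + 1)" unfolding sum.distrib by simp
    also have "\<dots> = (\<Sum>S\<in>\<rho>. card S)" using Spos by (intro sum.cong refl le_add_diff_inverse2)
    also have "\<dots> = card \<beta>" by (rule product_partition[OF \<rho> finS, symmetric])
    finally show ?thesis .
  qed
  let ?L = "{S\<in>\<rho>. 2 \<le> card S}" and ?T = "(`) lab ` {S\<in>\<rho>. 2 \<le> card S}"
  have Tne: "I \<subseteq> {1..k} \<and> I \<noteq> {}" if I: "I \<in> ?T" for I
  proof -
    obtain S where "S \<in> \<rho>" "I = lab ` S" using I by blast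
    then show ?thesis using lS Sne by blast
  qed
  have Teq: "(\<Sum>S\<in>\<rho>. card S - 1) = (\<Sum>I\<in>?T. card I - 1)"
    if i: "\<And>S. S \<in> \<rho> \<Longrightarrow> inj_on lab S" and iL: "inj_on ((`) lab) ?L"
  proof -
    have "(\<Sum>I\<in>?T. card I - 1) = (\<Sum>S\<in>?L. card (lab ` S) - 1)" by (simp add: sum.reindex[OF iL])
    also have "\<dots> = (\<Sum>S\<in>?L. card S - 1)" using i by (intro sum.cong refl) (simp add: card_image)
    also have "\<dots> = (\<Sum>S\<in>\<rho>. card S - 1)" by (rule sum.mono_neutral_left[OF finr]) auto
    finally show ?thesis by simp
  qed
  \<comment> \<open>A group consisting of one element has a single colour and imposes no closure
    condition, hence may be dropped from the hypergraph.\<close>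
  have Tconn: "incidence_connected {1..k} ?T \<longleftrightarrow>
      (\<forall>U\<subseteq>{1..k}. U \<noteq> {} \<and> (\<forall>S\<in>\<rho>. lab ` S \<inter> U \<noteq> {} \<longrightarrow> lab ` S \<subseteq> U) \<longrightarrow> U = {1..k})"
  proof -
    have "(\<forall>I\<in>?T. I \<inter> U \<noteq> {} \<longrightarrow> I \<subseteq> U) \<longleftrightarrow> (\<forall>S\<in>\<rho>. lab ` S \<inter> U \<noteq> {} \<longrightarrow> lab ` S \<subseteq> U)" for U
    proof
      assume a: "\<forall>I\<in>?T. I \<inter> U \<noteq> {} \<longrightarrow> I \<subseteq> U"
      show "\<forall>S\<in>\<rho>. lab ` S \<inter> U \<noteq> {} \<longrightarrow> lab ` S \<subseteq> U"
      proof (intro ballI impI)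
        fix S assume S: "S \<in> \<rho>" "lab ` S \<inter> U \<noteq> {}"
        show "lab ` S \<subseteq> U"
        proof (cases "2 \<le> card S")
          case True
          then have "lab ` S \<in> ?T" using S(1) by blast
          then show ?thesis using a S(2) by blast
        next
          case False
          then have "card S = 1" using Spos[OF S(1)] by linarith
          then obtain b where "S = {b}" by (auto simp: card_1_singleton_iff)
          then show ?thesis using S(2) by auto
        qed
      qed
    qed blast
    then show ?thesis using incidence_connected_iff[OF k Tne, of ?T] by simp
  qed
  show ?thesis
  proof
    assume a: "join_part H (Union ` \<rho>) \<pi> = {H} \<and> k + card \<rho> = card \<beta> + 1"
    have c: "U = {1..k}" if U: "U \<subseteq> {1..k}" "U \<noteq> {}" "\<And>S. S \<in> \<rho> \<Longrightarrow> lab ` S \<inter> U \<noteq> {} \<Longrightarrow> lab ` S \<subseteq> U" for U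
    proof -
      have "\<forall>S\<in>\<rho>. lab ` S \<inter> U \<noteq> {} \<longrightarrow> lab ` S \<subseteq> U" using U(3) by blast
      then show ?thesis using a[THEN conjunct1, unfolded conn, THEN spec, THEN mp, OF U(1)] U(2) by simp
    qed
    have s1: "(\<Sum>S\<in>\<rho>. card S - 1) = k - 1" and k1: "k \<ge> 1" using a ssum k by auto
    have "card {1..k} \<le> 1 + (\<Sum>S\<in>\<rho>. card (lab ` S) - 1)"
      by (rule connected_hypergraph_card[OF _ k finr lS c]) auto
    then have "(\<Sum>S\<in>\<rho>. card S - 1) \<le> (\<Sum>S\<in>\<rho>. card (lab ` S) - 1)" using s1 by simp
    moreover have le: "card (lab ` S) - 1 \<le> card S - 1" if "S \<in> \<rho>" for S
      using card_image_le[OF finS[OF that]] by (intro diff_le_mono)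
    then have "(\<Sum>S\<in>\<rho>. card (lab ` S) - 1) \<le> (\<Sum>S\<in>\<rho>. card S - 1)" by (rule sum_mono)
    \<comment> \<open>Equal sums of termwise comparable numbers are equal term by term, which gives
      injectivity of \<open>lab\<close> on each group.\<close>
    ultimately have se: "(\<Sum>S\<in>\<rho>. card (lab ` S) - 1) = (\<Sum>S\<in>\<rho>. card S - 1)" by simp
    have i: "inj_on lab S" if S: "S \<in> \<rho>" for S
    proof -
      have "card (lab ` S) - 1 = card S - 1" by (rule sum_mono_inv[OF se le S finr])
      moreover have "card (lab ` S) \<ge> 1" using Sne[OF S] finS[OF S] by (simp add: Suc_le_eq card_gt_0_iff)
      ultimately have "card (lab ` S) = card S" using Spos[OF S] by linarith
      then show ?thesis by (rule eq_card_imp_inj_on[OF finS[OF S]])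
    qed
    \<comment> \<open>If two groups had the same colours, the hypergraph without \<open>S'\<close>
      would still be connected, although its bound has dropped by at least one.\<close>
    have iL: "inj_on ((`) lab) ?L"
    proof (rule inj_onI, rule ccontr)
      fix S S' assume S: "S \<in> ?L" "S' \<in> ?L" "lab ` S = lab ` S'" "S \<noteq> S'"
      have "card {1..k} \<le> 1 + (\<Sum>S\<in>\<rho> - {S'}. card (lab ` S) - 1)"
      proof (rule connected_hypergraph_card[OF _ k])
        fix U assume U: "U \<subseteq> {1..k}" "U \<noteq> {}" "\<And>S. S \<in> \<rho> - {S'} \<Longrightarrow> lab ` S \<inter> U \<noteq> {} \<Longrightarrow> lab ` S \<subseteq> U"
        show "U = {1..k}"
        proof (rule c[OF U(1,2)])
          fix X assume X: "X \<in> \<rho>" "lab ` X \<inter> U \<noteq> {}"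
          show "lab ` X \<subseteq> U"
          proof (cases "X = S'")
            case True
            then show ?thesis using U(3)[of S] S X by simp
          next
            case False
            then show ?thesis using U(3)[of X] X by simp
          qed
        qed
      qed (use finr lS in auto)
      moreover have "(\<Sum>S\<in>\<rho>. card (lab ` S) - 1) = (card (lab ` S') - 1) + (\<Sum>S\<in>\<rho> - {S'}. card (lab ` S) - 1)"
        by (rule sum.remove[OF finr]) (use S in simp)
      moreover have "card (lab ` S') \<ge> 2" using S(2) i[of S'] by (simp add: card_image)
      ultimately show False using se s1 k1 by simp
    qed
    have "?T \<in> bip_trees k"
      unfolding bip_trees_def
    proof (intro CollectI conjI ballI)
      fix I assume I: "I \<in> ?T"
      then show "I \<subseteq> {1..k}" using Tne by blast
      obtain S where "S \<in> \<rho>" "2 \<le> card S" "I = lab ` S" using I by blast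
      then show "2 \<le> card I" using i[of S] by (simp add: card_image)
    next
      show "incidence_connected {1..k} ?T" using Tconn a conn by blast
      show "(\<Sum>I\<in>?T. card I - 1) = k - 1" using Teq[OF i iL] s1 by simp
    qed
    then show "tree_blocks lab k \<rho>" using i iL by (simp add: tree_blocks_def)
  next
    assume t: "tree_blocks lab k \<rho>"
    then have i: "\<And>S. S \<in> \<rho> \<Longrightarrow> inj_on lab S" and iL: "inj_on ((`) lab) ?L" and T: "?T \<in> bip_trees k"
      by (auto simp: tree_blocks_def)
    have "incidence_connected {1..k} ?T" "(\<Sum>I\<in>?T. card I - 1) = k - 1" using T unfolding bip_trees_def by blast+
    moreover have "k \<ge> 1" using k by simp
    ultimately show "join_part H (Union ` \<rho>) \<pi> = {H} \<and> k + card \<rho> = card \<beta> + 1"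
      using Tconn conn Teq[OF i iL] ssum by simp
  qed
qed

section \<open>The tree sum for a fixed permutation\<close>

lemma count_mult_partition: "count (mult_partition m d) a = (if a \<in> {1..m} then d a else 0)"
proof -
  have "count (mult_partition m d) a = (\<Sum>x = 1..m. if x = a then d x else 0)"
    unfolding mult_partition_def count_sum by (intro sum.cong refl) simp
  then show ?thesis by (simp add: sum.delta)
qed

text \<open>No cycle is empty or longer than |X|, so comparing the multiplicities of the parts from
  1 to |X| is enough.\<close>

lemma cycle_type_eq_mult_partition_iff:
  assumes "finite X" "partition_on X (cycles_on X \<sigma>)"
  shows "cycle_type X \<sigma> = mult_partition (card X) d \<longleftrightarrow> (\<forall>a\<in>{1..card X}. count (cycle_type X \<sigma>) a = d a)"
proof
  assume a: "\<forall>a\<in>{1..card X}. count (cycle_type X \<sigma>) a = d a"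
  show "cycle_type X \<sigma> = mult_partition (card X) d"
  proof (rule multiset_eqI)
    fix a
    show "count (cycle_type X \<sigma>) a = count (mult_partition (card X) d) a"
    proof (cases "a \<in> {1..card X}")
      case True then show ?thesis using a by (simp add: count_mult_partition)
    next
      case False
      have "a \<notin># cycle_type X \<sigma>"
      proof
        assume m: "a \<in># cycle_type X \<sigma>"
        then obtain c where "c \<in> cycles_on X \<sigma>" "a = card c" using finite_cycles_on[OF assms(1), of \<sigma>] by (auto simp: cycle_type_def)
        then have "a \<le> card X" using partition_on_subset[OF assms(2)] assms(1) by (auto intro: card_mono)
        then show False using cycle_type_pos[OF assms m] False by simp
      qed
      then show ?thesis using False by (auto simp: count_mult_partition not_in_iff)
    qed
  qed
qed (simp add: count_mult_partition)

text \<open>Coarsenings of the cycle partition become partitions of the set of cycles, each cycle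
  being coloured by the \<pi>-block that contains it. The two conditions select the tree-like ones,
  which are sorted by tree and index family. The indicator carries the only dependence on \<sigma>
  that remains, through its cycle types in the blocks.\<close>

lemma sum_tree_terms:
  fixes K :: "nat multiset \<Rightarrow> complex" and H :: "nat set" and G :: "nat \<Rightarrow> nat set"
  assumes fin: "finite H" "H \<noteq> {}" and \<sigma>: "\<sigma> permutes H" and r: "refines H (cycles_on H \<sigma>) \<pi>" and G: "bij_betw G {1..k} \<pi>"
  shows "(\<Sum>\<rho> | refines H (cycles_on H \<sigma>) \<rho> \<and> join_part H \<rho> \<pi> = {H} \<and> k + card \<rho> = card (cycles_on H \<sigma>) + 1.
      \<Prod>V\<in>\<rho>. K (cycle_type V \<sigma>)) =
    (\<Sum>T\<in>bip_trees k. \<Sum>(j, c)\<in>index_families k G T.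
        (if \<forall>i\<in>{1..k}. cycle_type (G i) \<sigma> = mult_partition (card (G i)) (\<lambda>a. c i a + q_mult T j i a) then 1 else 0) *
        ((\<Prod>I\<in>T. K (image_mset (j I) (mset_set I))) *
         (\<Prod>i = 1..k. \<Prod>a = 1..card (G i). fact (c i a + q_mult T j i a) / fact (c i a) * K {#a#} ^ c i a)))"
proof -
  let ?\<beta> = "cycles_on H \<sigma>"
  have pb: "partition_on H ?\<beta>" by (rule partition_on_cycles[OF fin(1) \<sigma>])
  have pp: "partition_on H \<pi>" and inv: "\<And>X. X \<in> \<pi> \<Longrightarrow> \<sigma> ` X = X" using r refines_cycles_iff[OF fin(1) \<sigma>] by auto
  have finb: "finite ?\<beta>" by (rule finite_cycles_on[OF fin(1)])
  have Gp: "G i \<in> \<pi>" if "i \<in> {1..k}" for i using G that by (auto simp: bij_betw_def)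
  have "\<exists>i. i \<in> {1..k} \<and> b \<subseteq> G i" if b: "b \<in> ?\<beta>" for b
  proof -
    obtain Y where Y: "Y \<in> \<pi>" "b \<subseteq> Y" using r b unfolding refines_def by blast
    then show ?thesis using G by (auto simp: bij_betw_def)
  qed
  then obtain lab where lab: "\<And>b. b \<in> ?\<beta> \<Longrightarrow> lab b \<in> {1..k} \<and> b \<subseteq> G (lab b)" by metis
  have labi: "{b\<in>?\<beta>. lab b = i} = cycles_on (G i) \<sigma>" if i: "i \<in> {1..k}" for i
  proof -
    have "lab b = i" if b: "b \<in> ?\<beta>" "b \<subseteq> G i" for b
    proof -
      obtain x where "x \<in> b" using partition_on_nonempty[OF pb b(1)] by blast
      then have "G (lab b) = G i"
        using partition_on_same_block[OF pp Gp Gp[OF i], of "lab b" x] lab[OF b(1)] b(2) by blast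
      then show ?thesis using G lab[OF b(1)] i by (auto simp: bij_betw_def dest: inj_onD)
    qed
    then have "{b\<in>?\<beta>. lab b = i} = {b\<in>?\<beta>. b \<subseteq> G i}" using lab by blast
    then show ?thesis using cycles_on_invariant[OF fin(1) \<sigma> partition_on_subset[OF pp Gp[OF i]] inv[OF Gp[OF i]]] by simp
  qed
  have pG: "partition_on (G i) (cycles_on (G i) \<sigma>)" "finite (G i)" if i: "i \<in> {1..k}" for i
    using partition_on_cycles_invariant[OF fin(1) \<sigma> partition_on_subset[OF pp Gp[OF i]] inv[OF Gp[OF i]]]
      finite_subset[OF partition_on_subset[OF pp Gp[OF i]] fin(1)] by auto
  have cG: "card (G i) = (\<Sum>b | b \<in> ?\<beta> \<and> lab b = i. card b)" if i: "i \<in> {1..k}" for i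
  proof -
    have "finite b" if "b \<in> cycles_on (G i) \<sigma>" for b
      using partition_on_subset[OF pG(1)[OF i] that] pG(2)[OF i] finite_subset by blast
    then show ?thesis using product_partition[OF pG(1)[OF i]] labi[OF i] by simp
  qed
  have bpos: "card b \<ge> 1" if "b \<in> ?\<beta>" for b
    using partition_on_nonempty[OF pb that] finite_subset[OF partition_on_subset[OF pb that] fin(1)] by (simp add: Suc_le_eq card_gt_0_iff)
  have cnt: "card {b\<in>?\<beta>. lab b = i \<and> card b = a} = count (cycle_type (G i) \<sigma>) a" if i: "i \<in> {1..k}" for i a
  proof -
    have "{b\<in>?\<beta>. lab b = i \<and> card b = a} = {b\<in>cycles_on (G i) \<sigma>. card b = a}" using labi[OF i] by blast
    then show ?thesis unfolding cycle_type_def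
      using count_image_mset_eq_card_vimage[OF finite_cycles_on[OF pG(2)[OF i]], of card \<sigma> a] by simp
  qed
  have ctU: "cycle_type (\<Union>S) \<sigma> = image_mset card (mset_set S)" if "S \<subseteq> ?\<beta>" for S
    using cycles_on_Union[OF fin(1) \<sigma> that] by (simp add: cycle_type_def)
  let ?Q = "\<lambda>\<rho>. join_part H \<rho> \<pi> = {H} \<and> k + card \<rho> = card ?\<beta> + 1"
  have "(\<Sum>\<rho> | refines H ?\<beta> \<rho> \<and> ?Q \<rho>. \<Prod>V\<in>\<rho>. K (cycle_type V \<sigma>))
      = (\<Sum>\<rho> | refines H ?\<beta> \<rho>. if ?Q \<rho> then \<Prod>V\<in>\<rho>. K (cycle_type V \<sigma>) else 0)"
    using sum.inter_filter[OF finite_refines(2)[OF fin(1), of ?\<beta>], of "\<lambda>\<rho>. \<Prod>V\<in>\<rho>. K (cycle_type V \<sigma>)" ?Q] by simp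
  also have "\<dots> = (\<Sum>\<rho> | partition_on ?\<beta> \<rho>. if ?Q (Union ` \<rho>) then \<Prod>V\<in>Union ` \<rho>. K (cycle_type V \<sigma>) else 0)"
    by (rule sum_coarsenings[OF pb])
  also have "\<dots> = (\<Sum>\<rho> | partition_on ?\<beta> \<rho>. if tree_blocks lab k \<rho> then \<Prod>S\<in>\<rho>. K (image_mset card (mset_set S)) else 0)"
  proof (intro sum.cong refl)
    fix \<rho> assume "\<rho> \<in> {\<rho>. partition_on ?\<beta> \<rho>}"
    then have p: "partition_on ?\<beta> \<rho>" by simp
    note i = inj_on_Union_partition[OF pb p]
    have "?Q (Union ` \<rho>) \<longleftrightarrow> tree_blocks lab k \<rho>"
      using tree_blocks_iff[OF fin r G lab p] by (simp add: card_image[OF i])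
    moreover have "(\<Prod>V\<in>Union ` \<rho>. K (cycle_type V \<sigma>)) = (\<Prod>S\<in>\<rho>. K (image_mset card (mset_set S)))"
      using ctU partition_on_subset[OF p] by (simp add: prod.reindex[OF i])
    ultimately show "(if ?Q (Union ` \<rho>) then \<Prod>V\<in>Union ` \<rho>. K (cycle_type V \<sigma>) else 0) =
      (if tree_blocks lab k \<rho> then \<Prod>S\<in>\<rho>. K (image_mset card (mset_set S)) else 0)" by (simp only:)
  qed
  also have "\<dots> = (\<Sum>\<rho> | partition_on ?\<beta> \<rho> \<and> tree_blocks lab k \<rho>. \<Prod>S\<in>\<rho>. K (image_mset card (mset_set S)))"
    using sum.inter_filter[OF finitely_many_partition_on[OF finb], of "\<lambda>\<rho>. \<Prod>S\<in>\<rho>. K (image_mset card (mset_set S))" "tree_blocks lab k"] by simp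
  also have "\<dots> = (\<Sum>T\<in>bip_trees k. \<Sum>h\<in>tree_embeddings ?\<beta> lab T. (\<Prod>I\<in>T. K (image_mset card (mset_set (h I ` I)))) *
      (\<Prod>b\<in>?\<beta> - (\<Union>I\<in>T. h I ` I). K (image_mset card (mset_set {b}))))"
    by (rule sum_tree_blocks[OF finb])
  also have "\<dots> = (\<Sum>T\<in>bip_trees k. \<Sum>(j, c)\<in>index_families k G T.
        (if \<forall>i\<in>{1..k}. cycle_type (G i) \<sigma> = mult_partition (card (G i)) (\<lambda>a. c i a + q_mult T j i a) then 1 else 0) *
        ((\<Prod>I\<in>T. K (image_mset (j I) (mset_set I))) *
         (\<Prod>i = 1..k. \<Prod>a = 1..card (G i). fact (c i a + q_mult T j i a) / fact (c i a) * K {#a#} ^ c i a)))"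
  proof (intro sum.cong refl)
    fix T assume T: "T \<in> bip_trees k"
    have "(\<Sum>h\<in>tree_embeddings ?\<beta> lab T. (\<Prod>I\<in>T. K (image_mset card (mset_set (h I ` I)))) *
      (\<Prod>b\<in>?\<beta> - (\<Union>I\<in>T. h I ` I). K {#card b#})) = (\<Sum>(j, c)\<in>index_families k G T.
        (if \<forall>i\<in>{1..k}. \<forall>a\<in>{1..card (G i)}. card {b\<in>?\<beta>. lab b = i \<and> card b = a} = c i a + q_mult T j i a then 1 else 0) *
        ((\<Prod>I\<in>T. K (image_mset (j I) (mset_set I))) *
         (\<Prod>i = 1..k. \<Prod>a = 1..card (G i). fact (c i a + q_mult T j i a) / fact (c i a) * K {#a#} ^ c i a)))"
      by (rule sum_tree_embeddings_index_families[OF finb T _ bpos cG]) (use lab in blast)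
    also have "\<dots> = (\<Sum>(j, c)\<in>index_families k G T.
        (if \<forall>i\<in>{1..k}. cycle_type (G i) \<sigma> = mult_partition (card (G i)) (\<lambda>a. c i a + q_mult T j i a) then 1 else 0) *
        ((\<Prod>I\<in>T. K (image_mset (j I) (mset_set I))) *
         (\<Prod>i = 1..k. \<Prod>a = 1..card (G i). fact (c i a + q_mult T j i a) / fact (c i a) * K {#a#} ^ c i a)))"
    proof (intro sum.cong refl, clarify)
      fix j c
      have "(\<forall>i\<in>{1..k}. \<forall>a\<in>{1..card (G i)}. card {b\<in>?\<beta>. lab b = i \<and> card b = a} = c i a + q_mult T j i a)
        \<longleftrightarrow> (\<forall>i\<in>{1..k}. cycle_type (G i) \<sigma> = mult_partition (card (G i)) (\<lambda>a. c i a + q_mult T j i a))"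
      proof (rule ball_cong[OF refl])
        fix i assume i: "i \<in> {1..k}"
        show "(\<forall>a\<in>{1..card (G i)}. card {b\<in>?\<beta>. lab b = i \<and> card b = a} = c i a + q_mult T j i a)
          \<longleftrightarrow> cycle_type (G i) \<sigma> = mult_partition (card (G i)) (\<lambda>a. c i a + q_mult T j i a)"
          unfolding cycle_type_eq_mult_partition_iff[OF pG(2)[OF i] pG(1)[OF i]] cnt[OF i] ..
      qed
      then show "(if \<forall>i\<in>{1..k}. \<forall>a\<in>{1..card (G i)}. card {b\<in>?\<beta>. lab b = i \<and> card b = a} = c i a + q_mult T j i a then 1 else 0) *
        ((\<Prod>I\<in>T. K (image_mset (j I) (mset_set I))) *
         (\<Prod>i = 1..k. \<Prod>a = 1..card (G i). fact (c i a + q_mult T j i a) / fact (c i a) * K {#a#} ^ c i a)) =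
        (if \<forall>i\<in>{1..k}. cycle_type (G i) \<sigma> = mult_partition (card (G i)) (\<lambda>a. c i a + q_mult T j i a) then 1 else 0) *
        ((\<Prod>I\<in>T. K (image_mset (j I) (mset_set I))) *
         (\<Prod>i = 1..k. \<Prod>a = 1..card (G i). fact (c i a + q_mult T j i a) / fact (c i a) * K {#a#} ^ c i a))"
        by (simp only:)
    qed
    finally show "(\<Sum>h\<in>tree_embeddings ?\<beta> lab T. (\<Prod>I\<in>T. K (image_mset card (mset_set (h I ` I)))) *
      (\<Prod>b\<in>?\<beta> - (\<Union>I\<in>T. h I ` I). K (image_mset card (mset_set {b})))) = (\<Sum>(j, c)\<in>index_families k G T.
        (if \<forall>i\<in>{1..k}. cycle_type (G i) \<sigma> = mult_partition (card (G i)) (\<lambda>a. c i a + q_mult T j i a) then 1 else 0) *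
        ((\<Prod>I\<in>T. K (image_mset (j I) (mset_set I))) *
         (\<Prod>i = 1..k. \<Prod>a = 1..card (G i). fact (c i a + q_mult T j i a) / fact (c i a) * K {#a#} ^ c i a)))" by simp
  qed
  finally show ?thesis .
qed

text \<open>Disjoint blocks have different minima, so the rank of the minimum is injective into
  {1..#(\<pi>)} and hence bijective; \<open>nth_block\<close> is its inverse.\<close>

lemma nth_block_bij:
  assumes fin: "finite H" and p: "partition_on H \<pi>"
  shows "bij_betw (nth_block \<pi>) {1..card \<pi>} \<pi>"
proof -
  let ?r = "\<lambda>G. card {X \<in> \<pi>. Min X \<le> Min G}"
  have finp: "finite \<pi>" by (rule finite_elements[OF fin p])
  have mono: "?r X < ?r Y" if XY: "X \<in> \<pi>" "Y \<in> \<pi>" "Min X < Min Y" for X Y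
  proof (rule psubset_card_mono)
    show "{Z \<in> \<pi>. Min Z \<le> Min X} \<subset> {Z \<in> \<pi>. Min Z \<le> Min Y}"
    proof
      show "{Z \<in> \<pi>. Min Z \<le> Min X} \<subseteq> {Z \<in> \<pi>. Min Z \<le> Min Y}" using XY(3) by auto
      have "Y \<in> {Z \<in> \<pi>. Min Z \<le> Min Y}" "Y \<notin> {Z \<in> \<pi>. Min Z \<le> Min X}" using XY by auto
      then show "{Z \<in> \<pi>. Min Z \<le> Min X} \<noteq> {Z \<in> \<pi>. Min Z \<le> Min Y}" by blast
    qed
  qed (use finp in simp)
  have inj: "inj_on ?r \<pi>"
  proof (rule inj_onI)
    fix X Y assume XY: "X \<in> \<pi>" "Y \<in> \<pi>" "?r X = ?r Y"
    then have m: "Min X = Min Y"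
      using mono[of X Y] mono[of Y X] by (cases "Min X" "Min Y" rule: linorder_cases) simp_all
    have "finite X" "X \<noteq> {}" "finite Y" "Y \<noteq> {}"
      using finite_subset[OF partition_on_subset[OF p] fin] partition_on_nonempty[OF p] XY by auto
    then have "Min X \<in> X" "Min X \<in> Y" using m Min_in[of X] Min_in[of Y] by simp_all
    then show "X = Y" by (rule partition_on_same_block[OF p XY(1,2)])
  qed
  have "?r ` \<pi> \<subseteq> {1..card \<pi>}"
  proof
    fix i assume "i \<in> ?r ` \<pi>"
    then obtain X where X: "X \<in> \<pi>" "i = ?r X" by blast
    have "?r X \<le> card \<pi>" using finp by (intro card_mono) auto
    moreover have "{Z \<in> \<pi>. Min Z \<le> Min X} \<noteq> {}" using X by blast
    then have "?r X > 0" using finp by (simp add: card_gt_0_iff)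
    ultimately show "i \<in> {1..card \<pi>}" using X by simp
  qed
  then have im: "?r ` \<pi> = {1..card \<pi>}" by (intro card_subset_eq) (auto simp: card_image[OF inj])
  have nb: "nth_block \<pi> (?r X) = X" if X: "X \<in> \<pi>" for X
    unfolding nth_block_def
  proof (rule the_equality)
    fix Y assume "Y \<in> \<pi> \<and> ?r Y = ?r X"
    then show "Y = X" using inj_onD[OF inj] X by blast
  qed (use X in simp)
  show ?thesis
  proof (rule bij_betwI[where g = ?r])
    have pre: "\<exists>X\<in>\<pi>. i = ?r X" if i: "i \<in> {1..card \<pi>}" for i
    proof -
      have "i \<in> ?r ` \<pi>" unfolding im by (rule i)
      then show ?thesis by (rule imageE) (rule bexI)
    qed
    show "nth_block \<pi> \<in> {1..card \<pi>} \<rightarrow> \<pi>"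
    proof (rule funcsetI)
      fix i assume "i \<in> {1..card \<pi>}"
      then obtain X where X: "X \<in> \<pi>" "i = ?r X" using pre by blast
      show "nth_block \<pi> i \<in> \<pi>" unfolding X(2) nb[OF X(1)] by (rule X(1))
    qed
    show "?r \<in> \<pi> \<rightarrow> {1..card \<pi>}" using im by blast
    show "?r (nth_block \<pi> i) = i" if i: "i \<in> {1..card \<pi>}" for i
    proof -
      obtain X where X: "X \<in> \<pi>" "i = ?r X" using pre[OF i] by blast
      show ?thesis unfolding X(2) nb[OF X(1)] by (rule refl)
    qed
    show "nth_block \<pi> (?r X) = X" if "X \<in> \<pi>" for X by (rule nb[OF that])
  qed
qed

section \<open>Planar permutations relative to a partition\<close>

text \<open>Blocks of the join are minimal among nonempty saturated sets: from a point of
  \<open>U\<close> the transitive closure never leaves \<open>U\<close>.\<close>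

lemma join_block_saturated:
  assumes p: "partition_on H \<pi>\<^sub>1" "partition_on H \<pi>\<^sub>2" and X: "X \<in> join_part H \<pi>\<^sub>1 \<pi>\<^sub>2"
    and U: "U \<subseteq> X" "U \<noteq> {}" "\<And>Y. Y \<in> \<pi>\<^sub>1 \<union> \<pi>\<^sub>2 \<Longrightarrow> Y \<inter> U \<noteq> {} \<Longrightarrow> Y \<subseteq> U"
  shows "U = X"
proof -
  let ?R = "(same_block \<pi>\<^sub>1 \<union> same_block \<pi>\<^sub>2)\<^sup>+"
  have e: "equiv H ?R" by (rule equiv_join_part[OF p])
  obtain u where u: "u \<in> U" using U by blast
  have "X \<in> H // ?R" using X by (simp add: join_part_def)
  then obtain x where x: "X = ?R `` {x}" by (rule quotientE)
  have "(x, u) \<in> ?R" using U(1) u x by blast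
  then have Xu: "X = ?R `` {u}" unfolding x by (rule equiv_class_eq[OF e])
  have "y \<in> U" if "(u, y) \<in> ?R" for y
    using that
  proof (induction rule: trancl_induct)
    case (base y)
    then obtain Y where "Y \<in> \<pi>\<^sub>1 \<union> \<pi>\<^sub>2" "u \<in> Y" "y \<in> Y" by (auto simp: same_block_def)
    then show ?case using U(3)[of Y] u by blast
  next
    case (step y z)
    then obtain Y where "Y \<in> \<pi>\<^sub>1 \<union> \<pi>\<^sub>2" "y \<in> Y" "z \<in> Y" by (auto simp: same_block_def)
    then show ?case using U(3)[of Y] step.IH by blast
  qed
  then show ?thesis using Xu U(1) by blast
qed

lemma join_part_commute: "join_part H \<pi> \<rho> = join_part H \<rho> \<pi>"
  by (simp add: join_part_def Un_commute)

text \<open>Genus zero with a single joint block: |X| + 2 is |X| + 2 #(\<pi>) for #(\<pi>) = 1.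
  Since \<gamma> lives on a larger set, it is restricted to \<open>X\<close> before its inverse is
  taken.\<close>

definition planar_conn :: "('a \<Rightarrow> 'a) \<Rightarrow> 'a set \<Rightarrow> ('a \<Rightarrow> 'a) \<Rightarrow> bool" where
  "planar_conn \<gamma> X s \<longleftrightarrow> join_part X (cycles_on X s) (cycles_on X \<gamma>) = {X} \<and>
    card (cycles_on X s) + card (cycles_on X \<gamma>) + card (cycles_on X (s \<circ> inv_into UNIV (perm_restrict \<gamma> X))) = card X + 2"

lemma image_inv_invariant:
  assumes "\<tau> permutes H" "\<tau> ` X = X"
  shows "inv_into UNIV \<tau> ` X = X"
proof -
  have "inv_into UNIV \<tau> ` \<tau> ` X = X" by (simp add: image_image permutes_inverses(2)[OF assms(1)])
  then show ?thesis using assms(2) by simp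
qed

text \<open>Saturation can be tested inside an invariant block, because a cycle meeting the block
  lies in it. For the converse, each block of the join is a saturated part of a block of \<pi>, so
  connectedness there makes the two equal.\<close>

lemma join_part_eq_iff_blocks:
  assumes fin: "finite H" and \<sigma>: "\<sigma> permutes H" and \<gamma>: "\<gamma> permutes H" and r: "refines H (cycles_on H \<gamma>) \<pi>"
  shows "join_part H (cycles_on H \<sigma>) (cycles_on H \<gamma>) = \<pi> \<longleftrightarrow>
    (\<forall>X\<in>\<pi>. \<sigma> ` X = X) \<and> (\<forall>X\<in>\<pi>. join_part X (cycles_on X \<sigma>) (cycles_on X \<gamma>) = {X})"
proof -
  have pp: "partition_on H \<pi>" and gi: "\<And>X. X \<in> \<pi> \<Longrightarrow> \<gamma> ` X = X" using r refines_cycles_iff[OF fin \<gamma>] by auto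
  note pc = partition_on_cycles[OF fin \<sigma>] partition_on_cycles[OF fin \<gamma>]
  note rj = refines_join_part[OF pc]
  have sub: "X \<subseteq> H" and ne: "X \<noteq> {}" if "X \<in> \<pi>" for X
    using partition_on_subset[OF pp that] partition_on_nonempty[OF pp that] by auto
  have pX: "partition_on X (cycles_on X \<sigma>)" "partition_on X (cycles_on X \<gamma>)" if "X \<in> \<pi>" "\<sigma> ` X = X" for X
    using partition_on_cycles_invariant[OF fin \<sigma> sub[OF that(1)] that(2)]
      partition_on_cycles_invariant[OF fin \<gamma> sub[OF that(1)] gi[OF that(1)]] by auto
  have meet: "Y \<subseteq> X" if Y: "Y \<in> cycles_on H s" "Y \<inter> X \<noteq> {}" and s: "s permutes H" "s ` X = X" for Y X s
  proof -
    obtain x where x: "x \<in> Y" "x \<in> X" using Y(2) by blast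
    have "Y = orbit s x" using Y(1) x(1) orbit_eq_of_mem[OF fin s(1)] by (auto simp: cycles_on_def)
    then show ?thesis using orbit_subset_invariant[of s X x] s(2) x(2) by simp
  qed
  have cyc: "Y \<in> cycles_on X s" if Y: "Y \<in> cycles_on H s" "Y \<inter> U \<noteq> {}" "U \<subseteq> X" and s: "s permutes H" "s ` X = X" for Y X U s
  proof -
    obtain x where x: "x \<in> Y" "x \<in> X" using Y by blast
    have "Y = orbit s x" using Y(1) x(1) orbit_eq_of_mem[OF fin s(1)] by (auto simp: cycles_on_def)
    then show ?thesis using x(2) by (simp add: cycles_on_def)
  qed
  have cycsub: "Y \<in> cycles_on H s" if "Y \<in> cycles_on X s" "X \<subseteq> H" for Y X s using that by (auto simp: cycles_on_def)
  show ?thesis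
  proof
    assume j: "join_part H (cycles_on H \<sigma>) (cycles_on H \<gamma>) = \<pi>"
    then have rs: "refines H (cycles_on H \<sigma>) \<pi>" using rj(1) by simp
    then have si: "\<And>X. X \<in> \<pi> \<Longrightarrow> \<sigma> ` X = X" using refines_cycles_iff[OF fin \<sigma>] by blast
    have "join_part X (cycles_on X \<sigma>) (cycles_on X \<gamma>) = {X}" if X: "X \<in> \<pi>" for X
      unfolding join_top_iff_saturated[OF ne[OF X] pX[OF X si[OF X]]]
    proof (intro allI impI)
      fix U assume U: "U \<subseteq> X" "U \<noteq> {} \<and> (\<forall>Y\<in>cycles_on X \<sigma> \<union> cycles_on X \<gamma>. Y \<inter> U \<noteq> {} \<longrightarrow> Y \<subseteq> U)"
      show "U = X"
      proof (rule join_block_saturated[OF pc])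
        show "X \<in> join_part H (cycles_on H \<sigma>) (cycles_on H \<gamma>)" using X j by simp
        show "U \<subseteq> X" "U \<noteq> {}" using U by auto
        fix Y assume Y: "Y \<in> cycles_on H \<sigma> \<union> cycles_on H \<gamma>" "Y \<inter> U \<noteq> {}"
        have "Y \<in> cycles_on X \<sigma> \<union> cycles_on X \<gamma>"
          using Y cyc[OF _ Y(2) U(1) \<sigma> si[OF X]] cyc[OF _ Y(2) U(1) \<gamma> gi[OF X]] by blast
        then show "Y \<subseteq> U" using U(2) Y(2) by blast
      qed
    qed
    then show "(\<forall>X\<in>\<pi>. \<sigma> ` X = X) \<and> (\<forall>X\<in>\<pi>. join_part X (cycles_on X \<sigma>) (cycles_on X \<gamma>) = {X})" using si by blast
  next
    assume a: "(\<forall>X\<in>\<pi>. \<sigma> ` X = X) \<and> (\<forall>X\<in>\<pi>. join_part X (cycles_on X \<sigma>) (cycles_on X \<gamma>) = {X})"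
    let ?J = "join_part H (cycles_on H \<sigma>) (cycles_on H \<gamma>)"
    have rs: "refines H (cycles_on H \<sigma>) \<pi>" using refines_cycles_iff[OF fin \<sigma>] pp conjunct1[OF a] by simp
    have rJ: "refines H ?J \<pi>" by (rule join_part_least[OF rs r])
    have pJ: "partition_on H ?J" using rJ by (simp add: refines_def)
    have up: "\<exists>W\<in>?J. Y \<subseteq> W" if "Y \<in> cycles_on H \<sigma> \<union> cycles_on H \<gamma>" for Y
      using rj that by (auto simp: refines_def)
    have "\<exists>Z\<in>?J. X \<subseteq> Z" if X: "X \<in> \<pi>" for X
    proof -
      have sX: "\<sigma> ` X = X" using a X by blast
      obtain x where x: "x \<in> X" using ne[OF X] by blast
      then have "x \<in> H" using sub[OF X] by blast
      then obtain Z where Z: "Z \<in> ?J" "x \<in> Z" using partition_on_ex[OF pJ] by blast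
      obtain X' where X': "X' \<in> \<pi>" "Z \<subseteq> X'" using rJ Z(1) unfolding refines_def by blast
      then have "X' = X" using partition_on_same_block[OF pp X'(1) X _ x] Z(2) by blast
      then have ZX: "Z \<subseteq> X" using X' by simp
      have cl: "Y \<subseteq> Z" if Y: "Y \<in> cycles_on X \<sigma> \<union> cycles_on X \<gamma>" "Y \<inter> Z \<noteq> {}" for Y
      proof -
        have "Y \<in> cycles_on H \<sigma> \<union> cycles_on H \<gamma>" using Y(1) cycsub[OF _ sub[OF X]] by blast
        then obtain W where W: "W \<in> ?J" "Y \<subseteq> W" using up by blast
        obtain y where "y \<in> Y" "y \<in> Z" using Y(2) by blast
        then have "W = Z" using partition_on_same_block[OF pJ W(1) Z(1), of y] W(2) by blast
        then show ?thesis using W(2) by simp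
      qed
      have top: "join_part X (cycles_on X \<sigma>) (cycles_on X \<gamma>) = {X}" using a X by blast
      have "\<forall>Y\<in>cycles_on X \<sigma> \<union> cycles_on X \<gamma>. Y \<inter> Z \<noteq> {} \<longrightarrow> Y \<subseteq> Z" using cl by blast
      moreover have "Z \<noteq> {}" using Z(2) by blast
      ultimately have "Z = X"
        using top[unfolded join_top_iff_saturated[OF ne[OF X] pX[OF X sX]], THEN spec, THEN mp, OF ZX] by simp
      then show ?thesis using Z(1) by blast
    qed
    then have "refines H \<pi> ?J" using pp pJ by (simp add: refines_def)
    then show "?J = \<pi>" using rJ refines_asym by blast
  qed
qed

text \<open>The genus inequality holds in every block of \<pi> with one joint block, and cycle
  counts and sizes are additive over blocks. So equality for the whole set is equality in each
  block.\<close>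

lemma planar_conn_local:
  assumes fin: "finite H" and \<sigma>: "\<sigma> permutes H" and \<gamma>: "\<gamma> permutes H" and r: "refines H (cycles_on H \<gamma>) \<pi>"
  shows "join_part H (cycles_on H \<sigma>) (cycles_on H \<gamma>) = \<pi> \<and>
      card (cycles_on H \<sigma>) + card (cycles_on H \<gamma>) + card (cycles_on H (\<sigma> \<circ> inv_into UNIV \<gamma>)) = card H + 2 * card \<pi>
    \<longleftrightarrow> (\<forall>X\<in>\<pi>. \<sigma> ` X = X) \<and> (\<forall>X\<in>\<pi>. planar_conn \<gamma> X (perm_restrict \<sigma> X))"
proof (cases "(\<forall>X\<in>\<pi>. \<sigma> ` X = X) \<and> (\<forall>X\<in>\<pi>. join_part X (cycles_on X \<sigma>) (cycles_on X \<gamma>) = {X})")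
  case True
  have pp: "partition_on H \<pi>" and gi: "\<And>X. X \<in> \<pi> \<Longrightarrow> \<gamma> ` X = X" using r refines_cycles_iff[OF fin \<gamma>] by auto
  have si: "\<And>X. X \<in> \<pi> \<Longrightarrow> \<sigma> ` X = X" using True by blast
  have finp: "finite \<pi>" by (rule finite_elements[OF fin pp])
  have finX: "finite X" if "X \<in> \<pi>" for X using finite_subset[OF partition_on_subset[OF pp that] fin] .
  let ?a = "\<sigma> \<circ> inv_into UNIV \<gamma>"
  have a: "?a permutes H" using \<sigma> \<gamma> permutes_compose permutes_inv by blast
  have ai: "?a ` X = X" if X: "X \<in> \<pi>" for X
  proof -
    have "\<sigma> ` inv_into UNIV \<gamma> ` X = X" using image_inv_invariant[OF \<gamma> gi[OF X]] si[OF X] by simp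
    then show ?thesis by (simp only: image_comp)
  qed
  let ?f = "\<lambda>X. card (cycles_on X \<sigma>) + card (cycles_on X \<gamma>) + card (cycles_on X ?a)"
  have tot: "card (cycles_on H \<sigma>) + card (cycles_on H \<gamma>) + card (cycles_on H ?a) = (\<Sum>X\<in>\<pi>. ?f X)"
    using card_cycles_on_sum[OF fin \<sigma> pp] card_cycles_on_sum[OF fin \<gamma> pp] card_cycles_on_sum[OF fin a pp] si gi ai
    by (simp add: sum.distrib)
  have totH: "card H + 2 * card \<pi> = (\<Sum>X\<in>\<pi>. card X + 2)"
    using product_partition[OF pp finX] by (simp only: sum.distrib sum_constant) simp
  have res: "cycles_on X (perm_restrict \<sigma> X) = cycles_on X \<sigma>" "cycles_on X (perm_restrict \<gamma> X) = cycles_on X \<gamma>"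
    "cycles_on X (perm_restrict \<sigma> X \<circ> inv_into UNIV (perm_restrict \<gamma> X)) = cycles_on X ?a" if X: "X \<in> \<pi>" for X
    using cycles_on_perm_restrict[OF si[OF X]] cycles_on_perm_restrict[OF gi[OF X]] cycles_on_perm_restrict[OF ai[OF X]]
      perm_restrict_comp_inv[OF finX[OF X] \<sigma> \<gamma> si[OF X] gi[OF X]] by simp_all
  have le: "?f X \<le> card X + 2" if X: "X \<in> \<pi>" for X
  proof -
    have s: "perm_restrict \<sigma> X permutes X" "perm_restrict \<gamma> X permutes X"
      using perm_restrict_permutes[OF finX[OF X] \<sigma> si[OF X]] perm_restrict_permutes[OF finX[OF X] \<gamma> gi[OF X]] by auto
    have ne: "X \<noteq> {}" by (rule partition_on_nonempty[OF pp X])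
    have px: "partition_on X (cycles_on X (perm_restrict \<sigma> X))" by (rule partition_on_cycles[OF finX[OF X] s(1)])
    \<comment> \<open>Only the genus part of \<open>exponent_nonpos\<close> is wanted; the choice
      \<rho> = {X} meets its assumptions.\<close>
    have "join_part X {X} (cycles_on X (perm_restrict \<gamma> X)) = {X}"
      by (rule join_top_left[OF ne partition_on_cycles[OF finX[OF X] s(2)]])
    note e = exponent_nonpos(3)[OF finX[OF X] ne s refines_top[OF ne px] this]
    have "card (join_part X (cycles_on X \<sigma>) (cycles_on X \<gamma>)) = 1" using True X by simp
    then show ?thesis using e unfolding res[OF X] by simp
  qed
  have "(\<Sum>X\<in>\<pi>. ?f X) = (\<Sum>X\<in>\<pi>. card X + 2) \<longleftrightarrow> (\<forall>X\<in>\<pi>. ?f X = card X + 2)"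
  proof
    assume "(\<Sum>X\<in>\<pi>. ?f X) = (\<Sum>X\<in>\<pi>. card X + 2)"
    from sum_mono_inv[OF this le _ finp] show "\<forall>X\<in>\<pi>. ?f X = card X + 2" by blast
  qed (rule sum.cong[OF refl], blast)
  moreover have "(\<forall>X\<in>\<pi>. planar_conn \<gamma> X (perm_restrict \<sigma> X)) \<longleftrightarrow> (\<forall>X\<in>\<pi>. ?f X = card X + 2)"
    using True res by (intro ball_cong refl) (simp add: planar_conn_def)
  ultimately show ?thesis using True join_part_eq_iff_blocks[OF fin \<sigma> \<gamma> r] tot totH by simp
next
  case False
  have "\<forall>X\<in>\<pi>. join_part X (cycles_on X \<sigma>) (cycles_on X \<gamma>) = {X}"
    if "\<forall>X\<in>\<pi>. \<sigma> ` X = X" and pl: "\<forall>X\<in>\<pi>. planar_conn \<gamma> X (perm_restrict \<sigma> X)"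
  proof
    fix X assume X: "X \<in> \<pi>"
    then have "cycles_on X (perm_restrict \<sigma> X) = cycles_on X \<sigma>" using that(1) by (intro cycles_on_perm_restrict) blast
    then show "join_part X (cycles_on X \<sigma>) (cycles_on X \<gamma>) = {X}" using bspec[OF pl X] by (simp add: planar_conn_def)
  qed
  then show ?thesis using False join_part_eq_iff_blocks[OF fin \<sigma> \<gamma> r] by blast
qed

section \<open>Transport of planar permutations to the standard one\<close>

lemma join_top_image:
  assumes ne: "A \<noteq> {}" and p: "partition_on A \<pi>" "partition_on A \<rho>" and f: "inj_on f A"
  shows "join_part (f ` A) ((`) f ` \<pi>) ((`) f ` \<rho>) = {f ` A} \<longleftrightarrow> join_part A \<pi> \<rho> = {A}"
proof -
  have img: "partition_on (f ` A) ((`) f ` \<mu>)" if "partition_on A \<mu>" for \<mu>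
    using partition_on_inj_image[OF that f] partition_on_nonempty[OF that] by (simp add: image_iff)
  have ne': "f ` A \<noteq> {}" using ne by simp
  have sub: "Y \<subseteq> A" if "Y \<in> \<pi> \<union> \<rho>" for Y using that partition_on_subset[OF p(1)] partition_on_subset[OF p(2)] by blast
  have sat: "(\<forall>X\<in>(`) f ` \<pi> \<union> (`) f ` \<rho>. X \<inter> f ` U \<noteq> {} \<longrightarrow> X \<subseteq> f ` U) \<longleftrightarrow> (\<forall>Y\<in>\<pi> \<union> \<rho>. Y \<inter> U \<noteq> {} \<longrightarrow> Y \<subseteq> U)"
    if U: "U \<subseteq> A" for U
  proof -
    have "(f ` Y \<inter> f ` U \<noteq> {} \<longrightarrow> f ` Y \<subseteq> f ` U) \<longleftrightarrow> (Y \<inter> U \<noteq> {} \<longrightarrow> Y \<subseteq> U)" if Y: "Y \<in> \<pi> \<union> \<rho>" for Y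
      using inj_on_image_Int[OF f sub[OF Y] U] inj_on_image_subset_iff[OF f sub[OF Y] U] by (metis image_is_empty)
    then have "(\<forall>Y\<in>\<pi> \<union> \<rho>. f ` Y \<inter> f ` U \<noteq> {} \<longrightarrow> f ` Y \<subseteq> f ` U) \<longleftrightarrow> (\<forall>Y\<in>\<pi> \<union> \<rho>. Y \<inter> U \<noteq> {} \<longrightarrow> Y \<subseteq> U)"
      by (rule ball_cong[OF refl])
    moreover have "(\<forall>X\<in>(`) f ` S. Q X) \<longleftrightarrow> (\<forall>Y\<in>S. Q (f ` Y))" for S Q by blast
    ultimately show ?thesis unfolding image_Un[symmetric] by simp
  qed
  show ?thesis
    unfolding join_top_iff_saturated[OF ne p] join_top_iff_saturated[OF ne' img[OF p(1)] img[OF p(2)]]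
  proof
    assume a: "\<forall>U\<subseteq>f ` A. U \<noteq> {} \<and> (\<forall>X\<in>(`) f ` \<pi> \<union> (`) f ` \<rho>. X \<inter> U \<noteq> {} \<longrightarrow> X \<subseteq> U) \<longrightarrow> U = f ` A"
    show "\<forall>U\<subseteq>A. U \<noteq> {} \<and> (\<forall>X\<in>\<pi> \<union> \<rho>. X \<inter> U \<noteq> {} \<longrightarrow> X \<subseteq> U) \<longrightarrow> U = A"
    proof (intro allI impI)
      fix U assume U: "U \<subseteq> A" "U \<noteq> {} \<and> (\<forall>X\<in>\<pi> \<union> \<rho>. X \<inter> U \<noteq> {} \<longrightarrow> X \<subseteq> U)"
      have 1: "f ` U \<subseteq> f ` A" using U(1) by blast
      have 2: "\<forall>X\<in>(`) f ` \<pi> \<union> (`) f ` \<rho>. X \<inter> f ` U \<noteq> {} \<longrightarrow> X \<subseteq> f ` U" unfolding sat[OF U(1)] using U(2) by (rule conjunct2)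
      have "f ` U \<noteq> {}" using U(2) by blast
      then have "f ` U = f ` A" using a[THEN spec, THEN mp, OF 1] 2 by blast
      then show "U = A" using inj_on_image_eq_iff[OF f U(1) order_refl] by simp
    qed
  next
    assume a: "\<forall>U\<subseteq>A. U \<noteq> {} \<and> (\<forall>X\<in>\<pi> \<union> \<rho>. X \<inter> U \<noteq> {} \<longrightarrow> X \<subseteq> U) \<longrightarrow> U = A"
    show "\<forall>U\<subseteq>f ` A. U \<noteq> {} \<and> (\<forall>X\<in>(`) f ` \<pi> \<union> (`) f ` \<rho>. X \<inter> U \<noteq> {} \<longrightarrow> X \<subseteq> U) \<longrightarrow> U = f ` A"
    proof (intro allI impI)
      fix W assume W: "W \<subseteq> f ` A" "W \<noteq> {} \<and> (\<forall>X\<in>(`) f ` \<pi> \<union> (`) f ` \<rho>. X \<inter> W \<noteq> {} \<longrightarrow> X \<subseteq> W)"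
      obtain U where U: "U \<subseteq> A" "W = f ` U" using W(1) by (metis subset_imageE)
      have "U \<noteq> {}" using W(2) U(2) by blast
      moreover have "\<forall>X\<in>\<pi> \<union> \<rho>. X \<inter> U \<noteq> {} \<longrightarrow> X \<subseteq> U" using conjunct2[OF W(2)] unfolding U(2) sat[OF U(1)] .
      ultimately have "U = A" using a[THEN spec, THEN mp, OF U(1)] by blast
      then show "W = f ` A" using U(2) by simp
    qed
  qed
qed

text \<open>Conjugation by \<open>f\<close> carries the standard permutation to the restriction of
  \<gamma>, and \<tau> is inverted on the way: \<open>planar_conn\<close> involves s \<gamma>^-1
  whereas the genus in \<open>mcount\<close> involves \<gamma> \<tau>, and (\<gamma> \<tau>)^-1 =
  \<tau>^-1 \<gamma>^-1. Inversion changes neither the cycle type nor the cycle partition.\<close>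

lemma card_planar_conn:
  fixes X :: "nat set"
  assumes fin: "finite H" and \<gamma>: "\<gamma> permutes H" and X: "X \<subseteq> H" "X \<noteq> {}" "\<gamma> ` X = X"
  shows "card {s. s permutes X \<and> planar_conn \<gamma> X s \<and> cycle_type X s = \<nu>} = mcount (cycle_type X \<gamma>) \<nu>"
proof -
  let ?g = "perm_restrict \<gamma> X" and ?\<mu> = "cycle_type X \<gamma>"
  have finX: "finite X" using X fin finite_subset by blast
  have g: "?g permutes X" by (rule perm_restrict_permutes[OF finX \<gamma> X(3)])
  have cg: "cycles_on X ?g = cycles_on X \<gamma>" by (rule cycles_on_perm_restrict[OF X(3)])
  have ctg: "cycle_type X ?g = ?\<mu>" by (rule cycle_type_cong[OF cg])
  have pg: "partition_on X (cycles_on X ?g)" by (rule partition_on_cycles[OF finX g])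
  let ?A = "{1..sum_mset ?\<mu>}" and ?\<delta> = "gamma (parts_list ?\<mu>)"
  have "\<forall>a\<in>#?\<mu>. a \<ge> 1" using cycle_type_pos[OF finX pg] ctg by auto
  note d = gamma_parts_list[OF this]
  have finA: "finite ?A" by simp
  obtain f where f: "bij_betw f ?A X" "\<And>x. x \<in> ?A \<Longrightarrow> ?g (f x) = f (?\<delta> x)"
    using cycle_type_eq_imp_conjugate[OF finA d(1) finX g] d(2) ctg by auto
  have fi: "inj_on f ?A" and fA: "f ` ?A = X" using f(1) by (auto simp: bij_betw_def)
  have cAX: "card ?A = card X" by (rule bij_betw_same_card[OF f(1)])
  have neA: "?A \<noteq> {}" using fA X(2) by blast
  let ?m = "map_permutation ?A f"
  have md: "?m ?\<delta> = ?g"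
  proof
    fix y show "?m ?\<delta> y = ?g y"
    proof (cases "y \<in> X")
      case True
      then obtain x where "x \<in> ?A" "y = f x" using fA by blast
      then show ?thesis using f(2) map_permutation_apply[OF fi] by simp
    next
      case False
      then show ?thesis using permutes_not_in[OF map_permutation_permutes[OF f(1) d(1)]] permutes_not_in[OF g] by simp
    qed
  qed
  have cm: "cycles_on X (?m s) = (`) f ` cycles_on ?A s" if s: "s permutes ?A" for s
    using cycles_on_transport[OF finA s, of "?m s" f] map_permutation_apply[OF fi] fA by simp
  have ccm: "card (cycles_on X (?m s)) = card (cycles_on ?A s)" if s: "s permutes ?A" for s
    using cycle_type_map_permutation[OF finA f(1) s] by (metis size_cycle_type)
  let ?F = "\<lambda>\<tau>. ?m (inv_into UNIV \<tau>)"
  let ?PA = "{\<tau>. \<tau> permutes ?A}" and ?PX = "{s. s permutes X}"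
  have inv_bij: "bij_betw (inv_into UNIV) ?PA ?PA"
    by (rule bij_betwI[where g = "inv_into UNIV"]) (auto simp: permutes_inv permutes_inv_inv)
  have Fb: "bij_betw ?F ?PA ?PX"
    using bij_betw_trans[OF inv_bij map_permutation_bij[OF f(1)]] by (simp add: o_def)
  have equiv: "planar_conn \<gamma> X (?F \<tau>) \<and> cycle_type X (?F \<tau>) = \<nu> \<longleftrightarrow>
      genus ?A ?\<delta> \<tau> = 0 \<and> join_part ?A (cycles_on ?A ?\<delta>) (cycles_on ?A \<tau>) = one_part (sum_mset ?\<mu>) \<and> cycle_type ?A \<tau> = \<nu>"
    if \<tau>: "\<tau> permutes ?A" for \<tau>
  proof -
    have i: "inv_into UNIV \<tau> permutes ?A" "inv_into UNIV ?\<delta> permutes ?A" using \<tau> d(1) permutes_inv by blast+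
    have ci: "cycles_on ?A (inv_into UNIV \<tau>) = cycles_on ?A \<tau>" by (rule cycles_on_inv[OF finA \<tau>])
    have ct: "cycle_type X (?F \<tau>) = cycle_type ?A \<tau>"
      using cycle_type_map_permutation[OF finA f(1) i(1)] cycle_type_cong[OF ci] by simp
    have jn: "join_part X (cycles_on X (?F \<tau>)) (cycles_on X \<gamma>) = {X} \<longleftrightarrow> join_part ?A (cycles_on ?A ?\<delta>) (cycles_on ?A \<tau>) = {?A}"
    proof -
      have "cycles_on X (?F \<tau>) = (`) f ` cycles_on ?A \<tau>" using cm[OF i(1)] ci by simp
      moreover have "cycles_on X \<gamma> = (`) f ` cycles_on ?A ?\<delta>" using cm[OF d(1)] md cg by simp
      ultimately have "join_part X (cycles_on X (?F \<tau>)) (cycles_on X \<gamma>) = {X} \<longleftrightarrow> join_part ?A (cycles_on ?A \<tau>) (cycles_on ?A ?\<delta>) = {?A}"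
        using join_top_image[OF neA partition_on_cycles[OF finA \<tau>] partition_on_cycles[OF finA d(1)] fi] fA by simp
      then show ?thesis by (simp only: join_part_commute[of ?A "cycles_on ?A \<tau>"])
    qed
    have c1: "card (cycles_on X (?F \<tau>)) = card (cycles_on ?A \<tau>)" using ccm[OF i(1)] ci by simp
    have c2: "card (cycles_on X \<gamma>) = card (cycles_on ?A ?\<delta>)" using ccm[OF d(1)] md cg by simp
    have c3: "card (cycles_on X (?F \<tau> \<circ> inv_into UNIV ?g)) = card (cycles_on ?A (?\<delta> \<circ> \<tau>))"
    proof -
      have "?F \<tau> \<circ> inv_into UNIV ?g = ?m (inv_into UNIV \<tau> \<circ> inv_into UNIV ?\<delta>)"
        unfolding md[symmetric] map_permutation_inv[OF f(1) d(1), symmetric]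
        by (rule map_permutation_compose'[OF fi i(2), symmetric])
      then have "card (cycles_on X (?F \<tau> \<circ> inv_into UNIV ?g)) = card (cycles_on ?A (inv_into UNIV \<tau> \<circ> inv_into UNIV ?\<delta>))"
        using ccm[OF permutes_compose[OF i(2,1)]] by simp
      also have "inv_into UNIV \<tau> \<circ> inv_into UNIV ?\<delta> = inv_into UNIV (?\<delta> \<circ> \<tau>)"
        by (rule o_inv_distrib[symmetric]) (use permutes_bij[OF d(1)] permutes_bij[OF \<tau>] in auto)
      also have "cycles_on ?A (inv_into UNIV (?\<delta> \<circ> \<tau>)) = cycles_on ?A (?\<delta> \<circ> \<tau>)"
        by (rule cycles_on_inv[OF finA permutes_compose[OF \<tau> d(1)]])
      finally show ?thesis .
    qed
    have gen: "genus ?A ?\<delta> \<tau> = 0 \<longleftrightarrow> card (cycles_on ?A \<tau>) + card (cycles_on ?A ?\<delta>) + card (cycles_on ?A (?\<delta> \<circ> \<tau>)) = card ?A + 2"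
      if j: "join_part ?A (cycles_on ?A ?\<delta>) (cycles_on ?A \<tau>) = {?A}"
    proof -
      have "genus ?A ?\<delta> \<tau> = 0 \<longleftrightarrow> (of_nat (card ?A + 2) :: rat)
          = of_nat (card (cycles_on ?A \<tau>) + card (cycles_on ?A ?\<delta>) + card (cycles_on ?A (?\<delta> \<circ> \<tau>)))"
        unfolding genus_def j by (simp del: card_atLeastAtMost) linarith
      then show ?thesis unfolding of_nat_eq_iff by auto
    qed
    show ?thesis
    proof (cases "join_part ?A (cycles_on ?A ?\<delta>) (cycles_on ?A \<tau>) = {?A}")
      case True
      then show ?thesis using gen[OF True] jn ct c1 c2 c3 cAX unfolding planar_conn_def one_part_def by simp
    next
      case False
      then show ?thesis using jn unfolding planar_conn_def one_part_def by blast
    qed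
  qed
  have "{s. s permutes X \<and> planar_conn \<gamma> X s \<and> cycle_type X s = \<nu>} = ?F ` {\<tau>. \<tau> permutes ?A \<and> genus ?A ?\<delta> \<tau> = 0 \<and>
      join_part ?A (cycles_on ?A ?\<delta>) (cycles_on ?A \<tau>) = one_part (sum_mset ?\<mu>) \<and> cycle_type ?A \<tau> = \<nu>}" (is "?L = ?F ` ?R")
  proof
    show "?L \<subseteq> ?F ` ?R"
    proof
      fix s assume s: "s \<in> ?L"
      then have "s \<in> ?F ` ?PA" using Fb by (simp add: bij_betw_def)
      then obtain \<tau> where t: "\<tau> permutes ?A" "s = ?F \<tau>" by blast
      then have "\<tau> \<in> ?R" using equiv[OF t(1)] s by simp
      then show "s \<in> ?F ` ?R" using t(2) by blast
    qed
    show "?F ` ?R \<subseteq> ?L"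
    proof
      fix s assume "s \<in> ?F ` ?R"
      then obtain \<tau> where t: "\<tau> \<in> ?R" "s = ?F \<tau>" by blast
      then have "\<tau> permutes ?A" by simp
      moreover from this have "s permutes X" using Fb t(2) by (auto simp: bij_betw_def)
      ultimately show "s \<in> ?L" using equiv[of \<tau>] t by simp
    qed
  qed
  moreover have "inj_on ?F ?R" using Fb by (auto simp: bij_betw_def intro: inj_on_subset)
  ultimately have "card ?L = card ?R" by (simp only: card_image)
  then show ?thesis by (simp only: mcount_def Let_def)
qed

section \<open>Summing over planar permutations\<close>

lemma prod_indicator:
  assumes "finite A"
  shows "(\<Prod>x\<in>A. if Q x then 1 else 0 :: complex) = (if \<forall>x\<in>A. Q x then 1 else 0)"
  using assms by (induction rule: finite_induct) auto

text \<open>Planarity and the prescribed cycle types are conditions on the restrictions to the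
  blocks, so the indicator is a product over \<pi> and the sum over \<sigma> factors into the counts
  \<open>mcount\<close>.\<close>

lemma sum_planar_conn:
  fixes H :: "nat set" and \<nu> :: "nat \<Rightarrow> nat multiset"
  assumes fin: "finite H" and \<gamma>: "\<gamma> permutes H" and r: "refines H (cycles_on H \<gamma>) \<pi>" and G: "bij_betw G {1..k} \<pi>"
  shows "(\<Sum>\<sigma> | \<sigma> permutes H \<and> (\<forall>X\<in>\<pi>. \<sigma> ` X = X) \<and> (\<forall>X\<in>\<pi>. planar_conn \<gamma> X (perm_restrict \<sigma> X)).
      if \<forall>i\<in>{1..k}. cycle_type (G i) \<sigma> = \<nu> i then 1 else 0 :: complex) = (\<Prod>i = 1..k. of_nat (mcount (cycle_type (G i) \<gamma>) (\<nu> i)))"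
proof -
  have pp: "partition_on H \<pi>" and gi: "\<And>X. X \<in> \<pi> \<Longrightarrow> \<gamma> ` X = X" using r refines_cycles_iff[OF fin \<gamma>] by auto
  have finp: "finite \<pi>" by (rule finite_elements[OF fin pp])
  \<comment> \<open>The prescription is re-indexed by the blocks themselves, over which the
    distributive law runs.\<close>
  define \<nu>' where "\<nu>' X = \<nu> (inv_into {1..k} G X)" for X
  have n: "\<nu>' (G i) = \<nu> i" if "i \<in> {1..k}" for i using G that by (simp add: \<nu>'_def bij_betw_def)
  have Gim: "\<pi> = G ` {1..k}" using G by (simp add: bij_betw_def)
  let ?F = "\<lambda>X s. if planar_conn \<gamma> X s \<and> cycle_type X s = \<nu>' X then 1 else 0 :: complex"
  have finP: "finite {\<sigma>. \<sigma> permutes H \<and> (\<forall>X\<in>\<pi>. \<sigma> ` X = X)}"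
    by (rule finite_subset[OF _ finite_permutations[OF fin]]) auto
  have "(\<Sum>\<sigma> | \<sigma> permutes H \<and> (\<forall>X\<in>\<pi>. \<sigma> ` X = X) \<and> (\<forall>X\<in>\<pi>. planar_conn \<gamma> X (perm_restrict \<sigma> X)).
      if \<forall>i\<in>{1..k}. cycle_type (G i) \<sigma> = \<nu> i then 1 else 0 :: complex)
    = (\<Sum>\<sigma> | \<sigma> permutes H \<and> (\<forall>X\<in>\<pi>. \<sigma> ` X = X). \<Prod>X\<in>\<pi>. ?F X (perm_restrict \<sigma> X))"
  proof (rule sum.mono_neutral_cong_left[OF finP])
    fix \<sigma> assume s: "\<sigma> \<in> {\<sigma>. \<sigma> permutes H \<and> (\<forall>X\<in>\<pi>. \<sigma> ` X = X) \<and> (\<forall>X\<in>\<pi>. planar_conn \<gamma> X (perm_restrict \<sigma> X))}"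
    have "cycle_type X (perm_restrict \<sigma> X) = cycle_type X \<sigma>" if X: "X \<in> \<pi>" for X
      using s X by (intro cycle_type_cong cycles_on_perm_restrict) blast
    then have "(\<forall>X\<in>\<pi>. planar_conn \<gamma> X (perm_restrict \<sigma> X) \<and> cycle_type X (perm_restrict \<sigma> X) = \<nu>' X) \<longleftrightarrow> (\<forall>X\<in>\<pi>. cycle_type X \<sigma> = \<nu>' X)"
      using s by auto
    also have "\<dots> \<longleftrightarrow> (\<forall>i\<in>{1..k}. cycle_type (G i) \<sigma> = \<nu> i)" using n by (simp add: Gim)
    finally show "(if \<forall>i\<in>{1..k}. cycle_type (G i) \<sigma> = \<nu> i then 1 else 0 :: complex) = (\<Prod>X\<in>\<pi>. ?F X (perm_restrict \<sigma> X))"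
      unfolding prod_indicator[OF finp] by (simp only:)
  qed (auto simp: prod_indicator[OF finp])
  also have "\<dots> = (\<Prod>X\<in>\<pi>. \<Sum>s | s permutes X. ?F X s)" by (rule prod_sum_permutes[OF fin pp, symmetric])
  also have "\<dots> = (\<Prod>X\<in>\<pi>. of_nat (mcount (cycle_type X \<gamma>) (\<nu>' X)))"
  proof (intro prod.cong refl)
    fix X assume X: "X \<in> \<pi>"
    have XH: "X \<subseteq> H" "X \<noteq> {}" using partition_on_subset[OF pp X] partition_on_nonempty[OF pp X] by auto
    have finX: "finite X" using XH fin finite_subset by blast
    have "(\<Sum>s | s permutes X. ?F X s) = (\<Sum>s\<in>{s \<in> {s. s permutes X}. planar_conn \<gamma> X s \<and> cycle_type X s = \<nu>' X}. 1)"
      by (rule sum.inter_filter[OF finite_permutations[OF finX], symmetric])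
    also have "\<dots> = of_nat (card {s. s permutes X \<and> planar_conn \<gamma> X s \<and> cycle_type X s = \<nu>' X})" by simp
    finally show "(\<Sum>s | s permutes X. ?F X s) = of_nat (mcount (cycle_type X \<gamma>) (\<nu>' X))"
      by (simp only: card_planar_conn[OF fin \<gamma> XH gi[OF X]])
  qed
  also have "\<dots> = (\<Prod>i = 1..k. of_nat (mcount (cycle_type (G i) \<gamma>) (\<nu>' (G i))))"
    by (rule prod.reindex_bij_betw[OF G, symmetric])
  also have "\<dots> = (\<Prod>i = 1..k. of_nat (mcount (cycle_type (G i) \<gamma>) (\<nu> i)))" using n by (intro prod.cong refl) simp
  finally show ?thesis .
qed

text \<open>As \<rho> is already coarser than the cycles of \<sigma>, enlarging the cycles of \<tau>
  by those of \<sigma> does not change whether the join is trivial.\<close>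

lemma connecting_partitions_iff:
  assumes fin: "finite H" and ne: "H \<noteq> {}" and \<sigma>: "\<sigma> permutes H" and \<tau>: "\<tau> permutes H"
  shows "\<rho> \<in> connecting_partitions H \<tau> \<sigma> \<longleftrightarrow> refines H (cycles_on H \<sigma>) \<rho> \<and>
    join_part H \<rho> (join_part H (cycles_on H \<sigma>) (cycles_on H \<tau>)) = {H}" (is "_ \<longleftrightarrow> ?r \<and> join_part H \<rho> ?J = {H}")
proof -
  note pc = partition_on_cycles[OF fin \<sigma>] partition_on_cycles[OF fin \<tau>]
  have pJ: "partition_on H ?J" using refines_join_part(1)[OF pc] by (simp add: refines_def)
  have "join_part H \<rho> (cycles_on H \<tau>) = {H}" if r: ?r and j: "join_part H \<rho> ?J = {H}"
  proof -
    have p: "partition_on H \<rho>" using r by (simp add: refines_def)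
    show ?thesis
      unfolding join_part_eq_top_iff[OF ne p pc(2)]
    proof (intro allI impI)
      fix \<upsilon> assume u: "refines H \<rho> \<upsilon> \<and> refines H (cycles_on H \<tau>) \<upsilon>"
      then have "refines H ?J \<upsilon>" using join_part_least[OF refines_trans[OF r]] by blast
      then show "\<upsilon> = {H}" using j[unfolded join_part_eq_top_iff[OF ne p pJ]] u by blast
    qed
  qed
  moreover have "join_part H \<rho> ?J = {H}" if "?r" "join_part H \<rho> (cycles_on H \<tau>) = {H}"
    by (rule exponent_nonpos(1)[OF fin ne \<sigma> \<tau> that])
  ultimately show ?thesis unfolding connecting_partitions_def by blast
qed

text \<open>Each \<sigma> determines \<pi> as the join of its cycles with those of \<gamma>. Sorting
  by \<pi> splits the vanishing of the exponent into planarity of \<sigma> in each block of \<pi>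
  and the tree condition on \<rho>.\<close>

lemma sum_leading_terms_by_join:
  fixes F :: "(nat \<Rightarrow> nat) \<Rightarrow> nat set set \<Rightarrow> complex"
  assumes fin: "finite H" and ne: "H \<noteq> {}" and \<gamma>: "\<gamma> permutes H"
  shows "(\<Sum>\<sigma> | \<sigma> permutes H. \<Sum>\<rho> | \<rho> \<in> connecting_partitions H \<gamma> \<sigma> \<and> leading_exponent H \<gamma> \<sigma> \<rho> = 0. F \<sigma> \<rho>) =
    (\<Sum>\<pi> | refines H (cycles_on H \<gamma>) \<pi>.
      \<Sum>\<sigma> | \<sigma> permutes H \<and> (\<forall>X\<in>\<pi>. \<sigma> ` X = X) \<and> (\<forall>X\<in>\<pi>. planar_conn \<gamma> X (perm_restrict \<sigma> X)).
        \<Sum>\<rho> | refines H (cycles_on H \<sigma>) \<rho> \<and> join_part H \<rho> \<pi> = {H} \<and> card \<pi> + card \<rho> = card (cycles_on H \<sigma>) + 1. F \<sigma> \<rho>)"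
proof -
  let ?J = "\<lambda>\<sigma>. join_part H (cycles_on H \<sigma>) (cycles_on H \<gamma>)"
  let ?R = "{\<pi>. refines H (cycles_on H \<gamma>) \<pi>}"
  let ?e = "\<lambda>\<sigma> \<pi>. card (cycles_on H \<sigma>) + card (cycles_on H \<gamma>) + card (cycles_on H (\<sigma> \<circ> inv_into UNIV \<gamma>)) = card H + 2 * card \<pi>"
  let ?S = "\<lambda>\<sigma> \<pi>. \<Sum>\<rho> | refines H (cycles_on H \<sigma>) \<rho> \<and> join_part H \<rho> \<pi> = {H} \<and> card \<pi> + card \<rho> = card (cycles_on H \<sigma>) + 1. F \<sigma> \<rho>"
  have finR: "finite ?R" by (rule finite_refines(2)[OF fin])
  have inner: "(\<Sum>\<rho> | \<rho> \<in> connecting_partitions H \<gamma> \<sigma> \<and> leading_exponent H \<gamma> \<sigma> \<rho> = 0. F \<sigma> \<rho>) = (\<Sum>\<pi>\<in>?R. if ?J \<sigma> = \<pi> \<and> ?e \<sigma> \<pi> then ?S \<sigma> \<pi> else 0)"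
    if \<sigma>: "\<sigma> permutes H" for \<sigma>
  proof -
    have JR: "?J \<sigma> \<in> ?R" using refines_join_part(2)[OF partition_on_cycles[OF fin \<sigma>] partition_on_cycles[OF fin \<gamma>]] by simp
    have set: "{\<rho>. \<rho> \<in> connecting_partitions H \<gamma> \<sigma> \<and> leading_exponent H \<gamma> \<sigma> \<rho> = 0} =
        (if ?e \<sigma> (?J \<sigma>) then {\<rho>. refines H (cycles_on H \<sigma>) \<rho> \<and> join_part H \<rho> (?J \<sigma>) = {H} \<and> card (?J \<sigma>) + card \<rho> = card (cycles_on H \<sigma>) + 1} else {})"
    proof (rule Set.set_eqI)
      fix \<rho>
      show "\<rho> \<in> {\<rho>. \<rho> \<in> connecting_partitions H \<gamma> \<sigma> \<and> leading_exponent H \<gamma> \<sigma> \<rho> = 0} \<longleftrightarrow> \<rho> \<in>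
        (if ?e \<sigma> (?J \<sigma>) then {\<rho>. refines H (cycles_on H \<sigma>) \<rho> \<and> join_part H \<rho> (?J \<sigma>) = {H} \<and> card (?J \<sigma>) + card \<rho> = card (cycles_on H \<sigma>) + 1} else {})"
      proof (cases "\<rho> \<in> connecting_partitions H \<gamma> \<sigma>")
        case True
        then show ?thesis using leading_exponent_zero_iff[OF fin ne \<sigma> \<gamma> True] connecting_partitions_iff[OF fin ne \<sigma> \<gamma>, of \<rho>] by (cases "?e \<sigma> (?J \<sigma>)") simp_all
      next
        case False
        then show ?thesis using connecting_partitions_iff[OF fin ne \<sigma> \<gamma>, of \<rho>] by (cases "?e \<sigma> (?J \<sigma>)") auto
      qed
    qed
    have "(\<Sum>\<pi>\<in>?R. if ?J \<sigma> = \<pi> \<and> ?e \<sigma> \<pi> then ?S \<sigma> \<pi> else 0) = (\<Sum>\<pi>\<in>?R. if ?J \<sigma> = \<pi> then (if ?e \<sigma> \<pi> then ?S \<sigma> \<pi> else 0) else 0)"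
      by (simp only: if_if_eq_conj)
    also have "\<dots> = (if ?e \<sigma> (?J \<sigma>) then ?S \<sigma> (?J \<sigma>) else 0)"
      unfolding sum.delta'[OF finR] using JR by (simp only: if_True)
    finally show ?thesis unfolding set if_distrib[of "sum (F \<sigma>)"] sum.empty by (rule sym)
  qed
  have "(\<Sum>\<sigma> | \<sigma> permutes H. \<Sum>\<rho> | \<rho> \<in> connecting_partitions H \<gamma> \<sigma> \<and> leading_exponent H \<gamma> \<sigma> \<rho> = 0. F \<sigma> \<rho>)
      = (\<Sum>\<sigma> | \<sigma> permutes H. \<Sum>\<pi>\<in>?R. if ?J \<sigma> = \<pi> \<and> ?e \<sigma> \<pi> then ?S \<sigma> \<pi> else 0)"
    by (rule sum.cong[OF refl]) (rule inner, simp)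
  also have "\<dots> = (\<Sum>\<pi>\<in>?R. \<Sum>\<sigma> | \<sigma> permutes H. if ?J \<sigma> = \<pi> \<and> ?e \<sigma> \<pi> then ?S \<sigma> \<pi> else 0)" by (rule sum.swap)
  also have "\<dots> = (\<Sum>\<pi>\<in>?R. \<Sum>\<sigma> | \<sigma> permutes H \<and> (\<forall>X\<in>\<pi>. \<sigma> ` X = X) \<and> (\<forall>X\<in>\<pi>. planar_conn \<gamma> X (perm_restrict \<sigma> X)). ?S \<sigma> \<pi>)"
  proof (rule sum.cong[OF refl])
    fix \<pi> assume "\<pi> \<in> ?R"
    then have r: "refines H (cycles_on H \<gamma>) \<pi>" by simp
    have "(\<Sum>\<sigma> | \<sigma> permutes H. if ?J \<sigma> = \<pi> \<and> ?e \<sigma> \<pi> then ?S \<sigma> \<pi> else 0)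
        = (\<Sum>\<sigma>\<in>{\<sigma> \<in> {\<sigma>. \<sigma> permutes H}. ?J \<sigma> = \<pi> \<and> ?e \<sigma> \<pi>}. ?S \<sigma> \<pi>)"
      by (rule sum.inter_filter[OF finite_permutations[OF fin], symmetric])
    also have "{\<sigma> \<in> {\<sigma>. \<sigma> permutes H}. ?J \<sigma> = \<pi> \<and> ?e \<sigma> \<pi>}
        = {\<sigma>. \<sigma> permutes H \<and> (\<forall>X\<in>\<pi>. \<sigma> ` X = X) \<and> (\<forall>X\<in>\<pi>. planar_conn \<gamma> X (perm_restrict \<sigma> X))}"
      unfolding mem_Collect_eq by (intro Collect_cong conj_cong refl planar_conn_local[OF fin _ \<gamma> r])
    finally show "(\<Sum>\<sigma> | \<sigma> permutes H. if ?J \<sigma> = \<pi> \<and> ?e \<sigma> \<pi> then ?S \<sigma> \<pi> else 0) =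
        (\<Sum>\<sigma> | \<sigma> permutes H \<and> (\<forall>X\<in>\<pi>. \<sigma> ` X = X) \<and> (\<forall>X\<in>\<pi>. planar_conn \<gamma> X (perm_restrict \<sigma> X)). ?S \<sigma> \<pi>)" .
  qed
  finally show ?thesis .
qed

text \<open>For a fixed tree and index family the permutation enters only through the indicator of
  its cycle types, so the sum over \<sigma> replaces this indicator by a product of numbers
  \<open>mcount\<close>.\<close>

lemma sum_planar_tree_terms:
  fixes K :: "nat multiset \<Rightarrow> complex" and H :: "nat set" and G :: "nat \<Rightarrow> nat set"
  assumes fin: "finite H" and ne: "H \<noteq> {}" and \<gamma>: "\<gamma> permutes H" and r: "refines H (cycles_on H \<gamma>) \<pi>" and G: "bij_betw G {1..k} \<pi>"
  shows "(\<Sum>\<sigma> | \<sigma> permutes H \<and> (\<forall>X\<in>\<pi>. \<sigma> ` X = X) \<and> (\<forall>X\<in>\<pi>. planar_conn \<gamma> X (perm_restrict \<sigma> X)).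
        \<Sum>\<rho> | refines H (cycles_on H \<sigma>) \<rho> \<and> join_part H \<rho> \<pi> = {H} \<and> k + card \<rho> = card (cycles_on H \<sigma>) + 1.
          \<Prod>V\<in>\<rho>. K (cycle_type V \<sigma>)) =
    (\<Sum>T\<in>bip_trees k. \<Sum>(j, c)\<in>index_families k G T.
      (\<Prod>I\<in>T. K (image_mset (j I) (mset_set I))) *
      (\<Prod>i = 1..k. of_nat (mcount (cycle_type (G i) \<gamma>) (mult_partition (card (G i)) (\<lambda>a. c i a + q_mult T j i a))) *
        (\<Prod>a = 1..card (G i). fact (c i a + q_mult T j i a) / fact (c i a) * K {#a#} ^ c i a)))" (is "?L = ?rhs")
proof -
  let ?X = "{\<sigma>. \<sigma> permutes H \<and> (\<forall>X\<in>\<pi>. \<sigma> ` X = X) \<and> (\<forall>X\<in>\<pi>. planar_conn \<gamma> X (perm_restrict \<sigma> X))}"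
  let ?\<nu> = "\<lambda>T j c i. mult_partition (card (G i)) (\<lambda>a. c i a + q_mult T j i a)"
  let ?w = "\<lambda>T j c i. \<Prod>a = 1..card (G i). fact (c i a + q_mult T j i a) / fact (c i a) * K {#a#} ^ c i a"
  let ?t = "\<lambda>T j c. (\<Prod>I\<in>T. K (image_mset (j I) (mset_set I))) * (\<Prod>i = 1..k. ?w T j c i)"
  let ?d = "\<lambda>T j c \<sigma>. if \<forall>i\<in>{1..k}. cycle_type (G i) \<sigma> = ?\<nu> T j c i then 1 else 0 :: complex"
  have pp: "partition_on H \<pi>" using r by (simp add: refines_def)
  have "?L = (\<Sum>\<sigma>\<in>?X. \<Sum>T\<in>bip_trees k. \<Sum>(j, c)\<in>index_families k G T. ?d T j c \<sigma> * ?t T j c)"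
  proof (rule sum.cong[OF refl])
    fix \<sigma> assume s: "\<sigma> \<in> ?X"
    have \<sigma>: "\<sigma> permutes H" using s by simp
    have "refines H (cycles_on H \<sigma>) \<pi>" using refines_cycles_iff[OF fin \<sigma>] pp s by simp
    from sum_tree_terms[OF fin ne \<sigma> this G, of K]
    show "(\<Sum>\<rho> | refines H (cycles_on H \<sigma>) \<rho> \<and> join_part H \<rho> \<pi> = {H} \<and> k + card \<rho> = card (cycles_on H \<sigma>) + 1.
          \<Prod>V\<in>\<rho>. K (cycle_type V \<sigma>)) = (\<Sum>T\<in>bip_trees k. \<Sum>(j, c)\<in>index_families k G T. ?d T j c \<sigma> * ?t T j c)" .
  qed
  also have "\<dots> = (\<Sum>T\<in>bip_trees k. \<Sum>\<sigma>\<in>?X. \<Sum>(j, c)\<in>index_families k G T. ?d T j c \<sigma> * ?t T j c)" by (rule sum.swap)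
  also have "\<dots> = ?rhs"
  proof (rule sum.cong[OF refl])
    fix T
    have "(\<Sum>\<sigma>\<in>?X. \<Sum>(j, c)\<in>index_families k G T. ?d T j c \<sigma> * ?t T j c) = (\<Sum>x\<in>index_families k G T. \<Sum>\<sigma>\<in>?X. case x of (j, c) \<Rightarrow> ?d T j c \<sigma> * ?t T j c)"
      by (rule sum.swap)
    also have "\<dots> = (\<Sum>(j, c)\<in>index_families k G T. (\<Prod>I\<in>T. K (image_mset (j I) (mset_set I))) *
      (\<Prod>i = 1..k. of_nat (mcount (cycle_type (G i) \<gamma>) (?\<nu> T j c i)) * ?w T j c i))"
    proof (rule sum.cong[OF refl])
      fix x assume "x \<in> index_families k G T"
      obtain j c where x: "x = (j, c)" by (rule prod.exhaust)
      have "(\<Sum>\<sigma>\<in>?X. ?d T j c \<sigma> * ?t T j c) = (\<Sum>\<sigma>\<in>?X. ?d T j c \<sigma>) * ?t T j c" by (rule sum_distrib_right[symmetric])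
      also have "(\<Sum>\<sigma>\<in>?X. ?d T j c \<sigma>) = (\<Prod>i = 1..k. of_nat (mcount (cycle_type (G i) \<gamma>) (?\<nu> T j c i)))"
        by (rule sum_planar_conn[OF fin \<gamma> r G])
      also have "\<dots> * ?t T j c = (\<Prod>I\<in>T. K (image_mset (j I) (mset_set I))) *
          (\<Prod>i = 1..k. of_nat (mcount (cycle_type (G i) \<gamma>) (?\<nu> T j c i)) * ?w T j c i)"
        unfolding prod.distrib[of "\<lambda>i. of_nat (mcount (cycle_type (G i) \<gamma>) (?\<nu> T j c i))"] by (rule mult.left_commute)
      finally show "(\<Sum>\<sigma>\<in>?X. case x of (j, c) \<Rightarrow> ?d T j c \<sigma> * ?t T j c) = (case x of (j, c) \<Rightarrow> (\<Prod>I\<in>T. K (image_mset (j I) (mset_set I))) *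
          (\<Prod>i = 1..k. of_nat (mcount (cycle_type (G i) \<gamma>) (?\<nu> T j c i)) * ?w T j c i))"
        unfolding x prod.case .
    qed
    finally show "(\<Sum>\<sigma>\<in>?X. \<Sum>(j, c)\<in>index_families k G T. ?d T j c \<sigma> * ?t T j c) = (\<Sum>(j, c)\<in>index_families k G T. (\<Prod>I\<in>T. K (image_mset (j I) (mset_set I))) *
      (\<Prod>i = 1..k. of_nat (mcount (cycle_type (G i) \<gamma>) (?\<nu> T j c i)) * ?w T j c i))" .
  qed
  finally show ?thesis .
qed

text \<open>The indices are listed in the order of the labels in \<open>I\<close>, but only their
  multiset matters. They are positive, as \<open>free_cumulant_eq\<close> demands, because j takes
  values from 1 on.\<close>

lemma free_cumulant_family:
  assumes ex: "phi_limits_exist P B" and T: "T \<in> bip_trees k" and jc: "(j, c) \<in> index_families k G T" and I: "I \<in> T"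
  shows "free_cumulant P B (map (j I) (sorted_list_of_set I)) = kappa_limit P B (image_mset (j I) (mset_set I))"
proof -
  have fI: "finite I" "I \<noteq> {}" using bip_trees_finite(2)[OF T I] by auto
  have "j \<in> (\<Pi>\<^sub>E I\<in>T. \<Pi>\<^sub>E i\<in>I. {1..})" using jc by (simp add: index_families_def)
  then have "j I \<in> (\<Pi>\<^sub>E i\<in>I. {1..})" using I by (rule PiE_mem)
  then have j: "j I i \<ge> 1" if "i \<in> I" for i using PiE_mem[of "j I" I "\<lambda>_. {1..}" i] that by simp
  have "free_cumulant P B (map (j I) (sorted_list_of_set I)) = kappa_limit P B (mset (map (j I) (sorted_list_of_set I)))"
    by (rule free_cumulant_eq[OF ex]) (use j fI in auto)
  also have "mset (map (j I) (sorted_list_of_set I)) = image_mset (j I) (mset_set I)"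
    by (simp add: sorted_list_of_mset_set[symmetric] del: sorted_list_of_mset_set)
  finally show ?thesis .
qed

theorem theorem3p5:
  fixes P :: "nat \<Rightarrow> 'w measure" and B :: "nat \<Rightarrow> 'w \<Rightarrow> complex mat"
    and lam :: "nat list" and n p :: nat
  assumes "random_matrices P B"
    and "phi_limits_exist P B"
    and "n \<ge> 1"
    and "sorted_wrt (\<ge>) lam" and "\<forall>l\<in>set lam. l \<ge> 1" and "sum_list lam = n" and "length lam = p"
  shows "moment P B lam =
    (\<Sum>k = 1..p.
      \<Sum>\<pi> | refines {1..n} (cycles_on {1..n} (gamma lam)) \<pi> \<and> card \<pi> = k.
        let G = nth_block \<pi> in
        \<Sum>\<I>\<in>bip_trees k.
          \<Sum>(j, c)\<in>index_families k G \<I>.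
            (\<Prod>I\<in>\<I>. free_cumulant P B (map (j I) (sorted_list_of_set I))) *
            (\<Prod>i = 1..k.
              of_nat (mcount (cycle_type (G i) (gamma lam))
                (mult_partition (card (G i)) (\<lambda>a. c i a + q_mult \<I> j i a))) *
              (\<Prod>a = 1..card (G i).
                fact (c i a + q_mult \<I> j i a) / fact (c i a) * free_cumulant P B [a] ^ c i a)))"
proof -
  note ex = assms(2)
  define H where "H = {1..n}"
  define \<gamma> where "\<gamma> = gamma lam"
  let ?K = "kappa_limit P B"
  let ?R = "{\<pi>. refines H (cycles_on H \<gamma>) \<pi>}"
  \<comment> \<open>The contribution of one \<pi>, with the cumulants still in multiset form. They
    are converted at the end, where the index families supply positivity of the indices.\<close>
  define total where "total k \<pi> = (\<Sum>\<I>\<in>bip_trees k. \<Sum>(j, c)\<in>index_families k (nth_block \<pi>) \<I>.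
      (\<Prod>I\<in>\<I>. ?K (image_mset (j I) (mset_set I))) *
      (\<Prod>i = 1..k. of_nat (mcount (cycle_type (nth_block \<pi> i) \<gamma>)
          (mult_partition (card (nth_block \<pi> i)) (\<lambda>a. c i a + q_mult \<I> j i a))) *
        (\<Prod>a = 1..card (nth_block \<pi> i). fact (c i a + q_mult \<I> j i a) / fact (c i a) * ?K {#a#} ^ c i a)))" for k \<pi>
  have lam: "lam \<noteq> []" using assms(3,6) by auto
  have fin: "finite H" and ne: "H \<noteq> {}" using assms(3) by (auto simp: H_def)
  have \<gamma>: "\<gamma> permutes H" using gamma_permutes[OF assms(5)] by (simp only: H_def \<gamma>_def assms(6))
  have finR: "finite ?R" by (rule finite_refines(2)[OF fin])
  have cg: "card (cycles_on H \<gamma>) = p"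
    using cycle_type_gamma[OF assms(5)] size_cycle_type[of H \<gamma>] by (simp only: H_def \<gamma>_def assms(6,7) size_mset)
  have "moment P B lam = (\<Sum>\<sigma> | \<sigma> permutes H. \<Sum>\<rho> | \<rho> \<in> connecting_partitions H \<gamma> \<sigma> \<and> leading_exponent H \<gamma> \<sigma> \<rho> = 0. \<Prod>V\<in>\<rho>. ?K (cycle_type V \<sigma>))"
    using moment_leading_terms[OF ex assms(5) lam] by (simp only: H_def \<gamma>_def assms(6))
  also have "\<dots> = (\<Sum>\<pi>\<in>?R. total (card \<pi>) \<pi>)"
    unfolding sum_leading_terms_by_join[OF fin ne \<gamma>]
  proof (rule sum.cong[OF refl])
    fix \<pi> assume "\<pi> \<in> ?R"
    then have r: "refines H (cycles_on H \<gamma>) \<pi>" by simp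
    then have "bij_betw (nth_block \<pi>) {1..card \<pi>} \<pi>" by (intro nth_block_bij[OF fin]) (simp add: refines_def)
    from sum_planar_tree_terms[OF fin ne \<gamma> r this]
    show "(\<Sum>\<sigma> | \<sigma> permutes H \<and> (\<forall>X\<in>\<pi>. \<sigma> ` X = X) \<and> (\<forall>X\<in>\<pi>. planar_conn \<gamma> X (perm_restrict \<sigma> X)).
        \<Sum>\<rho> | refines H (cycles_on H \<sigma>) \<rho> \<and> join_part H \<rho> \<pi> = {H} \<and> card \<pi> + card \<rho> = card (cycles_on H \<sigma>) + 1.
          \<Prod>V\<in>\<rho>. ?K (cycle_type V \<sigma>)) = total (card \<pi>) \<pi>"
      unfolding total_def .
  qed
  also have "\<dots> = (\<Sum>k = 1..p. \<Sum>\<pi>\<in>{\<pi> \<in> ?R. card \<pi> = k}. total (card \<pi>) \<pi>)"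
  \<comment> \<open>The partitions are sorted by their number of blocks, which is at least 1 and at
    most p because \<pi> is coarser than the p cycles of \<gamma>.\<close>
  proof (rule sum.group[OF finR _ , symmetric])
    show "card ` ?R \<subseteq> {1..p}"
    proof
      fix m assume "m \<in> card ` ?R"
      then obtain \<pi> where \<pi>: "refines H (cycles_on H \<gamma>) \<pi>" "m = card \<pi>" by blast
      then have pp: "partition_on H \<pi>" by (simp add: refines_def)
      have "\<pi> \<noteq> {}" using partition_onD1[OF pp] ne by blast
      then have "card \<pi> \<ge> 1" using finite_elements[OF fin pp] by (simp add: Suc_le_eq card_gt_0_iff)
      moreover have "card \<pi> \<le> p" using sum_card_blocks_minus[OF fin \<pi>(1)] cg by linarith
      ultimately show "m \<in> {1..p}" using \<pi>(2) by simp
    qed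
  qed simp
  also have "\<dots> = (\<Sum>k = 1..p. \<Sum>\<pi> | refines H (cycles_on H \<gamma>) \<pi> \<and> card \<pi> = k. total k \<pi>)"
    by (intro sum.cong refl) auto
  also have "\<dots> = (\<Sum>k = 1..p.
      \<Sum>\<pi> | refines {1..n} (cycles_on {1..n} (gamma lam)) \<pi> \<and> card \<pi> = k.
        let G = nth_block \<pi> in
        \<Sum>\<I>\<in>bip_trees k.
          \<Sum>(j, c)\<in>index_families k G \<I>.
            (\<Prod>I\<in>\<I>. free_cumulant P B (map (j I) (sorted_list_of_set I))) *
            (\<Prod>i = 1..k.
              of_nat (mcount (cycle_type (G i) (gamma lam))
                (mult_partition (card (G i)) (\<lambda>a. c i a + q_mult \<I> j i a))) *
              (\<Prod>a = 1..card (G i).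
                fact (c i a + q_mult \<I> j i a) / fact (c i a) * free_cumulant P B [a] ^ c i a)))"
  proof -
    \<comment> \<open>The product over a starts at 1, so [a] is a list of positive indices and its
      cumulant has the multiset form.\<close>
    have single: "?K {#a#} = free_cumulant P B [a]" if "a \<in> {1..m}" for a m
      using free_cumulant_eq[OF ex, of "[a]"] that by simp
    have "(\<Prod>I\<in>\<I>. ?K (image_mset (j I) (mset_set I))) = (\<Prod>I\<in>\<I>. free_cumulant P B (map (j I) (sorted_list_of_set I)))"
      if "\<I> \<in> bip_trees k" "(j, c) \<in> index_families k G \<I>" for \<I> j c k G
      by (rule prod.cong[OF refl], rule free_cumulant_family[OF ex that, symmetric])
    moreover have "(\<Prod>a = 1..m. f a * ?K {#a#} ^ e a) = (\<Prod>a = 1..m. f a * free_cumulant P B [a] ^ e a)" for f e m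
      by (rule prod.cong[OF refl]) (simp only: single)
    ultimately show ?thesis
      unfolding total_def Let_def H_def \<gamma>_def
    proof (intro sum.cong refl, goal_cases)
      case (1 k \<pi> \<I> x)
      then show ?case by (cases x) (simp only: prod.case)
    qed
  qed
  finally show ?thesis .
qed

end
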